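(* The vector functions $I^{\pm}_X(\lambda)$, $X\in\mathcal X$, are solutions of $$I'=-\Big(\mathcal A+\tfrac1\lambda\mathcal B\Big)I ,$$ and they form a canonical sectorial solution basis in the corresponding sector $S_\pm$ (i.e. $(I^+_X)_{X}$ in $S_+$ and $(I^-_X)_X$ in $S_-$). The lifts to $S_0$, $S_1$, $S_2$ of the solution bases $(I^+_X)_X|_{S_+}$, $(I^-_X)_X|_{S_-}$, $(e^{2\pi i\alpha_X}I^+_X)_X|_{S_+}$ respectively form a normalized tuple of canonical sectorial solution bases.
   Context: **Arrangement.** $f_1,\dots,f_N$ are affine forms on $\mathbb R^k$, $N\ge k$, $H_j=\{f_j=0\}$, $l_j(z)=f_j(z)-f_j(0)$. The hyperplanes are in generic position: all are distinct, any $k$ of them intersect in a single point, any $k+1$ have empty intersection. To each $H_j$ a weight $\alpha_j>0$ is attached; for $U\subset\{1,\dots,N\}$ put $\alpha_U=\sum_{j\in U}\alpha_j$. A vertex $X$ is a set of $k$ indices $\{j_1,\dots,j_k\}$, identified with the point $H_{j_1}\cap\dots\cap H_{j_k}$; $\mathcal X$ is the set of vertices. $f_0$ is a linear form on $\mathbb R^k$ taking distinct values at the vertices and nonconstant on each line that is the intersection of $k-1$ of the hyperplanes. For a set $U$ of $k-1$ indices, $L_U=\bigcap_{j\in U}H_j$ and $e_U$ is the vector directing the line $L_U$ with $f_0(e_U)=1$. Arrangement domains are the connected components of $\mathbb R^k\setminus\bigcup_jH_j$. For a vertex $X$, $\Delta_X$ is the unique arrangement domain having $X$ in its boundary and on which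 $f_0>f_0(X)$. $\mathcal C_X^+$ is the unique open cone bounded by the hyperplanes $(H_j)_{j\in X}$ on which $f_0-f_0(X)$ is positive. **Equation.** $\mathcal A$ is the diagonal matrix (indexed by $\mathcal X$) with $\mathcal A_{X,X}=f_0(X)$. $\mathcal B_{X,X}=\alpha_X$; $\mathcal B_{X,Y}=0$ if $|X\cap Y|<k-1$; if $|X\cap Y|=k-1$, with $\{j\}=X\setminus Y$, $\{r\}=Y\setminus X$, $U=X\cap Y$, then $\mathcal B_{X,Y}=\operatorname{sgn}(l_j(e_U)l_r(e_U))\,\alpha_r$. **Integrals.** Fix an orientation of $\mathbb R^k$. For $X=\{j_1,\dots,j_k\}$ let $\omega_X=\frac{df_{j_1}}{f_{j_1}}\wedge\dots\wedge\frac{df_{j_k}}{f_{j_k}}$, ordered so that $df_{j_1}\wedge\dots\wedge df_{j_k}$ is positively oriented (if $k=1$, $\omega_X=\pm df_{j_1}/f_{j_1}$ with the sign for which $\pm df_{j_1}$ is positively oriented), and $\Omega_X=\big(\prod_{j=1}^N|f_j|^{\alpha_j}\big)\omega_X$. All forms $f_0,f_j$ are extended complex-affinely to $\mathbb C^k$. For $\rho\in\mathbb C$, $|\rho|=1$, let $\mathcal C_X^\rho=\{X+\rho\sum_{j\in X}a_je_{X\setminus\{j\}}: a_j>0\}\subset\mathbb C^k$, oriented as the image of $\mathcal C_X^+\subset\mathbb R^k$ under $x\mapsto X+\rho(x-X)$. For $\operatorname{Im}\rho<0$ and $\operatorname{Re}(\rho\lambda)>0$ let $$I^+_{X,X'}(\lambda)=\int_{\mathcal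 C_X^\rho}e^{-\lambda f_0}\,\Omega_{X'},$$ where on $\bigcup_{\operatorname{Im}\rho<0}\mathcal C_X^\rho$ (which is simply connected and disjoint from the complexified hyperplanes) $\Omega_{X'}$ denotes the holomorphic branch which is the immediate analytic extension of the real form $\Omega_{X'}$ on $\Delta_X\subset\mathcal C_X^+=\mathcal C_X^1$ (i.e. it tends to it as $\rho\to1$). The value does not depend on $\rho$ and defines an analytic function on $\mathbb C\setminus i\mathbb R_{\le0}$. Similarly, $I^-_{X,X'}(\lambda)$ is defined with $\operatorname{Im}\rho>0$, $\operatorname{Re}(\rho\lambda)>0$ and the branch on $\bigcup_{\operatorname{Im}\rho>0}\mathcal C_X^\rho$ extending the real form on $\Delta_X$; it is analytic on $\mathbb C\setminus i\mathbb R_{\ge0}$. Put $I_X^\pm=(I^\pm_{X,X'})_{X'\in\mathcal X}$. **Sectors.** Fix $0<\varepsilon<\pi/2$ and let $S_\pm=\{\varepsilon-\frac\pi2<\pm\arg\lambda<\frac{3\pi}2-\varepsilon\}$. On the universal cover of $\mathbb C^*$ (with coordinate $\arg\lambda\in\mathbb R$), $S_0,S_1,S_2$ are connected components of the preimages of $S_+,S_-,S_+$ respectively, ordered clockwise, with $S_0\cap S_1\ne\emptyset$, $S_1\cap S_2\neq\emptyset$; e.g. $S_0=\{\varepsilon-\frac\pi2<\arg\lambda<\frac{3\pi}2-\varepsilon\}$, $S_1=\{-\frac{3\pi}2+\varepsilon<\arg\lambda<\frac\pi2-\varepsilon\}$, $S_2=\{\varepsilon-\frac{5\pi}2<\arg\lambda<-\frac\pi2-\varepsilon\}$.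 **Canonical bases.** The formal normal form is $Y'=-(\mathcal A+\frac1\lambda\operatorname{diag}(\mathcal B))Y$, $\operatorname{diag}(\mathcal B)$ being the diagonal part of $\mathcal B$. There is a unique formal change $I=\hat H(\lambda)Y$, $\hat H=\mathrm{Id}+\sum_{m\ge1}H_m\lambda^{-m}$, bringing the equation to the normal form, and on each sector $S_\pm$ a unique holomorphic invertible change $I=H_\pm(\lambda)Y$ doing the same and having $\hat H$ as asymptotic series at infinity (sectorial normalization). A canonical sectorial solution basis in $S_\pm$ is the basis formed by the columns of $H_\pm W$, where $W$ is a diagonal fundamental matrix of the normal form on $S_\pm$; it is unique up to multiplying the basis solutions by constants. A normalized tuple of canonical sectorial solution bases in $S_0,S_1,S_2$ consists of the column bases of the (lifted) matrices $H_+W$ on $S_0$, $H_-W$ on $S_1$, $H_+W$ on $S_2$, where $W$ is one and the same holomorphic branch on the universal cover of a diagonal fundamental matrix of the normal form. *)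

theory Defs
  imports
    "HOL-Complex_Analysis.Complex_Analysis"
    "HOL-Computational_Algebra.Formal_Power_Series"
    "HOL-Library.Landau_Symbols"
begin

section \<open>Hyperplane arrangements\<close>

definition lin_part :: "(real^'k \<Rightarrow> real) \<Rightarrow> real^'k \<Rightarrow> real" where
  "lin_part g z = g z - g 0"

definition hyp :: "(nat \<Rightarrow> real^'k \<Rightarrow> real) \<Rightarrow> nat \<Rightarrow> (real^'k) set" where
  "hyp f j = {x. f j x = 0}"

definition flat :: "(nat \<Rightarrow> real^'k \<Rightarrow> real) \<Rightarrow> nat set \<Rightarrow> (real^'k) set" where
  "flat f U = (\<Inter>j\<in>U. hyp f j)"

text \<open>That each \<open>f j\<close> is nonconstant follows from the condition on \<open>k\<close>-fold intersections.\<close>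

definition generic_arrangement :: "nat \<Rightarrow> (nat \<Rightarrow> real^'k \<Rightarrow> real) \<Rightarrow> bool" where
  "generic_arrangement N f \<longleftrightarrow>
     CARD('k) \<le> N \<and>
     (\<forall>j\<in>{1..N}. linear (lin_part (f j))) \<and>
     inj_on (hyp f) {1..N} \<and>
     (\<forall>J\<subseteq>{1..N}. card J = CARD('k) \<longrightarrow> (\<exists>x. flat f J = {x})) \<and>
     (\<forall>J\<subseteq>{1..N}. card J = CARD('k) + 1 \<longrightarrow> flat f J = {})"

definition vertices :: "nat \<Rightarrow> nat \<Rightarrow> nat set set" where
  "vertices k N = {X. X \<subseteq> {1..N} \<and> card X = k}"

definition vertex_point :: "(nat \<Rightarrow> real^'k \<Rightarrow> real) \<Rightarrow> nat set \<Rightarrow> real^'k" where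
  "vertex_point f X = (THE x. flat f X = {x})"

definition generic_linear_form ::
  "nat \<Rightarrow> (nat \<Rightarrow> real^'k \<Rightarrow> real) \<Rightarrow> (real^'k \<Rightarrow> real) \<Rightarrow> bool" where
  "generic_linear_form N f f0 \<longleftrightarrow>
     linear f0 \<and>
     inj_on (\<lambda>X. f0 (vertex_point f X)) (vertices CARD('k) N) \<and>
     (\<forall>U\<subseteq>{1..N}. card U = CARD('k) - 1 \<longrightarrow> \<not> f0 constant_on flat f U)"

definition edge_vec ::
  "(nat \<Rightarrow> real^'k \<Rightarrow> real) \<Rightarrow> (real^'k \<Rightarrow> real) \<Rightarrow> nat set \<Rightarrow> real^'k" where
  "edge_vec f f0 U =
     (THE v. f0 v = 1 \<and> (\<exists>p. flat f U = range (\<lambda>t. p + t *\<^sub>R v)))"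

definition vertex_domain ::
  "nat \<Rightarrow> (nat \<Rightarrow> real^'k \<Rightarrow> real) \<Rightarrow> (real^'k \<Rightarrow> real) \<Rightarrow> nat set \<Rightarrow> (real^'k) set" where
  "vertex_domain N f f0 X =
     (THE D. D \<in> components (- (\<Union>j\<in>{1..N}. hyp f j)) \<and>
        vertex_point f X \<in> frontier D \<and> (\<forall>x\<in>D. f0 (vertex_point f X) < f0 x))"

definition vertex_cone ::
  "(nat \<Rightarrow> real^'k \<Rightarrow> real) \<Rightarrow> (real^'k \<Rightarrow> real) \<Rightarrow> nat set \<Rightarrow> (real^'k) set" where
  "vertex_cone f f0 X =
     (THE C. C \<in> components (- (\<Union>j\<in>X. hyp f j)) \<and>
        (\<forall>x\<in>C. f0 (vertex_point f X) < f0 x))"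


section \<open>The matrices of the equation\<close>

definition matA ::
  "(nat \<Rightarrow> real^'k \<Rightarrow> real) \<Rightarrow> (real^'k \<Rightarrow> real) \<Rightarrow> nat set \<Rightarrow> nat set \<Rightarrow> complex" where
  "matA f f0 X Y = (if X = Y then of_real (f0 (vertex_point f X)) else 0)"

definition matB ::
  "(nat \<Rightarrow> real^'k \<Rightarrow> real) \<Rightarrow> (nat \<Rightarrow> real) \<Rightarrow> (real^'k \<Rightarrow> real) \<Rightarrow>
     nat set \<Rightarrow> nat set \<Rightarrow> complex" where
  "matB f \<alpha> f0 X Y =
     (if X = Y then of_real (\<Sum>j\<in>X. \<alpha> j)
      else if card (X \<inter> Y) = CARD('k) - 1 then
        (let j = the_elem (X - Y); r = the_elem (Y - X); e = edge_vec f f0 (X \<inter> Y)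
         in of_real (sgn (lin_part (f j) e * lin_part (f r) e) * \<alpha> r))
      else 0)"


section \<open>The integrals\<close>

text \<open>Complex-affine extension of a real affine form from real to complex \<open>k\<close>-space.\<close>

definition cext :: "(real^'k \<Rightarrow> real) \<Rightarrow> complex^'k \<Rightarrow> complex" where
  "cext g z = Complex (g (\<chi> i. Re (z $ i))) (lin_part g (\<chi> i. Im (z $ i)))"

definition cvec :: "real^'k \<Rightarrow> complex^'k" where
  "cvec x = (\<chi> i. of_real (x $ i))"

definition rot :: "(nat \<Rightarrow> real^'k \<Rightarrow> real) \<Rightarrow> nat set \<Rightarrow> complex \<Rightarrow> real^'k \<Rightarrow> complex^'k" where
  "rot f X \<rho> x = cvec (vertex_point f X) + \<rho> *s cvec (x - vertex_point f X)"

definition rot_cone ::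
  "(nat \<Rightarrow> real^'k \<Rightarrow> real) \<Rightarrow> (real^'k \<Rightarrow> real) \<Rightarrow> nat set \<Rightarrow> complex \<Rightarrow> (complex^'k) set" where
  "rot_cone f f0 X \<rho> =
     {cvec (vertex_point f X) + \<rho> *s cvec (\<Sum>j\<in>X. a j *\<^sub>R edge_vec f f0 (X - {j})) | a.
        \<forall>j\<in>X. 0 < a j}"

definition lower_arc :: "complex set" where
  "lower_arc = {\<rho>. cmod \<rho> = 1 \<and> Im \<rho> < 0}"

definition upper_arc :: "complex set" where
  "upper_arc = {\<rho>. cmod \<rho> = 1 \<and> 0 < Im \<rho>}"

text \<open>
  \<open>\<Phi>\<close> is the branch over the union of the cones \<open>rot_cone f f0 X \<rho>\<close>, \<open>\<rho> \<in> P\<close>, of the factor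
  \<open>\<Prod>j. \<bar>f j\<bar> powr \<alpha> j\<close> on \<open>vertex_domain N f f0 X\<close>.  On that domain the factor is a constant
  multiple of a branch of \<open>\<Prod>j. f j powr \<alpha> j\<close>, so its continuations are the functions
  \<open>c * exp (\<Sum>j. \<alpha> j * M j)\<close> with \<open>M j\<close> a branch of the logarithm of \<open>f j\<close>.  The union of the
  cones has real dimension \<open>k + 1\<close>, hence is not open for \<open>k > 1\<close>; a continuous
  logarithm of the nonvanishing \<open>f j\<close> on it is the restriction of a function holomorphic nearby.
\<close>

definition is_branch ::
  "nat \<Rightarrow> (nat \<Rightarrow> real^'k \<Rightarrow> real) \<Rightarrow> (nat \<Rightarrow> real) \<Rightarrow> (real^'k \<Rightarrow> real) \<Rightarrow>
     complex set \<Rightarrow> nat set \<Rightarrow> (complex^'k \<Rightarrow> complex) \<Rightarrow> bool" where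
  "is_branch N f \<alpha> f0 P X \<Phi> \<longleftrightarrow>
     (\<exists>M c. (\<forall>j\<in>{1..N}. continuous_on (\<Union>\<rho>\<in>P. rot_cone f f0 X \<rho>) (M j) \<and>
               (\<forall>z\<in>(\<Union>\<rho>\<in>P. rot_cone f f0 X \<rho>). exp (M j z) = cext (f j) z)) \<and>
            (\<forall>z\<in>(\<Union>\<rho>\<in>P. rot_cone f f0 X \<rho>).
               \<Phi> z = c * exp (\<Sum>j\<in>{1..N}. of_real (\<alpha> j) * M j z))) \<and>
     (\<forall>x\<in>vertex_domain N f f0 X.
        ((\<lambda>\<rho>. \<Phi> (rot f X \<rho> x)) \<longlongrightarrow> of_real (\<Prod>j\<in>{1..N}. \<bar>f j x\<bar> powr \<alpha> j)) (at 1 within P))"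

definition branch ::
  "nat \<Rightarrow> (nat \<Rightarrow> real^'k \<Rightarrow> real) \<Rightarrow> (nat \<Rightarrow> real) \<Rightarrow> (real^'k \<Rightarrow> real) \<Rightarrow>
     complex set \<Rightarrow> nat set \<Rightarrow> complex^'k \<Rightarrow> complex" where
  "branch N f \<alpha> f0 P X = (SOME \<Phi>. is_branch N f \<alpha> f0 P X \<Phi>)"

text \<open>
  The number \<open>ori\<close>, which is \<open>1\<close> or \<open>-1\<close>, is the sign of the standard basis in the fixed
  orientation of real \<open>k\<close>-space.  The form \<open>log_form\<close> is evaluated at a point \<open>z\<close> on a
  tuple \<open>v\<close> of \<open>k\<close> vectors.  An arbitrary ordering \<open>p\<close> of \<open>X\<close> is corrected by
  the sign that makes the product of the \<open>df j\<close> positively oriented; for \<open>k > 1\<close> this amounts to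
  choosing a positive ordering, and for \<open>k = 1\<close> it is the sign in \<open>\<plusminus> df j / f j\<close>.
\<close>

definition log_form ::
  "(nat \<Rightarrow> real^'k \<Rightarrow> real) \<Rightarrow> real \<Rightarrow> nat set \<Rightarrow> complex^'k \<Rightarrow> ('k \<Rightarrow> complex^'k) \<Rightarrow> complex" where
  "log_form f ori X z v =
     (let p = (SOME p :: 'k \<Rightarrow> nat. bij_betw p UNIV X);
          s = sgn (ori * det (\<chi> a b. lin_part (f (p a)) (axis b 1)))
      in of_real s * det (\<chi> a b. cext (lin_part (f (p a))) (v b)) / (\<Prod>a\<in>UNIV. cext (f (p a)) z))"

text \<open>
  With \<open>\<mu>\<close> the independent variable of the equation, this is the
  density, with respect to Lebesgue measure on \<open>vertex_cone f f0 X\<close>, of the pullback of the form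
  \<open>exp (- \<mu> f0) \<Omega>\<^bsub>X'\<^esub>\<close> under \<open>rot f X \<rho>\<close>, whose differential maps \<open>v\<close> to \<open>\<rho> *s v\<close>.  The factor \<open>ori\<close>
  arises since the integral of \<open>g dx\<^sub>1 \<dots> dx\<^sub>k\<close> over an oriented domain is \<open>ori\<close> times the
  Lebesgue integral of \<open>g\<close>.
\<close>

definition pullback_density ::
  "nat \<Rightarrow> (nat \<Rightarrow> real^'k \<Rightarrow> real) \<Rightarrow> (nat \<Rightarrow> real) \<Rightarrow> (real^'k \<Rightarrow> real) \<Rightarrow> real \<Rightarrow>
     complex set \<Rightarrow> nat set \<Rightarrow> nat set \<Rightarrow> complex \<Rightarrow> complex \<Rightarrow> real^'k \<Rightarrow> complex" where
  "pullback_density N f \<alpha> f0 ori P X X' \<mu> \<rho> x =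
     (let z = rot f X \<rho> x
      in of_real ori * exp (- \<mu> * cext f0 z) * branch N f \<alpha> f0 P X z *
         log_form f ori X' z (\<lambda>b. \<rho> *s axis b 1))"

text \<open>
  The common value, for all admissible \<open>\<rho> \<in> P\<close>, of the absolutely convergent integrals.
  The last argument is the component \<open>X'\<close> of the vector function indexed by \<open>X\<close>.
\<close>

definition cone_integral ::
  "nat \<Rightarrow> (nat \<Rightarrow> real^'k \<Rightarrow> real) \<Rightarrow> (nat \<Rightarrow> real) \<Rightarrow> (real^'k \<Rightarrow> real) \<Rightarrow> real \<Rightarrow>
     complex set \<Rightarrow> nat set \<Rightarrow> complex \<Rightarrow> nat set \<Rightarrow> complex" where
  "cone_integral N f \<alpha> f0 ori P X \<mu> X' =
     (THE v. \<forall>\<rho>\<in>P. 0 < Re (\<rho> * \<mu>) \<longrightarrow>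
        has_bochner_integral lborel
          (\<lambda>x. indicator (vertex_cone f f0 X) x *\<^sub>R pullback_density N f \<alpha> f0 ori P X X' \<mu> \<rho> x) v)"

definition Iplus ::
  "nat \<Rightarrow> (nat \<Rightarrow> real^'k \<Rightarrow> real) \<Rightarrow> (nat \<Rightarrow> real) \<Rightarrow> (real^'k \<Rightarrow> real) \<Rightarrow> real \<Rightarrow>
     nat set \<Rightarrow> complex \<Rightarrow> nat set \<Rightarrow> complex" where
  "Iplus N f \<alpha> f0 ori = cone_integral N f \<alpha> f0 ori lower_arc"

definition Iminus ::
  "nat \<Rightarrow> (nat \<Rightarrow> real^'k \<Rightarrow> real) \<Rightarrow> (nat \<Rightarrow> real) \<Rightarrow> (real^'k \<Rightarrow> real) \<Rightarrow> real \<Rightarrow>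
     nat set \<Rightarrow> complex \<Rightarrow> nat set \<Rightarrow> complex" where
  "Iminus N f \<alpha> f0 ori = cone_integral N f \<alpha> f0 ori upper_arc"


section \<open>Linear systems and their canonical sectorial bases\<close>

text \<open>
  Vectors and matrices are functions, of which only the values on the finite index set \<open>V\<close>
  matter.  A family \<open>I x \<mu> x'\<close> of vector functions has \<open>I x\<close> as its column with index \<open>x\<close>.
\<close>

definition invertible_matrix :: "'v set \<Rightarrow> ('v \<Rightarrow> 'v \<Rightarrow> complex) \<Rightarrow> bool" where
  "invertible_matrix V P \<longleftrightarrow>
     (\<exists>Q. \<forall>x\<in>V. \<forall>y\<in>V. (\<Sum>z\<in>V. P x z * Q z y) = (if x = y then 1 else 0) \<and>
                      (\<Sum>z\<in>V. Q x z * P z y) = (if x = y then 1 else 0))"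

definition diag_part :: "('v \<Rightarrow> 'v \<Rightarrow> complex) \<Rightarrow> 'v \<Rightarrow> 'v \<Rightarrow> complex" where
  "diag_part B x y = (if x = y then B x y else 0)"

definition sys_matrix ::
  "('v \<Rightarrow> 'v \<Rightarrow> complex) \<Rightarrow> ('v \<Rightarrow> 'v \<Rightarrow> complex) \<Rightarrow> complex \<Rightarrow> 'v \<Rightarrow> 'v \<Rightarrow> complex" where
  "sys_matrix A B \<mu> x y = - (A x y + B x y / \<mu>)"

definition solution_on ::
  "'v set \<Rightarrow> ('v \<Rightarrow> 'v \<Rightarrow> complex) \<Rightarrow> ('v \<Rightarrow> 'v \<Rightarrow> complex) \<Rightarrow> complex set \<Rightarrow>
     (complex \<Rightarrow> 'v \<Rightarrow> complex) \<Rightarrow> bool" where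
  "solution_on V A B S I \<longleftrightarrow>
     (\<forall>\<mu>\<in>S. \<forall>x\<in>V. ((\<lambda>\<nu>. I \<nu> x) has_field_derivative
        (\<Sum>y\<in>V. sys_matrix A B \<mu> x y * I \<mu> y)) (at \<mu>))"

text \<open>
  The formal variable \<open>fps_X\<close> stands for \<open>1 / \<mu>\<close>, so the derivative in \<open>\<mu>\<close> is
  \<open>- fps_X\<^sup>2 * fps_deriv\<close>.  A change \<open>I = H Y\<close> transforms \<open>I' = M I\<close> to \<open>Y' = N Y\<close>
  iff \<open>H' = M H - H N\<close>.
\<close>

definition fps_sys_matrix ::
  "('v \<Rightarrow> 'v \<Rightarrow> complex) \<Rightarrow> ('v \<Rightarrow> 'v \<Rightarrow> complex) \<Rightarrow> 'v \<Rightarrow> 'v \<Rightarrow> complex fps" where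
  "fps_sys_matrix A B x y = - (fps_const (A x y) + fps_const (B x y) * fps_X)"

definition formal_normalization ::
  "'v set \<Rightarrow> ('v \<Rightarrow> 'v \<Rightarrow> complex) \<Rightarrow> ('v \<Rightarrow> 'v \<Rightarrow> complex) \<Rightarrow> ('v \<Rightarrow> 'v \<Rightarrow> complex fps) \<Rightarrow> bool" where
  "formal_normalization V A B F \<longleftrightarrow>
     (\<forall>x\<in>V. \<forall>y\<in>V. fps_nth (F x y) 0 = (if x = y then 1 else 0) \<and>
        - (fps_X\<^sup>2 * fps_deriv (F x y)) =
          (\<Sum>z\<in>V. fps_sys_matrix A B x z * F z y) -
          (\<Sum>z\<in>V. F x z * fps_sys_matrix A (diag_part B) z y))"

definition sectorial_normalization ::
  "'v set \<Rightarrow> ('v \<Rightarrow> 'v \<Rightarrow> complex) \<Rightarrow> ('v \<Rightarrow> 'v \<Rightarrow> complex) \<Rightarrow> complex set \<Rightarrow>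
     (complex \<Rightarrow> 'v \<Rightarrow> 'v \<Rightarrow> complex) \<Rightarrow> bool" where
  "sectorial_normalization V A B S H \<longleftrightarrow>
     (\<forall>x\<in>V. \<forall>y\<in>V. (\<lambda>\<nu>. H \<nu> x y) holomorphic_on S) \<and>
     (\<forall>\<mu>\<in>S. invertible_matrix V (H \<mu>)) \<and>
     (\<forall>\<mu>\<in>S. \<forall>x\<in>V. \<forall>y\<in>V. ((\<lambda>\<nu>. H \<nu> x y) has_field_derivative
        (\<Sum>z\<in>V. sys_matrix A B \<mu> x z * H \<mu> z y) -
        (\<Sum>z\<in>V. H \<mu> x z * sys_matrix A (diag_part B) \<mu> z y)) (at \<mu>)) \<and>
     (\<exists>F. formal_normalization V A B F \<and>
        (\<forall>x\<in>V. \<forall>y\<in>V. \<forall>n.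
           (\<lambda>\<nu>. H \<nu> x y - (\<Sum>m\<le>n. fps_nth (F x y) m / \<nu> ^ m))
             \<in> O[inf at_infinity (principal S)](\<lambda>\<nu>. 1 / \<nu> ^ (n + 1))))"

definition diagonal_fundamental ::
  "'v set \<Rightarrow> ('v \<Rightarrow> 'v \<Rightarrow> complex) \<Rightarrow> ('v \<Rightarrow> 'v \<Rightarrow> complex) \<Rightarrow> complex set \<Rightarrow>
     (complex \<Rightarrow> 'v \<Rightarrow> 'v \<Rightarrow> complex) \<Rightarrow> bool" where
  "diagonal_fundamental V A B S W \<longleftrightarrow>
     (\<forall>\<mu>\<in>S. invertible_matrix V (W \<mu>) \<and> (\<forall>x\<in>V. \<forall>y\<in>V. x \<noteq> y \<longrightarrow> W \<mu> x y = 0)) \<and>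
     (\<forall>y\<in>V. solution_on V A (diag_part B) S (\<lambda>\<mu> x. W \<mu> x y))"

definition canonical_sectorial_basis ::
  "'v set \<Rightarrow> ('v \<Rightarrow> 'v \<Rightarrow> complex) \<Rightarrow> ('v \<Rightarrow> 'v \<Rightarrow> complex) \<Rightarrow> complex set \<Rightarrow>
     ('v \<Rightarrow> complex \<Rightarrow> 'v \<Rightarrow> complex) \<Rightarrow> bool" where
  "canonical_sectorial_basis V A B S I \<longleftrightarrow>
     (\<exists>H W. sectorial_normalization V A B S H \<and> diagonal_fundamental V A B S W \<and>
        (\<forall>\<mu>\<in>S. \<forall>x\<in>V. \<forall>x'\<in>V. I x \<mu> x' = (\<Sum>z\<in>V. H \<mu> x' z * W \<mu> z x)))"


section \<open>Sectors and normalized tuples\<close>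

definition sector_plus :: "real \<Rightarrow> complex set" where
  "sector_plus \<epsilon> =
     {of_real r * cis \<theta> | r \<theta>. 0 < r \<and> \<epsilon> - pi/2 < \<theta> \<and> \<theta> < 3*pi/2 - \<epsilon>}"

definition sector_minus :: "real \<Rightarrow> complex set" where
  "sector_minus \<epsilon> =
     {of_real r * cis \<theta> | r \<theta>. 0 < r \<and> \<epsilon> - pi/2 < - \<theta> \<and> - \<theta> < 3*pi/2 - \<epsilon>}"

text \<open>
  The universal cover of the punctured plane is the complex plane with the covering map \<open>exp\<close>; the
  coordinate \<open>arg\<close> is \<open>Im\<close>, and clockwise means in the direction of decreasing \<open>Im\<close>.
\<close>

definition clockwise_sectors ::
  "real \<Rightarrow> complex set \<Rightarrow> complex set \<Rightarrow> complex set \<Rightarrow> bool" where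
  "clockwise_sectors \<epsilon> S0 S1 S2 \<longleftrightarrow>
     S0 \<in> components (exp -` sector_plus \<epsilon>) \<and>
     S1 \<in> components (exp -` sector_minus \<epsilon>) \<and>
     S2 \<in> components (exp -` sector_plus \<epsilon>) \<and>
     S0 \<inter> S1 \<noteq> {} \<and> S1 \<inter> S2 \<noteq> {} \<and>
     Sup (Im ` S1) < Sup (Im ` S0) \<and> Sup (Im ` S2) < Sup (Im ` S1)"

text \<open>
  In the coordinate \<open>w\<close> with \<open>\<mu> = exp w\<close> the system \<open>dW/d\<mu> = N(\<mu>) W\<close>
  reads \<open>dW/dw = exp w * N(exp w) W\<close>.
\<close>

definition diagonal_fundamental_cover ::
  "'v set \<Rightarrow> ('v \<Rightarrow> 'v \<Rightarrow> complex) \<Rightarrow> ('v \<Rightarrow> 'v \<Rightarrow> complex) \<Rightarrow>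
     (complex \<Rightarrow> 'v \<Rightarrow> 'v \<Rightarrow> complex) \<Rightarrow> bool" where
  "diagonal_fundamental_cover V A B W \<longleftrightarrow>
     (\<forall>w. invertible_matrix V (W w) \<and> (\<forall>x\<in>V. \<forall>y\<in>V. x \<noteq> y \<longrightarrow> W w x y = 0)) \<and>
     (\<forall>w. \<forall>x\<in>V. \<forall>y\<in>V. ((\<lambda>u. W u x y) has_field_derivative
        exp w * (\<Sum>z\<in>V. sys_matrix A (diag_part B) (exp w) x z * W w z y)) (at w))"

definition normalized_tuple ::
  "'v set \<Rightarrow> ('v \<Rightarrow> 'v \<Rightarrow> complex) \<Rightarrow> ('v \<Rightarrow> 'v \<Rightarrow> complex) \<Rightarrow> real \<Rightarrow>
     complex set \<Rightarrow> complex set \<Rightarrow> complex set \<Rightarrow>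
     ('v \<Rightarrow> complex \<Rightarrow> 'v \<Rightarrow> complex) \<Rightarrow> ('v \<Rightarrow> complex \<Rightarrow> 'v \<Rightarrow> complex) \<Rightarrow>
     ('v \<Rightarrow> complex \<Rightarrow> 'v \<Rightarrow> complex) \<Rightarrow> bool" where
  "normalized_tuple V A B \<epsilon> S0 S1 S2 J0 J1 J2 \<longleftrightarrow>
     (\<exists>Hp Hm W.
        sectorial_normalization V A B (sector_plus \<epsilon>) Hp \<and>
        sectorial_normalization V A B (sector_minus \<epsilon>) Hm \<and>
        diagonal_fundamental_cover V A B W \<and>
        (\<forall>x\<in>V. \<forall>x'\<in>V.
           (\<forall>w\<in>S0. J0 x w x' = (\<Sum>z\<in>V. Hp (exp w) x' z * W w z x)) \<and>
           (\<forall>w\<in>S1. J1 x w x' = (\<Sum>z\<in>V. Hm (exp w) x' z * W w z x)) \<and>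
           (\<forall>w\<in>S2. J2 x w x' = (\<Sum>z\<in>V. Hp (exp w) x' z * W w z x))))"

end

theory Submission
  imports Defs "HOL-Real_Asymp.Real_Asymp"
begin

text \<open>
  In the coordinates along the edges at a vertex \<open>X\<close>, each integral over the rotated cone is, up to a
  constant and the factor \<open>exp (- \<mu> * f0 X)\<close>, a Laplace integral over the positive orthant of a
  product of powers of the coordinates and of factors \<open>1 + s * t\<close> with \<open>t\<close> linear.  Integration by
  parts along the coordinates shows that it does not depend on the direction \<open>s\<close> of rotation, and yields
  contiguity relations between the integrands belonging to different vertices; together these are
  the differential system.  Scaling the variable so that \<open>s\<close> becomes inversely proportional to \<open>\<mu>\<close>
  and expanding the factors \<open>1 + s * t\<close> at \<open>s = 0\<close> gives the asymptotic series, with identity leading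
  term after division by the solutions of the diagonal normal form.  Such series are unique and may be
  differentiated, so the series is the formal normalization; the monodromy factors
  come from comparing branches of the logarithm on consecutive sectors.
\<close>

section \<open>Parameter integrals and the half-line\<close>

text \<open>The matrix of the system contains only weights and signs, while the integrals carry
  determinants and the values \<open>l j (edge W j)\<close>. The link is that
  \<open>f0 - f0 (pt W)\<close> is the sum over \<open>j \<in> W\<close> of
  \<open>f j / l j (edge W j)\<close>: differentiation in \<open>\<mu>\<close> brings down
  \<open>f0\<close>, each summand cancels one denominator, and integration by parts along
  \<open>edge W j\<close> restores a denominator \<open>f r\<close>, where \<open>r = j\<close>
  gives the diagonal of the matrix and the other \<open>r\<close> give the neighbours of
  \<open>W\<close>. The remaining ratios are, up to sign, ratios of determinants. The second
  difficulty is uniformity. A linear form takes both signs on a cone, so \<open>1 + s * t\<close>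
  has to avoid 0 and the branch cut for all real \<open>t\<close>; it does as long as
  \<open>s\<close> keeps a positive angle with the real axis. For a fixed value of
  \<open>\<mu> * s\<close> this confines \<open>\<mu>\<close> to an opening below \<open>pi\<close>,
  whereas the sectors are wider, so they are assembled from pieces whose expansions are matched on a
  common ray. Constants depending on the vertex alone, such as Jacobians, only rescale a solution;
  they have to be nonzero but are never computed.\<close>

text \<open>A single integrable bound on \<open>F\<close> itself suffices: by Cauchy's inequality on
  discs of radius \<open>r\<close> it bounds the derivative by \<open>g a / r\<close>, hence also
  the difference quotients, and dominated convergence applies to these.\<close>

lemma has_field_derivative_integral:
  fixes F :: "complex \<Rightarrow> 'a \<Rightarrow> complex"
  assumes "open S" "z0 \<in> S"
    and hol: "\<And>a. a \<in> space M \<Longrightarrow> (\<lambda>z. F z a) holomorphic_on S"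
    and meas: "\<And>z. z \<in> S \<Longrightarrow> F z \<in> borel_measurable M"
    and bd: "\<And>z a. z \<in> S \<Longrightarrow> a \<in> space M \<Longrightarrow> norm (F z a) \<le> g a"
    and g: "integrable M g"
    and der: "\<And>a. a \<in> space M \<Longrightarrow> ((\<lambda>z. F z a) has_field_derivative F' a) (at z0)"
  shows "integrable M F'" "((\<lambda>z. \<integral>a. F z a \<partial>M) has_field_derivative (\<integral>a. F' a \<partial>M)) (at z0)"
proof -
  obtain e where e: "e > 0" "cball z0 e \<subseteq> S"
    using assms(1,2) open_contains_cball_eq by blast
  define r where "r = e/2"
  have r: "r > 0" using e by (simp add: r_def)
  have sub: "cball z r \<subseteq> S" if "z \<in> ball z0 r" for z
  proof
    fix y assume "y \<in> cball z r"
    with that have "dist z0 y \<le> e"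
      using dist_triangle[of z0 y z] by (auto simp: r_def)
    with e show "y \<in> S" by auto
  qed
  have gnn: "0 \<le> g a" if "a \<in> space M" for a
    using bd[OF \<open>z0 \<in> S\<close> that] norm_ge_zero order_trans by blast
  have dbd: "norm (deriv (\<lambda>z. F z a) z) \<le> g a / r" if "a \<in> space M" "z \<in> ball z0 r" for a z
  proof -
    have "norm ((deriv ^^ 1) (\<lambda>z. F z a) z) \<le> fact 1 * g a / r ^ 1"
    proof (rule Cauchy_inequality)
      show "(\<lambda>z. F z a) holomorphic_on ball z r"
        using hol[OF that(1)] sub[OF that(2)] ball_subset_cball holomorphic_on_subset by blast
      show "continuous_on (cball z r) (\<lambda>z. F z a)"
        using hol[OF that(1)] sub[OF that(2)] holomorphic_on_imp_continuous_on holomorphic_on_subset by blast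
      show "norm (F x a) \<le> g a" if "norm (z - x) = r" for x
        using sub[OF \<open>z \<in> ball z0 r\<close>] that \<open>a \<in> space M\<close> by (intro bd) (auto simp: dist_norm)
    qed (use r in auto)
    then show ?thesis by simp
  qed
  have lip: "norm (F z a - F z0 a) \<le> g a / r * norm (z - z0)" if "a \<in> space M" "z \<in> ball z0 r" for a z
  proof (rule field_differentiable_bound[where S = "ball z0 r"])
    fix y assume y: "y \<in> ball z0 r"
    then have "y \<in> S" using sub[OF y] r by auto
    then have "(\<lambda>z. F z a) field_differentiable at y"
      using hol[OF that(1)] \<open>open S\<close> holomorphic_on_imp_differentiable_at by blast
    then show "((\<lambda>z. F z a) has_field_derivative deriv (\<lambda>z. F z a) y) (at y within ball z0 r)"
      using field_differentiable_derivI has_field_derivative_at_within by blast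
  qed (use dbd that r in auto)
  define q where "q = (\<lambda>z a. (F z a - F z0 a) / (z - z0))"
  have qbd: "norm (q z a) \<le> g a / r" if "a \<in> space M" "z \<in> ball z0 r" "z \<noteq> z0" for a z
    using lip[OF that(1,2)] that(3) by (simp add: q_def norm_divide divide_le_eq)
  have qlim: "((\<lambda>z. q z a) \<longlongrightarrow> F' a) (at z0 within ball z0 r)" if "a \<in> space M" for a
    using der[OF that] r unfolding q_def has_field_derivative_iff
    by (metis Lim_at_imp_Lim_at_within)
  have zS: "z \<in> S" if "z \<in> ball z0 r" for z using sub[OF that] r by auto
  have qm: "q z \<in> borel_measurable M" if "z \<in> ball z0 r" for z
    unfolding q_def using meas[OF zS[OF that]] meas[OF \<open>z0 \<in> S\<close>] by measurable
  have int: "integrable M (F z)" if "z \<in> S" for z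
    using g meas[OF that] bd[OF that] gnn by (intro Bochner_Integration.integrable_bound[OF g]) (auto intro!: AE_I2)
  have seq: "integrable M F' \<and> (\<lambda>n. integral\<^sup>L M (q (X n))) \<longlonglongrightarrow> integral\<^sup>L M F'"
    if X: "\<forall>i. X i \<in> ball z0 r - {z0}" "X \<longlonglongrightarrow> z0" for X
  proof -
    have lim: "(\<lambda>n. q (X n) a) \<longlonglongrightarrow> F' a" if "a \<in> space M" for a
      using qlim[OF that] X unfolding tendsto_at_iff_sequentially by (auto simp: o_def)
    have m: "F' \<in> borel_measurable M"
      by (rule borel_measurable_LIMSEQ_metric[OF _ lim]) (use qm X in auto)
    have gi: "integrable M (\<lambda>a. g a / r)" using g by simp
    have b: "AE a in M. norm (q (X n) a) \<le> g a / r" for n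
      using X by (intro AE_I2 qbd) auto
    have l: "AE a in M. (\<lambda>n. q (X n) a) \<longlonglongrightarrow> F' a" using lim by (intro AE_I2) auto
    have qmX: "\<And>n. q (X n) \<in> borel_measurable M" using qm X by auto
    show ?thesis
      using integrable_dominated_convergence[OF m qmX gi l b] integral_dominated_convergence[OF m qmX gi l b]
      by blast
  qed
  \<comment> \<open>One concrete sequence in the punctured ball, from which the integrability of
    \<open>F'\<close> is read off.\<close>
  have "(\<lambda>n. z0 + of_real (r / (2 + real n))) \<longlonglongrightarrow> z0 + of_real 0"
    by (intro tendsto_intros) real_asymp
  then have "integrable M F' \<and> (\<lambda>n. integral\<^sup>L M (q (z0 + of_real (r / (2 + real n))))) \<longlonglongrightarrow> integral\<^sup>L M F'"
    using r by (intro seq) (auto simp: dist_norm norm_divide divide_simps norm_mult simp del: of_real_divide of_real_add)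
  then show "integrable M F'" by blast
  have "((\<lambda>z. integral\<^sup>L M (q z)) \<longlongrightarrow> integral\<^sup>L M F') (at z0 within ball z0 r)"
    unfolding tendsto_at_iff_sequentially using seq by (auto simp: o_def)
  moreover have "\<forall>\<^sub>F z in at z0 within ball z0 r.
      integral\<^sup>L M (q z) = (integral\<^sup>L M (F z) - integral\<^sup>L M (F z0)) / (z - z0)"
    using int zS \<open>z0 \<in> S\<close>
    by (auto simp: eventually_at_filter q_def integral_diff intro!: always_eventually)
  ultimately have "((\<lambda>z. (integral\<^sup>L M (F z) - integral\<^sup>L M (F z0)) / (z - z0)) \<longlongrightarrow> integral\<^sup>L M F') (at z0 within ball z0 r)"
    by (rule Lim_transform_eventually)
  then show "((\<lambda>z. \<integral>a. F z a \<partial>M) has_field_derivative (\<integral>a. F' a \<partial>M)) (at z0)"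
    using r by (simp add: has_field_derivative_iff at_within_open[of z0 "ball z0 r"])
qed

text \<open>A measure space of its own instead of an indicator: finite products then carry integrals
  over the open orthant, and every coordinate of a point of the space is positive.\<close>

definition pos_measure :: "real measure" where
  "pos_measure = restrict_space lborel {0<..}"

lemma space_pos_measure [simp]: "space pos_measure = {0<..}"
  by (simp add: pos_measure_def space_restrict_space)

lemma measurable_pos_measure [measurable]: "(\<lambda>x. x) \<in> borel_measurable pos_measure"
  unfolding pos_measure_def by (rule measurable_restrict_space1) simp

interpretation pos: product_sigma_finite "\<lambda>_ :: nat. pos_measure"
  unfolding pos_measure_def product_sigma_finite_def
  by (auto intro!: sigma_finite_measure_restrict_space sigma_finite_lborel)

lemma integrable_pos_measure_iff:
  fixes f :: "real \<Rightarrow> 'b::{banach, second_countable_topology}"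
  shows "integrable pos_measure f \<longleftrightarrow> set_integrable lborel {0<..} f"
  unfolding pos_measure_def set_integrable_def by (rule integrable_restrict_space) simp

lemma integral_pos_measure:
  fixes f :: "real \<Rightarrow> 'b::{banach, second_countable_topology}"
  shows "integral\<^sup>L pos_measure f = (LINT x:{0<..}|lborel. f x)"
  unfolding pos_measure_def set_lebesgue_integral_def by (rule integral_restrict_space) simp

lemma integrable_pos_Gamma:
  assumes "b > 0" "c > 0"
  shows "integrable pos_measure (\<lambda>t. exp (- c * t) * t powr (b - 1))"
proof -
  have "(\<lambda>t. norm (complex_of_real t powr (of_real b - 1) / of_real (exp (c * t)))) absolutely_integrable_on {0<..}"
    by (rule absolutely_integrable_norm[unfolded o_def], rule absolutely_integrable_Gamma_integral)
      (use assms in auto)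
  then have "set_integrable lebesgue {0<..} (\<lambda>t. exp (- c * t) * t powr (b - 1))"
    by (rule set_integrable_cong[THEN iffD1, rotated -1])
       (auto simp: norm_divide norm_powr_real_powr exp_minus field_simps norm_powr_real)
  then show ?thesis
    unfolding integrable_pos_measure_iff set_integrable_def
    by (subst (asm) integrable_completion) auto
qed

text \<open>The integral is \<open>Gamma b\<close>. Its positivity is what later makes the leading
  coefficient of the expansions nonzero.\<close>

lemma integral_pos_Gamma_pos:
  assumes "b > 0"
  shows "0 < integral\<^sup>L pos_measure (\<lambda>t. exp (- t) * t powr (b - 1))"
proof -
  have "set_integrable lborel {0<..} (\<lambda>t. exp (- t) * t powr (b - 1))"
    using integrable_pos_Gamma[OF assms, of 1] by (simp add: integrable_pos_measure_iff)
  then have "((\<lambda>t. exp (- t) * t powr (b - 1)) has_integral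
      (LINT t:{0<..}|lborel. exp (- t) * t powr (b - 1))) {0<..}"
    by (metis has_integral_integral set_borel_integral_eq_integral)
  moreover have "((\<lambda>t. exp (- t) * t powr (b - 1)) has_integral Gamma b) {0<..}"
  proof -
    have "((\<lambda>t. exp (- t) * t powr (b - 1)) has_integral Gamma b) {0..}"
      by (rule has_integral_eq[OF _ Gamma_integral_real[OF assms]]) (auto simp: exp_minus field_simps)
    then show ?thesis
      by (rule has_integral_spike_set_eq[THEN iffD1, rotated -1])
         (auto intro: negligible_subset[of "{0}"])
  qed
  ultimately show ?thesis
    unfolding integral_pos_measure using has_integral_unique Gamma_real_pos[OF assms] by metis
qed

text \<open>Integration by parts without boundary terms: the bound forces \<open>G\<close> to vanish
  at 0 because \<open>b > 0\<close>, and at infinity because \<open>c > 0\<close>.\<close>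

lemma integral_deriv_pos_measure_zero:
  fixes G g :: "real \<Rightarrow> complex"
  assumes der: "\<And>t. t > 0 \<Longrightarrow> (G has_vector_derivative g t) (at t)"
    and cont: "continuous_on {0<..} g"
    and int: "integrable pos_measure g"
    and bd: "\<And>t. t > 0 \<Longrightarrow> norm (G t) \<le> C * (t powr b * exp (- c * t))"
    and b: "b > 0" and c: "c > 0"
  shows "integral\<^sup>L pos_measure g = 0"
proof -
  have ein: "einterval 0 \<infinity> = {0::real<..}"
    by (auto simp: einterval_def)
  have "(LBINT t=0..\<infinity>. g t) = 0 - 0"
  proof (rule interval_integral_FTC_integrable)
    show "(G has_vector_derivative g x) (at x)" if "0 < ereal x" for x
      using der that by auto
    show "isCont g x" if "0 < ereal x" for x
      using cont that continuous_on_eq_continuous_at[of "{0<..}" g] by auto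
    show "set_integrable lborel (einterval 0 \<infinity>) g"
      using int by (simp add: ein integrable_pos_measure_iff)
    have "(G \<longlongrightarrow> 0) (at_right 0)"
    proof (rule Lim_null_comparison)
      show "\<forall>\<^sub>F t in at_right 0. norm (G t) \<le> C * (t powr b * exp (- c * t))"
        using bd by (auto simp: eventually_at_filter)
      show "((\<lambda>t. C * (t powr b * exp (- c * t))) \<longlongrightarrow> 0) (at_right 0)"
        using b by real_asymp
    qed
    then show "((G \<circ> real_of_ereal) \<longlongrightarrow> 0) (at_right 0)"
      by (simp add: zero_ereal_def at_right_ereal filterlim_filtermap o_def ereal_tendsto_simps)
    have "(G \<longlongrightarrow> 0) at_top"
    proof (rule Lim_null_comparison)
      show "\<forall>\<^sub>F t in at_top. norm (G t) \<le> C * (t powr b * exp (- c * t))"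
        by (rule eventually_mono[OF eventually_gt_at_top[of 0]]) (use bd in auto)
      show "((\<lambda>t. C * (t powr b * exp (- c * t))) \<longlongrightarrow> 0) at_top"
        using c by real_asymp
    qed
    then show "((G \<circ> real_of_ereal) \<longlongrightarrow> 0) (at_left \<infinity>)"
      by (simp add: at_left_PInf ereal_tendsto_simps filterlim_filtermap o_def)
  qed auto
  then show ?thesis
    by (simp add: integral_pos_measure interval_lebesgue_integral_0_infty)
qed

section \<open>Laplace integrals over the positive orthant\<close>

text \<open>Multiplication by \<open>cnj s\<close> makes the second summand real, so the imaginary
  part is \<open>- Im s\<close> whatever \<open>t\<close> is. The bound depends only on the angle
  between \<open>s\<close> and the real axis and survives \<open>s\<close> tending to 0.\<close>

lemma norm_one_plus_ge:
  fixes s :: complex and t :: real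
  assumes "d * cmod s \<le> \<bar>Im s\<bar>" "d \<le> 1"
  shows "d \<le> cmod (1 + s * of_real t)"
proof (cases "s = 0")
  case False
  have "\<bar>Im s\<bar> = \<bar>Im (cnj s * (1 + s * of_real t))\<bar>"
    by (simp add: algebra_simps)
  also have "\<dots> \<le> cmod s * cmod (1 + s * of_real t)"
    using abs_Im_le_cmod[of "cnj s * (1 + s * of_real t)"] by (simp add: norm_mult)
  finally have "d * cmod s \<le> cmod (1 + s * of_real t) * cmod s"
    using assms by (simp add: mult.commute)
  then show ?thesis using False by (simp)
qed (use assms in auto)

lemma one_plus_notin_nonpos_Reals:
  assumes "Im s \<noteq> 0 \<or> s = 0"
  shows "1 + s * of_real t \<notin> \<real>\<^sub>\<le>\<^sub>0"
  using assms by (cases "t = 0") (auto simp: complex_nonpos_Reals_iff)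

text \<open>The inequality \<open>ln y \<le> y - 1\<close> at \<open>y = q * (1 + x)\<close>. The
  slope \<open>q\<close> may be as small as desired, so powers of \<open>1 + s * t\<close> can be
  absorbed by an arbitrarily weak exponential.\<close>

lemma ln_one_plus_le:
  assumes "q > 0" "x \<ge> 0"
  shows "ln (1 + x) \<le> (q - 1 - ln q) + q * (x::real)"
proof -
  have "ln (q * (1 + x)) \<le> q * (1 + x) - 1"
    using assms by (intro ln_le_minus_one) auto
  moreover have "ln (q * (1 + x)) = ln q + ln (1 + x)"
    using assms by (intro ln_mult_pos) auto
  ultimately show ?thesis
    by (simp add: algebra_simps)
qed

section \<open>The Laplace integrand and its majorant\<close>

definition incr :: "nat \<Rightarrow> (nat \<Rightarrow> real) \<Rightarrow> nat \<Rightarrow> real" where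
  "incr i \<beta> = \<beta>(i := \<beta> i + 1)"

definition decr :: "nat \<Rightarrow> (nat \<Rightarrow> real) \<Rightarrow> nat \<Rightarrow> real" where
  "decr j \<gamma> = \<gamma>(j := \<gamma> j - 1)"

text \<open>\<open>X\<close> indexes the coordinates along the edges at a vertex, \<open>J\<close>
  the hyperplanes that miss the vertex, and \<open>\<tau> j i\<close> is the slope of the normalized
  form \<open>j\<close> along the edge \<open>i\<close>.\<close>

locale laplace_cone =
  fixes X J :: "nat set" and \<tau> :: "nat \<Rightarrow> nat \<Rightarrow> real"
  assumes finX: "finite X" and finJ: "finite J"
begin

abbreviation PM :: "(nat \<Rightarrow> real) measure" where
  "PM \<equiv> Pi\<^sub>M X (\<lambda>_. pos_measure)"

definition lform where
  "lform j a = (\<Sum>i\<in>X. \<tau> j i * a i)"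

definition csum :: "(nat \<Rightarrow> real) \<Rightarrow> real" where
  "csum a = (\<Sum>i\<in>X. a i)"

text \<open>
  The principal branch is the right one for every \<open>s\<close> off the real axis and for \<open>s = 0\<close>, since then
  \<open>1 + s * t\<close> avoids the closed negative half-line for all real \<open>t\<close>, of either sign.
\<close>

definition ph :: "(nat \<Rightarrow> real) \<Rightarrow> complex \<Rightarrow> (nat \<Rightarrow> real) \<Rightarrow> complex" where
  "ph \<gamma> s a = exp (\<Sum>j\<in>J. of_real (\<gamma> j) * Ln (1 + s * of_real (lform j a)))"

text \<open>The damping \<open>\<sigma>\<close> is kept apart from \<open>s\<close> because the two
  are coupled in two ways: with \<open>\<sigma> = \<mu> * s\<close> and \<open>\<mu>\<close> fixed
  the cone is rotated, and with \<open>\<sigma>\<close> fixed and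
  \<open>s = \<sigma> / \<mu>\<close> the variable \<open>\<mu>\<close> tends to infinity.\<close>

definition T :: "(nat \<Rightarrow> real) \<Rightarrow> (nat \<Rightarrow> real) \<Rightarrow> complex \<Rightarrow> complex \<Rightarrow> (nat \<Rightarrow> real) \<Rightarrow> complex" where
  "T \<beta> \<gamma> \<sigma> s a = exp (- \<sigma> * of_real (csum a)) * of_real (\<Prod>i\<in>X. a i powr (\<beta> i - 1)) * ph \<gamma> s a"

definition E :: "(nat \<Rightarrow> real) \<Rightarrow> (nat \<Rightarrow> real) \<Rightarrow> complex \<Rightarrow> complex \<Rightarrow> complex" where
  "E \<beta> \<gamma> \<sigma> s = integral\<^sup>L PM (T \<beta> \<gamma> \<sigma> s)"

lemma space_PM: "a \<in> space PM \<Longrightarrow> i \<in> X \<Longrightarrow> 0 < a i"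
  by (auto simp: space_PiM PiE_def Pi_def)

lemma incr_pos: "\<forall>i\<in>X. 0 < \<beta> i \<Longrightarrow> \<forall>k\<in>X. 0 < incr i \<beta> k"
  by (auto simp: incr_def add_pos_pos)

lemma norm_ph:
  assumes "Im s \<noteq> 0 \<or> s = 0"
  shows "norm (ph \<gamma> s a) = exp (\<Sum>j\<in>J. \<gamma> j * ln (cmod (1 + s * of_real (lform j a))))"
proof -
  have "1 + s * of_real (lform j a) \<noteq> 0" for j
    using one_plus_notin_nonpos_Reals[OF assms] by (metis nonpos_Reals_zero_I)
  then show ?thesis by (simp add: ph_def norm_exp_eq_Re)
qed

lemma abs_lform_le:
  assumes "\<forall>i\<in>X. 0 < a i" "j \<in> J"
  shows "\<bar>lform j a\<bar> \<le> (\<Sum>j\<in>J. \<Sum>i\<in>X. \<bar>\<tau> j i\<bar>) * csum a"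
proof -
  have "\<bar>lform j a\<bar> \<le> (\<Sum>i\<in>X. \<bar>\<tau> j i\<bar> * a i)"
    unfolding lform_def using assms by (intro order_trans[OF sum_abs] sum_mono) (auto simp: abs_mult)
  also have "\<dots> \<le> (\<Sum>i\<in>X. \<bar>\<tau> j i\<bar> * csum a)"
    unfolding csum_def using assms finX
    by (intro sum_mono mult_left_mono member_le_sum) (auto simp: less_imp_le)
  also have "\<dots> = (\<Sum>i\<in>X. \<bar>\<tau> j i\<bar>) * csum a" by (simp add: sum_distrib_right)
  also have "\<dots> \<le> (\<Sum>j\<in>J. \<Sum>i\<in>X. \<bar>\<tau> j i\<bar>) * csum a"
    using assms finJ unfolding csum_def
    by (intro mult_right_mono member_le_sum[of j J "\<lambda>j. \<Sum>i\<in>X. \<bar>\<tau> j i\<bar>"])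
       (auto intro!: sum_nonneg simp: less_imp_le)
  finally show ?thesis .
qed

lemma csum_nonneg: "\<forall>i\<in>X. 0 < a i \<Longrightarrow> 0 \<le> csum a"
  unfolding csum_def by (intro sum_nonneg) (auto simp: less_imp_le)

text \<open>The norm is controlled by the absolute values of \<open>ln (cmod (1 + s * t))\<close>.
  These are bounded below by \<open>norm_one_plus_ge\<close> and above by
  \<open>ln_one_plus_le\<close>, uniformly for \<open>s\<close> in a bounded double sector around
  the imaginary axis.\<close>

lemma ph_bound:
  assumes "0 < \<kappa>" "0 < d" "d \<le> 1" "0 \<le> R"
  obtains C where "C > 0"
    "\<And>s a. d * cmod s \<le> \<bar>Im s\<bar> \<Longrightarrow> cmod s \<le> R \<Longrightarrow> \<forall>i\<in>X. 0 < a i \<Longrightarrow> norm (ph \<gamma> s a) \<le> C * exp (\<kappa> * csum a)"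
proof -
  define B where "B = (\<Sum>j\<in>J. \<Sum>i\<in>X. \<bar>\<tau> j i\<bar>)"
  define G where "G = (\<Sum>j\<in>J. \<bar>\<gamma> j\<bar>)"
  have B: "B \<ge> 0" and G: "G \<ge> 0" unfolding B_def G_def by (auto intro!: sum_nonneg)
  \<comment> \<open>Small enough that the combined growth rate \<open>G * (q * (R * B))\<close>
    stays below \<open>\<kappa>\<close>; the summand 1 keeps the denominator positive when
    \<open>G\<close>, \<open>R\<close> or \<open>B\<close> vanishes.\<close>
  define q where "q = \<kappa> / (G * R * B + 1)"
  have q: "q > 0" using assms B G by (simp add: q_def add_nonneg_pos)
  have GRB: "G * (q * (R * B)) \<le> \<kappa>"
  proof -
    have "0 < G * R * B + 1" using assms B G by (simp add: add_nonneg_pos)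
    then have "\<kappa> * (G * R * B) / (G * R * B + 1) \<le> \<kappa>"
      using assms by (simp add: pos_divide_le_eq ring_distribs)
    then show ?thesis by (simp add: q_def algebra_simps)
  qed
  define c where "c = q - 1 - ln q"
  have c: "c \<ge> 0" using q ln_le_minus_one[of q] by (simp add: c_def)
  show ?thesis
  proof (rule that[of "exp (G * (c - ln d))"])
    fix s and a :: "nat \<Rightarrow> real" assume s: "d * cmod s \<le> \<bar>Im s\<bar>" "cmod s \<le> R" and a: "\<forall>i\<in>X. 0 < a i"
    have s0: "Im s \<noteq> 0 \<or> s = 0"
      using s(1) assms(2) by (metis abs_zero linorder_not_le mult_pos_pos zero_less_norm_iff)
    have "(\<Sum>j\<in>J. \<gamma> j * ln (cmod (1 + s * of_real (lform j a)))) \<le> (\<Sum>j\<in>J. \<bar>\<gamma> j\<bar> * ((c - ln d) + q * (R * B) * csum a))"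
    proof (rule sum_mono)
      fix j assume j: "j \<in> J"
      let ?w = "cmod (1 + s * of_real (lform j a))"
      have w: "d \<le> ?w" using norm_one_plus_ge s(1) assms(3) by blast
      have "?w \<le> 1 + cmod s * \<bar>lform j a\<bar>"
        by (rule order_trans[OF norm_triangle_ineq]) (simp add: norm_mult)
      also have "\<dots> \<le> 1 + R * (B * csum a)"
        using abs_lform_le[OF a j] s(2) assms(4) unfolding B_def by (intro add_left_mono mult_mono) auto
      finally have "ln ?w \<le> ln (1 + R * (B * csum a))"
        using w assms(2) by (subst ln_le_cancel_iff) auto
      also have "\<dots> \<le> c + q * (R * (B * csum a))"
        unfolding c_def using q B assms csum_nonneg[OF a] by (intro ln_one_plus_le) auto
      finally have u: "ln ?w \<le> c + q * (R * (B * csum a))" .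
      have l: "ln d \<le> ln ?w" using w assms(2) by (subst ln_le_cancel_iff) auto
      have "ln d \<le> 0" using assms by simp
      have "0 \<le> q * (R * (B * csum a))" using q B assms csum_nonneg[OF a] by auto
      then have "\<bar>ln ?w\<bar> \<le> (c - ln d) + q * (R * B) * csum a"
        using u l \<open>ln d \<le> 0\<close> c by (simp add: abs_le_iff mult.assoc)
      then have "\<bar>\<gamma> j\<bar> * \<bar>ln ?w\<bar> \<le> \<bar>\<gamma> j\<bar> * ((c - ln d) + q * (R * B) * csum a)"
        by (rule mult_left_mono) simp
      then show "\<gamma> j * ln ?w \<le> \<bar>\<gamma> j\<bar> * ((c - ln d) + q * (R * B) * csum a)"
        by (metis abs_le_D1 abs_mult)
    qed
    also have "\<dots> = G * ((c - ln d) + q * (R * B) * csum a)"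
      by (simp only: G_def sum_distrib_right)
    also have "\<dots> = G * (c - ln d) + G * (q * (R * B)) * csum a"
      by (simp only: distrib_left mult.assoc)
    also have "\<dots> \<le> G * (c - ln d) + \<kappa> * csum a"
      using GRB csum_nonneg[OF a] by (intro add_left_mono mult_right_mono) auto
    finally show "norm (ph \<gamma> s a) \<le> exp (G * (c - ln d)) * exp (\<kappa> * csum a)"
      unfolding norm_ph[OF s0] exp_add[symmetric] by simp
  qed auto
qed

text \<open>The majorant for \<open>T\<close>, written as a product over the coordinates so that its
  integrability reduces to one-dimensional Gamma integrals.\<close>

definition wt :: "real \<Rightarrow> (nat \<Rightarrow> real) \<Rightarrow> (nat \<Rightarrow> real) \<Rightarrow> real" where
  "wt \<kappa> \<beta> a = (\<Prod>i\<in>X. exp (- \<kappa> * a i) * a i powr (\<beta> i - 1))"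

lemma wt_eq: "wt \<kappa> \<beta> a = exp (- \<kappa> * csum a) * (\<Prod>i\<in>X. a i powr (\<beta> i - 1))"
  using finX by (simp add: wt_def prod.distrib exp_sum[symmetric] csum_def sum_distrib_left sum_negf)

lemma integrable_wt: "\<kappa> > 0 \<Longrightarrow> \<forall>i\<in>X. 0 < \<beta> i \<Longrightarrow> integrable PM (wt \<kappa> \<beta>)"
  unfolding wt_def using finX by (intro pos.product_integrable_prod integrable_pos_Gamma) auto

text \<open>Half of the decay rate \<open>2 * \<kappa>\<close> pays for the growth of
  \<open>ph\<close>; the other half remains in the majorant.\<close>

lemma T_bound:
  assumes "0 < \<kappa>" "0 < d" "d \<le> 1" "0 \<le> R"
  obtains C where "C > 0"
    "\<And>\<sigma> s a. 2 * \<kappa> \<le> Re \<sigma> \<Longrightarrow> d * cmod s \<le> \<bar>Im s\<bar> \<Longrightarrow> cmod s \<le> R \<Longrightarrow> \<forall>i\<in>X. 0 < a i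
      \<Longrightarrow> norm (T \<beta> \<gamma> \<sigma> s a) \<le> C * wt \<kappa> \<beta> a"
proof -
  obtain C where C: "C > 0"
    "\<And>s a. d * cmod s \<le> \<bar>Im s\<bar> \<Longrightarrow> cmod s \<le> R \<Longrightarrow> \<forall>i\<in>X. 0 < a i \<Longrightarrow> norm (ph \<gamma> s a) \<le> C * exp (\<kappa> * csum a)"
    using ph_bound[OF assms] by metis
  show ?thesis
  proof (rule that[OF C(1)])
    fix \<sigma> s and a :: "nat \<Rightarrow> real" assume *: "2 * \<kappa> \<le> Re \<sigma>" "d * cmod s \<le> \<bar>Im s\<bar>" "cmod s \<le> R" "\<forall>i\<in>X. 0 < a i"
    have P: "0 \<le> (\<Prod>i\<in>X. a i powr (\<beta> i - 1))" by (intro prod_nonneg) auto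
    have "norm (T \<beta> \<gamma> \<sigma> s a) = exp (- Re \<sigma> * csum a) * (\<Prod>i\<in>X. a i powr (\<beta> i - 1)) * norm (ph \<gamma> s a)"
      unfolding T_def norm_mult norm_of_real using P by (simp add: norm_exp_eq_Re)
    also have "\<dots> \<le> exp (- (2 * \<kappa>) * csum a) * (\<Prod>i\<in>X. a i powr (\<beta> i - 1)) * (C * exp (\<kappa> * csum a))"
      using * C csum_nonneg[OF *(4)] P
      by (intro mult_mono mult_right_mono) (auto intro!: mult_right_mono)
    also have "\<dots> = C * wt \<kappa> \<beta> a"
      by (simp add: wt_eq algebra_simps exp_add[symmetric])
    finally show "norm (T \<beta> \<gamma> \<sigma> s a) \<le> C * wt \<kappa> \<beta> a" .
  qed
qed

lemma T_bound':
  assumes "0 < Re \<sigma>" "Im s \<noteq> 0 \<or> s = 0"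
  obtains C \<kappa> where "C > 0" "\<kappa> > 0"
    "\<And>a :: nat \<Rightarrow> real. \<forall>i\<in>X. 0 < a i \<Longrightarrow> norm (T \<beta> \<gamma> \<sigma> s a) \<le> C * wt \<kappa> \<beta> a"
proof -
  \<comment> \<open>The sine of the angle between \<open>s\<close> and the real axis. At
    \<open>s = 0\<close> there is no angle and the largest permitted value is taken.\<close>
  define d where "d = (if s = 0 then 1 else \<bar>Im s\<bar> / cmod s)"
  have "0 < d" "d \<le> 1" "d * cmod s \<le> \<bar>Im s\<bar>"
    using assms abs_Im_le_cmod[of s] by (auto simp: d_def)
  then obtain C where "C > 0"
    "\<And>\<sigma>' s' (a :: nat \<Rightarrow> real). 2 * (Re \<sigma> / 2) \<le> Re \<sigma>' \<Longrightarrow> d * cmod s' \<le> \<bar>Im s'\<bar> \<Longrightarrow> cmod s' \<le> cmod s \<Longrightarrow> \<forall>i\<in>X. 0 < a i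
      \<Longrightarrow> norm (T \<beta> \<gamma> \<sigma>' s' a) \<le> C * wt (Re \<sigma> / 2) \<beta> a"
    using T_bound[of "Re \<sigma> / 2" d "cmod s" \<beta> \<gamma>] assms by auto
  then show ?thesis using that[of C "Re \<sigma> / 2"] \<open>d * cmod s \<le> \<bar>Im s\<bar>\<close> assms by auto
qed

lemma measurable_coord [measurable]: "i \<in> X \<Longrightarrow> (\<lambda>a. a i) \<in> borel_measurable PM"
  by (rule measurable_compose[OF measurable_component_singleton[of i X "\<lambda>_. pos_measure"] measurable_pos_measure]) auto

lemma measurable_ph:
  assumes "Im s \<noteq> 0 \<or> s = 0"
  shows "ph \<gamma> s \<in> borel_measurable PM"
proof -
  have [measurable]: "(\<lambda>t::real. Ln (1 + s * of_real t)) \<in> borel_measurable borel"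
    using one_plus_notin_nonpos_Reals[OF assms]
    by (intro borel_measurable_continuous_onI continuous_intros) auto
  have [measurable]: "lform j \<in> borel_measurable PM" for j
    unfolding lform_def[abs_def] by measurable
  show ?thesis unfolding ph_def[abs_def] by measurable
qed

lemma measurable_T:
  assumes "Im s \<noteq> 0 \<or> s = 0"
  shows "T \<beta> \<gamma> \<sigma> s \<in> borel_measurable PM"
proof -
  note measurable_ph[OF assms, measurable]
  show ?thesis unfolding T_def[abs_def] csum_def[abs_def] by measurable
qed

lemma integrable_T:
  assumes "0 < Re \<sigma>" "Im s \<noteq> 0 \<or> s = 0" "\<forall>i\<in>X. 0 < \<beta> i"
  shows "integrable PM (T \<beta> \<gamma> \<sigma> s)"
proof -
  obtain C \<kappa> where C: "C > 0" "\<kappa> > 0" "\<And>a. \<forall>i\<in>X. 0 < a i \<Longrightarrow> norm (T \<beta> \<gamma> \<sigma> s a) \<le> C * wt \<kappa> \<beta> a"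
    using T_bound'[OF assms(1,2)] by metis
  have i: "integrable PM (\<lambda>a. C * wt \<kappa> \<beta> a)" using integrable_wt[OF C(2) assms(3)] by simp
  show ?thesis
    by (rule Bochner_Integration.integrable_bound[OF i measurable_T[OF assms(2)]])
       (auto intro!: AE_I2 order_trans[OF C(3)] simp: space_PM)
qed

lemma T_incr:
  assumes "i \<in> X" "0 < a i"
  shows "T (incr i \<beta>) \<gamma> \<sigma> s a = of_real (a i) * T \<beta> \<gamma> \<sigma> s a"
proof -
  have "(\<Prod>k\<in>X. a k powr (incr i \<beta> k - 1)) = a i * (\<Prod>k\<in>X. a k powr (\<beta> k - 1))"
    using assms finX by (simp add: prod.remove[of X i] incr_def powr_diff powr_add cong: prod.cong_simp)
  then show ?thesis by (simp add: T_def)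
qed

lemma ph_decr:
  assumes "Im s \<noteq> 0 \<or> s = 0" "j \<in> J"
  shows "ph (decr j \<gamma>) s a = ph \<gamma> s a / (1 + s * of_real (lform j a))"
proof -
  have "1 + s * of_real (lform j a) \<noteq> 0"
    using one_plus_notin_nonpos_Reals[OF assms(1)] by (metis nonpos_Reals_zero_I)
  moreover have "(\<Sum>k\<in>J. of_real (decr j \<gamma> k) * Ln (1 + s * of_real (lform k a))) =
      (\<Sum>k\<in>J. of_real (\<gamma> k) * Ln (1 + s * of_real (lform k a))) - Ln (1 + s * of_real (lform j a))"
    using assms finJ by (simp add: sum.remove[of J j] decr_def algebra_simps cong: sum.cong_simp)
  ultimately show ?thesis by (simp add: ph_def exp_diff)
qed

lemma T_decr:
  assumes "Im s \<noteq> 0 \<or> s = 0" "j \<in> J"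
  shows "T \<beta> (decr j \<gamma>) \<sigma> s a = T \<beta> \<gamma> \<sigma> s a / (1 + s * of_real (lform j a))"
  using ph_decr[OF assms] by (simp add: T_def)

lemma ph_has_field_derivative:
  assumes "Im s \<noteq> 0 \<or> s = 0"
  shows "((\<lambda>s. ph \<gamma> s a) has_field_derivative (\<Sum>j\<in>J. of_real (\<gamma> j * lform j a) * ph (decr j \<gamma>) s a)) (at s)"
proof -
  have n: "1 + s * of_real (lform j a) \<notin> \<real>\<^sub>\<le>\<^sub>0" for j
    using one_plus_notin_nonpos_Reals[OF assms] .
  have "((\<lambda>s. ph \<gamma> s a) has_field_derivative
      ph \<gamma> s a * (\<Sum>j\<in>J. of_real (\<gamma> j) * (of_real (lform j a) / (1 + s * of_real (lform j a))))) (at s)"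
    unfolding ph_def by (auto intro!: derivative_eq_intros n sum.cong simp: divide_inverse mult_ac)
  also have "ph \<gamma> s a * (\<Sum>j\<in>J. of_real (\<gamma> j) * (of_real (lform j a) / (1 + s * of_real (lform j a)))) =
      (\<Sum>j\<in>J. of_real (\<gamma> j * lform j a) * ph (decr j \<gamma>) s a)"
    using assms by (simp add: sum_distrib_left ph_decr divide_inverse mult_ac)
  finally show ?thesis .
qed

section \<open>Derivatives in the parameters and integration by parts\<close>

lemma integral_PM_sum_T:
  assumes "\<And>i. i \<in> I \<Longrightarrow> integrable PM (g i)"
  shows "integral\<^sup>L PM (\<lambda>a. \<Sum>i\<in>I. c i * g i a) = (\<Sum>i\<in>I. c i * integral\<^sup>L PM (g i) :: complex)"
  using assms by (subst Bochner_Integration.integral_sum) auto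

lemma E_deriv_sigma:
  assumes "0 < Re \<sigma>" "Im s \<noteq> 0 \<or> s = 0" "\<forall>i\<in>X. 0 < \<beta> i"
  shows "((\<lambda>\<sigma>. E \<beta> \<gamma> \<sigma> s) has_field_derivative - (\<Sum>i\<in>X. E (incr i \<beta>) \<gamma> \<sigma> s)) (at \<sigma>)"
proof -
  \<comment> \<open>A quarter, so that the half-plane \<open>2 * \<kappa> < Re \<sigma>\<close> on
    which the majorant is valid contains the given point in its interior.\<close>
  define \<kappa> where "\<kappa> = Re \<sigma> / 4"
  have \<kappa>: "\<kappa> > 0" using assms by (simp add: \<kappa>_def)
  define d where "d = (if s = 0 then 1 else \<bar>Im s\<bar> / cmod s)"
  have d: "0 < d" "d \<le> 1" "d * cmod s \<le> \<bar>Im s\<bar>"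
    using assms abs_Im_le_cmod[of s] by (auto simp: d_def)
  obtain C where C: "\<And>\<sigma>' s' a. 2 * \<kappa> \<le> Re \<sigma>' \<Longrightarrow> d * cmod s' \<le> \<bar>Im s'\<bar> \<Longrightarrow> cmod s' \<le> cmod s \<Longrightarrow>
      \<forall>i\<in>X. 0 < a i \<Longrightarrow> norm (T \<beta> \<gamma> \<sigma>' s' a) \<le> C * wt \<kappa> \<beta> a"
    using T_bound[OF \<kappa> d(1,2), of "cmod s" \<beta> \<gamma>] norm_ge_zero by metis
  have "((\<lambda>\<sigma>. \<integral>a. T \<beta> \<gamma> \<sigma> s a \<partial>PM) has_field_derivative (\<integral>a. (\<Sum>i\<in>X. - 1 * T (incr i \<beta>) \<gamma> \<sigma> s a) \<partial>PM)) (at \<sigma>)"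
  proof (rule has_field_derivative_integral(2)[where S = "{\<sigma>. 2 * \<kappa> < Re \<sigma>}" and g = "\<lambda>a. C * wt \<kappa> \<beta> a"])
    show "open {\<sigma>. 2 * \<kappa> < Re \<sigma>}" by (rule open_halfspace_Re_gt)
    show "\<sigma> \<in> {\<sigma>. 2 * \<kappa> < Re \<sigma>}" using assms by (simp add: \<kappa>_def)
    show "(\<lambda>z. T \<beta> \<gamma> z s a) holomorphic_on {\<sigma>. 2 * \<kappa> < Re \<sigma>}" for a
      unfolding T_def by (intro holomorphic_intros)
    show "T \<beta> \<gamma> z s \<in> borel_measurable PM" for z by (rule measurable_T[OF assms(2)])
    show "cmod (T \<beta> \<gamma> z s a) \<le> C * wt \<kappa> \<beta> a" if "z \<in> {\<sigma>. 2 * \<kappa> < Re \<sigma>}" "a \<in> space PM" for z a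
      using that d by (intro C) (auto simp: space_PM)
    show "integrable PM (\<lambda>a. C * wt \<kappa> \<beta> a)" using integrable_wt[OF \<kappa> assms(3)] by simp
    fix a assume a: "a \<in> space PM"
    have "((\<lambda>z. T \<beta> \<gamma> z s a) has_field_derivative - of_real (csum a) * T \<beta> \<gamma> \<sigma> s a) (at \<sigma>)"
      unfolding T_def by (auto intro!: derivative_eq_intros)
    also have "- of_real (csum a) * T \<beta> \<gamma> \<sigma> s a = (\<Sum>i\<in>X. - 1 * T (incr i \<beta>) \<gamma> \<sigma> s a)"
      using space_PM[OF a] by (simp add: T_incr csum_def sum_distrib_right sum_negf)
    finally show "((\<lambda>z. T \<beta> \<gamma> z s a) has_field_derivative (\<Sum>i\<in>X. - 1 * T (incr i \<beta>) \<gamma> \<sigma> s a)) (at \<sigma>)" .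
  qed
  also have "(\<integral>a. (\<Sum>i\<in>X. - 1 * T (incr i \<beta>) \<gamma> \<sigma> s a) \<partial>PM) = (\<Sum>i\<in>X. - 1 * E (incr i \<beta>) \<gamma> \<sigma> s)"
    unfolding E_def by (rule integral_PM_sum_T) (intro integrable_T assms incr_pos)
  finally show ?thesis by (simp add: E_def sum_negf)
qed

lemma E_deriv_s:
  assumes "0 < Re (\<mu> * s)" "Im s \<noteq> 0" "\<forall>i\<in>X. 0 < \<beta> i"
  shows "((\<lambda>s. E \<beta> \<gamma> (\<mu> * s) s) has_field_derivative
    (\<Sum>i\<in>X. - \<mu> * E (incr i \<beta>) \<gamma> (\<mu> * s) s +
       (\<Sum>j\<in>J. of_real (\<gamma> j * \<tau> j i) * E (incr i \<beta>) (decr j \<gamma>) (\<mu> * s) s))) (at s)"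
proof -
  define \<kappa> where "\<kappa> = Re (\<mu> * s) / 4"
  have \<kappa>: "\<kappa> > 0" using assms by (simp add: \<kappa>_def)
  have s0: "s \<noteq> 0" using assms by auto
  \<comment> \<open>Half the sine of the angle of \<open>s\<close>, which makes the angular
    condition strict at \<open>s\<close> and hence valid on a neighbourhood.\<close>
  define d where "d = \<bar>Im s\<bar> / cmod s / 2"
  have d: "0 < d" "d \<le> 1" "d * cmod s < \<bar>Im s\<bar>"
    using assms s0 abs_Im_le_cmod[of s] by (auto simp: d_def divide_simps)
  define S where "S = {z. d * cmod z < \<bar>Im z\<bar>} \<inter> {z. cmod z < cmod s + 1} \<inter> {z. 2 * \<kappa> < Re (\<mu> * z)}"
  obtain C where C: "\<And>\<sigma>' s' a. 2 * \<kappa> \<le> Re \<sigma>' \<Longrightarrow> d * cmod s' \<le> \<bar>Im s'\<bar> \<Longrightarrow> cmod s' \<le> cmod s + 1 \<Longrightarrow>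
      \<forall>i\<in>X. 0 < a i \<Longrightarrow> norm (T \<beta> \<gamma> \<sigma>' s' a) \<le> C * wt \<kappa> \<beta> a"
  proof -
    have "0 \<le> cmod s + 1" by simp
    from T_bound[OF \<kappa> d(1,2) this, of \<beta> \<gamma>] that show ?thesis by metis
  qed
  have SIm: "Im z \<noteq> 0 \<or> z = 0" if "z \<in> S" for z
    using that d(1) unfolding S_def
    by (metis (no_types, lifting) IntD1 abs_zero linorder_not_le mem_Collect_eq mult_nonneg_nonneg norm_ge_zero order_less_imp_le)
  have dT: "((\<lambda>z. T \<beta> \<gamma> (\<mu> * z) z a) has_field_derivative
      - \<mu> * of_real (csum a) * T \<beta> \<gamma> (\<mu> * z) z a + (\<Sum>j\<in>J. of_real (\<gamma> j * lform j a) * T \<beta> (decr j \<gamma>) (\<mu> * z) z a)) (at z)"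
    if "Im z \<noteq> 0 \<or> z = 0" for z a
    unfolding T_def
    by (rule derivative_eq_intros refl ph_has_field_derivative[OF that])+
       (simp add: sum_distrib_left algebra_simps)
  have "((\<lambda>s. \<integral>a. T \<beta> \<gamma> (\<mu> * s) s a \<partial>PM) has_field_derivative (\<integral>a. (\<Sum>i\<in>X. 1 * (- \<mu> * T (incr i \<beta>) \<gamma> (\<mu> * s) s a +
       (\<Sum>j\<in>J. of_real (\<gamma> j * \<tau> j i) * T (incr i \<beta>) (decr j \<gamma>) (\<mu> * s) s a))) \<partial>PM)) (at s)"
  proof (rule has_field_derivative_integral(2)[where S = S and g = "\<lambda>a. C * wt \<kappa> \<beta> a"])
    show "open S" unfolding S_def
      by (intro open_Int open_Collect_less continuous_intros)
    show "s \<in> S" using assms d by (simp add: \<kappa>_def S_def)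
    show "(\<lambda>z. T \<beta> \<gamma> (\<mu> * z) z a) holomorphic_on S" for a
      unfolding holomorphic_on_def using dT[OF SIm] field_differentiable_at_within field_differentiable_def by blast
    show "T \<beta> \<gamma> (\<mu> * z) z \<in> borel_measurable PM" if "z \<in> S" for z by (rule measurable_T[OF SIm[OF that]])
    show "cmod (T \<beta> \<gamma> (\<mu> * z) z a) \<le> C * wt \<kappa> \<beta> a" if "z \<in> S" "a \<in> space PM" for z a
      using that d by (intro C) (auto simp: space_PM S_def)
    show "integrable PM (\<lambda>a. C * wt \<kappa> \<beta> a)" using integrable_wt[OF \<kappa> assms(3)] by simp
    fix a assume a: "a \<in> space PM"
    have "- \<mu> * of_real (csum a) * T \<beta> \<gamma> (\<mu> * s) s a + (\<Sum>j\<in>J. of_real (\<gamma> j * lform j a) * T \<beta> (decr j \<gamma>) (\<mu> * s) s a) =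
      (\<Sum>i\<in>X. - \<mu> * T (incr i \<beta>) \<gamma> (\<mu> * s) s a) +
       (\<Sum>j\<in>J. \<Sum>i\<in>X. of_real (\<gamma> j * \<tau> j i) * T (incr i \<beta>) (decr j \<gamma>) (\<mu> * s) s a)"
      using space_PM[OF a] by (simp add: T_incr csum_def lform_def sum_distrib_right sum_distrib_left algebra_simps)
    also have "\<dots> = (\<Sum>i\<in>X. 1 * (- \<mu> * T (incr i \<beta>) \<gamma> (\<mu> * s) s a +
       (\<Sum>j\<in>J. of_real (\<gamma> j * \<tau> j i) * T (incr i \<beta>) (decr j \<gamma>) (\<mu> * s) s a)))"
      by (subst sum.swap) (simp add: sum.distrib sum_subtractf sum_negf)
    finally show "((\<lambda>z. T \<beta> \<gamma> (\<mu> * z) z a) has_field_derivative (\<Sum>i\<in>X. 1 * (- \<mu> * T (incr i \<beta>) \<gamma> (\<mu> * s) s a +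
       (\<Sum>j\<in>J. of_real (\<gamma> j * \<tau> j i) * T (incr i \<beta>) (decr j \<gamma>) (\<mu> * s) s a)))) (at s)"
      using dT[of s a] assms(2) by simp
  qed
  also have "(\<integral>a. (\<Sum>i\<in>X. 1 * (- \<mu> * T (incr i \<beta>) \<gamma> (\<mu> * s) s a +
       (\<Sum>j\<in>J. of_real (\<gamma> j * \<tau> j i) * T (incr i \<beta>) (decr j \<gamma>) (\<mu> * s) s a))) \<partial>PM) =
     (\<Sum>i\<in>X. 1 * (\<integral>a. (- \<mu> * T (incr i \<beta>) \<gamma> (\<mu> * s) s a +
       (\<Sum>j\<in>J. of_real (\<gamma> j * \<tau> j i) * T (incr i \<beta>) (decr j \<gamma>) (\<mu> * s) s a)) \<partial>PM))"
    by (rule integral_PM_sum_T)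
       (intro integrable_T assms incr_pos Bochner_Integration.integrable_add integrable_mult_right Bochner_Integration.integrable_sum disjI1)
  also have "\<dots> = (\<Sum>i\<in>X. - \<mu> * E (incr i \<beta>) \<gamma> (\<mu> * s) s +
       (\<Sum>j\<in>J. of_real (\<gamma> j * \<tau> j i) * E (incr i \<beta>) (decr j \<gamma>) (\<mu> * s) s))"
    unfolding E_def using assms
    by (intro sum.cong refl)
       (subst Bochner_Integration.integral_add, auto intro!: integrable_T incr_pos Bochner_Integration.integrable_sum integral_PM_sum_T)
  finally show ?thesis by (simp add: E_def)
qed

lemma integrable_T_slice:
  assumes "0 < Re \<sigma>" "Im s \<noteq> 0 \<or> s = 0" "i \<in> X" "0 < \<beta> i" "x \<in> space (Pi\<^sub>M (X - {i}) (\<lambda>_. pos_measure))"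
  shows "integrable pos_measure (\<lambda>t. T \<beta> \<gamma> \<sigma> s (x(i := t)))"
proof -
  obtain C \<kappa> where C: "C > 0" "\<kappa> > 0" "\<And>a. \<forall>i\<in>X. 0 < a i \<Longrightarrow> norm (T \<beta> \<gamma> \<sigma> s a) \<le> C * wt \<kappa> \<beta> a"
    using T_bound'[OF assms(1,2)] by metis
  define K where "K = (\<Prod>k\<in>X - {i}. exp (- \<kappa> * x k) * x k powr (\<beta> k - 1))"
  have x: "0 < x k" if "k \<in> X - {i}" for k
    using assms(5) that by (auto simp: space_PiM PiE_def Pi_def)
  have ins: "insert i (X - {i}) = X" using assms(3) by auto
  have m: "(\<lambda>t. x(i := t)) \<in> measurable pos_measure PM"
    using measurable_component_update[OF assms(5), of i] ins by simp
  have int: "integrable pos_measure (\<lambda>t. C * K * (exp (- \<kappa> * t) * t powr (\<beta> i - 1)))"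
    using integrable_pos_Gamma[OF assms(4) C(2)] by simp
  show ?thesis
  proof (rule Bochner_Integration.integrable_bound[OF int])
    show "(\<lambda>t. T \<beta> \<gamma> \<sigma> s (x(i := t))) \<in> borel_measurable pos_measure"
      by (rule measurable_compose[OF m measurable_T[OF assms(2)]])
    show "AE t in pos_measure. norm (T \<beta> \<gamma> \<sigma> s (x(i := t))) \<le> norm (C * K * (exp (- \<kappa> * t) * t powr (\<beta> i - 1)))"
    proof (rule AE_I2)
      fix t assume "t \<in> space pos_measure"
      then have t: "t > 0" by simp
      have "norm (T \<beta> \<gamma> \<sigma> s (x(i := t))) \<le> C * wt \<kappa> \<beta> (x(i := t))"
        using x t by (intro C(3)) auto
      also have "wt \<kappa> \<beta> (x(i := t)) = exp (- \<kappa> * t) * t powr (\<beta> i - 1) * K"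
        unfolding wt_def K_def using assms(3) finX by (simp add: prod.remove[of X i] cong: prod.cong_simp)
      also have "C * (exp (- \<kappa> * t) * t powr (\<beta> i - 1) * K) = C * K * (exp (- \<kappa> * t) * t powr (\<beta> i - 1))"
        by (simp only: mult_ac)
      also have "\<dots> \<le> norm (C * K * (exp (- \<kappa> * t) * t powr (\<beta> i - 1)))"
        by (simp only: real_norm_def abs_ge_self)
      finally show "norm (T \<beta> \<gamma> \<sigma> s (x(i := t))) \<le> norm (C * K * (exp (- \<kappa> * t) * t powr (\<beta> i - 1)))" .
    qed
  qed
qed

text \<open>The integrand of the left-hand side is the derivative with respect to \<open>a i\<close>
  of \<open>a i * T\<close>: the terms come from the power, the exponential and the factors
  \<open>1 + s * t\<close>. Fubini isolates the coordinate \<open>i\<close>, and the inner integral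
  of a derivative vanishes.\<close>

lemma E_ibp:
  assumes "0 < Re \<sigma>" "Im s \<noteq> 0 \<or> s = 0" "\<forall>i\<in>X. 0 < \<beta> i" "i \<in> X"
  shows "of_real (\<beta> i) * E \<beta> \<gamma> \<sigma> s - \<sigma> * E (incr i \<beta>) \<gamma> \<sigma> s
    + (\<Sum>j\<in>J. of_real (\<gamma> j * \<tau> j i) * s * E (incr i \<beta>) (decr j \<gamma>) \<sigma> s) = 0"
proof -
  define g where "g a = of_real (\<beta> i) * T \<beta> \<gamma> \<sigma> s a - \<sigma> * T (incr i \<beta>) \<gamma> \<sigma> s a
    + (\<Sum>j\<in>J. of_real (\<gamma> j * \<tau> j i) * s * T (incr i \<beta>) (decr j \<gamma>) \<sigma> s a)" for a
  define Y where "Y = X - {i}"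
  have XY: "X = insert i Y" "i \<notin> Y" "finite Y" using assms finX by (auto simp: Y_def)
  note iT = integrable_T[OF assms(1,2)]
  have "integral\<^sup>L PM g = of_real (\<beta> i) * E \<beta> \<gamma> \<sigma> s - \<sigma> * E (incr i \<beta>) \<gamma> \<sigma> s
    + (\<Sum>j\<in>J. of_real (\<gamma> j * \<tau> j i) * s * E (incr i \<beta>) (decr j \<gamma>) \<sigma> s)"
  proof -
    have 1: "integral\<^sup>L PM (\<lambda>a. \<Sum>j\<in>J. of_real (\<gamma> j * \<tau> j i) * s * T (incr i \<beta>) (decr j \<gamma>) \<sigma> s a) =
        (\<Sum>j\<in>J. of_real (\<gamma> j * \<tau> j i) * s * integral\<^sup>L PM (T (incr i \<beta>) (decr j \<gamma>) \<sigma> s))"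
      by (rule integral_PM_sum_T) (intro iT incr_pos assms(3))
    have i1: "integrable PM (T \<beta> \<gamma> \<sigma> s)" "integrable PM (T (incr i \<beta>) \<gamma> \<sigma> s)"
      "integrable PM (\<lambda>a. \<Sum>j\<in>J. of_real (\<gamma> j * \<tau> j i) * s * T (incr i \<beta>) (decr j \<gamma>) \<sigma> s a)"
      by (intro iT incr_pos assms(3) integrable_mult_right Bochner_Integration.integrable_sum)+
    show ?thesis
      unfolding g_def[abs_def] E_def using i1 1 by simp
  qed
  moreover have "integrable PM g"
    unfolding g_def[abs_def]
    by (intro iT incr_pos assms(3) Bochner_Integration.integrable_add integrable_mult_right Bochner_Integration.integrable_diff Bochner_Integration.integrable_sum)
  then have "integral\<^sup>L PM g = (\<integral>x. (\<integral>t. g (x(i := t)) \<partial>pos_measure) \<partial>(Pi\<^sub>M Y (\<lambda>_. pos_measure)))"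
    using pos.product_integral_insert[OF XY(3,2)] XY(1) by simp
  moreover have "(\<integral>t. g (x(i := t)) \<partial>pos_measure) = 0" if x: "x \<in> space (Pi\<^sub>M Y (\<lambda>_. pos_measure))" for x
  proof -
    have xp: "0 < x k" if "k \<in> Y" for k
      using x that by (auto simp: space_PiM PiE_def Pi_def)
    obtain C \<kappa> where C: "C > 0" "\<kappa> > 0" "\<And>a. \<forall>i\<in>X. 0 < a i \<Longrightarrow> norm (T (incr i \<beta>) \<gamma> \<sigma> s a) \<le> C * wt \<kappa> (incr i \<beta>) a"
      using T_bound'[OF assms(1,2)] by metis
    define K where "K = (\<Prod>k\<in>Y. exp (- \<kappa> * x k) * x k powr (\<beta> k - 1))"
    define P where "P = (\<Prod>k\<in>Y. x k powr (\<beta> k - 1))"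
    define c where "c = (\<Sum>k\<in>Y. x k)"
    define dd where "dd j = (\<Sum>k\<in>Y. \<tau> j k * x k)" for j
    have tlx: "lform j (x(i := t)) = \<tau> j i * t + dd j" for j t
      unfolding lform_def dd_def Y_def using finX assms(4) by (simp add: sum.remove[of X i] cong: sum.cong_simp)
    have sgx: "csum (x(i := t)) = t + c" for t
      unfolding csum_def c_def Y_def using finX assms(4) by (simp add: sum.remove[of X i] cong: sum.cong_simp)
    \<comment> \<open>An extension of \<open>G\<close> to complex arguments, holomorphic near the
      positive half-line; the derivative of \<open>G\<close> is read off from the complex
      one.\<close>
    define Gc where "Gc z = of_real P * exp (of_real (\<beta> i) * Ln z + - \<sigma> * (z + of_real c) +
        (\<Sum>j\<in>J. of_real (\<gamma> j) * Ln (1 + s * (of_real (\<tau> j i) * z + of_real (dd j)))))" for z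
    define G where "G t = T (incr i \<beta>) \<gamma> \<sigma> s (x(i := t))" for t
    have prodx: "(\<Prod>k\<in>X. (x(i := t)) k powr (incr i \<beta> k - 1)) = t powr \<beta> i * P" for t
      unfolding P_def Y_def using finX assms(4) by (simp add: prod.remove[of X i] incr_def cong: prod.cong_simp)
    have GGc: "G t = Gc (of_real t)" if "t > 0" for t
    proof -
      have "complex_of_real (t powr \<beta> i) = exp (of_real (\<beta> i) * Ln (of_real t))"
        using that by (simp add: powr_def Ln_of_real exp_of_real[symmetric])
      then show ?thesis
        unfolding G_def Gc_def T_def prodx sgx ph_def tlx by (simp add: exp_add exp_diff exp_minus divide_inverse mult_ac)
    qed
    have nz: "1 + s * (of_real (\<tau> j i) * of_real t + of_real (dd j)) \<notin> \<real>\<^sub>\<le>\<^sub>0" for j t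
      using one_plus_notin_nonpos_Reals[OF assms(2), of "\<tau> j i * t + dd j"] unfolding of_real_add of_real_mult .
    \<comment> \<open>The logarithmic derivative of \<open>Gc\<close> on the positive
      half-line.\<close>
    define q where "q t = of_real (\<beta> i) / of_real t - \<sigma> +
       (\<Sum>j\<in>J. of_real (\<gamma> j) * (s * of_real (\<tau> j i)) / (1 + s * (of_real (\<tau> j i) * of_real t + of_real (dd j))))" for t :: real
    have dGc: "(Gc has_field_derivative Gc (of_real t) * q t) (at (of_real t))" if "t > 0" for t
    proof -
      have "((\<lambda>z. of_real (\<gamma> j) * Ln (1 + s * (of_real (\<tau> j i) * z + of_real (dd j)))) has_field_derivative
          of_real (\<gamma> j) * (s * of_real (\<tau> j i)) / (1 + s * (of_real (\<tau> j i) * of_real t + of_real (dd j)))) (at (of_real t))" for j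
        by (rule derivative_eq_intros refl nz)+ (simp add: divide_inverse mult_ac)
      then have d1: "((\<lambda>z. \<Sum>j\<in>J. of_real (\<gamma> j) * Ln (1 + s * (of_real (\<tau> j i) * z + of_real (dd j)))) has_field_derivative
          (\<Sum>j\<in>J. of_real (\<gamma> j) * (s * of_real (\<tau> j i)) / (1 + s * (of_real (\<tau> j i) * of_real t + of_real (dd j))))) (at (of_real t))"
        by (intro DERIV_sum)
      have "complex_of_real t \<notin> \<real>\<^sub>\<le>\<^sub>0" using that by (simp add: complex_nonpos_Reals_iff)
      then have d2: "((\<lambda>z. of_real (\<beta> i) * Ln z) has_field_derivative of_real (\<beta> i) / of_real t) (at (of_real t))"
        by (auto intro!: derivative_eq_intros simp: divide_inverse)
      have d3: "((\<lambda>z. - \<sigma> * (z + of_real c)) has_field_derivative - \<sigma>) (at (of_real t))"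
        by (auto intro!: derivative_eq_intros)
      have "((\<lambda>z. of_real P * exp (of_real (\<beta> i) * Ln z + - \<sigma> * (z + of_real c) +
        (\<Sum>j\<in>J. of_real (\<gamma> j) * Ln (1 + s * (of_real (\<tau> j i) * z + of_real (dd j)))))) has_field_derivative
          of_real P * (exp (of_real (\<beta> i) * Ln (of_real t) + - \<sigma> * (of_real t + of_real c) +
        (\<Sum>j\<in>J. of_real (\<gamma> j) * Ln (1 + s * (of_real (\<tau> j i) * of_real t + of_real (dd j))))) * q t)) (at (of_real t))"
        using DERIV_cmult[OF DERIV_fun_exp[OF DERIV_add[OF DERIV_add[OF d2 d3] d1]], of "of_real P"]
        by (simp add: q_def)
      then show ?thesis unfolding Gc_def by (simp only: mult.assoc)
    qed
    have dG: "(G has_vector_derivative G t * q t) (at t)" if "t > 0" for t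
    proof -
      have "((\<lambda>t. Gc (of_real t)) has_vector_derivative G t * q t) (at t)"
        using has_vector_derivative_real_field[OF dGc[OF that]] GGc[OF that] by simp
      then show ?thesis
        by (rule has_vector_derivative_transform_within_open[where S = "{0<..}"])
           (use that GGc in auto)
    qed
    have gG: "g (x(i := t)) = G t * q t" if "t > 0" for t
    proof -
      have "T (incr i \<beta>) (decr j \<gamma>) \<sigma> s (x(i := t)) =
          G t / (1 + s * (of_real (\<tau> j i) * of_real t + of_real (dd j)))" if "j \<in> J" for j
        using T_decr[OF assms(2) that] by (simp add: G_def tlx)
      moreover have "T \<beta> \<gamma> \<sigma> s (x(i := t)) = G t / of_real t"
        using T_incr[OF assms(4), of "x(i := t)" \<beta> \<gamma> \<sigma> s] that by (simp add: G_def)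
      ultimately show ?thesis
        unfolding g_def q_def G_def[symmetric]
        by (simp add: algebra_simps sum_distrib_left)
    qed
    have contG: "continuous_on {0<..} G"
      by (rule continuous_on_vector_derivative)
         (use dG in \<open>auto intro: has_vector_derivative_at_within\<close>)
    have contq: "continuous_on {0<..} q"
    proof -
      have "1 + s * (of_real (\<tau> j i) * of_real t + of_real (dd j)) \<noteq> 0" for j t
        using nz by (metis nonpos_Reals_zero_I)
      then show ?thesis unfolding q_def by (intro continuous_intros) auto
    qed
    have "(\<integral>t. g (x(i := t)) \<partial>pos_measure) = (\<integral>t. G t * q t \<partial>pos_measure)"
      using gG by (intro Bochner_Integration.integral_cong) auto
    also have "\<dots> = 0"
    proof (rule integral_deriv_pos_measure_zero[OF dG])
      show "continuous_on {0<..} (\<lambda>t. G t * q t)"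
        by (intro continuous_intros contG contq)
      have "integrable pos_measure (\<lambda>t. g (x(i := t)))"
      proof -
        have sl: "integrable pos_measure (\<lambda>t. T b c \<sigma> s (x(i := t)))" if "\<forall>k\<in>X. 0 < b k" for b c
          by (rule integrable_T_slice) (use assms that x in \<open>auto simp: Y_def\<close>)
        show ?thesis
          unfolding g_def
          by (intro Bochner_Integration.integrable_add integrable_mult_right Bochner_Integration.integrable_diff
             Bochner_Integration.integrable_sum sl assms(3) incr_pos)
      qed
      moreover have "integrable pos_measure (\<lambda>t. g (x(i := t))) \<longleftrightarrow> integrable pos_measure (\<lambda>t. G t * q t)"
        by (rule Bochner_Integration.integrable_cong) (auto simp: gG)
      ultimately show "integrable pos_measure (\<lambda>t. G t * q t)" by blast
      show "0 < \<beta> i" "0 < \<kappa>" using assms C by auto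
      fix t :: real assume t: "t > 0"
      have "norm (G t) \<le> C * wt \<kappa> (incr i \<beta>) (x(i := t))"
        unfolding G_def using xp t XY(1) by (intro C(3)) auto
      also have "wt \<kappa> (incr i \<beta>) (x(i := t)) = exp (- \<kappa> * t) * t powr \<beta> i * K"
        unfolding wt_def K_def Y_def using finX assms(4) by (simp add: prod.remove[of X i] incr_def cong: prod.cong_simp)
      finally show "norm (G t) \<le> C * K * (t powr \<beta> i * exp (- \<kappa> * t))"
        by (simp add: mult_ac)
    qed
    finally show ?thesis .
  qed
  then have "(\<integral>x. (\<integral>t. g (x(i := t)) \<partial>pos_measure) \<partial>(Pi\<^sub>M Y (\<lambda>_. pos_measure))) =
      (\<integral>x. 0 \<partial>(Pi\<^sub>M Y (\<lambda>_. pos_measure)))"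
    by (intro Bochner_Integration.integral_cong) auto
  ultimately show ?thesis by (simp only: Bochner_Integration.integral_zero)
qed

section \<open>Independence of the direction of rotation\<close>

definition admissible :: "real \<Rightarrow> complex \<Rightarrow> complex \<Rightarrow> bool" where
  "admissible \<eta> \<mu> s \<longleftrightarrow> 0 < \<eta> * Im s \<and> 0 < Re (\<mu> * s)"

text \<open>
  \<open>Es \<beta> \<gamma> \<mu> s\<close> is the Laplace integral in \<open>\<mu>\<close> over the orthant rotated to the direction \<open>s\<close>.  It is the
  same for all admissible \<open>s\<close>, so that \<open>Eh\<close> does not depend on the choice made in its definition.  The
  number \<open>\<eta>\<close>, which is \<open>1\<close> or \<open>-1\<close>, selects the half-plane of \<open>s\<close>: the value \<open>-1\<close> belongs to the
  integrals with superscript plus, the value \<open>1\<close> to those with superscript minus.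
\<close>

definition Es :: "(nat \<Rightarrow> real) \<Rightarrow> (nat \<Rightarrow> real) \<Rightarrow> complex \<Rightarrow> complex \<Rightarrow> complex" where
  "Es \<beta> \<gamma> \<mu> s = exp (of_real (\<Sum>i\<in>X. \<beta> i) * Ln s) * E \<beta> \<gamma> (\<mu> * s) s"

definition Eh :: "real \<Rightarrow> (nat \<Rightarrow> real) \<Rightarrow> (nat \<Rightarrow> real) \<Rightarrow> complex \<Rightarrow> complex" where
  "Eh \<eta> \<beta> \<gamma> \<mu> = Es \<beta> \<gamma> \<mu> (SOME s. admissible \<eta> \<mu> s)"

lemma convex_admissible: "convex {s. admissible \<eta> \<mu> s}"
proof (rule convexI)
  fix x y and u v :: real
  assume *: "x \<in> {s. admissible \<eta> \<mu> s}" "y \<in> {s. admissible \<eta> \<mu> s}" and uv: "0 \<le> u" "0 \<le> v" "u + v = 1"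
  have a: "0 < u * p + v * q" if "0 < p" "0 < q" for p q :: real
    using uv that by (metis add_nonneg_pos add_pos_nonneg mult_nonneg_nonneg mult_pos_pos less_eq_real_def add.left_neutral zero_neq_one)
  have e: "\<eta> * Im (u *\<^sub>R x + v *\<^sub>R y) = u * (\<eta> * Im x) + v * (\<eta> * Im y)"
    "Re (\<mu> * (u *\<^sub>R x + v *\<^sub>R y)) = u * Re (\<mu> * x) + v * Re (\<mu> * y)"
    by (simp_all add: algebra_simps)
  show "u *\<^sub>R x + v *\<^sub>R y \<in> {s. admissible \<eta> \<mu> s}"
    using * a unfolding admissible_def mem_Collect_eq e by blast
qed

text \<open>A homogeneity argument: the integrations by parts in all coordinates add up to
  \<open>s * D = - b * E\<close> with \<open>b\<close> the sum of the exponents, and the prefactor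
  \<open>exp (b * Ln s)\<close> has logarithmic derivative \<open>b / s\<close>, which compensates
  exactly.\<close>

lemma Es_deriv_zero:
  assumes "admissible \<eta> \<mu> s" "\<forall>i\<in>X. 0 < \<beta> i"
  shows "((\<lambda>s. Es \<beta> \<gamma> \<mu> s) has_field_derivative 0) (at s)"
proof -
  let ?b = "complex_of_real (\<Sum>i\<in>X. \<beta> i)"
  have s: "0 < Re (\<mu> * s)" "Im s \<noteq> 0" "s \<notin> \<real>\<^sub>\<le>\<^sub>0" "s \<noteq> 0"
    using assms by (auto simp: admissible_def complex_nonpos_Reals_iff)
  define D where "D = (\<Sum>i\<in>X. - \<mu> * E (incr i \<beta>) \<gamma> (\<mu> * s) s +
       (\<Sum>j\<in>J. of_real (\<gamma> j * \<tau> j i) * E (incr i \<beta>) (decr j \<gamma>) (\<mu> * s) s))"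
  have "s * D = (\<Sum>i\<in>X. - of_real (\<beta> i) * E \<beta> \<gamma> (\<mu> * s) s)"
    unfolding D_def sum_distrib_left
  proof (rule sum.cong[OF refl])
    fix i assume "i \<in> X"
    from E_ibp[OF s(1) disjI1[OF s(2)] assms(2) this, of \<gamma>]
    show "s * (- \<mu> * E (incr i \<beta>) \<gamma> (\<mu> * s) s +
       (\<Sum>j\<in>J. of_real (\<gamma> j * \<tau> j i) * E (incr i \<beta>) (decr j \<gamma>) (\<mu> * s) s)) = - of_real (\<beta> i) * E \<beta> \<gamma> (\<mu> * s) s"
      by (simp add: algebra_simps sum_distrib_left add_eq_0_iff)
  qed
  also have "\<dots> = - ?b * E \<beta> \<gamma> (\<mu> * s) s"
    by (simp add: sum_distrib_right sum_negf)
  finally have D: "D = - ?b * E \<beta> \<gamma> (\<mu> * s) s / s"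
    using s(4) by (metis nonzero_mult_div_cancel_left)
  have d1: "((\<lambda>s. exp (?b * Ln s)) has_field_derivative exp (?b * Ln s) * (?b * inverse s)) (at s)"
    by (intro DERIV_fun_exp DERIV_cmult has_field_derivative_Ln s)
  have "((\<lambda>s. Es \<beta> \<gamma> \<mu> s) has_field_derivative
     exp (?b * Ln s) * (?b * inverse s) * E \<beta> \<gamma> (\<mu> * s) s + D * exp (?b * Ln s)) (at s)"
    unfolding Es_def D_def
    by (rule DERIV_mult[OF d1 E_deriv_s[OF s(1,2) assms(2)]])
  then show ?thesis by (simp add: D divide_inverse)
qed

text \<open>The admissible directions form an intersection of half-planes, which is convex, so a
  vanishing derivative gives a constant.\<close>

lemma Eh_eq:
  assumes "admissible \<eta> \<mu> s" "\<forall>i\<in>X. 0 < \<beta> i"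
  shows "Eh \<eta> \<beta> \<gamma> \<mu> = Es \<beta> \<gamma> \<mu> s"
proof -
  have "\<exists>c. \<forall>z\<in>{s. admissible \<eta> \<mu> s}. Es \<beta> \<gamma> \<mu> z = c"
  proof (rule has_field_derivative_zero_constant[OF convex_admissible])
    fix x assume "x \<in> {s. admissible \<eta> \<mu> s}"
    then have "admissible \<eta> \<mu> x" by simp
    from has_field_derivative_at_within[OF Es_deriv_zero[OF this assms(2)]]
    show "(Es \<beta> \<gamma> \<mu> has_field_derivative 0) (at x within {s. admissible \<eta> \<mu> s})" .
  qed
  moreover have "admissible \<eta> \<mu> (SOME s. admissible \<eta> \<mu> s)" using assms(1) by (rule someI)
  ultimately show ?thesis using assms(1) unfolding Eh_def by auto
qed

lemma sum_incr: "i \<in> X \<Longrightarrow> (\<Sum>k\<in>X. incr i \<beta> k) = (\<Sum>k\<in>X. \<beta> k) + 1"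
  using finX by (simp add: sum.remove[of X i] incr_def cong: sum.cong_simp)

lemma Es_incr:
  assumes "i \<in> X" "s \<noteq> 0"
  shows "Es (incr i \<beta>) \<gamma> \<mu> s = exp (of_real (\<Sum>i\<in>X. \<beta> i) * Ln s) * (s * E (incr i \<beta>) \<gamma> (\<mu> * s) s)"
  using assms by (simp add: Es_def sum_incr distrib_right exp_add)

text \<open>Every \<open>incr\<close> raises the power of \<open>s\<close> in \<open>Es\<close> by
  one. This absorbs the explicit factors \<open>s\<close> of \<open>E_ibp\<close> and leaves a
  relation in which no direction occurs.\<close>

lemma Eh_ibp:
  assumes "admissible \<eta> \<mu> s" "\<forall>i\<in>X. 0 < \<beta> i" "i \<in> X"
  shows "\<mu> * Eh \<eta> (incr i \<beta>) \<gamma> \<mu> = of_real (\<beta> i) * Eh \<eta> \<beta> \<gamma> \<mu>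
    + (\<Sum>j\<in>J. of_real (\<gamma> j * \<tau> j i) * Eh \<eta> (incr i \<beta>) (decr j \<gamma>) \<mu>)"
proof -
  have s: "0 < Re (\<mu> * s)" "Im s \<noteq> 0" "s \<noteq> 0"
    using assms by (auto simp: admissible_def)
  let ?e = "exp (of_real (\<Sum>i\<in>X. \<beta> i) * Ln s)"
  have "?e * (of_real (\<beta> i) * E \<beta> \<gamma> (\<mu> * s) s - \<mu> * s * E (incr i \<beta>) \<gamma> (\<mu> * s) s
    + (\<Sum>j\<in>J. of_real (\<gamma> j * \<tau> j i) * s * E (incr i \<beta>) (decr j \<gamma>) (\<mu> * s) s)) = 0"
    using E_ibp[OF s(1) disjI1[OF s(2)] assms(2,3), of \<gamma>] by simp
  then have "\<mu> * Es (incr i \<beta>) \<gamma> \<mu> s = of_real (\<beta> i) * Es \<beta> \<gamma> \<mu> s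
    + (\<Sum>j\<in>J. of_real (\<gamma> j * \<tau> j i) * Es (incr i \<beta>) (decr j \<gamma>) \<mu> s)"
    unfolding Es_incr[OF assms(3) s(3)] by (simp add: Es_def algebra_simps sum_distrib_left)
  then show ?thesis
    using Eh_eq[OF assms(1)] incr_pos[OF assms(2)] assms(2) by simp
qed

text \<open>One factor \<open>1 + s * lform j a\<close> is split off and expanded in the
  coordinates; each coordinate raises an exponent and thereby absorbs its factor
  \<open>s\<close>.\<close>

lemma Eh_decr:
  assumes "admissible \<eta> \<mu> s" "\<forall>i\<in>X. 0 < \<beta> i" "j \<in> J"
  shows "Eh \<eta> \<beta> \<gamma> \<mu> = Eh \<eta> \<beta> (decr j \<gamma>) \<mu> + (\<Sum>i\<in>X. of_real (\<tau> j i) * Eh \<eta> (incr i \<beta>) (decr j \<gamma>) \<mu>)"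
proof -
  have s: "0 < Re (\<mu> * s)" "Im s \<noteq> 0 \<or> s = 0" "s \<noteq> 0"
    using assms by (auto simp: admissible_def)
  have "E \<beta> \<gamma> (\<mu> * s) s = (\<integral>a. T \<beta> (decr j \<gamma>) (\<mu> * s) s a +
      (\<Sum>i\<in>X. of_real (\<tau> j i) * s * T (incr i \<beta>) (decr j \<gamma>) (\<mu> * s) s a) \<partial>PM)"
    unfolding E_def
  proof (rule Bochner_Integration.integral_cong[OF refl])
    fix a assume a: "a \<in> space PM"
    have "1 + s * of_real (lform j a) \<noteq> 0"
      using one_plus_notin_nonpos_Reals[OF s(2)] by (metis nonpos_Reals_zero_I)
    then have "T \<beta> \<gamma> (\<mu> * s) s a = T \<beta> (decr j \<gamma>) (\<mu> * s) s a * (1 + s * of_real (lform j a))"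
      by (simp add: T_decr[OF s(2) assms(3)])
    then show "T \<beta> \<gamma> (\<mu> * s) s a = T \<beta> (decr j \<gamma>) (\<mu> * s) s a +
      (\<Sum>i\<in>X. of_real (\<tau> j i) * s * T (incr i \<beta>) (decr j \<gamma>) (\<mu> * s) s a)"
      using space_PM[OF a] by (simp add: T_incr lform_def algebra_simps sum_distrib_left sum_distrib_right)
  qed
  also have "\<dots> = E \<beta> (decr j \<gamma>) (\<mu> * s) s + (\<Sum>i\<in>X. of_real (\<tau> j i) * s * E (incr i \<beta>) (decr j \<gamma>) (\<mu> * s) s)"
    unfolding E_def using assms s
    by (subst Bochner_Integration.integral_add)
       (auto intro!: integrable_T incr_pos Bochner_Integration.integrable_sum integral_PM_sum_T)
  finally have "Es \<beta> \<gamma> \<mu> s = Es \<beta> (decr j \<gamma>) \<mu> s + (\<Sum>i\<in>X. of_real (\<tau> j i) * Es (incr i \<beta>) (decr j \<gamma>) \<mu> s)"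
    using s(3) by (simp add: Es_incr) (simp add: Es_def algebra_simps sum_distrib_left)
  then show ?thesis
    using Eh_eq[OF assms(1)] incr_pos[OF assms(2)] assms(2) by simp
qed

text \<open>A direction admissible for \<open>\<mu>\<close> is admissible for all nearby values, so
  locally \<open>Eh\<close> may be computed with a fixed \<open>s\<close>, and only the damping
  varies.\<close>

lemma Eh_deriv:
  assumes "admissible \<eta> \<mu> s" "\<forall>i\<in>X. 0 < \<beta> i"
  shows "((\<lambda>\<mu>. Eh \<eta> \<beta> \<gamma> \<mu>) has_field_derivative - (\<Sum>i\<in>X. Eh \<eta> (incr i \<beta>) \<gamma> \<mu>)) (at \<mu>)"
proof -
  have s: "0 < Re (\<mu> * s)" "Im s \<noteq> 0 \<or> s = 0" "s \<noteq> 0"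
    using assms by (auto simp: admissible_def)
  have "((\<lambda>\<mu>. E \<beta> \<gamma> (\<mu> * s) s) has_field_derivative - (\<Sum>i\<in>X. E (incr i \<beta>) \<gamma> (\<mu> * s) s) * s) (at \<mu>)"
    by (rule DERIV_chain2[where f = "\<lambda>\<sigma>. E \<beta> \<gamma> \<sigma> s" and g = "\<lambda>\<mu>. \<mu> * s", OF E_deriv_sigma[OF s(1,2) assms(2), of \<gamma>]])
       (auto intro!: derivative_eq_intros)
  then have "((\<lambda>\<mu>. Es \<beta> \<gamma> \<mu> s) has_field_derivative
     exp (of_real (\<Sum>i\<in>X. \<beta> i) * Ln s) * (- (\<Sum>i\<in>X. E (incr i \<beta>) \<gamma> (\<mu> * s) s) * s)) (at \<mu>)"
    unfolding Es_def by (rule DERIV_cmult)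
  also have "exp (of_real (\<Sum>i\<in>X. \<beta> i) * Ln s) * (- (\<Sum>i\<in>X. E (incr i \<beta>) \<gamma> (\<mu> * s) s) * s) =
      - (\<Sum>i\<in>X. Es (incr i \<beta>) \<gamma> \<mu> s)"
    using s(3) by (simp add: Es_incr sum_distrib_left sum_distrib_right mult_ac)
  also have "\<dots> = - (\<Sum>i\<in>X. Eh \<eta> (incr i \<beta>) \<gamma> \<mu>)"
    using Eh_eq[OF assms(1) incr_pos[OF assms(2)]] by simp
  finally have *: "((\<lambda>\<mu>. Es \<beta> \<gamma> \<mu> s) has_field_derivative - (\<Sum>i\<in>X. Eh \<eta> (incr i \<beta>) \<gamma> \<mu>)) (at \<mu>)" .
  have o: "open {\<mu>. admissible \<eta> \<mu> s}"
  proof -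
    have "{\<mu>. admissible \<eta> \<mu> s} = {\<mu>. 0 < Re (\<mu> * s)}" using assms(1) by (auto simp: admissible_def)
    moreover have "open {\<mu>. 0 < Re (\<mu> * s)}" by (intro open_Collect_less continuous_intros)
    ultimately show ?thesis by simp
  qed
  show ?thesis
    by (rule has_field_derivative_transform_within_open[OF * o])
       (use assms(1) Eh_eq[OF _ assms(2)] in auto)
qed

section \<open>Taylor expansion at s = 0\<close>

primrec phd :: "nat \<Rightarrow> (nat \<Rightarrow> real) \<Rightarrow> complex \<Rightarrow> (nat \<Rightarrow> real) \<Rightarrow> complex" where
  "phd 0 \<gamma> s a = ph \<gamma> s a"
| "phd (Suc n) \<gamma> s a = (\<Sum>j\<in>J. of_real (\<gamma> j * lform j a) * phd n (decr j \<gamma>) s a)"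

text \<open>Thus \<open>phd n\<close> is the derivative of order \<open>n\<close> of
  \<open>ph\<close> in \<open>s\<close>. The recursive formula, in which each differentiation lowers
  one exponent, lets bounds and measurability be inherited from \<open>ph\<close> by
  induction.\<close>

lemma phd_deriv:
  assumes "Im s \<noteq> 0 \<or> s = 0"
  shows "((\<lambda>s. phd n \<gamma> s a) has_field_derivative phd (Suc n) \<gamma> s a) (at s)"
proof (induction n arbitrary: \<gamma>)
  case 0
  then show ?case using ph_has_field_derivative[OF assms] by simp
next
  case (Suc n)
  have "((\<lambda>s. \<Sum>j\<in>J. of_real (\<gamma> j * lform j a) * phd n (decr j \<gamma>) s a) has_field_derivative
      (\<Sum>j\<in>J. of_real (\<gamma> j * lform j a) * phd (Suc n) (decr j \<gamma>) s a)) (at s)"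
    by (intro DERIV_sum DERIV_cmult Suc)
  then show ?case by (simp only: phd.simps(2)[of n \<gamma>] phd.simps(2)[of "Suc n" \<gamma>])
qed

text \<open>Each differentiation costs a factor \<open>lform j a\<close>, at most linear in
  \<open>csum a\<close>. It is absorbed by half of the exponential rate, the induction hypothesis
  being used with the other half.\<close>

lemma phd_bound:
  assumes "0 < \<kappa>" "0 < d" "d \<le> 1" "0 \<le> R"
  shows "\<exists>C>0. \<forall>s a. d * cmod s \<le> \<bar>Im s\<bar> \<longrightarrow> cmod s \<le> R \<longrightarrow> (\<forall>i\<in>X. 0 < a i) \<longrightarrow>
     norm (phd n \<gamma> s a) \<le> C * exp (\<kappa> * csum a)"
  using assms(1)
proof (induction n arbitrary: \<gamma> \<kappa>)
  case 0
  then show ?case using ph_bound[OF _ assms(2-), of \<kappa> \<gamma>] by simp metis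
next
  case (Suc n)
  define B where "B = (\<Sum>j\<in>J. \<Sum>i\<in>X. \<bar>\<tau> j i\<bar>)"
  have B: "B \<ge> 0" unfolding B_def by (auto intro!: sum_nonneg)
  have "\<forall>j. \<exists>C>0. \<forall>s a. d * cmod s \<le> \<bar>Im s\<bar> \<longrightarrow> cmod s \<le> R \<longrightarrow> (\<forall>i\<in>X. 0 < a i) \<longrightarrow>
     norm (phd n (decr j \<gamma>) s a) \<le> C * exp (\<kappa> / 2 * csum a)"
    using Suc.IH[of "\<kappa> / 2"] Suc.prems by simp
  then obtain C where C: "\<And>j. C j > 0" "\<And>j s a. d * cmod s \<le> \<bar>Im s\<bar> \<Longrightarrow> cmod s \<le> R \<Longrightarrow> (\<forall>i\<in>X. 0 < a i) \<Longrightarrow>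
     norm (phd n (decr j \<gamma>) s a) \<le> C j * exp (\<kappa> / 2 * csum a)"
    by metis
  define K where "K = (\<Sum>j\<in>J. \<bar>\<gamma> j\<bar> * (B * (2 / \<kappa>)) * C j)"
  have "K \<ge> 0" unfolding K_def using B C(1) Suc.prems by (intro sum_nonneg mult_nonneg_nonneg) (auto simp: less_imp_le)
  have "norm (phd (Suc n) \<gamma> s a) \<le> (K + 1) * exp (\<kappa> * csum a)"
    if s: "d * cmod s \<le> \<bar>Im s\<bar>" "cmod s \<le> R" and a: "\<forall>i\<in>X. 0 < a i" for s a
  proof -
    have e: "csum a \<le> 2 / \<kappa> * exp (\<kappa> / 2 * csum a)"
    proof -
      have "\<kappa> / 2 * csum a \<le> exp (\<kappa> / 2 * csum a)" using exp_ge_add_one_self[of "\<kappa> / 2 * csum a"] by linarith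
      then show ?thesis using Suc.prems by (simp add: field_simps)
    qed
    have "norm (phd (Suc n) \<gamma> s a) \<le> (\<Sum>j\<in>J. norm (of_real (\<gamma> j * lform j a) * phd n (decr j \<gamma>) s a))"
      by (simp only: phd.simps norm_sum)
    also have "\<dots> \<le> (\<Sum>j\<in>J. \<bar>\<gamma> j\<bar> * (B * (2 / \<kappa> * exp (\<kappa> / 2 * csum a))) * (C j * exp (\<kappa> / 2 * csum a)))"
    proof (rule sum_mono)
      fix j assume j: "j \<in> J"
      have "\<bar>lform j a\<bar> \<le> B * (2 / \<kappa> * exp (\<kappa> / 2 * csum a))"
        using abs_lform_le[OF a j] mult_left_mono[OF e B] unfolding B_def by linarith
      then have "\<bar>\<gamma> j\<bar> * \<bar>lform j a\<bar> * norm (phd n (decr j \<gamma>) s a) \<le> \<bar>\<gamma> j\<bar> * (B * (2 / \<kappa> * exp (\<kappa> / 2 * csum a))) * (C j * exp (\<kappa> / 2 * csum a))"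
        using C(2)[OF s a, of j] B Suc.prems by (intro mult_mono) auto
      then show "norm (of_real (\<gamma> j * lform j a) * phd n (decr j \<gamma>) s a) \<le> \<bar>\<gamma> j\<bar> * (B * (2 / \<kappa> * exp (\<kappa> / 2 * csum a))) * (C j * exp (\<kappa> / 2 * csum a))"
        by (simp add: norm_mult abs_mult)
    qed
    also have "\<dots> = K * (exp (\<kappa> / 2 * csum a) * exp (\<kappa> / 2 * csum a))"
      unfolding K_def by (simp add: sum_distrib_left sum_distrib_right mult_ac)
    also have "exp (\<kappa> / 2 * csum a) * exp (\<kappa> / 2 * csum a) = exp (\<kappa> * csum a)"
      by (simp add: exp_add[symmetric])
    also have "K * exp (\<kappa> * csum a) \<le> (K + 1) * exp (\<kappa> * csum a)" by simp
    finally show ?thesis .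
  qed
  then show ?case using \<open>K \<ge> 0\<close> by (intro exI[of _ "K + 1"]) auto
qed

definition wc :: "complex \<Rightarrow> (nat \<Rightarrow> real) \<Rightarrow> (nat \<Rightarrow> real) \<Rightarrow> complex" where
  "wc \<sigma> \<beta> a = exp (- \<sigma> * of_real (csum a)) * of_real (\<Prod>i\<in>X. a i powr (\<beta> i - 1))"

lemma norm_wc: "norm (wc \<sigma> \<beta> a) = wt (Re \<sigma>) \<beta> a"
  unfolding wc_def wt_eq norm_mult norm_of_real
  by (simp add: norm_exp_eq_Re abs_of_nonneg[OF prod_nonneg])

lemma wt_split: "wt (2 * \<kappa>) \<beta> a * exp (\<kappa> * csum a) = wt \<kappa> \<beta> a"
proof -
  have "exp (- (2 * \<kappa>) * csum a) * exp (\<kappa> * csum a) = exp (- \<kappa> * csum a)"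
    by (simp add: exp_add[symmetric])
  then show ?thesis unfolding wt_eq by (simp only: mult.commute[of _ "exp (\<kappa> * csum a)"] mult.assoc[symmetric])
qed

lemma measurable_phd:
  assumes "Im s \<noteq> 0 \<or> s = 0"
  shows "phd n \<gamma> s \<in> borel_measurable PM"
proof (induction n arbitrary: \<gamma>)
  case 0
  then show ?case using measurable_ph[OF assms] by (simp add: phd.simps(1)[abs_def])
next
  case (Suc n)
  note Suc[measurable]
  have [measurable]: "lform j \<in> borel_measurable PM" for j
    unfolding lform_def[abs_def] by measurable
  show ?case unfolding phd.simps(2)[abs_def] by measurable
qed

lemma measurable_wc: "wc \<sigma> \<beta> \<in> borel_measurable PM"
  unfolding wc_def[abs_def] csum_def[abs_def] by measurable

lemma integrable_wc_phd:
  assumes "0 < Re \<sigma>" "\<forall>i\<in>X. 0 < \<beta> i"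
  shows "integrable PM (\<lambda>a. wc \<sigma> \<beta> a * phd m \<gamma> 0 a)"
proof -
  define \<kappa> where "\<kappa> = Re \<sigma> / 2"
  have \<kappa>: "\<kappa> > 0" "Re \<sigma> = 2 * \<kappa>" using assms by (auto simp: \<kappa>_def)
  obtain C where C: "C > 0" "\<And>a. \<forall>i\<in>X. 0 < a i \<Longrightarrow> norm (phd m \<gamma> 0 a) \<le> C * exp (\<kappa> * csum a)"
    using phd_bound[OF \<kappa>(1), of 1 0 m \<gamma>] by auto
  have i: "integrable PM (\<lambda>a. C * wt \<kappa> \<beta> a)" using integrable_wt[OF \<kappa>(1) assms(2)] by simp
  show ?thesis
  proof (rule Bochner_Integration.integrable_bound[OF i])
    show "(\<lambda>a. wc \<sigma> \<beta> a * phd m \<gamma> 0 a) \<in> borel_measurable PM"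
      by (intro borel_measurable_times measurable_wc measurable_phd) simp
    show "AE a in PM. norm (wc \<sigma> \<beta> a * phd m \<gamma> 0 a) \<le> norm (C * wt \<kappa> \<beta> a)"
    proof (rule AE_I2)
      fix a assume a: "a \<in> space PM"
      have "norm (wc \<sigma> \<beta> a * phd m \<gamma> 0 a) \<le> wt (2 * \<kappa>) \<beta> a * (C * exp (\<kappa> * csum a))"
        unfolding norm_mult norm_wc \<kappa>(2)
        by (intro mult_left_mono C(2)) (auto simp: space_PM[OF a] wt_def intro!: prod_nonneg)
      also have "\<dots> = C * (wt (2 * \<kappa>) \<beta> a * exp (\<kappa> * csum a))" by (simp only: mult_ac)
      also have "\<dots> = C * wt \<kappa> \<beta> a" by (simp only: wt_split)
      also have "\<dots> \<le> norm (C * wt \<kappa> \<beta> a)" by (simp only: real_norm_def abs_ge_self)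
      finally show "norm (wc \<sigma> \<beta> a * phd m \<gamma> 0 a) \<le> norm (C * wt \<kappa> \<beta> a)" .
    qed
  qed
qed

definition tcoeff :: "(nat \<Rightarrow> real) \<Rightarrow> (nat \<Rightarrow> real) \<Rightarrow> complex \<Rightarrow> nat \<Rightarrow> complex" where
  "tcoeff \<beta> \<gamma> \<sigma> m = integral\<^sup>L PM (\<lambda>a. wc \<sigma> \<beta> a * phd m \<gamma> 0 a) / fact m"

text \<open>The point 0 is only the vertex of the double sector on which \<open>E\<close> is
  controlled, so Taylor's formula is applied to the integrand, along the segment from 0 to
  \<open>s\<close>. Its remainder is bounded uniformly by a multiple of
  \<open>exp (\<kappa> * csum a)\<close> and can be integrated.\<close>

lemma E_expansion:
  assumes "0 < Re \<sigma>" "\<forall>i\<in>X. 0 < \<beta> i" "0 < d" "d \<le> 1" "0 \<le> R"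
  shows "\<exists>C. \<forall>s. d * cmod s \<le> \<bar>Im s\<bar> \<longrightarrow> cmod s \<le> R \<longrightarrow>
    norm (E \<beta> \<gamma> \<sigma> s - (\<Sum>m\<le>n. tcoeff \<beta> \<gamma> \<sigma> m * s ^ m)) \<le> C * cmod s ^ Suc n"
proof -
  define \<kappa> where "\<kappa> = Re \<sigma> / 2"
  have \<kappa>: "\<kappa> > 0" "Re \<sigma> = 2 * \<kappa>" using assms by (auto simp: \<kappa>_def)
  obtain C where C0: "C > 0" "\<forall>s a. d * cmod s \<le> \<bar>Im s\<bar> \<longrightarrow> cmod s \<le> R \<longrightarrow> (\<forall>i\<in>X. 0 < a i) \<longrightarrow>
      norm (phd (Suc n) \<gamma> s a) \<le> C * exp (\<kappa> * csum a)"
    using phd_bound[OF \<kappa>(1) assms(3-5), of "Suc n" \<gamma>] by (elim exE conjE)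
  have C: "C > 0" "norm (phd (Suc n) \<gamma> s a) \<le> C * exp (\<kappa> * csum a)"
    if "d * cmod s \<le> \<bar>Im s\<bar>" "cmod s \<le> R" "\<forall>i\<in>X. 0 < a i" for s a
    using C0 that by blast+
  define I where "I = integral\<^sup>L PM (wt \<kappa> \<beta>)"
  show ?thesis
  proof (intro exI[of _ "C * I"] allI impI)
    fix s assume s: "d * cmod s \<le> \<bar>Im s\<bar>" "cmod s \<le> R"
    have s0: "Im s \<noteq> 0 \<or> s = 0"
      using s(1) assms(3) by (metis abs_zero linorder_not_le mult_pos_pos zero_less_norm_iff)
    define Q where "Q a = (\<Sum>m\<le>n. s ^ m / fact m * (wc \<sigma> \<beta> a * phd m \<gamma> 0 a))" for a
    have iQ: "integrable PM Q" unfolding Q_def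
      by (intro Bochner_Integration.integrable_sum integrable_mult_right integrable_wc_phd assms)
    have "integral\<^sup>L PM Q = (\<Sum>m\<le>n. s ^ m / fact m * integral\<^sup>L PM (\<lambda>a. wc \<sigma> \<beta> a * phd m \<gamma> 0 a))"
      unfolding Q_def by (rule integral_PM_sum_T) (intro integrable_wc_phd assms)
    then have IQ: "integral\<^sup>L PM Q = (\<Sum>m\<le>n. tcoeff \<beta> \<gamma> \<sigma> m * s ^ m)"
      by (simp add: tcoeff_def mult_ac)
    have iT: "integrable PM (T \<beta> \<gamma> \<sigma> s)" by (intro integrable_T assms s0)
    have pt: "norm (T \<beta> \<gamma> \<sigma> s a - Q a) \<le> C * cmod s ^ Suc n * wt \<kappa> \<beta> a" if a: "a \<in> space PM" for a
    proof -
      \<comment> \<open>The double sector and the disc are star-shaped about 0, so the bounds hold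
        along the whole segment.\<close>
      have seg: "d * cmod z \<le> \<bar>Im z\<bar> \<and> cmod z \<le> R \<and> (Im z \<noteq> 0 \<or> z = 0)" if "z \<in> closed_segment 0 s" for z
      proof -
        obtain u where u: "0 \<le> u" "u \<le> 1" "z = of_real u * s"
          using \<open>z \<in> closed_segment 0 s\<close> by (auto simp: in_segment scaleR_conv_of_real)
        have "d * cmod z = u * (d * cmod s)" using u by (simp add: norm_mult)
        also have "\<dots> \<le> u * \<bar>Im s\<bar>" using u s by (intro mult_left_mono)
        also have "\<dots> = \<bar>Im z\<bar>" using u by (simp add: abs_mult)
        finally have "d * cmod z \<le> \<bar>Im z\<bar>" .
        moreover have "cmod z \<le> R" using u s mult_left_le_one_le[of "cmod s" u] by (simp add: norm_mult)
        ultimately show ?thesis using u s0 by auto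
      qed
      have "cmod (phd 0 \<gamma> s a - (\<Sum>i\<le>n. phd i \<gamma> 0 a * (s - 0) ^ i / fact i))
          \<le> (C * exp (\<kappa> * csum a)) * cmod (s - 0) ^ Suc n / fact n"
      proof (rule complex_Taylor[where S = "closed_segment 0 s" and f = "\<lambda>i x. phd i \<gamma> x a"])
        show "((\<lambda>x. phd i \<gamma> x a) has_field_derivative phd (Suc i) \<gamma> x a) (at x within closed_segment 0 s)"
          if "x \<in> closed_segment 0 s" for i x
          by (rule has_field_derivative_at_within[OF phd_deriv]) (use seg[OF that] in auto)
        show "cmod (phd (Suc n) \<gamma> x a) \<le> C * exp (\<kappa> * csum a)" if "x \<in> closed_segment 0 s" for x
          using seg[OF that] a by (intro C(2)) (auto simp: space_PM)
      qed auto
      also have "\<dots> \<le> (C * exp (\<kappa> * csum a)) * cmod s ^ Suc n"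
      proof -
        have "0 \<le> (C * exp (\<kappa> * csum a)) * cmod s ^ Suc n" using C0(1) by simp
        then have "(C * exp (\<kappa> * csum a)) * cmod s ^ Suc n / fact n \<le> (C * exp (\<kappa> * csum a)) * cmod s ^ Suc n / 1"
          by (intro divide_left_mono fact_ge_1) auto
        then show ?thesis by simp
      qed
      finally have ph: "cmod (ph \<gamma> s a - (\<Sum>i\<le>n. phd i \<gamma> 0 a * s ^ i / fact i)) \<le> C * exp (\<kappa> * csum a) * cmod s ^ Suc n"
        by simp
      have "T \<beta> \<gamma> \<sigma> s a - Q a = wc \<sigma> \<beta> a * (ph \<gamma> s a - (\<Sum>i\<le>n. phd i \<gamma> 0 a * s ^ i / fact i))"
        unfolding T_def Q_def wc_def by (simp add: algebra_simps sum_distrib_left)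
      also have "norm \<dots> \<le> wt (2 * \<kappa>) \<beta> a * (C * exp (\<kappa> * csum a) * cmod s ^ Suc n)"
        unfolding norm_mult norm_wc \<kappa>(2)
        by (intro mult_left_mono ph) (auto simp: space_PM[OF a] wt_def intro!: prod_nonneg)
      also have "\<dots> = C * cmod s ^ Suc n * (wt (2 * \<kappa>) \<beta> a * exp (\<kappa> * csum a))" by (simp only: mult_ac)
      also have "\<dots> = C * cmod s ^ Suc n * wt \<kappa> \<beta> a" by (simp only: wt_split)
      finally show ?thesis .
    qed
    have "E \<beta> \<gamma> \<sigma> s - (\<Sum>m\<le>n. tcoeff \<beta> \<gamma> \<sigma> m * s ^ m) = (\<integral>a. T \<beta> \<gamma> \<sigma> s a - Q a \<partial>PM)"
      unfolding E_def IQ[symmetric] using iT iQ by (subst Bochner_Integration.integral_diff) auto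
    also have "norm \<dots> \<le> (\<integral>a. C * cmod s ^ Suc n * wt \<kappa> \<beta> a \<partial>PM)"
      by (rule order_trans[OF integral_norm_bound integral_mono])
         (use iT iQ pt integrable_wt[OF \<kappa>(1) assms(2)] in auto)
    also have "\<dots> = C * I * cmod s ^ Suc n" by (simp add: I_def)
    finally show "norm (E \<beta> \<gamma> \<sigma> s - (\<Sum>m\<le>n. tcoeff \<beta> \<gamma> \<sigma> m * s ^ m)) \<le> C * I * cmod s ^ Suc n" .
  qed
qed

lemma integral_wt_pos:
  assumes "\<forall>i\<in>X. 0 < \<beta> i"
  shows "0 < integral\<^sup>L PM (wt 1 \<beta>)"
  unfolding wt_def using assms finX integrable_pos_Gamma[of _ 1] integral_pos_Gamma_pos
  by (subst pos.product_integral_prod) (auto intro!: prod_pos)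

lemma tcoeff_0: "tcoeff \<beta> \<gamma> 1 0 = of_real (integral\<^sup>L PM (wt 1 \<beta>))"
proof -
  have "wc 1 \<beta> a * phd 0 \<gamma> 0 a = of_real (wt 1 \<beta> a)" for a
    by (simp add: wc_def wt_eq ph_def flip: exp_of_real)
  then show ?thesis by (simp add: tcoeff_def)
qed

end

section \<open>Asymptotic expansions and finite linear systems\<close>

text \<open>Explicit constants in place of a filter: expansions on different sets can then be
  restricted, united and compared directly. \<open>asymp_exp_bigo\<close> converts to the Landau
  form.\<close>

definition asymp_exp :: "complex set \<Rightarrow> (complex \<Rightarrow> complex) \<Rightarrow> complex fps \<Rightarrow> bool" where
  "asymp_exp S g F \<longleftrightarrow> (\<forall>n. \<exists>C R. \<forall>\<mu>\<in>S. R \<le> cmod \<mu> \<longrightarrow>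
     cmod (g \<mu> - (\<Sum>m\<le>n. fps_nth F m / \<mu> ^ m)) \<le> C / cmod \<mu> ^ (n + 1))"

lemma asymp_expI:
  assumes "\<And>n. \<exists>C R. \<forall>\<mu>\<in>S. R \<le> cmod \<mu> \<longrightarrow>
     cmod (g \<mu> - (\<Sum>m\<le>n. fps_nth F m / \<mu> ^ m)) \<le> C / cmod \<mu> ^ (n + 1)"
  shows "asymp_exp S g F"
  using assms by (simp add: asymp_exp_def)

lemma asymp_expD:
  assumes "asymp_exp S g F"
  obtains C R where "R \<ge> 1" "C \<ge> 0" "\<And>\<mu>. \<mu> \<in> S \<Longrightarrow> R \<le> cmod \<mu> \<Longrightarrow>
     cmod (g \<mu> - (\<Sum>m\<le>n. fps_nth F m / \<mu> ^ m)) \<le> C / cmod \<mu> ^ (n + 1)"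
proof -
  obtain C R where CR: "\<forall>\<mu>\<in>S. R \<le> cmod \<mu> \<longrightarrow>
     cmod (g \<mu> - (\<Sum>m\<le>n. fps_nth F m / \<mu> ^ m)) \<le> C / cmod \<mu> ^ (n + 1)"
    using assms unfolding asymp_exp_def by blast
  show ?thesis
  proof (rule that[of "max 1 R" "\<bar>C\<bar>"])
    fix \<mu> assume "\<mu> \<in> S" "max 1 R \<le> cmod \<mu>"
    then have "cmod (g \<mu> - (\<Sum>m\<le>n. fps_nth F m / \<mu> ^ m)) \<le> C / cmod \<mu> ^ (n + 1)"
      using CR by auto
    also have "\<dots> \<le> \<bar>C\<bar> / cmod \<mu> ^ (n + 1)"
      by (intro divide_right_mono) auto
    finally show "cmod (g \<mu> - (\<Sum>m\<le>n. fps_nth F m / \<mu> ^ m)) \<le> \<bar>C\<bar> / cmod \<mu> ^ (n + 1)" .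
  qed auto
qed

lemma asymp_exp_bigo:
  assumes "asymp_exp S g F"
  shows "(\<lambda>\<nu>. g \<nu> - (\<Sum>m\<le>n. fps_nth F m / \<nu> ^ m)) \<in> O[inf at_infinity (principal S)](\<lambda>\<nu>. 1 / \<nu> ^ (n + 1))"
proof -
  obtain C R where "\<And>\<mu>. \<mu> \<in> S \<Longrightarrow> R \<le> cmod \<mu> \<Longrightarrow>
     cmod (g \<mu> - (\<Sum>m\<le>n. fps_nth F m / \<mu> ^ m)) \<le> C / cmod \<mu> ^ (n + 1)"
    using asymp_expD[OF assms, of n] by metis
  then show ?thesis
    by (intro bigoI[of _ C])
       (auto simp: eventually_inf_principal eventually_at_infinity norm_divide norm_power norm_mult intro!: exI[of _ R])
qed

lemma asymp_exp_subset: "asymp_exp S g F \<Longrightarrow> T \<subseteq> S \<Longrightarrow> asymp_exp T g F"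
  unfolding asymp_exp_def by blast

lemma asymp_exp_Un:
  assumes "asymp_exp S g F" "asymp_exp T g F"
  shows "asymp_exp (S \<union> T) g F"
proof (rule asymp_expI)
  fix n
  obtain C R where 1: "\<And>\<mu>. \<mu> \<in> S \<Longrightarrow> R \<le> cmod \<mu> \<Longrightarrow>
     cmod (g \<mu> - (\<Sum>m\<le>n. fps_nth F m / \<mu> ^ m)) \<le> C / cmod \<mu> ^ (n + 1)"
    using asymp_expD[OF assms(1), of n] by metis
  obtain C' R' where 2: "\<And>\<mu>. \<mu> \<in> T \<Longrightarrow> R' \<le> cmod \<mu> \<Longrightarrow>
     cmod (g \<mu> - (\<Sum>m\<le>n. fps_nth F m / \<mu> ^ m)) \<le> C' / cmod \<mu> ^ (n + 1)"
    using asymp_expD[OF assms(2), of n] by metis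
  have le: "C / cmod \<mu> ^ (n + 1) \<le> max C C' / cmod \<mu> ^ (n + 1)"
    "C' / cmod \<mu> ^ (n + 1) \<le> max C C' / cmod \<mu> ^ (n + 1)" for \<mu> :: complex
    by (intro divide_right_mono; simp)+
  have "cmod (g \<mu> - (\<Sum>m\<le>n. fps_nth F m / \<mu> ^ m)) \<le> max C C' / cmod \<mu> ^ (n + 1)"
    if \<mu>: "\<mu> \<in> S \<union> T" "max R R' \<le> cmod \<mu>" for \<mu>
  proof (cases "\<mu> \<in> S")
    case True
    have "R \<le> cmod \<mu>" using \<mu> by simp
    from order_trans[OF 1[OF True this] le(1)] show ?thesis .
  next
    case False
    then have "\<mu> \<in> T" "R' \<le> cmod \<mu>" using \<mu> by auto
    from order_trans[OF 2[OF this] le(2)] show ?thesis .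
  qed
  then show "\<exists>C R. \<forall>\<mu>\<in>S \<union> T. R \<le> cmod \<mu> \<longrightarrow>
     cmod (g \<mu> - (\<Sum>m\<le>n. fps_nth F m / \<mu> ^ m)) \<le> C / cmod \<mu> ^ (n + 1)"
    by blast
qed

lemma asymp_exp_cong:
  assumes "asymp_exp S g F" "\<And>\<mu>. \<mu> \<in> S \<Longrightarrow> \<mu> \<noteq> 0 \<Longrightarrow> g \<mu> = h \<mu>"
  shows "asymp_exp S h F"
proof (rule asymp_expI)
  fix n
  obtain C R where 1: "R \<ge> 1" "\<And>\<mu>. \<mu> \<in> S \<Longrightarrow> R \<le> cmod \<mu> \<Longrightarrow>
     cmod (g \<mu> - (\<Sum>m\<le>n. fps_nth F m / \<mu> ^ m)) \<le> C / cmod \<mu> ^ (n + 1)"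
    using asymp_expD[OF assms(1), of n] by metis
  then show "\<exists>C R. \<forall>\<mu>\<in>S. R \<le> cmod \<mu> \<longrightarrow>
     cmod (h \<mu> - (\<Sum>m\<le>n. fps_nth F m / \<mu> ^ m)) \<le> C / cmod \<mu> ^ (n + 1)"
    using assms(2) by (intro exI[of _ C] exI[of _ R]) fastforce
qed

lemma asymp_exp_add:
  assumes "asymp_exp S g F" "asymp_exp S h G"
  shows "asymp_exp S (\<lambda>\<mu>. g \<mu> + h \<mu>) (F + G)"
proof (rule asymp_expI)
  fix n
  obtain C R where 1: "\<And>\<mu>. \<mu> \<in> S \<Longrightarrow> R \<le> cmod \<mu> \<Longrightarrow>
     cmod (g \<mu> - (\<Sum>m\<le>n. fps_nth F m / \<mu> ^ m)) \<le> C / cmod \<mu> ^ (n + 1)"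
    using asymp_expD[OF assms(1), of n] by metis
  obtain C' R' where 2: "\<And>\<mu>. \<mu> \<in> S \<Longrightarrow> R' \<le> cmod \<mu> \<Longrightarrow>
     cmod (h \<mu> - (\<Sum>m\<le>n. fps_nth G m / \<mu> ^ m)) \<le> C' / cmod \<mu> ^ (n + 1)"
    using asymp_expD[OF assms(2), of n] by metis
  have "cmod (g \<mu> + h \<mu> - (\<Sum>m\<le>n. fps_nth (F + G) m / \<mu> ^ m)) \<le> (C + C') / cmod \<mu> ^ (n + 1)"
    if "\<mu> \<in> S" "max R R' \<le> cmod \<mu>" for \<mu>
  proof -
    have "g \<mu> + h \<mu> - (\<Sum>m\<le>n. fps_nth (F + G) m / \<mu> ^ m) =
      (g \<mu> - (\<Sum>m\<le>n. fps_nth F m / \<mu> ^ m)) + (h \<mu> - (\<Sum>m\<le>n. fps_nth G m / \<mu> ^ m))"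
      by (simp add: sum.distrib add_divide_distrib)
    also have "cmod \<dots> \<le> C / cmod \<mu> ^ (n + 1) + C' / cmod \<mu> ^ (n + 1)"
      using 1 2 that by (intro norm_triangle_le add_mono) auto
    finally show ?thesis by (simp add: add_divide_distrib)
  qed
  then show "\<exists>C R. \<forall>\<mu>\<in>S. R \<le> cmod \<mu> \<longrightarrow>
     cmod (g \<mu> + h \<mu> - (\<Sum>m\<le>n. fps_nth (F + G) m / \<mu> ^ m)) \<le> C / cmod \<mu> ^ (n + 1)"
    by blast
qed

lemma asymp_exp_cmult:
  assumes "asymp_exp S g F"
  shows "asymp_exp S (\<lambda>\<mu>. c * g \<mu>) (fps_const c * F)"
proof (rule asymp_expI)
  fix n
  obtain C R where 1: "\<And>\<mu>. \<mu> \<in> S \<Longrightarrow> R \<le> cmod \<mu> \<Longrightarrow>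
     cmod (g \<mu> - (\<Sum>m\<le>n. fps_nth F m / \<mu> ^ m)) \<le> C / cmod \<mu> ^ (n + 1)"
    using asymp_expD[OF assms(1), of n] by metis
  have "cmod (c * g \<mu> - (\<Sum>m\<le>n. fps_nth (fps_const c * F) m / \<mu> ^ m)) \<le> (cmod c * C) / cmod \<mu> ^ (n + 1)"
    if "\<mu> \<in> S" "R \<le> cmod \<mu>" for \<mu>
  proof -
    have "c * g \<mu> - (\<Sum>m\<le>n. fps_nth (fps_const c * F) m / \<mu> ^ m) = c * (g \<mu> - (\<Sum>m\<le>n. fps_nth F m / \<mu> ^ m))"
      by (simp add: sum_distrib_left algebra_simps)
    also have "cmod \<dots> \<le> cmod c * (C / cmod \<mu> ^ (n + 1))"
      unfolding norm_mult using 1 that by (intro mult_left_mono) auto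
    finally show ?thesis by simp
  qed
  then show "\<exists>C R. \<forall>\<mu>\<in>S. R \<le> cmod \<mu> \<longrightarrow>
     cmod (c * g \<mu> - (\<Sum>m\<le>n. fps_nth (fps_const c * F) m / \<mu> ^ m)) \<le> C / cmod \<mu> ^ (n + 1)"
    by blast
qed

lemma asymp_exp_zero: "asymp_exp S (\<lambda>\<mu>. 0) 0"
  by (rule asymp_expI) (auto intro!: exI[of _ 0])

lemma asymp_exp_sum:
  assumes "finite I" "\<And>i. i \<in> I \<Longrightarrow> asymp_exp S (g i) (F i)"
  shows "asymp_exp S (\<lambda>\<mu>. \<Sum>i\<in>I. g i \<mu>) (\<Sum>i\<in>I. F i)"
  using assms by (induction I rule: finite_induct) (auto intro: asymp_exp_zero asymp_exp_add)

lemma asymp_exp_diff: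
  assumes "asymp_exp S g F" "asymp_exp S h G"
  shows "asymp_exp S (\<lambda>\<mu>. g \<mu> - h \<mu>) (F - G)"
  using asymp_exp_add[OF assms(1) asymp_exp_cmult[OF assms(2), of "-1"]]
  by (simp add: fps_const_neg[symmetric] del: fps_const_neg)

lemma asymp_exp_divide:
  assumes "asymp_exp S g F"
  shows "asymp_exp S (\<lambda>\<mu>. g \<mu> / \<mu>) (fps_X * F)"
proof (rule asymp_expI)
  fix n
  show "\<exists>C R. \<forall>\<mu>\<in>S. R \<le> cmod \<mu> \<longrightarrow>
     cmod (g \<mu> / \<mu> - (\<Sum>m\<le>n. fps_nth (fps_X * F) m / \<mu> ^ m)) \<le> C / cmod \<mu> ^ (n + 1)"
  \<comment> \<open>Order \<open>n\<close> of the quotient comes from order \<open>n - 1\<close> of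
    \<open>g\<close>. For \<open>n = 0\<close> no such order exists, and boundedness of
    \<open>g\<close> is used instead.\<close>
  proof (cases n)
    case 0
    obtain C R where 1: "R \<ge> 1" "C \<ge> 0" "\<And>\<mu>. \<mu> \<in> S \<Longrightarrow> R \<le> cmod \<mu> \<Longrightarrow>
       cmod (g \<mu> - (\<Sum>m\<le>0. fps_nth F m / \<mu> ^ m)) \<le> C / cmod \<mu> ^ (0 + 1)"
      using asymp_expD[OF assms(1), of 0] by metis
    have "cmod (g \<mu> / \<mu>) \<le> (C + cmod (fps_nth F 0)) / cmod \<mu>" if "\<mu> \<in> S" "R \<le> cmod \<mu>" for \<mu>
    proof -
      have "C / cmod \<mu> \<le> C"
        using 1(1,2) that(2) by (simp add: divide_le_eq mult_le_cancel_left1)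
      then have "cmod (g \<mu> - fps_nth F 0) \<le> C" using 1(3)[OF that] by simp
      then have "cmod (g \<mu>) \<le> C + cmod (fps_nth F 0)"
        by (smt (verit) norm_triangle_sub)
      then show ?thesis by (simp add: norm_divide divide_right_mono)
    qed
    then show ?thesis using 0 by auto
  next
    case (Suc k)
    obtain C R where 1: "R \<ge> 1" "\<And>\<mu>. \<mu> \<in> S \<Longrightarrow> R \<le> cmod \<mu> \<Longrightarrow>
       cmod (g \<mu> - (\<Sum>m\<le>k. fps_nth F m / \<mu> ^ m)) \<le> C / cmod \<mu> ^ (k + 1)"
      using asymp_expD[OF assms(1), of k] by metis
    have "cmod (g \<mu> / \<mu> - (\<Sum>m\<le>n. fps_nth (fps_X * F) m / \<mu> ^ m)) \<le> C / cmod \<mu> ^ (n + 1)"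
      if "\<mu> \<in> S" "R \<le> cmod \<mu>" for \<mu>
    proof -
      have "(\<Sum>m\<le>n. fps_nth (fps_X * F) m / \<mu> ^ m) = (\<Sum>m\<le>k. fps_nth F m / \<mu> ^ m) / \<mu>"
        unfolding Suc sum.atMost_Suc_shift by (simp add: sum_divide_distrib mult.commute)
      then have "g \<mu> / \<mu> - (\<Sum>m\<le>n. fps_nth (fps_X * F) m / \<mu> ^ m) = (g \<mu> - (\<Sum>m\<le>k. fps_nth F m / \<mu> ^ m)) / \<mu>"
        by (simp add: diff_divide_distrib)
      also have "cmod \<dots> \<le> C / cmod \<mu> ^ (k + 1) / cmod \<mu>"
        unfolding norm_divide using 1(2)[OF that] by (rule divide_right_mono) simp
      finally show ?thesis by (simp add: Suc mult.commute)
    qed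
    then show ?thesis by blast
  qed
qed

lemma asymp_exp_divide_power:
  assumes "asymp_exp S g F"
  shows "asymp_exp S (\<lambda>\<mu>. g \<mu> / \<mu> ^ d) (fps_X ^ d * F)"
proof (induction d)
  case (Suc d)
  from asymp_exp_divide[OF this] show ?case by (simp add: mult_ac)
qed (use assms in simp)

lemma asymp_exp_tendsto:
  assumes "asymp_exp S g F" "e > 0"
  obtains R where "\<And>\<mu>. \<mu> \<in> S \<Longrightarrow> R \<le> cmod \<mu> \<Longrightarrow> cmod (g \<mu> - fps_nth F 0) < e"
proof -
  obtain C R where 1: "R \<ge> 1" "C \<ge> 0" "\<And>\<mu>. \<mu> \<in> S \<Longrightarrow> R \<le> cmod \<mu> \<Longrightarrow>
     cmod (g \<mu> - (\<Sum>m\<le>0. fps_nth F m / \<mu> ^ m)) \<le> C / cmod \<mu> ^ (0 + 1)"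
    using asymp_expD[OF assms(1), of 0] by metis
  show ?thesis
  proof (rule that[of "max R (C / e + 1)"])
    fix \<mu> assume \<mu>: "\<mu> \<in> S" "max R (C / e + 1) \<le> cmod \<mu>"
    then have "cmod (g \<mu> - fps_nth F 0) \<le> C / cmod \<mu>" using 1(3)[of \<mu>] by simp
    moreover have "0 < cmod \<mu>" "C / e < cmod \<mu>" using \<mu> 1 assms(2) by auto
    then have "C / cmod \<mu> < e" using assms(2) by (simp add: field_simps)
    ultimately show "cmod (g \<mu> - fps_nth F 0) < e" by simp
  qed
qed

text \<open>For an expansion of the zero function, the first nonzero coefficient times
  \<open>cmod \<mu>\<close> would stay bounded while \<open>\<mu>\<close> is unbounded. A ray is
  therefore enough to determine the series.\<close>

lemma asymp_exp_unique:
  assumes "asymp_exp S g F" "asymp_exp S g G" and unb: "\<And>R. \<exists>\<mu>\<in>S. R \<le> cmod \<mu>"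
  shows "F = G"
proof (rule fps_ext)
  have "asymp_exp S (\<lambda>\<mu>. g \<mu> - g \<mu>) (F - G)" by (rule asymp_exp_diff[OF assms(1,2)])
  then have Z: "asymp_exp S (\<lambda>\<mu>. 0) (F - G)" by simp
  fix n
  have "fps_nth (F - G) n = 0"
  proof (induction n rule: less_induct)
    case (less n)
    obtain C R where 1: "R \<ge> 1" "C \<ge> 0" "\<And>\<mu>. \<mu> \<in> S \<Longrightarrow> R \<le> cmod \<mu> \<Longrightarrow>
       cmod (0 - (\<Sum>m\<le>n. fps_nth (F - G) m / \<mu> ^ m)) \<le> C / cmod \<mu> ^ (n + 1)"
      using asymp_expD[OF Z, of n] by metis
    have le: "cmod (fps_nth (F - G) n) * cmod \<mu> \<le> C" if "\<mu> \<in> S" "R \<le> cmod \<mu>" for \<mu>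
    proof -
      have p: "0 < cmod \<mu>" using that 1(1) by linarith
      have "(\<Sum>m\<le>n. fps_nth (F - G) m / \<mu> ^ m) = fps_nth (F - G) n / \<mu> ^ n"
        using less by (subst sum.remove[of _ n]) (auto intro!: sum.neutral)
      then have "cmod (fps_nth (F - G) n) / cmod \<mu> ^ n \<le> C / cmod \<mu> ^ (n + 1)"
        using 1(3)[OF that] by (simp add: norm_divide norm_power norm_minus_commute)
      then show ?thesis using p by (simp add: field_simps)
    qed
    show ?case
    proof (rule ccontr)
      assume nz: "fps_nth (F - G) n \<noteq> 0"
      obtain \<mu> where \<mu>: "\<mu> \<in> S" "max R (C / cmod (fps_nth (F - G) n) + 1) \<le> cmod \<mu>"
        using unb by blast
      then have "C / cmod (fps_nth (F - G) n) < cmod \<mu>" by linarith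
      then have "C < cmod (fps_nth (F - G) n) * cmod \<mu>" using nz by (simp add: field_simps)
      then show False using le[of \<mu>] \<mu> by auto
    qed
  qed
  then show "fps_nth F n = fps_nth G n" by simp
qed

text \<open>Expansions may be differentiated where discs of radius proportional to
  \<open>cmod \<mu>\<close> fit into the domain: Cauchy's inequality then improves the remainder by
  one power of \<open>1 / \<mu>\<close>, just as differentiation improves the terms of the
  series.\<close>

lemma asymp_exp_deriv:
  assumes "asymp_exp S g F" "\<And>\<mu>. \<mu> \<in> Q \<Longrightarrow> ball \<mu> (cmod \<mu>) \<subseteq> S" "g holomorphic_on S"
  shows "asymp_exp Q (deriv g) (- (fps_X\<^sup>2 * fps_deriv F))"
proof (rule asymp_expI)
  fix n
  let ?G = "- (fps_X\<^sup>2 * fps_deriv F)"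
  obtain C R where 1: "R \<ge> 1" "C \<ge> 0" "\<And>\<mu>. \<mu> \<in> S \<Longrightarrow> R \<le> cmod \<mu> \<Longrightarrow>
     cmod (g \<mu> - (\<Sum>m\<le>n. fps_nth F m / \<mu> ^ m)) \<le> C / cmod \<mu> ^ (n + 1)"
    using asymp_expD[OF assms(1), of n] by metis
  have nth: "fps_nth ?G (Suc m) = - of_nat m * fps_nth F m" for m
  proof (cases m)
    case (Suc k)
    then have "fps_nth ?G (Suc m) = - ((1 + of_nat k) * fps_nth F (Suc k))"
      by (simp add: fps_X_power_mult_nth fps_deriv_nth)
    then show ?thesis using Suc by (simp add: algebra_simps)
  qed (simp add: fps_X_power_mult_nth)
  have G0: "fps_nth ?G 0 = 0" by (simp add: fps_X_power_mult_nth)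
  have bd: "cmod (deriv g \<mu> - (\<Sum>m\<le>Suc n. fps_nth ?G m / \<mu> ^ m)) \<le> (C * 2 ^ (n + 2)) / cmod \<mu> ^ (n + 2)"
    if \<mu>: "\<mu> \<in> Q" "2 * R \<le> cmod \<mu>" for \<mu>
  proof -
    define r where "r = cmod \<mu> / 2"
    have m2: "cmod \<mu> \<ge> 2" using \<mu> 1(1) by linarith
    then have r: "r > 0" unfolding r_def by linarith
    define D where "D w = g w - (\<Sum>m\<le>n. fps_nth F m / w ^ m)" for w
    have cb: "w \<in> S" "w \<noteq> 0" "r \<le> cmod w" if "w \<in> cball \<mu> r" for w
    proof -
      have "dist \<mu> w \<le> cmod \<mu> / 2" using that by (simp add: r_def)
      then have "w \<in> ball \<mu> (cmod \<mu>)" using m2 unfolding mem_ball by linarith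
      then show "w \<in> S" using assms(2)[OF \<mu>(1)] by blast
      have "cmod \<mu> - cmod w \<le> cmod (\<mu> - w)" by (rule norm_triangle_ineq2)
      then show "r \<le> cmod w" using that by (auto simp: r_def dist_norm)
      then show "w \<noteq> 0" using r by auto
    qed
    have "S \<supseteq> cball \<mu> r" using cb by blast
    then have "D holomorphic_on cball \<mu> r"
      unfolding D_def using cb by (intro holomorphic_intros holomorphic_on_subset[OF assms(3)]) auto
    then have hol: "D holomorphic_on ball \<mu> r" "continuous_on (cball \<mu> r) D"
      using holomorphic_on_subset ball_subset_cball holomorphic_on_imp_continuous_on by blast+
    have "cmod ((deriv ^^ 1) D \<mu>) \<le> fact 1 * (C / r ^ (n + 1)) / r ^ 1"
    proof (rule Cauchy_inequality[OF hol r])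
      fix w assume "cmod (\<mu> - w) = r"
      then have w: "w \<in> cball \<mu> r" by (simp add: dist_norm)
      have "cmod (D w) \<le> C / cmod w ^ (n + 1)"
        unfolding D_def using cb[OF w] \<mu> by (intro 1(3)) (auto simp: r_def)
      also have "\<dots> \<le> C / r ^ (n + 1)"
        using cb[OF w] r 1(2) by (intro divide_left_mono power_mono mult_pos_pos zero_less_power) auto
      finally show "cmod (D w) \<le> C / r ^ (n + 1)" .
    qed
    then have "cmod (deriv D \<mu>) \<le> C / r ^ (n + 2)" by (simp add: mult_ac)
    also have "C / r ^ (n + 2) = (C * 2 ^ (n + 2)) / cmod \<mu> ^ (n + 2)"
      by (simp add: r_def power_divide)
    finally have dD: "cmod (deriv D \<mu>) \<le> (C * 2 ^ (n + 2)) / cmod \<mu> ^ (n + 2)" .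
    have \<mu>0: "\<mu> \<noteq> 0" using r by (auto simp: r_def)
    have "g holomorphic_on ball \<mu> r"
      using assms(3) \<open>cball \<mu> r \<subseteq> S\<close> ball_subset_cball holomorphic_on_subset by blast
    then have dg: "(g has_field_derivative deriv g \<mu>) (at \<mu>)"
      using r by (intro holomorphic_derivI[of _ "ball \<mu> r"]) auto
    have dm: "((\<lambda>w. fps_nth F m / w ^ m) has_field_derivative fps_nth ?G (Suc m) / \<mu> ^ Suc m) (at \<mu>)" for m
    proof (cases m)
      case (Suc k)
      have "((\<lambda>w. fps_nth F m / w ^ m) has_field_derivative
          - (fps_nth F m * (of_nat m * \<mu> ^ (m - 1))) / (\<mu> ^ m * \<mu> ^ m)) (at \<mu>)"
        using \<mu>0 by (auto intro!: derivative_eq_intros)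
      also have "- (fps_nth F m * (of_nat m * \<mu> ^ (m - 1))) / (\<mu> ^ m * \<mu> ^ m) = fps_nth ?G (Suc m) / \<mu> ^ Suc m"
        unfolding nth using \<mu>0 Suc by (simp add: field_simps)
      finally show ?thesis .
    qed (simp add: nth)
    have "(D has_field_derivative deriv g \<mu> - (\<Sum>m\<le>n. fps_nth ?G (Suc m) / \<mu> ^ Suc m)) (at \<mu>)"
      unfolding D_def by (intro DERIV_diff DERIV_sum dg dm)
    then have "deriv D \<mu> = deriv g \<mu> - (\<Sum>m\<le>n. fps_nth ?G (Suc m) / \<mu> ^ Suc m)"
      by (rule DERIV_imp_deriv)
    also have "(\<Sum>m\<le>n. fps_nth ?G (Suc m) / \<mu> ^ Suc m) = (\<Sum>m\<le>Suc n. fps_nth ?G m / \<mu> ^ m)"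
      unfolding sum.atMost_Suc_shift G0 by simp
    finally show ?thesis using dD by simp
  qed
  \<comment> \<open>The estimate \<open>bd\<close> has one term more than required; that term is
    moved into the error.\<close>
  define C' where "C' = C * 2 ^ (n + 2) + cmod (fps_nth ?G (Suc n))"
  have "cmod (deriv g \<mu> - (\<Sum>m\<le>n. fps_nth ?G m / \<mu> ^ m)) \<le> C' / cmod \<mu> ^ (n + 1)"
    if \<mu>: "\<mu> \<in> Q" "2 * R \<le> cmod \<mu>" for \<mu>
  proof -
    have m1: "1 \<le> cmod \<mu>" using \<mu> 1 by linarith
    have "deriv g \<mu> - (\<Sum>m\<le>n. fps_nth ?G m / \<mu> ^ m) =
        (deriv g \<mu> - (\<Sum>m\<le>Suc n. fps_nth ?G m / \<mu> ^ m)) + fps_nth ?G (Suc n) / \<mu> ^ Suc n"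
      unfolding sum.atMost_Suc by (simp only: algebra_simps)
    also have "cmod \<dots> \<le> (C * 2 ^ (n + 2)) / cmod \<mu> ^ (n + 2) + cmod (fps_nth ?G (Suc n)) / cmod \<mu> ^ (n + 1)"
      using bd[OF \<mu>] by (intro norm_triangle_le add_mono) (auto simp: norm_divide norm_power norm_mult)
    also have "(C * 2 ^ (n + 2)) / cmod \<mu> ^ (n + 2) \<le> (C * 2 ^ (n + 2)) / cmod \<mu> ^ (n + 1)"
      using m1 1(2) by (intro divide_left_mono power_increasing mult_pos_pos zero_less_power) auto
    finally show ?thesis by (simp add: C'_def add_divide_distrib)
  qed
  then show "\<exists>C R. \<forall>\<mu>\<in>Q. R \<le> cmod \<mu> \<longrightarrow>
     cmod (deriv g \<mu> - (\<Sum>m\<le>n. fps_nth ?G m / \<mu> ^ m)) \<le> C / cmod \<mu> ^ (n + 1)"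
    by blast
qed

section \<open>Finite linear systems and uniqueness for linear differential equations\<close>

lemma finite_linear_solvable:
  fixes P :: "'a \<Rightarrow> 'b \<Rightarrow> complex"
  assumes "finite B" "finite A" "card A = card B"
    and "\<And>c. (\<forall>x\<in>A. (\<Sum>y\<in>B. P x y * c y) = 0) \<Longrightarrow> \<forall>y\<in>B. c y = 0"
  shows "\<exists>c. \<forall>x\<in>A. (\<Sum>y\<in>B. P x y * c y) = b x"
  using assms
proof (induction B arbitrary: A P b rule: finite_induct)
  case empty
  then show ?case by simp
next
  case (insert y0 B)
  \<comment> \<open>A pivot for Gaussian elimination. If the column of \<open>y0\<close> vanished,
    the unit vector at \<open>y0\<close> would contradict injectivity.\<close>
  obtain x0 where x0: "x0 \<in> A" "P x0 y0 \<noteq> 0"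
  proof (rule ccontr)
    assume "\<not> thesis"
    then have "P x y0 = 0" if "x \<in> A" for x using that \<open>\<And>x0. x0 \<in> A \<Longrightarrow> P x0 y0 \<noteq> 0 \<Longrightarrow> thesis\<close> by blast
    then have "\<forall>x\<in>A. (\<Sum>y\<in>insert y0 B. P x y * (if y = y0 then 1 else 0)) = 0"
      using insert.hyps by (auto intro!: sum.neutral)
    from insert.prems(3)[OF this] show False by simp
  qed
  \<comment> \<open>\<open>P'\<close> is the Schur complement of the pivot. \<open>ext c r\<close>
    extends \<open>c\<close> by the value at \<open>y0\<close> that solves the equation
    \<open>x0\<close> with right-hand side \<open>r\<close>.\<close>
  define P' where "P' x y = P x y - P x y0 * P x0 y / P x0 y0" for x y
  define ext where "ext c r y = (if y = y0 then (r - (\<Sum>y\<in>B. P x0 y * c y)) / P x0 y0 else c y)" for c r y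
  have ext0: "(\<Sum>y\<in>insert y0 B. P x y * ext c r y) = P x y0 * r / P x0 y0 + (\<Sum>y\<in>B. P' x y * c y)" for x c r
  proof -
    have "(\<Sum>y\<in>insert y0 B. P x y * ext c r y) = P x y0 * ((r - (\<Sum>y\<in>B. P x0 y * c y)) / P x0 y0) + (\<Sum>y\<in>B. P x y * c y)"
      using insert.hyps by (auto simp: ext_def intro!: sum.cong)
    also have "\<dots> = P x y0 * r / P x0 y0 + ((\<Sum>y\<in>B. P x y * c y) - P x y0 / P x0 y0 * (\<Sum>y\<in>B. P x0 y * c y))"
      by (simp add: algebra_simps diff_divide_distrib)
    also have "(\<Sum>y\<in>B. P x y * c y) - P x y0 / P x0 y0 * (\<Sum>y\<in>B. P x0 y * c y) = (\<Sum>y\<in>B. P' x y * c y)"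
      by (simp add: P'_def sum_distrib_left sum_subtractf[symmetric] algebra_simps)
    finally show ?thesis .
  qed
  have P'0: "P' x0 y = 0" for y using x0 by (simp add: P'_def)
  have "\<exists>c. \<forall>x\<in>A - {x0}. (\<Sum>y\<in>B. P' x y * c y) = b x - P x y0 * b x0 / P x0 y0"
  proof (rule insert.IH)
    show "finite (A - {x0})" "card (A - {x0}) = card B"
      using insert.prems insert.hyps x0 by auto
    fix c assume c: "\<forall>x\<in>A - {x0}. (\<Sum>y\<in>B. P' x y * c y) = 0"
    have "\<forall>x\<in>A. (\<Sum>y\<in>insert y0 B. P x y * ext c 0 y) = 0"
      using c P'0 unfolding ext0 by (metis (no_types, lifting) DiffI add_0 div_0 mult_zero_left mult_zero_right singletonD sum.neutral)
    from insert.prems(3)[OF this] show "\<forall>y\<in>B. c y = 0"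
      using insert.hyps unfolding ext_def by (metis insertCI)
  qed
  then obtain c where c: "\<forall>x\<in>A - {x0}. (\<Sum>y\<in>B. P' x y * c y) = b x - P x y0 * b x0 / P x0 y0" by blast
  have "(\<Sum>y\<in>insert y0 B. P x y * ext c (b x0) y) = b x" if "x \<in> A" for x
  proof (cases "x = x0")
    case True
    then show ?thesis unfolding ext0 using P'0 x0 by simp
  next
    case False
    then show ?thesis unfolding ext0 using c that by simp
  qed
  then show ?case by blast
qed

text \<open>Injectivity gives solvability and so a right inverse \<open>Q\<close>. Since
  \<open>P\<close> annihilates \<open>Q P - 1\<close>, injectivity makes \<open>Q\<close> a left
  inverse as well.\<close>

lemma invertible_matrixI:
  assumes "finite V" "\<And>c. (\<forall>x\<in>V. (\<Sum>y\<in>V. P x y * c y) = 0) \<Longrightarrow> \<forall>y\<in>V. c y = 0"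
  shows "invertible_matrix V P"
proof -
  have "\<exists>c. \<forall>x\<in>V. (\<Sum>y\<in>V. P x y * c y) = (if x = z then 1 else 0)" for z
    by (rule finite_linear_solvable[OF assms(1,1) refl]) (use assms(2) in blast)
  then obtain Q' where Q': "\<And>z x. x \<in> V \<Longrightarrow> (\<Sum>y\<in>V. P x y * Q' z y) = (if x = z then 1 else 0)"
    by metis
  define Q where "Q y z = Q' z y" for y z
  have PQ: "(\<Sum>z\<in>V. P x z * Q z y) = (if x = y then 1 else 0)" if "x \<in> V" for x y
    using Q'[OF that] by (simp add: Q_def)
  have "(\<Sum>z\<in>V. Q x z * P z y) = (if x = y then 1 else 0)" if "x \<in> V" "y \<in> V" for x y
  proof -
    define c where "c u = (\<Sum>z\<in>V. Q u z * P z y) - (if u = y then 1 else 0)" for u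
    have "(\<Sum>u\<in>V. P v u * c u) = 0" if "v \<in> V" for v
    proof -
      have "(\<Sum>u\<in>V. P v u * c u) = (\<Sum>u\<in>V. \<Sum>z\<in>V. P v u * Q u z * P z y) - P v y"
        using \<open>y \<in> V\<close> assms(1)
        by (simp add: c_def right_diff_distrib sum_subtractf sum_distrib_left mult.assoc if_distrib[of "\<lambda>x. _ * x"] cong: if_cong)
      also have "(\<Sum>u\<in>V. \<Sum>z\<in>V. P v u * Q u z * P z y) = (\<Sum>z\<in>V. (\<Sum>u\<in>V. P v u * Q u z) * P z y)"
        by (subst sum.swap) (simp add: sum_distrib_right)
      also have "\<dots> = (\<Sum>z\<in>V. (if v = z then P z y else 0))"
        by (intro sum.cong refl) (simp add: PQ[OF that])
      also have "\<dots> = P v y" using that assms(1) by simp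
      finally show ?thesis by simp
    qed
    then have "c x = 0" using assms(2)[of c] \<open>x \<in> V\<close> by blast
    then show ?thesis by (simp add: c_def)
  qed
  then show ?thesis unfolding invertible_matrix_def using PQ by blast
qed

lemma higher_deriv_sum:
  assumes "finite I" "\<And>i. i \<in> I \<Longrightarrow> f i holomorphic_on S" "open S" "z \<in> S"
  shows "(deriv ^^ n) (\<lambda>w. \<Sum>i\<in>I. f i w) z = (\<Sum>i\<in>I. (deriv ^^ n) (f i) z)"
  using assms
proof (induction I rule: finite_induct)
  case (insert i I)
  then show ?case
    by (simp add: higher_deriv_add[OF _ _ assms(3)] holomorphic_on_sum)
qed simp

text \<open>By Leibniz's rule and induction, all derivatives of the solution vanish at
  \<open>\<mu>0\<close>; the identity theorem does the rest.\<close>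

lemma linear_ode_zero:
  assumes "finite V" "open S" "connected S" "\<mu>0 \<in> S"
    and M: "\<And>x y. x \<in> V \<Longrightarrow> y \<in> V \<Longrightarrow> (\<lambda>\<mu>. M \<mu> x y) holomorphic_on S"
    and u: "\<And>\<mu> x. \<mu> \<in> S \<Longrightarrow> x \<in> V \<Longrightarrow> ((\<lambda>\<mu>. u \<mu> x) has_field_derivative (\<Sum>y\<in>V. M \<mu> x y * u \<mu> y)) (at \<mu>)"
    and 0: "\<And>x. x \<in> V \<Longrightarrow> u \<mu>0 x = (0 :: complex)"
    and "\<mu> \<in> S" "x \<in> V"
  shows "u \<mu> x = 0"
proof -
  have hol: "(\<lambda>\<mu>. u \<mu> x) holomorphic_on S" if "x \<in> V" for x
    using u[OF _ that] \<open>open S\<close> by (auto simp: holomorphic_on_open)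
  have z: "(deriv ^^ n) (\<lambda>\<mu>. u \<mu> x) \<mu>0 = 0" if "x \<in> V" for n x
    using that
  proof (induction n arbitrary: x rule: less_induct)
    case (less n)
    show ?case
    proof (cases n)
      case (Suc k)
      have "(deriv ^^ n) (\<lambda>\<mu>. u \<mu> x) \<mu>0 = (deriv ^^ k) (deriv (\<lambda>\<mu>. u \<mu> x)) \<mu>0"
        by (simp only: Suc funpow_Suc_right o_apply)
      also have "\<dots> = (deriv ^^ k) (\<lambda>\<mu>. \<Sum>y\<in>V. M \<mu> x y * u \<mu> y) \<mu>0"
        using \<open>open S\<close> \<open>\<mu>0 \<in> S\<close> DERIV_imp_deriv[OF u[OF _ less.prems]]
        by (intro higher_deriv_transform_within_open[where S = S])
           (auto intro!: holomorphic_intros holomorphic_deriv hol less.prems M)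
      also have "\<dots> = (\<Sum>y\<in>V. (deriv ^^ k) (\<lambda>\<mu>. M \<mu> x y * u \<mu> y) \<mu>0)"
        using assms(1,2,4) hol M less.prems by (intro higher_deriv_sum[where S = S]) (auto intro!: holomorphic_intros)
      also have "\<dots> = 0"
      proof (rule sum.neutral, rule ballI)
        fix y assume y: "y \<in> V"
        have "(deriv ^^ k) (\<lambda>\<mu>. M \<mu> x y * u \<mu> y) \<mu>0 =
          (\<Sum>i = 0..k. of_nat (k choose i) * (deriv ^^ i) (\<lambda>\<mu>. M \<mu> x y) \<mu>0 * (deriv ^^ (k - i)) (\<lambda>\<mu>. u \<mu> y) \<mu>0)"
          by (rule higher_deriv_mult[OF M[OF less.prems y] hol[OF y] assms(2,4)])
        also have "\<dots> = 0"
          using less.IH[OF _ y] Suc by (intro sum.neutral) auto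
        finally show "(deriv ^^ k) (\<lambda>\<mu>. M \<mu> x y * u \<mu> y) \<mu>0 = 0" .
      qed
      finally show ?thesis .
    qed (use 0 less.prems in simp)
  qed
  show ?thesis
    by (rule holomorphic_fun_eq_0_on_connected[OF hol[OF \<open>x \<in> V\<close>] assms(2,3) z[OF \<open>x \<in> V\<close>] assms(4) \<open>\<mu> \<in> S\<close>])
qed

section \<open>Linear substitutions\<close>

text \<open>Only the existence of a factor is claimed, which is stable under composition and can be
  checked on elementary maps: singular maps give 0, and transpositions and shears preserve the
  measure of boxes. The value of the factor is immaterial, as it is common to all components of a
  solution.\<close>

lemma linear_image_measure:
  fixes f :: "real^'n \<Rightarrow> real^'n"
  assumes "linear f"
  shows "\<exists>m. \<forall>S\<in>lmeasurable. f ` S \<in> lmeasurable \<and> measure lebesgue (f ` S) = m * measure lebesgue S"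
proof (rule induct_linear_elementary[OF assms])
  fix f g :: "real^'n \<Rightarrow> real^'n"
  assume "\<exists>m. \<forall>S\<in>lmeasurable. f ` S \<in> lmeasurable \<and> measure lebesgue (f ` S) = m * measure lebesgue S"
    and "\<exists>m. \<forall>S\<in>lmeasurable. g ` S \<in> lmeasurable \<and> measure lebesgue (g ` S) = m * measure lebesgue S"
  then obtain m m' where "\<forall>S\<in>lmeasurable. f ` S \<in> lmeasurable \<and> measure lebesgue (f ` S) = m * measure lebesgue S"
    "\<forall>S\<in>lmeasurable. g ` S \<in> lmeasurable \<and> measure lebesgue (g ` S) = m' * measure lebesgue S" by blast
  then show "\<exists>m. \<forall>S\<in>lmeasurable. (f \<circ> g) ` S \<in> lmeasurable \<and> measure lebesgue ((f \<circ> g) ` S) = m * measure lebesgue S"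
    unfolding image_comp[symmetric] by (intro exI[of _ "m * m'"]) simp
next
  fix f :: "real^'n \<Rightarrow> real^'n" and i
  assume f: "linear f" "\<And>x. f x $ i = 0"
  have "\<not> inj f"
  proof
    assume "inj f"
    then have "surj f" by (rule linear_injective_imp_surjective[OF f(1)]) (rule refl)
    then obtain x where "axis i 1 = f x" by (rule surjE)
    then show False using f(2)[of x] by (metis axis_nth zero_neq_one)
  qed
  then have n: "negligible (f ` S)" for S using negligible_linear_singular_image[OF f(1)] by blast
  show "\<exists>m. \<forall>S\<in>lmeasurable. f ` S \<in> lmeasurable \<and> measure lebesgue (f ` S) = m * measure lebesgue S"
    using negligible_imp_measurable[OF n] negligible_imp_measure0[OF n] by (intro exI[of _ 0]) simp
next
  fix c :: "'n \<Rightarrow> real"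
  show "\<exists>m. \<forall>S\<in>lmeasurable. (\<lambda>x. \<chi> i. c i * x $ i) ` S \<in> lmeasurable \<and>
      measure lebesgue ((\<lambda>x. \<chi> i. c i * x $ i) ` S) = m * measure lebesgue S"
    using measurable_stretch measure_stretch by blast
next
  fix m n :: 'n assume "m \<noteq> n"
  let ?h = "\<lambda>v :: real^'n. \<chi> i. v $ Transposition.transpose m n i"
  have linear_l: "linear ?h" by (intro linearI) (simp_all add: vec_eq_iff)
  have "measure lebesgue (?h ` cbox a b) = 1 * measure lebesgue (cbox a b)" for a b
  proof (cases "cbox a b = {}")
    case False
    have im: "?h ` cbox a b = cbox (?h a) (?h b)"
    proof (intro set_eqI iffI)
      fix x assume x: "x \<in> cbox (?h a) (?h b)"
      have "?h x \<in> cbox a b"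
        unfolding mem_box_cart
      proof
        fix i
        from x have "?h a $ Transposition.transpose m n i \<le> x $ Transposition.transpose m n i"
          "x $ Transposition.transpose m n i \<le> ?h b $ Transposition.transpose m n i"
          unfolding mem_box_cart by blast+
        then show "a $ i \<le> ?h x $ i \<and> ?h x $ i \<le> b $ i" by simp
      qed
      moreover have "?h (?h x) = x" by (simp add: vec_eq_iff)
      ultimately show "x \<in> ?h ` cbox a b" by (metis imageI)
    qed (auto simp: mem_box_cart)
    then have ne: "cbox (?h a) (?h b) \<noteq> {}" using False by (metis image_is_empty)
    have "(\<Prod>i\<in>UNIV. b $ Transposition.transpose m n i - a $ Transposition.transpose m n i) = (\<Prod>i\<in>UNIV. b $ i - a $ i)"
      by (rule prod.reindex_bij_betw[OF bij_transpose, of "\<lambda>i. b $ i - a $ i"])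
    then show ?thesis
      unfolding im by (simp add: content_cbox_cart[OF False] content_cbox_cart[OF ne])
  qed simp
  note meq = this
  show "\<exists>m. \<forall>S\<in>lmeasurable. ?h ` S \<in> lmeasurable \<and> measure lebesgue (?h ` S) = m * measure lebesgue S"
  proof (intro exI[of _ 1] ballI)
    fix S :: "(real^'n) set" assume "S \<in> lmeasurable"
    from measure_linear_sufficient[OF linear_l this meq]
    show "?h ` S \<in> lmeasurable \<and> measure lebesgue (?h ` S) = 1 * measure lebesgue S" by simp
  qed
next
  fix m n :: 'n assume mn: "m \<noteq> n"
  let ?h = "\<lambda>x :: real^'n. \<chi> i. if i = m then x $ m + x $ n else x $ i"
  have linear_l: "linear ?h" by (intro linearI) (simp_all add: vec_eq_iff algebra_simps)
  have "measure lebesgue (?h ` cbox a b) = 1 * measure lebesgue (cbox a b)" for a b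
  proof (cases "cbox a b = {}")
    case False
    \<comment> \<open>The measure of a sheared box is computed for a box whose lower corner has
      nonnegative coordinate \<open>n\<close>. The translation by \<open>w\<close> makes that
      coordinate 0, and a shear carries translates to translates.\<close>
    define w where "w = (\<chi> i. if i = n then - a $ n else 0)"
    have ne: "cbox (w + a) (w + b) \<noteq> {}"
      using False cbox_translation[of w a b] by (metis image_is_empty)
    have "?h ` cbox (w + a) (w + b) = (+) (?h w) ` (?h ` cbox a b)"
      unfolding cbox_translation image_image using linear_add[OF linear_l, of w] by simp
    then have "measure lebesgue (?h ` cbox a b) = measure lebesgue (?h ` cbox (w + a) (w + b))"
      by (simp only: measure_translation)
    also have "\<dots> = measure lebesgue (cbox (w + a) (w + b))"
      by (rule measure_shear_interval[OF mn ne]) (simp add: w_def)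
    also have "\<dots> = measure lebesgue (cbox a b)"
      by (simp only: cbox_translation measure_translation)
    finally show ?thesis by simp
  qed simp
  note meq = this
  show "\<exists>m. \<forall>S\<in>lmeasurable. ?h ` S \<in> lmeasurable \<and> measure lebesgue (?h ` S) = m * measure lebesgue S"
  proof (intro exI[of _ 1] ballI)
    fix S :: "(real^'n) set" assume "S \<in> lmeasurable"
    from measure_linear_sufficient[OF linear_l this meq]
    show "?h ` S \<in> lmeasurable \<and> measure lebesgue (?h ` S) = 1 * measure lebesgue S" by simp
  qed
qed

text \<open>A preimage under \<open>T\<close> is an image under the inverse \<open>T'\<close>, which
  scales measure by \<open>c\<close>. The push-forward divided by \<open>c\<close> agrees with
  Lebesgue measure on boxes, hence on all Borel sets.\<close>

lemma emeasure_lborel_affine_vimage: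
  fixes T :: "real^'k \<Rightarrow> real^'k"
  assumes T: "linear T" "inj T"
  obtains c where "c > 0"
    "\<And>S. S \<in> sets borel \<Longrightarrow> emeasure lborel ((\<lambda>x. x0 + T x) -` S) = ennreal c * emeasure lborel S"
proof -
  obtain T' where T': "linear T'" "\<And>x. T' (T x) = x" "\<And>x. T (T' x) = x"
    using linear_injective_isomorphism[OF T] by metis
  obtain c where im: "\<And>S. S \<in> lmeasurable \<Longrightarrow> T' ` S \<in> lmeasurable"
    "\<And>S. S \<in> lmeasurable \<Longrightarrow> measure lebesgue (T' ` S) = c * measure lebesgue S"
    using linear_image_measure[OF T'(1)] by metis
  obtain d where "\<And>S. S \<in> lmeasurable \<Longrightarrow> measure lebesgue (T ` S) = d * measure lebesgue S"
    using linear_image_measure[OF T(1)] by metis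
  \<comment> \<open>The unit cube is mapped by \<open>T'\<close> and back by \<open>T\<close>, so
    the two factors are inverse to each other; in particular \<open>c\<close> is not 0.\<close>
  from this[of "T' ` cbox 0 One"] im(2)[of "cbox 0 One"] im(1)[of "cbox 0 One"]
  have "d * c = 1" using T'(3) by (simp add: image_image)
  moreover have "0 \<le> c" using im(2)[of "cbox 0 One"] by (simp add: measure_nonneg) (metis measure_nonneg)
  ultimately have c: "c > 0" by (metis less_eq_real_def mult_zero_right zero_neq_one)
  have Tm: "(\<lambda>x. x0 + T x) \<in> borel_measurable borel"
    using linear_continuous_on[OF linear_conv_bounded_linear[THEN iffD1, OF T(1)], of UNIV]
    by (intro borel_measurable_continuous_onI continuous_intros) auto
  define M where "M = density (distr lborel borel (\<lambda>x. x0 + T x)) (\<lambda>_. ennreal (1 / c))"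
  have "lborel = M"
  proof (rule lborel_eqI)
    fix l u :: "real^'k" assume lu: "\<And>b. b \<in> Basis \<Longrightarrow> l \<bullet> b \<le> u \<bullet> b"
    have v: "(\<lambda>x. x0 + T x) -` box l u = T' ` ((+) (- x0) ` box l u)"
    proof (intro set_eqI iffI)
      fix x assume "x \<in> (\<lambda>x. x0 + T x) -` box l u"
      then show "x \<in> T' ` ((+) (- x0) ` box l u)"
        using T'(2)[of x] by (intro image_eqI[of _ _ "T x"] image_eqI[of _ _ "x0 + T x"]) auto
    qed (use T'(3) in auto)
    have lm: "(+) (- x0) ` box l u \<in> lmeasurable" by (intro measurable_translation) simp
    have m: "T' ` ((+) (- x0) ` box l u) \<in> lmeasurable"
      "measure lebesgue (T' ` ((+) (- x0) ` box l u)) = c * measure lebesgue (box l u)"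
      using im[OF lm] by (simp_all only: measure_translation)
    have b: "(\<lambda>x. x0 + T x) -` box l u \<in> sets borel"
      by (rule measurable_sets_borel[OF Tm]) simp
    have "emeasure lborel ((\<lambda>x. x0 + T x) -` box l u) = emeasure lebesgue ((\<lambda>x. x0 + T x) -` box l u)"
      using b by simp
    also have "\<dots> = ennreal (c * measure lebesgue (box l u))"
      using m unfolding v by (simp add: emeasure_eq_measure2)
    finally have e: "emeasure lborel ((\<lambda>x. x0 + T x) -` box l u) = ennreal c * ennreal (\<Prod>b\<in>Basis. (u - l) \<bullet> b)"
      using lu c by (simp add: ennreal_mult'' ennreal_mult' measure_completion)
    have "emeasure M (box l u) = ennreal (1 / c) * emeasure lborel ((\<lambda>x. x0 + T x) -` box l u)"
      unfolding M_def using Tm by (simp add: emeasure_density_const emeasure_distr)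
    also have "\<dots> = ennreal (\<Prod>b\<in>Basis. (u - l) \<bullet> b)"
      unfolding e using c by (simp add: mult.assoc[symmetric] ennreal_mult'[symmetric])
    finally show "emeasure M (box l u) = (\<Prod>b\<in>Basis. (u - l) \<bullet> b)" .
  qed (simp add: M_def)
  show ?thesis
  proof (rule that[OF c])
    fix S :: "(real^'k) set" assume S: "S \<in> sets borel"
    have "emeasure lborel S = ennreal (1 / c) * emeasure lborel ((\<lambda>x. x0 + T x) -` S)"
      using S Tm by (subst \<open>lborel = M\<close>) (simp add: M_def emeasure_density_const emeasure_distr)
    then show "emeasure lborel ((\<lambda>x. x0 + T x) -` S) = ennreal c * emeasure lborel S"
      using c by (simp add: mult.assoc[symmetric] ennreal_mult'[symmetric])
  qed
qed

lemma emeasure_lborel_vec_prod: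
  fixes A :: "'k::finite \<Rightarrow> real set"
  assumes "\<And>a. A a \<in> sets borel"
  shows "emeasure lborel {y :: real^'k. \<forall>a. y $ a \<in> A a} = (\<Prod>a\<in>UNIV. emeasure lborel (A a))"
proof -
  \<comment> \<open>The sets reindexed by basis vectors, as the product formula over
    \<open>Basis\<close> requires.\<close>
  define F where "F b = A (SOME a. b = (axis a 1 :: real^'k))" for b
  have F: "F (axis a 1) = A a" for a
    unfolding F_def by (metis (mono_tags, lifting) axis_eq_axis someI_ex zero_neq_one)
  have Fm [measurable]: "F b \<in> sets borel" for b unfolding F_def by (rule assms)
  have B: "(Basis :: (real^'k) set) = range (\<lambda>a. axis a 1)"
    by (auto simp: Basis_vec_def)
  have inj: "inj (\<lambda>a. axis a 1 :: real^'k)" by (auto simp: inj_def axis_eq_axis)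
  have "{y :: real^'k. \<forall>a. y $ a \<in> A a} \<in> sets borel"
  proof -
    have "{y :: real^'k. \<forall>a. y $ a \<in> A a} = (\<Inter>a. (\<lambda>y. y $ a) -` A a)" by auto
    moreover have "(\<lambda>y :: real^'k. y $ a) -` A a \<in> sets borel" for a
      using measurable_sets[of "\<lambda>y :: real^'k. y $ a" borel borel "A a"] assms by simp
    ultimately show ?thesis by auto
  qed
  then have "emeasure lborel {y :: real^'k. \<forall>a. y $ a \<in> A a} =
      (\<integral>\<^sup>+y. indicator {y :: real^'k. \<forall>a. y $ a \<in> A a} y \<partial>lborel)"
    by simp
  also have "\<dots> = (\<integral>\<^sup>+y. (\<Prod>b\<in>Basis. indicator (F b) (y \<bullet> b)) \<partial>lborel)"
  proof (rule nn_integral_cong)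
    fix y :: "real^'k"
    have "(\<Prod>b\<in>Basis. indicator (F b) (y \<bullet> b)) = (\<Prod>a\<in>UNIV. (indicator (A a) (y $ a) :: ennreal))"
      unfolding B using inj by (subst prod.reindex) (auto simp: F inner_axis)
    also have "\<dots> = indicator {y :: real^'k. \<forall>a. y $ a \<in> A a} y"
      by (auto simp: indicator_def prod_zero_iff intro!: prod.neutral)
    finally show "indicator {y :: real^'k. \<forall>a. y $ a \<in> A a} y = (\<Prod>b\<in>Basis. indicator (F b) (y \<bullet> b) :: ennreal)" ..
  qed
  also have "\<dots> = (\<Prod>b\<in>Basis. (\<integral>\<^sup>+x. indicator (F b) x \<partial>lborel))"
    by (rule nn_integral_lborel_prod) auto
  also have "\<dots> = (\<Prod>a\<in>UNIV. emeasure lborel (A a))"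
    unfolding B using inj assms by (subst prod.reindex) (auto simp: F)
  finally show ?thesis .
qed

lemma emeasure_pos_measure: "A \<in> sets pos_measure \<Longrightarrow> emeasure pos_measure A = emeasure lborel A"
  unfolding pos_measure_def by (rule emeasure_restrict_space) (auto simp: sets_restrict_space)

lemma sets_pos_measure: "A \<in> sets pos_measure \<longleftrightarrow> A \<in> sets borel \<and> A \<subseteq> {0<..}"
  unfolding pos_measure_def by (subst sets_restrict_space_iff) auto

section \<open>Hyperplane arrangements\<close>

locale arrangement =
  fixes N :: nat and f :: "nat \<Rightarrow> real^'k \<Rightarrow> real" and \<alpha> :: "nat \<Rightarrow> real" and f0 :: "real^'k \<Rightarrow> real"
  assumes gen: "generic_arrangement N f" and \<alpha>_pos: "\<forall>j\<in>{1..N}. 0 < \<alpha> j"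
    and glf: "generic_linear_form N f f0"
begin

abbreviation l :: "nat \<Rightarrow> real^'k \<Rightarrow> real" where "l j \<equiv> lin_part (f j)"
abbreviation pt :: "nat set \<Rightarrow> real^'k" where "pt \<equiv> vertex_point f"
abbreviation edge :: "nat set \<Rightarrow> nat \<Rightarrow> real^'k" where "edge X j \<equiv> edge_vec f f0 (X - {j})"

lemma linear_l: "j \<in> {1..N} \<Longrightarrow> linear (l j)"
  using gen by (simp add: generic_arrangement_def)

lemma lin_f0: "linear f0"
  using glf by (simp add: generic_linear_form_def)

lemma f_add: "j \<in> {1..N} \<Longrightarrow> f j (x + v) = f j x + l j v"
  using linear_add[OF linear_l[of j], of x v] by (simp add: lin_part_def)

lemma vertexD: "X \<in> vertices CARD('k) N \<Longrightarrow> X \<subseteq> {1..N} \<and> card X = CARD('k) \<and> finite X \<and> X \<noteq> {}"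
  unfolding vertices_def using finite_subset[of X "{1..N}"] by (auto simp: card_0_eq)

lemma vertex_index: "X \<in> vertices CARD('k) N \<Longrightarrow> j \<in> X \<Longrightarrow> j \<in> {1..N}"
  using vertexD by blast

lemma flat_iff: "x \<in> flat f U \<longleftrightarrow> (\<forall>j\<in>U. f j x = 0)"
  by (auto simp: flat_def hyp_def)

lemma flat_V: "X \<in> vertices CARD('k) N \<Longrightarrow> flat f X = {pt X}"
proof -
  assume "X \<in> vertices CARD('k) N"
  then obtain x where x: "flat f X = {x}"
    using gen vertexD[of X] unfolding generic_arrangement_def by metis
  then have "pt X = x" unfolding vertex_point_def by (intro the_equality) auto
  then show ?thesis using x by simp
qed

lemma vertex_point_iff: "X \<in> vertices CARD('k) N \<Longrightarrow> (\<forall>j\<in>X. f j x = 0) \<longleftrightarrow> x = pt X"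
  using flat_V[of X] flat_iff[of x X] by auto

lemma f_pt [simp]: "X \<in> vertices CARD('k) N \<Longrightarrow> j \<in> X \<Longrightarrow> f j (pt X) = 0"
  using vertex_point_iff by blast

text \<open>Otherwise \<open>pt X + v\<close> would be a second common point of the hyperplanes in
  \<open>X\<close>.\<close>

lemma kernel:
  assumes "X \<in> vertices CARD('k) N" "\<And>j. j \<in> X \<Longrightarrow> l j v = 0"
  shows "v = 0"
proof -
  have "\<forall>j\<in>X. f j (pt X + v) = 0"
    using assms vertex_index[OF assms(1)] by (simp add: f_add)
  then show ?thesis using vertex_point_iff[OF assms(1), of "pt X + v"] by simp
qed

lemma f_pt_nz:
  assumes "X \<in> vertices CARD('k) N" "j \<in> {1..N} - X"
  shows "f j (pt X) \<noteq> 0"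
proof
  assume "f j (pt X) = 0"
  then have "pt X \<in> flat f (insert j X)" using assms by (auto simp: flat_iff)
  moreover have "flat f (insert j X) = {}"
    using gen vertexD[OF assms(1)] assms(2) unfolding generic_arrangement_def by simp
  ultimately show False by simp
qed

section \<open>The edge vectors as a basis at a vertex\<close>

lemma obtain_enum:
  assumes "X \<in> vertices CARD('k) N"
  obtains p :: "'k \<Rightarrow> nat" where "bij_betw p UNIV X"
  using vertexD[OF assms] finite_same_card_bij[of "UNIV :: 'k set" X] by auto

lemma dual_basis:
  assumes "X \<in> vertices CARD('k) N" "j \<in> X"
  obtains b where "\<And>i. i \<in> X \<Longrightarrow> l i b = (if i = j then 1 else 0)"
proof -
  obtain p :: "'k \<Rightarrow> nat" where p: "bij_betw p UNIV X" by (rule obtain_enum[OF assms(1)])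
  define L where "L v = (\<chi> a. l (p a) v)" for v
  have pX: "p a \<in> X" for a using p by (auto simp: bij_betw_def)
  have linL: "linear L"
    using linear_l[OF vertex_index[OF assms(1) pX]]
    by (intro linearI) (auto simp: L_def vec_eq_iff linear_add linear_cmul)
  have "inj L"
    unfolding linear_injective_0[OF linL]
  proof (intro allI impI)
    fix v assume v: "L v = 0"
    have "l i v = 0" if i: "i \<in> X" for i
    proof -
      obtain a where "i = p a" using p i by (auto simp: bij_betw_def)
      then show ?thesis using v by (simp add: L_def vec_eq_iff)
    qed
    then show "v = 0" using kernel[OF assms(1)] by blast
  qed
  then have "surj L" by (rule linear_injective_imp_surjective[OF linL]) (rule refl)
  then obtain b where b: "L b = (\<chi> a. if p a = j then 1 else 0)" by (metis surjD)
  have "l i b = (if i = j then 1 else 0)" if i: "i \<in> X" for i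
  proof -
    obtain a where "i = p a" using p i by (auto simp: bij_betw_def)
    then show ?thesis using b by (simp add: L_def vec_eq_iff)
  qed
  then show ?thesis by (rule that)
qed

text \<open>The edge vector is the dual basis vector \<open>b\<close> rescaled to
  \<open>f0 = 1\<close>. This is possible because \<open>f0\<close> would otherwise be constant on
  the line, and it is the only choice because two parametrizations of a line have proportional
  directions.\<close>

lemma edge_props:
  assumes "X \<in> vertices CARD('k) N" "j \<in> X"
  shows "f0 (edge X j) = 1" "\<And>i. i \<in> X \<Longrightarrow> i \<noteq> j \<Longrightarrow> l i (edge X j) = 0" "l j (edge X j) \<noteq> 0"
proof -
  obtain b where b: "\<And>i. i \<in> X \<Longrightarrow> l i b = (if i = j then 1 else 0)" by (rule dual_basis[OF assms]) blast
  have fl: "flat f (X - {j}) = range (\<lambda>t. pt X + t *\<^sub>R b)"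
  proof (intro set_eqI iffI)
    fix x assume x: "x \<in> flat f (X - {j})"
    have "x - pt X - l j (x - pt X) *\<^sub>R b = 0"
    proof (rule kernel[OF assms(1)])
      fix i assume i: "i \<in> X"
      have "f i x = f i (pt X) + l i (x - pt X)"
        using f_add[OF vertex_index[OF assms(1) i], of "pt X" "x - pt X"] by simp
      then have "i \<noteq> j \<Longrightarrow> l i (x - pt X) = 0" using x i assms(1) by (auto simp: flat_iff)
      then show "l i (x - pt X - l j (x - pt X) *\<^sub>R b) = 0"
        using b[OF i] i linear_diff[OF linear_l[OF vertex_index[OF assms(1) i]]] linear_cmul[OF linear_l[OF vertex_index[OF assms(1) i]]]
        by auto
    qed
    then have "x = pt X + l j (x - pt X) *\<^sub>R b" by (simp add: algebra_simps)
    then show "x \<in> range (\<lambda>t. pt X + t *\<^sub>R b)" by blast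
  next
    fix x assume "x \<in> range (\<lambda>t. pt X + t *\<^sub>R b)"
    then obtain t where t: "x = pt X + t *\<^sub>R b" by blast
    show "x \<in> flat f (X - {j})"
      unfolding flat_iff t
    proof
      fix i assume i: "i \<in> X - {j}"
      then have "i \<in> X" by simp
      with i show "f i (pt X + t *\<^sub>R b) = 0"
        using b[of i] assms(1) vertex_index[OF assms(1)] by (simp add: f_add linear_cmul[OF linear_l[OF vertex_index[OF assms(1) \<open>i \<in> X\<close>]]])
    qed
  qed
  have f0b: "f0 b \<noteq> 0"
  proof
    assume "f0 b = 0"
    then have "f0 constant_on flat f (X - {j})"
      unfolding fl constant_on_def using linear_add[OF lin_f0] linear_cmul[OF lin_f0]
      by (intro exI[of _ "f0 (pt X)"]) auto
    moreover have "X - {j} \<subseteq> {1..N}" "card (X - {j}) = CARD('k) - 1"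
      using vertexD[OF assms(1)] assms(2) by auto
    ultimately show False
      using glf unfolding generic_linear_form_def by blast
  qed
  have "edge X j = (1 / f0 b) *\<^sub>R b"
    unfolding edge_vec_def
  proof (rule the_equality)
    show "f0 ((1 / f0 b) *\<^sub>R b) = 1 \<and> (\<exists>p. flat f (X - {j}) = range (\<lambda>t. p + t *\<^sub>R (1 / f0 b) *\<^sub>R b))"
    proof
      show "f0 ((1 / f0 b) *\<^sub>R b) = 1" using f0b by (simp only: linear_cmul[OF lin_f0]) simp
      show "\<exists>p. flat f (X - {j}) = range (\<lambda>t. p + t *\<^sub>R (1 / f0 b) *\<^sub>R b)"
      proof (intro exI[of _ "pt X"] set_eqI iffI)
        fix x assume "x \<in> flat f (X - {j})"
        then obtain t where "x = pt X + t *\<^sub>R b" unfolding fl by blast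
        then have "x = pt X + (t * f0 b) *\<^sub>R (1 / f0 b) *\<^sub>R b" using f0b by simp
        then show "x \<in> range (\<lambda>t. pt X + t *\<^sub>R (1 / f0 b) *\<^sub>R b)" by blast
      next
        fix x assume "x \<in> range (\<lambda>t. pt X + t *\<^sub>R (1 / f0 b) *\<^sub>R b)"
        then show "x \<in> flat f (X - {j})" unfolding fl by auto
      qed
    qed
    fix v assume v: "f0 v = 1 \<and> (\<exists>p. flat f (X - {j}) = range (\<lambda>t. p + t *\<^sub>R v))"
    then obtain p where p: "range (\<lambda>t. p + t *\<^sub>R v) = range (\<lambda>t. pt X + t *\<^sub>R b)" unfolding fl by metis
    have "p + 0 *\<^sub>R v \<in> range (\<lambda>t. pt X + t *\<^sub>R b)" "p + 1 *\<^sub>R v \<in> range (\<lambda>t. pt X + t *\<^sub>R b)"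
      unfolding p[symmetric] by blast+
    then obtain s t where st: "p + 0 *\<^sub>R v = pt X + s *\<^sub>R b" "p + 1 *\<^sub>R v = pt X + t *\<^sub>R b" by blast
    have "v = (p + 1 *\<^sub>R v) - (p + 0 *\<^sub>R v)" by simp
    then have "v = (t - s) *\<^sub>R b" unfolding st by (simp add: algebra_simps)
    moreover from this v have "(t - s) * f0 b = 1" by (simp add: linear_cmul[OF lin_f0])
    then have "t - s = 1 / f0 b" using f0b by (simp add: field_simps)
    ultimately show "v = (1 / f0 b) *\<^sub>R b" by simp
  qed
  then show "f0 (edge X j) = 1" "\<And>i. i \<in> X \<Longrightarrow> i \<noteq> j \<Longrightarrow> l i (edge X j) = 0" "l j (edge X j) \<noteq> 0"
    using f0b b assms linear_l vertex_index[OF assms(1)] by (auto simp: linear_cmul lin_f0)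
qed

lemma expansion:
  assumes "X \<in> vertices CARD('k) N"
  shows "v = (\<Sum>j\<in>X. (l j v / l j (edge X j)) *\<^sub>R edge X j)"
proof -
  have "v - (\<Sum>j\<in>X. (l j v / l j (edge X j)) *\<^sub>R edge X j) = 0"
  proof (rule kernel[OF assms])
    fix i assume i: "i \<in> X"
    have li: "linear (l i)" using linear_l vertex_index[OF assms i] by blast
    have "l i (\<Sum>j\<in>X. (l j v / l j (edge X j)) *\<^sub>R edge X j) = (\<Sum>j\<in>X. (l j v / l j (edge X j)) * l i (edge X j))"
      by (simp add: linear_sum[OF li] linear_cmul[OF li])
    also have "\<dots> = (\<Sum>j\<in>X. if j = i then l i v else 0)"
      using edge_props[OF assms] i by (intro sum.cong) auto
    also have "\<dots> = l i v" using i vertexD[OF assms] by simp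
    finally show "l i (v - (\<Sum>j\<in>X. (l j v / l j (edge X j)) *\<^sub>R edge X j)) = 0"
      by (simp add: linear_diff[OF li])
  qed
  then show ?thesis by simp
qed

lemma linear_expansion:
  assumes "X \<in> vertices CARD('k) N" "linear (g :: real^'k \<Rightarrow> real)"
  shows "g v = (\<Sum>j\<in>X. l j v / l j (edge X j) * g (edge X j))"
  by (subst expansion[OF assms(1), of v]) (simp add: linear_sum[OF assms(2)] linear_cmul[OF assms(2)])

text \<open>All edge vectors have \<open>f0\<close> equal to 1. Through this identity,
  multiplication by \<open>f0\<close> turns into the cancellation of single denominators.\<close>

lemma f0_expansion: "X \<in> vertices CARD('k) N \<Longrightarrow> f0 v = (\<Sum>j\<in>X. l j v / l j (edge X j))"
  using linear_expansion[OF _ lin_f0, of X v] edge_props(1)[of X] by simp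

text \<open>
  In the coordinates \<open>a\<close> along the edges at \<open>X\<close>, the form \<open>f j\<close> is \<open>scal X j * a j\<close> for \<open>j \<in> X\<close> and
  \<open>scal X j * (1 + (\<Sum>i\<in>X. slope X j i * a i))\<close> otherwise.
\<close>

definition scal :: "nat set \<Rightarrow> nat \<Rightarrow> real" where
  "scal X j = (if j \<in> X then l j (edge X j) else f j (pt X))"

lemma scal_nz: "X \<in> vertices CARD('k) N \<Longrightarrow> j \<in> {1..N} \<Longrightarrow> scal X j \<noteq> 0"
  using edge_props(3) f_pt_nz by (auto simp: scal_def)

definition slope :: "nat set \<Rightarrow> nat \<Rightarrow> nat \<Rightarrow> real" where
  "slope X j i = l j (edge X i) / f j (pt X)"

definition cone_point :: "nat set \<Rightarrow> (nat \<Rightarrow> real) \<Rightarrow> real^'k" where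
  "cone_point X a = pt X + (\<Sum>j\<in>X. a j *\<^sub>R edge X j)"

lemma f_cone_point: "X \<in> vertices CARD('k) N \<Longrightarrow> i \<in> {1..N} \<Longrightarrow> f i (cone_point X a) = f i (pt X) + (\<Sum>j\<in>X. a j * l i (edge X j))"
  by (simp add: cone_point_def f_add linear_sum[OF linear_l] linear_cmul[OF linear_l])

lemma f_cone_point_in: "X \<in> vertices CARD('k) N \<Longrightarrow> i \<in> X \<Longrightarrow> f i (cone_point X a) = a i * scal X i"
proof -
  assume X: "X \<in> vertices CARD('k) N" and i: "i \<in> X"
  have "(\<Sum>j\<in>X. a j * l i (edge X j)) = (\<Sum>j\<in>X. if j = i then a i * l i (edge X i) else 0)"
    using edge_props[OF X] i by (intro sum.cong) auto
  then show ?thesis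
    using X i vertexD[OF X] f_cone_point[OF X vertex_index[OF X i], of a] by (simp add: scal_def)
qed

lemma f_cone_point_out:
  assumes "X \<in> vertices CARD('k) N" "i \<in> {1..N} - X"
  shows "f i (cone_point X a) = scal X i * (1 + (\<Sum>j\<in>X. slope X i j * a j))"
proof -
  have nz: "f i (pt X) \<noteq> 0" by (rule f_pt_nz[OF assms])
  have "scal X i * (\<Sum>j\<in>X. slope X i j * a j) = (\<Sum>j\<in>X. a j * l i (edge X j))"
    unfolding sum_distrib_left using nz assms(2) by (intro sum.cong) (auto simp: scal_def slope_def)
  moreover have "i \<in> {1..N}" using assms(2) by blast
  moreover have "scal X i = f i (pt X)" using assms(2) by (simp add: scal_def)
  ultimately show ?thesis using f_cone_point[OF assms(1), of i a] by (simp only: distrib_left mult_1_right)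
qed

lemma f0_cone_point:
  assumes "X \<in> vertices CARD('k) N"
  shows "f0 (cone_point X a) = f0 (pt X) + (\<Sum>j\<in>X. a j)"
proof -
  have "f0 (cone_point X a) = f0 (pt X) + (\<Sum>j\<in>X. a j *\<^sub>R f0 (edge X j))"
    unfolding cone_point_def by (simp only: linear_add[OF lin_f0] linear_sum[OF lin_f0] linear_cmul[OF lin_f0])
  also have "(\<Sum>j\<in>X. a j *\<^sub>R f0 (edge X j)) = (\<Sum>j\<in>X. a j)"
    by (rule sum.cong[OF refl]) (simp add: edge_props(1)[OF assms])
  finally show ?thesis .
qed

lemma cone_point_coord: "X \<in> vertices CARD('k) N \<Longrightarrow> cone_point X (\<lambda>j. f j x / scal X j) = x"
proof -
  assume X: "X \<in> vertices CARD('k) N"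
  have "f j x = l j (x - pt X)" if "j \<in> X" for j
    using f_add[OF vertex_index[OF X that], of "pt X" "x - pt X"] X that by simp
  then have "(\<Sum>j\<in>X. (f j x / scal X j) *\<^sub>R edge X j) = (\<Sum>j\<in>X. (l j (x - pt X) / l j (edge X j)) *\<^sub>R edge X j)"
    by (intro sum.cong) (auto simp: scal_def)
  then show ?thesis using expansion[OF X, of "x - pt X"] by (simp add: cone_point_def)
qed

lemma continuous_f:
  assumes "j \<in> {1..N}"
  shows "continuous_on S (f j)"
proof -
  have "continuous_on S (l j)" using linear_continuous_on[OF linear_conv_bounded_linear[THEN iffD1, OF linear_l[OF assms]]] .
  then have "continuous_on S (\<lambda>x. f j 0 + l j x)" by (intro continuous_intros)
  then show ?thesis by (simp add: lin_part_def)
qed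

section \<open>Determinants of the linear parts at a vertex\<close>

definition row_matrix :: "('k \<Rightarrow> nat) \<Rightarrow> real^'k^'k" where
  "row_matrix p = (\<chi> a b. l (p a) (axis b 1))"

lemma abs_det_row_matrix_indep:
  assumes "bij_betw p UNIV X" "bij_betw q UNIV X"
  shows "\<bar>det (row_matrix p)\<bar> = \<bar>det (row_matrix q)\<bar>"
proof -
  define \<pi> where "\<pi> = inv_into UNIV q \<circ> p"
  have "bij_betw \<pi> UNIV UNIV"
    unfolding \<pi>_def using assms by (meson bij_betw_inv_into bij_betw_trans)
  then have perm: "\<pi> permutes UNIV" by (simp add: permutes_univ bij_iff)
  have q: "q (\<pi> a) = p a" for a
    unfolding \<pi>_def using assms bij_betw_inv_into_right[OF assms(2)] by (auto simp: bij_betw_def)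
  have "row_matrix p = (\<chi> i. row_matrix q $ \<pi> i)" by (simp add: row_matrix_def q vec_eq_iff)
  then have "det (row_matrix p) = of_int (sign \<pi>) * det (row_matrix q)" using det_permute_rows[OF perm] by metis
  then show ?thesis by (simp add: abs_mult sign_def)
qed

text \<open>The coefficient of the wedge product of the \<open>df j\<close>,
  \<open>j \<in> X\<close>, in a positive ordering. The orientation settles its sign, and the
  absolute value does not depend on the enumeration.\<close>

definition abs_det :: "nat set \<Rightarrow> real" where
  "abs_det X = \<bar>det (row_matrix (SOME p. bij_betw p UNIV X))\<bar>"

lemma abs_det_eq: "bij_betw p UNIV X \<Longrightarrow> abs_det X = \<bar>det (row_matrix p)\<bar>"
  unfolding abs_det_def using abs_det_row_matrix_indep someI[of "\<lambda>p. bij_betw p UNIV X" p] by metis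

lemma abs_det_pos: assumes "X \<in> vertices CARD('k) N" shows "abs_det X > 0"
proof -
  obtain p :: "'k \<Rightarrow> nat" where p: "bij_betw p UNIV X" by (rule obtain_enum[OF assms(1)])
  have pX: "p a \<in> X" for a using p by (auto simp: bij_betw_def)
  have mul: "(row_matrix p *v v) $ a = l (p a) v" for v a
  proof -
    have li: "linear (l (p a))" using linear_l vertex_index[OF assms pX] by blast
    have "l (p a) v = l (p a) (\<Sum>b\<in>UNIV. v $ b *\<^sub>R axis b 1)"
      using basis_expansion[of v] by (simp add: scalar_mult_eq_scaleR)
    also have "\<dots> = (\<Sum>b\<in>UNIV. v $ b * l (p a) (axis b 1))"
      by (simp add: linear_sum[OF li] linear_cmul[OF li])
    finally show ?thesis by (simp add: matrix_vector_mult_def row_matrix_def mult.commute)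
  qed
  have "inj ((*v) (row_matrix p))"
    unfolding linear_injective_0[OF matrix_vector_mul_linear]
  proof (intro allI impI)
    fix v assume "row_matrix p *v v = 0"
    then have a: "l (p a) v = 0" for a using mul[of v a] by simp
    have "l i v = 0" if "i \<in> X" for i
    proof -
      obtain a where "i = p a" using p \<open>i \<in> X\<close> by (auto simp: bij_betw_def)
      then show ?thesis using a by simp
    qed
    then show "v = 0" using kernel[OF assms] by blast
  qed
  then have "invertible (row_matrix p)"
    by (metis invertible_left_inverse matrix_left_invertible_injective)
  then have "det (row_matrix p) \<noteq> 0" by (simp add: invertible_det_nz)
  then show ?thesis by (simp add: abs_det_eq[OF p])
qed

text \<open>Cramer's rule: in the expansion of \<open>l r\<close> in the forms of \<open>X\<close>,
  the coefficient of \<open>l j\<close> is \<open>l r (edge X j) / l j (edge X j)\<close>, and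
  replacing the row \<open>l j\<close> by \<open>l r\<close> multiplies the determinant by it. This
  turns the ratios in the contiguity relations into the signs of the matrix.\<close>

lemma abs_det_swap:
  assumes X: "X \<in> vertices CARD('k) N" and j: "j \<in> X" and r: "r \<in> {1..N} - X"
  shows "abs_det (insert r (X - {j})) * \<bar>l j (edge X j)\<bar> = abs_det X * \<bar>l r (edge X j)\<bar>"
proof -
  obtain p :: "'k \<Rightarrow> nat" where p: "bij_betw p UNIV X" by (rule obtain_enum[OF X])
  obtain k0 where k0: "p k0 = j" using p j by (auto simp: bij_betw_def)
  define q where "q = p(k0 := r)"
  have q: "bij_betw q UNIV (insert r (X - {j}))"
  proof -
    have "p a = j \<longleftrightarrow> a = k0" for a using p k0 by (auto simp: bij_betw_def inj_def)
    then show ?thesis using p r k0 unfolding bij_betw_def q_def inj_def by (auto simp: image_iff)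
  qed
  have lr: "linear (l r)" using linear_l r by blast
  define x where "x = (\<chi> a. l r (edge X (p a)) / l (p a) (edge X (p a)))"
  have "(\<Sum>i\<in>UNIV. x $ i *s row i (row_matrix p)) = (\<chi> b. l r (axis b 1))"
  proof (simp add: vec_eq_iff, intro allI)
    fix b
    have "l r (axis b 1) = (\<Sum>i\<in>X. l i (axis b 1) / l i (edge X i) * l r (edge X i))"
      by (rule linear_expansion[OF X lr])
    also have "\<dots> = (\<Sum>a\<in>UNIV. l (p a) (axis b 1) / l (p a) (edge X (p a)) * l r (edge X (p a)))"
      by (rule sum.reindex_bij_betw[OF p, symmetric])
    finally show "(\<Sum>i\<in>UNIV. x $ i * row i (row_matrix p) $ b) = l r (axis b 1)"
      by (simp add: x_def row_def row_matrix_def mult.commute)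
  qed
  then have "row_matrix q = (\<chi> i. if i = k0 then \<Sum>i\<in>UNIV. x $ i *s row i (row_matrix p) else row i (row_matrix p))"
    by (simp add: vec_eq_iff row_matrix_def q_def row_def)
  then have "det (row_matrix q) = x $ k0 * det (row_matrix p)"
    using cramer_lemma_transpose[of k0 x "row_matrix p"] by simp
  then have "abs_det (insert r (X - {j})) = \<bar>l r (edge X j)\<bar> / \<bar>l j (edge X j)\<bar> * abs_det X"
    unfolding abs_det_eq[OF p] abs_det_eq[OF q] by (simp add: x_def k0 abs_mult abs_divide)
  then show ?thesis using edge_props(3)[OF X j] by simp
qed

section \<open>The cone and the arrangement domain at a vertex\<close>

lemma sign_region_component:
  assumes X: "X \<in> vertices CARD('k) N" and I: "I \<subseteq> {1..N}" and ne: "{x. \<forall>j\<in>I. 0 < f j x / scal X j} \<noteq> {}"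
  shows "{x. \<forall>j\<in>I. 0 < f j x / scal X j} \<in> components (- (\<Union>j\<in>I. hyp f j))" (is "?S \<in> _")
  unfolding in_components_maximal
proof (intro conjI allI impI)
  show "?S \<noteq> {}" by (rule ne)
  show "?S \<subseteq> - (\<Union>j\<in>I. hyp f j)" by (auto simp: hyp_def)
  have "convex ?S"
  proof (rule convexI)
    fix x y and u v :: real
    assume xy: "x \<in> ?S" "y \<in> ?S" and uv: "0 \<le> u" "0 \<le> v" "u + v = 1"
    show "u *\<^sub>R x + v *\<^sub>R y \<in> ?S"
    proof (intro CollectI ballI)
      fix j assume j: "j \<in> I"
      then have li: "linear (l j)" using linear_l I by blast
      have "f j (u *\<^sub>R x + v *\<^sub>R y) = (u + v) * f j 0 + l j (u *\<^sub>R x + v *\<^sub>R y)"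
        using uv by (simp add: lin_part_def)
      also have "\<dots> = u * f j x + v * f j y"
        by (simp only: linear_add[OF li] linear_cmul[OF li]) (simp add: lin_part_def algebra_simps)
      finally have "f j (u *\<^sub>R x + v *\<^sub>R y) / scal X j = u * (f j x / scal X j) + v * (f j y / scal X j)"
        by (simp add: add_divide_distrib)
      moreover have "0 < f j x / scal X j" "0 < f j y / scal X j" using xy j by auto
      ultimately show "0 < f j (u *\<^sub>R x + v *\<^sub>R y) / scal X j"
        using uv by (metis add_nonneg_pos add_pos_nonneg mult_nonneg_nonneg mult_pos_pos less_eq_real_def add.left_neutral zero_neq_one)
    qed
  qed
  then show "connected ?S" by (rule convex_connected)
  fix D assume D: "D \<noteq> {} \<and> ?S \<subseteq> D \<and> D \<subseteq> - (\<Union>j\<in>I. hyp f j) \<and> connected D"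
  obtain x where x: "x \<in> ?S" using ne by blast
  have "D \<subseteq> ?S"
  \<comment> \<open>On a connected set without zeros of \<open>f j\<close> the sign of
    \<open>f j\<close> is constant, and \<open>x\<close> shows which sign it is.\<close>
  proof (intro subsetI CollectI ballI)
    fix y j assume y: "y \<in> D" and j: "j \<in> I"
    have jN: "j \<in> {1..N}" using j I by blast
    define g where "g x = f j x / scal X j" for x
    have "connected (g ` D)"
      unfolding g_def using D scal_nz[OF X jN]
      by (intro connected_continuous_image continuous_on_divide continuous_f jN continuous_on_const) auto
    moreover have "0 \<notin> g ` D" using D j scal_nz[OF X jN] by (auto simp: g_def hyp_def)
    moreover have "0 < g x" "g x \<in> g ` D" "g y \<in> g ` D" using x D y j by (auto simp: g_def)
    ultimately have "0 < g y"
      by (metis connectedD_interval linorder_not_less order_less_imp_le)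
    then show "0 < f j y / scal X j" by (simp add: g_def)
  qed
  then show "D = ?S" using D by blast
qed

text \<open>The uniqueness argument shared by the cone, with \<open>I = X\<close>, and the domain,
  with \<open>I = {1..N}\<close>. If the coordinate \<open>i\<close> of \<open>y\<close> were
  negative, shrinking the other coordinates would stay inside \<open>D\<close> and end at a point
  where the sum of the coordinates, which is \<open>f0 - f0 (pt X)\<close>, is negative. The
  hypothesis \<open>nz\<close> prevents the shrinking from crossing the remaining
  hyperplanes.\<close>

lemma coords_positive:
  assumes X: "X \<in> vertices CARD('k) N" and XI: "X \<subseteq> I" and I: "I \<subseteq> {1..N}"
    and D: "D \<in> components (- (\<Union>j\<in>I. hyp f j))" and y: "y \<in> D"
    and f0D: "\<forall>x\<in>D. f0 (pt X) < f0 x"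
    and nz: "\<And>j b. j \<in> I - X \<Longrightarrow> (\<forall>i\<in>X. \<bar>b i\<bar> \<le> \<bar>f i y / scal X i\<bar>) \<Longrightarrow> f j (cone_point X b) \<noteq> 0"
    and i: "i \<in> X"
  shows "0 < f i y / scal X i"
proof (rule ccontr)
  assume neg: "\<not> 0 < f i y / scal X i"
  define co where "co k = f k y / scal X k" for k
  have D': "D \<subseteq> - (\<Union>j\<in>I. hyp f j)" using D by (rule in_components_subset)
  have co_nz: "co k \<noteq> 0" if "k \<in> X" for k
    using that y D' XI scal_nz[OF X] vertex_index[OF X that] by (auto simp: co_def hyp_def)
  have coi: "co i < 0" using neg co_nz[OF i] unfolding co_def by linarith
  define S where "S = (\<Sum>k\<in>X. \<bar>co k\<bar>)"
  have S: "S \<ge> 0" unfolding S_def by (intro sum_nonneg) auto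
  \<comment> \<open>Chosen so that \<open>t * S < - co i\<close>: after shrinking by
    \<open>t\<close> the other coordinates cannot outweigh the negative one.\<close>
  define t where "t = - co i / (- co i + 1 + S)"
  have t: "0 < t" "t \<le> 1" using coi S by (auto simp: t_def divide_simps)
  have tS: "t * S < - co i"
  proof -
    have "- co i * S < - co i * (- co i + 1 + S)" using coi by (intro mult_strict_left_mono) auto
    moreover have "0 < - co i + 1 + S" using coi S by linarith
    ultimately have "(- co i * S) / (- co i + 1 + S) < - co i" by (simp only: pos_divide_less_eq)
    then show ?thesis by (simp add: t_def)
  qed
  \<comment> \<open>The coordinates of the path, which starts at \<open>y\<close> for
    \<open>\<theta> = 1\<close> and keeps the coordinate \<open>i\<close> fixed while
    \<open>\<theta>\<close> decreases to \<open>t\<close>.\<close>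
  define b where "b \<theta> k = (if k = i then co i else \<theta> * co k)" for \<theta> k
  define Q where "Q = (\<lambda>\<theta>. cone_point X (b \<theta>)) ` {t..1}"
  have "connected Q"
  proof -
    have "continuous_on {t..1} (\<lambda>\<theta>. b \<theta> k)" for k
      unfolding b_def by (cases "k = i") (auto intro!: continuous_intros)
    then show ?thesis
      unfolding Q_def cone_point_def by (intro connected_continuous_image continuous_intros) auto
  qed
  have Qs: "Q \<subseteq> - (\<Union>j\<in>I. hyp f j)"
  proof -
    have "f j (cone_point X (b \<theta>)) \<noteq> 0" if j: "j \<in> I" and \<theta>: "t \<le> \<theta>" "\<theta> \<le> 1" for j \<theta>
    proof (cases "j \<in> X")
      case True
      have "b \<theta> j \<noteq> 0" using co_nz True i \<theta> t by (auto simp: b_def)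
      then show ?thesis using f_cone_point_in[OF X True] scal_nz[OF X vertex_index[OF X True]] by simp
    next
      case False
      have "\<bar>b \<theta> k\<bar> \<le> \<bar>co k\<bar>" for k
        using \<theta> t mult_left_le_one_le[of "\<bar>co k\<bar>" \<theta>] by (simp add: b_def abs_mult)
      then show ?thesis using nz[of j "b \<theta>"] j False by (simp add: co_def)
    qed
    then show ?thesis by (auto simp: Q_def hyp_def)
  qed
  have "b 1 = co" by (auto simp: b_def fun_eq_iff)
  then have "cone_point X (b 1) = y" using cone_point_coord[OF X, of y] by (simp add: co_def[abs_def])
  then have "y \<in> Q" using t by (auto simp: Q_def intro!: image_eqI[of _ _ 1])
  then have "Q \<subseteq> D" using components_maximal[OF D \<open>connected Q\<close> Qs] y by blast
  moreover have "cone_point X (b t) \<in> Q" using t by (auto simp: Q_def)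
  ultimately have "f0 (pt X) < f0 (cone_point X (b t))" using f0D by blast
  then have p: "0 < (\<Sum>k\<in>X. b t k)" using f0_cone_point[OF X] by simp
  have q: "(\<Sum>k\<in>X. b t k) \<le> co i + t * S"
  proof -
    have "(\<Sum>k\<in>X. b t k) = co i + (\<Sum>k\<in>X - {i}. t * co k)"
      using i vertexD[OF X] by (simp add: sum.remove[of X i] b_def)
    also have "(\<Sum>k\<in>X - {i}. t * co k) \<le> (\<Sum>k\<in>X - {i}. t * \<bar>co k\<bar>)"
      using t by (intro sum_mono mult_left_mono) auto
    also have "\<dots> \<le> (\<Sum>k\<in>X. t * \<bar>co k\<bar>)"
      using t vertexD[OF X] by (intro sum_mono2) auto
    finally show ?thesis by (simp add: S_def sum_distrib_left)
  qed
  show False using p q tS by linarith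
qed

definition sign_cone :: "nat set \<Rightarrow> (real^'k) set" where
  "sign_cone X = {x. \<forall>j\<in>X. 0 < f j x / scal X j}"

lemma cone_point_in_sign_cone: "X \<in> vertices CARD('k) N \<Longrightarrow> \<forall>i\<in>X. 0 < a i \<Longrightarrow> cone_point X a \<in> sign_cone X"
  using scal_nz[of X] vertex_index[of X] by (auto simp: sign_cone_def f_cone_point_in)

lemma f0_sign_cone: assumes "X \<in> vertices CARD('k) N" "x \<in> sign_cone X" shows "f0 (pt X) < f0 x"
proof -
  have "f0 x = f0 (pt X) + (\<Sum>j\<in>X. f j x / scal X j)"
    using f0_cone_point[OF assms(1), of "\<lambda>j. f j x / scal X j"] cone_point_coord[OF assms(1), of x] by simp
  moreover have "0 < (\<Sum>j\<in>X. f j x / scal X j)"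
    using assms vertexD[OF assms(1)] by (intro sum_pos) (auto simp: sign_cone_def)
  ultimately show ?thesis by simp
qed

lemma vertex_cone_eq:
  assumes X: "X \<in> vertices CARD('k) N"
  shows "vertex_cone f f0 X = sign_cone X"
  unfolding vertex_cone_def
proof (rule the_equality)
  have ne: "sign_cone X \<noteq> {}" using cone_point_in_sign_cone[OF X, of "\<lambda>_. 1"] by auto
  have XN: "X \<subseteq> {1..N}" using vertexD[OF X] by blast
  have comp: "sign_cone X \<in> components (- (\<Union>j\<in>X. hyp f j))"
    unfolding sign_cone_def by (rule sign_region_component[OF X XN]) (use ne in \<open>simp add: sign_cone_def\<close>)
  then show "sign_cone X \<in> components (- (\<Union>j\<in>X. hyp f j)) \<and> (\<forall>x\<in>sign_cone X. f0 (pt X) < f0 x)"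
    using f0_sign_cone[OF X] by blast
  fix C assume C: "C \<in> components (- (\<Union>j\<in>X. hyp f j)) \<and> (\<forall>x\<in>C. f0 (pt X) < f0 x)"
  then obtain y where y: "y \<in> C" using in_components_nonempty by blast
  have "y \<in> sign_cone X"
    unfolding sign_cone_def using coords_positive[OF X order_refl XN _ y] C by blast
  then show "C = sign_cone X" using components_eq[of C _ "sign_cone X"] C comp y by blast
qed

definition sign_domain :: "nat set \<Rightarrow> (real^'k) set" where
  "sign_domain X = {x. \<forall>j\<in>{1..N}. 0 < f j x / scal X j}"

text \<open>With \<open>S\<close> the sum of the absolute slopes, coordinates of size at most
  \<open>1 / (1 + S)\<close> change the normalized forms by less than 1, so the other forms keep the
  signs they have at the vertex.\<close>

lemma near_vertex:
  assumes X: "X \<in> vertices CARD('k) N"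
  obtains r where "r > 0" "\<And>j b. j \<in> {1..N} - X \<Longrightarrow> (\<forall>i\<in>X. \<bar>b i\<bar> \<le> r) \<Longrightarrow> 0 < f j (cone_point X b) / scal X j"
proof -
  define S where "S = (\<Sum>j\<in>{1..N}. \<Sum>i\<in>X. \<bar>slope X j i\<bar>)"
  have S: "S \<ge> 0" unfolding S_def by (intro sum_nonneg) auto
  show ?thesis
  proof (rule that[of "1 / (1 + S)"])
    fix j b assume j: "j \<in> {1..N} - X" and b: "\<forall>i\<in>X. \<bar>b i\<bar> \<le> 1 / (1 + S)"
    have "\<bar>\<Sum>i\<in>X. slope X j i * b i\<bar> \<le> (\<Sum>i\<in>X. \<bar>slope X j i\<bar> * (1 / (1 + S)))"
    proof (rule order_trans[OF sum_abs], rule sum_mono)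
      fix i assume "i \<in> X"
      with b have "\<bar>b i\<bar> \<le> 1 / (1 + S)" by blast
      then show "\<bar>slope X j i * b i\<bar> \<le> \<bar>slope X j i\<bar> * (1 / (1 + S))"
        unfolding abs_mult by (rule mult_left_mono) simp
    qed
    also have "\<dots> = (\<Sum>i\<in>X. \<bar>slope X j i\<bar>) * (1 / (1 + S))" by (simp only: sum_distrib_right)
    also have "\<dots> \<le> S * (1 / (1 + S))"
    proof (rule mult_right_mono)
      show "(\<Sum>i\<in>X. \<bar>slope X j i\<bar>) \<le> S"
        unfolding S_def using j
        by (intro member_le_sum[of j "{1..N}" "\<lambda>j. \<Sum>i\<in>X. \<bar>slope X j i\<bar>"]) (auto intro!: sum_nonneg)
    qed (use S in simp)
    also have "\<dots> < 1" using S by (simp add: divide_simps)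
    finally have "0 < 1 + (\<Sum>i\<in>X. slope X j i * b i)" by linarith
    then show "0 < f j (cone_point X b) / scal X j"
      using f_cone_point_out[OF X j] scal_nz[OF X, of j] j by simp
  qed (use S in auto)
qed

text \<open>Points with small equal positive coordinates show that the sign region is nonempty and
  has the vertex in its frontier. Any other candidate contains a point near the vertex, and there
  \<open>coords_positive\<close> applies.\<close>

lemma vertex_domain_eq:
  assumes X: "X \<in> vertices CARD('k) N"
  shows "vertex_domain N f f0 X = sign_domain X" "sign_domain X \<noteq> {}"
proof -
  obtain r where r: "r > 0" "\<And>j b. j \<in> {1..N} - X \<Longrightarrow> (\<forall>i\<in>X. \<bar>b i\<bar> \<le> r) \<Longrightarrow> 0 < f j (cone_point X b) / scal X j"
    by (rule near_vertex[OF X]) blast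
  have XN: "X \<subseteq> {1..N}" using vertexD[OF X] by blast
  have small: "cone_point X (\<lambda>_. t) \<in> sign_domain X" if "0 < t" "t \<le> r" for t
    unfolding sign_domain_def
  proof (intro CollectI ballI)
    fix j assume j: "j \<in> {1..N}"
    show "0 < f j (cone_point X (\<lambda>_. t)) / scal X j"
    proof (cases "j \<in> X")
      case True
      then show ?thesis using that f_cone_point_in[OF X True] scal_nz[OF X j] by simp
    next
      case False
      then show ?thesis using that j by (intro r(2)) auto
    qed
  qed
  then show ne: "sign_domain X \<noteq> {}" using r(1) by blast
  have comp: "sign_domain X \<in> components (- (\<Union>j\<in>{1..N}. hyp f j))"
    unfolding sign_domain_def by (rule sign_region_component[OF X order_refl]) (use ne in \<open>simp add: sign_domain_def\<close>)
  have sub: "sign_domain X \<subseteq> sign_cone X" using XN by (auto simp: sign_domain_def sign_cone_def)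
  have front: "pt X \<in> frontier (sign_domain X)"
  proof -
    obtain i0 where i0: "i0 \<in> X" using vertexD[OF X] by blast
    then have "\<not> 0 < f i0 (pt X) / scal X i0" using X by simp
    then have "pt X \<notin> sign_domain X" unfolding sign_domain_def using i0 XN by blast
    then have "pt X \<notin> interior (sign_domain X)" using interior_subset by blast
    moreover have "pt X \<in> closure (sign_domain X)"
    proof (rule Lim_in_closed_set[of "closure (sign_domain X)" "\<lambda>t. cone_point X (\<lambda>_. t)" "at_right 0"])
      show "\<forall>\<^sub>F t in at_right 0. cone_point X (\<lambda>_. t) \<in> closure (sign_domain X)"
        unfolding eventually_at_right_field using small r(1) closure_subset by (intro exI[of _ r]) force
      have "((\<lambda>t. cone_point X (\<lambda>_. t)) \<longlongrightarrow> pt X + (\<Sum>j\<in>X. 0 *\<^sub>R edge X j)) (at_right 0)"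
        unfolding cone_point_def by (intro tendsto_intros)
      then show "((\<lambda>t. cone_point X (\<lambda>_. t)) \<longlongrightarrow> pt X) (at_right 0)" by simp
    qed auto
    ultimately show ?thesis by (simp add: frontier_def)
  qed
  show "vertex_domain N f f0 X = sign_domain X"
    unfolding vertex_domain_def
  proof (rule the_equality)
    show "sign_domain X \<in> components (- (\<Union>j\<in>{1..N}. hyp f j)) \<and> pt X \<in> frontier (sign_domain X) \<and> (\<forall>x\<in>sign_domain X. f0 (pt X) < f0 x)"
      using comp front sub f0_sign_cone[OF X] by blast
    fix D assume D: "D \<in> components (- (\<Union>j\<in>{1..N}. hyp f j)) \<and> pt X \<in> frontier D \<and> (\<forall>x\<in>D. f0 (pt X) < f0 x)"
    \<comment> \<open>A neighbourhood of the vertex in which all coordinates are below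
      \<open>r\<close>, so that shrinking them cannot reach the hyperplanes outside
      \<open>X\<close>.\<close>
    define U where "U = (\<Inter>i\<in>X. {y. \<bar>f i y / scal X i\<bar> < r})"
    have "open U"
      unfolding U_def using vertexD[OF X] scal_nz[OF X] vertex_index[OF X]
      by (intro open_INT ballI open_Collect_less continuous_on_rabs continuous_on_divide continuous_f continuous_on_const) auto
    moreover have "pt X \<in> U" using r(1) X by (auto simp: U_def)
    moreover have "pt X \<in> closure D" using D by (simp add: frontier_def)
    ultimately have "U \<inter> D \<noteq> {}" using open_Int_closure_eq_empty by blast
    then obtain y where y: "y \<in> U" "y \<in> D" by blast
    have yr: "\<bar>f i y / scal X i\<bar> \<le> r" if "i \<in> X" for i using y that by (auto simp: U_def less_imp_le)
    have "0 < f i y / scal X i" if "i \<in> {1..N}" for i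
    proof (cases "i \<in> X")
      case True
      show ?thesis
      proof (rule coords_positive[OF X XN order_refl _ y(2) _ _ True])
        show "f j (cone_point X b) \<noteq> 0" if "j \<in> {1..N} - X" "\<forall>i\<in>X. \<bar>b i\<bar> \<le> \<bar>f i y / scal X i\<bar>" for j b
        proof -
          have "0 < f j (cone_point X b) / scal X j"
            using that yr by (intro r(2)) (auto intro: order_trans)
          then show ?thesis by auto
        qed
      qed (use D in auto)
    next
      case False
      then show ?thesis using r(2)[of i "\<lambda>j. f j y / scal X j"] yr that by (simp add: cone_point_coord[OF X])
    qed
    then have "y \<in> sign_domain X" by (simp add: sign_domain_def)
    then show "D = sign_domain X" using components_eq[of D _ "sign_domain X"] D comp y(2) by blast
  qed
qed

section \<open>The edge coordinates as a substitution\<close>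

lemma open_sign_cone: "X \<in> vertices CARD('k) N \<Longrightarrow> open (sign_cone X)"
proof -
  assume X: "X \<in> vertices CARD('k) N"
  have "sign_cone X = (\<Inter>j\<in>X. {x. 0 < f j x / scal X j})" by (auto simp: sign_cone_def)
  also have "open \<dots>"
    using vertexD[OF X] scal_nz[OF X] vertex_index[OF X]
    by (intro open_INT ballI open_Collect_less continuous_on_divide continuous_f continuous_on_const) auto
  finally show ?thesis .
qed

text \<open>The coordinate map carries Lebesgue measure on the cone to a multiple of the product
  measure, as is checked on product sets. The form with \<open>has_bochner_integral\<close>
  transfers integrability and value together, with one constant for all integrands.\<close>

lemma change_of_variables:
  assumes X: "X \<in> vertices CARD('k) N"
  obtains c where "c > 0"
    "\<And>h v (g :: real^'k \<Rightarrow> complex). has_bochner_integral (Pi\<^sub>M X (\<lambda>_. pos_measure)) h v \<Longrightarrow>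
      (\<And>x. x \<in> sign_cone X \<Longrightarrow> g x = h (\<lambda>j\<in>X. f j x / scal X j)) \<Longrightarrow>
      has_bochner_integral lborel (\<lambda>x. indicator (sign_cone X) x *\<^sub>R g x) (c *\<^sub>R v)"
proof -
  let ?PM = "Pi\<^sub>M X (\<lambda>_. pos_measure)"
  obtain p :: "'k \<Rightarrow> nat" where p: "bij_betw p UNIV X" by (rule obtain_enum[OF X])
  have pX: "p a \<in> X" for a using p by (auto simp: bij_betw_def)
  have finX: "finite X" using vertexD[OF X] by blast
  define L where "L v = (\<chi> a. l (p a) v / scal X (p a))" for v
  define L0 where "L0 = (\<chi> a. f (p a) 0 / scal X (p a))"
  have linL: "linear L"
    using linear_l[OF vertex_index[OF X pX]]
    by (intro linearI) (auto simp: L_def vec_eq_iff linear_add linear_cmul add_divide_distrib)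
  have "inj L"
    unfolding linear_injective_0[OF linL]
  proof (intro allI impI)
    fix v assume v: "L v = 0"
    have "l i v = 0" if i: "i \<in> X" for i
    proof -
      obtain a where "i = p a" using p i by (auto simp: bij_betw_def)
      moreover have "L v $ a = 0" using v by simp
      ultimately show ?thesis using scal_nz[OF X vertex_index[OF X i]] by (simp add: L_def)
    qed
    then show "v = 0" using kernel[OF X] by blast
  qed
  then obtain c where c: "c > 0"
    "\<And>S. S \<in> sets borel \<Longrightarrow> emeasure lborel ((\<lambda>x. L0 + L x) -` S) = ennreal c * emeasure lborel S"
    using emeasure_lborel_affine_vimage[OF linL, of L0] by metis
  have LL: "(L0 + L x) $ a = f (p a) x / scal X (p a)" for x a
    by (simp add: L0_def L_def lin_part_def add_divide_distrib[symmetric])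
  define co where "co x = (\<lambda>j\<in>X. f j x / scal X j)" for x
  define \<nu> where "\<nu> = restrict_space lborel (sign_cone X)"
  have cm: "sign_cone X \<in> sets borel" using open_sign_cone[OF X] by simp
  have sp: "space \<nu> = sign_cone X" by (simp add: \<nu>_def space_restrict_space)
  have fm: "(\<lambda>x. f j x / scal X j) \<in> measurable \<nu> pos_measure" if "j \<in> X" for j
  proof -
    have "(\<lambda>x. f j x / scal X j) \<in> borel_measurable borel"
      using scal_nz[OF X vertex_index[OF X that]]
      by (intro borel_measurable_continuous_onI continuous_on_divide continuous_f[OF vertex_index[OF X that]] continuous_on_const) auto
    then have "(\<lambda>x. f j x / scal X j) \<in> borel_measurable \<nu>"
      unfolding \<nu>_def by (intro measurable_restrict_space1) simp
    then show ?thesis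
      unfolding pos_measure_def using that
      by (intro measurable_restrict_space2) (auto simp: sp sign_cone_def)
  qed
  have com: "co \<in> measurable \<nu> ?PM"
    unfolding co_def by (intro measurable_restrict fm)
  define P where "P = density (distr \<nu> ?PM co) (\<lambda>_. ennreal (1 / c))"
  have "P = ?PM"
  proof (rule pos.PiM_eqI[OF finX])
    show "sets P = sets ?PM" by (simp add: P_def)
    fix A :: "nat \<Rightarrow> real set" assume A: "\<And>i. i \<in> X \<Longrightarrow> A i \<in> sets pos_measure"
    have PA: "Pi\<^sub>E X A \<in> sets ?PM" using A finX by (intro sets_PiM_I_finite) auto
    have Ap: "A i \<in> sets borel" "A i \<subseteq> {0<..}" if "i \<in> X" for i
      using A[OF that] by (auto simp: sets_pos_measure)
    let ?Y = "{y :: real^'k. \<forall>a. y $ a \<in> A (p a)}"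
    have Ym: "?Y \<in> sets borel"
    proof -
      have "?Y = (\<Inter>a. (\<lambda>y. y $ a) -` A (p a))" by auto
      moreover have "(\<lambda>y :: real^'k. y $ a) -` A (p a) \<in> sets borel" for a
        using measurable_sets[of "\<lambda>y :: real^'k. y $ a" borel borel "A (p a)"] Ap(1)[OF pX] by simp
      ultimately show ?thesis by auto
    qed
    have pre: "co -` Pi\<^sub>E X A \<inter> space \<nu> = (\<lambda>x. L0 + L x) -` ?Y"
    proof (intro set_eqI iffI)
      fix x assume x: "x \<in> co -` Pi\<^sub>E X A \<inter> space \<nu>"
      have "f j x / scal X j \<in> A j" if "j \<in> X" for j
        using x that PiE_mem[of "co x" X A j] by (simp add: co_def)
      then show "x \<in> (\<lambda>x. L0 + L x) -` ?Y" using pX by (simp only: vimage_eq mem_Collect_eq LL) blast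
    next
      fix x assume "x \<in> (\<lambda>x. L0 + L x) -` ?Y"
      then have "f (p a) x / scal X (p a) \<in> A (p a)" for a by (simp only: vimage_eq mem_Collect_eq LL)
      then have "f j x / scal X j \<in> A j" if "j \<in> X" for j
        using p that by (metis bij_betw_imp_surj_on imageE)
      then show "x \<in> co -` Pi\<^sub>E X A \<inter> space \<nu>"
        using Ap(2) by (auto simp: co_def sp sign_cone_def)
    qed
    have "emeasure P (Pi\<^sub>E X A) = ennreal (1 / c) * emeasure \<nu> (co -` Pi\<^sub>E X A \<inter> space \<nu>)"
      unfolding P_def using PA com by (simp add: emeasure_density_const emeasure_distr)
    also have "emeasure \<nu> (co -` Pi\<^sub>E X A \<inter> space \<nu>) = emeasure lborel (co -` Pi\<^sub>E X A \<inter> space \<nu>)"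
      unfolding \<nu>_def using cm by (intro emeasure_restrict_space) (auto simp: space_restrict_space)
    also have "\<dots> = ennreal c * emeasure lborel ?Y"
      unfolding pre by (rule c(2)[OF Ym])
    also have "ennreal (1 / c) * (ennreal c * emeasure lborel ?Y) = emeasure lborel ?Y"
      using c(1) by (simp add: mult.assoc[symmetric] ennreal_mult'[symmetric])
    also have "\<dots> = (\<Prod>a\<in>UNIV. emeasure lborel (A (p a)))"
      by (rule emeasure_lborel_vec_prod) (rule Ap(1)[OF pX])
    also have "\<dots> = (\<Prod>j\<in>X. emeasure lborel (A j))"
      by (rule prod.reindex_bij_betw[OF p])
    also have "\<dots> = (\<Prod>j\<in>X. emeasure pos_measure (A j))"
      using A by (intro prod.cong refl) (simp add: emeasure_pos_measure)
    finally show "emeasure P (Pi\<^sub>E X A) = (\<Prod>i\<in>X. emeasure pos_measure (A i))" .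
  qed
  show ?thesis
  proof (rule that[OF c(1)])
    fix h v and g :: "real^'k \<Rightarrow> complex"
    assume h: "has_bochner_integral ?PM h v" and g: "\<And>x. x \<in> sign_cone X \<Longrightarrow> g x = h (\<lambda>j\<in>X. f j x / scal X j)"
    have hm: "h \<in> borel_measurable ?PM" using h by (rule borel_measurable_has_bochner_integral)
    have "has_bochner_integral P h v" using h \<open>P = ?PM\<close> by simp
    then have "has_bochner_integral (distr \<nu> ?PM co) (\<lambda>a. (1 / c) *\<^sub>R h a) v"
      unfolding P_def using hm c(1)
      by (simp add: has_bochner_integral_iff integrable_density integral_density)
    then have "has_bochner_integral \<nu> (\<lambda>x. (1 / c) *\<^sub>R h (co x)) v"
      using hm com by (simp add: has_bochner_integral_iff integrable_distr_eq integral_distr)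
    then have "has_bochner_integral \<nu> (\<lambda>x. c *\<^sub>R ((1 / c) *\<^sub>R h (co x))) (c *\<^sub>R v)"
      by (rule has_bochner_integral_scaleR_right)
    then have "has_bochner_integral \<nu> (\<lambda>x. h (co x)) (c *\<^sub>R v)"
      using c(1) by simp
    then have "has_bochner_integral \<nu> g (c *\<^sub>R v)"
      using g by (subst has_bochner_integral_cong[OF refl _ refl, of _ _ "\<lambda>x. h (co x)"]) (auto simp: sp co_def)
    then show "has_bochner_integral lborel (\<lambda>x. indicator (sign_cone X) x *\<^sub>R g x) (c *\<^sub>R v)"
      unfolding \<nu>_def using cm by (simp add: has_bochner_integral_iff integrable_restrict_space integral_restrict_space)
  qed
qed

end

section \<open>The integrals over rotated cones\<close>

lemma (in laplace_cone) Eh_integral: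
  assumes "admissible \<eta> \<mu> \<rho>" "\<forall>i\<in>X. 0 < \<beta> i"
  shows "has_bochner_integral PM (\<lambda>a. exp (of_real (\<Sum>i\<in>X. \<beta> i) * Ln \<rho>) * T \<beta> \<gamma> (\<mu> * \<rho>) \<rho> a) (Eh \<eta> \<beta> \<gamma> \<mu>)"
proof -
  have "0 < Re (\<mu> * \<rho>)" "Im \<rho> \<noteq> 0 \<or> \<rho> = 0" using assms(1) by (auto simp: admissible_def)
  then have "has_bochner_integral PM (T \<beta> \<gamma> (\<mu> * \<rho>) \<rho>) (E \<beta> \<gamma> (\<mu> * \<rho>) \<rho>)"
    unfolding E_def by (intro has_bochner_integral_integrable integrable_T assms(2))
  then show ?thesis
    unfolding Eh_eq[OF assms] Es_def by (rule has_bochner_integral_mult_right)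
qed

text \<open>The plane slit along the closed ray
  \<open>{\<mu>. Re \<mu> = 0 \<and> 0 \<le> \<eta> * Im \<mu>}\<close>, described by the existence
  of an admissible direction.\<close>

definition cut_plane :: "real \<Rightarrow> complex set" where
  "cut_plane \<eta> = {\<mu>. \<exists>s. 0 < \<eta> * Im s \<and> 0 < Re (\<mu> * s)}"

definition half_circle :: "real \<Rightarrow> complex set" where
  "half_circle \<eta> = {\<rho>. cmod \<rho> = 1 \<and> 0 < \<eta> * Im \<rho>}"

lemma cut_plane_arc:
  assumes "\<mu> \<in> cut_plane \<eta>"
  obtains \<rho> where "\<rho> \<in> half_circle \<eta>" "0 < Re (\<mu> * \<rho>)"
proof -
  obtain s where s: "0 < \<eta> * Im s" "0 < Re (\<mu> * s)" using assms by (auto simp: cut_plane_def)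
  define \<rho> where "\<rho> = of_real (1 / cmod s) * s"
  have "s \<noteq> 0" using s by auto
  then have "cmod \<rho> = 1" by (simp add: \<rho>_def norm_mult norm_divide)
  moreover have "\<eta> * Im \<rho> = (1 / cmod s) * (\<eta> * Im s)" by (simp add: \<rho>_def)
  moreover have "Re (\<mu> * \<rho>) = (1 / cmod s) * Re (\<mu> * s)" by (simp add: \<rho>_def algebra_simps diff_divide_distrib)
  ultimately show ?thesis
    using s \<open>s \<noteq> 0\<close> by (intro that[of \<rho>]) (simp_all add: half_circle_def)
qed

section \<open>Complexified forms and the half-circle of directions\<close>

lemma cext_line:
  fixes g :: "real^'k \<Rightarrow> real"
  assumes "linear (lin_part g)"
  shows "cext g (cvec p + \<rho> *s cvec v) = of_real (g p) + \<rho> * of_real (lin_part g v)"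
proof -
  have 1: "(\<chi> i. Re ((cvec p + \<rho> *s cvec v) $ i)) = p + Re \<rho> *\<^sub>R v"
    "(\<chi> i. Im ((cvec p + \<rho> *s cvec v) $ i)) = Im \<rho> *\<^sub>R v"
    by (simp_all add: vec_eq_iff cvec_def)
  have "g (p + Re \<rho> *\<^sub>R v) = g p + Re \<rho> * lin_part g v"
    using linear_add[OF assms, of p "Re \<rho> *\<^sub>R v"] linear_cmul[OF assms, of "Re \<rho>" v]
    by (simp add: lin_part_def)
  moreover have "lin_part g (Im \<rho> *\<^sub>R v) = Im \<rho> * lin_part g v"
    using linear_cmul[OF assms, of "Im \<rho>" v] by simp
  ultimately show ?thesis
    unfolding cext_def 1 by (simp add: complex_eq_iff)
qed

lemma continuous_on_cext:
  fixes g :: "real^'k \<Rightarrow> real"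
  assumes "linear (lin_part g)"
  shows "continuous_on S (cext g)"
proof -
  have cl: "continuous_on A (lin_part g)" for A
    using linear_continuous_on[OF linear_conv_bounded_linear[THEN iffD1, OF assms]] .
  have 1: "cext g z = of_real (g 0) + of_real (lin_part g (\<chi> i. Re (z $ i))) + \<i> * of_real (lin_part g (\<chi> i. Im (z $ i)))" for z
    unfolding cext_def by (simp add: complex_eq_iff lin_part_def)
  have "continuous_on S (\<lambda>z. lin_part g (\<chi> i. Re (z $ i)))" "continuous_on S (\<lambda>z. lin_part g (\<chi> i. Im (z $ i)))"
    by (intro continuous_on_compose2[OF cl[of UNIV]] continuous_on_vec_lambda continuous_intros; simp)+
  then show ?thesis unfolding 1[abs_def] by (intro continuous_intros)
qed

lemma det_complex_of_real:
  "det (\<chi> a b. complex_of_real (A $ a $ b)) = of_real (det A)"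
  by (simp add: det_def)

lemma det_scale:
  fixes A :: "complex^'k^'k"
  shows "det (\<chi> a b. c * A $ a $ b) = c ^ CARD('k) * det A"
proof -
  have "det (\<chi> a. c *s A $ a) = (\<Prod>a\<in>(UNIV :: 'k set). c) * det (\<chi> a. A $ a)"
    by (rule det_rows_mul)
  moreover have "(\<chi> a. c *s A $ a) = (\<chi> a b. c * A $ a $ b)" by (simp add: vec_eq_iff)
  moreover have "(\<chi> a. A $ a) = A" by (simp add: vec_eq_iff)
  ultimately show ?thesis by simp
qed

lemma arc_connected:
  assumes "\<eta> = 1 \<or> \<eta> = - 1"
  shows "connected (half_circle \<eta>)"
proof -
  have "half_circle \<eta> = (\<lambda>t. cis (\<eta> * t)) ` {0<..<pi}"
  proof (intro set_eqI iffI)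
    fix \<rho> assume "\<rho> \<in> half_circle \<eta>"
    then have \<rho>: "cmod \<rho> = 1" "0 < \<eta> * Im \<rho>" by (auto simp: half_circle_def)
    have e: "\<rho> = cis (Arg \<rho>)" using \<rho>(1) by (simp add: cis_Arg complex_norm_eq_1_exp) (metis \<rho>(1) cis_Arg complex_sgn_def div_by_1 inverse_1 norm_zero scaleR_one zero_neq_one)
    have "\<eta> * Arg \<rho> \<in> {0<..<pi}"
    proof (cases "\<eta> = 1")
      case True
      then have "0 < Im \<rho>" using \<rho> by simp
      then show ?thesis using True Arg_lt_pi by auto
    next
      case False
      then have "\<eta> = - 1" "Im \<rho> < 0" using assms \<rho> by auto
      then show ?thesis using Arg_neg_iff[of \<rho>] Arg_bounded[of \<rho>] \<rho> by auto
    qed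
    moreover have eq: "\<eta> * (\<eta> * Arg \<rho>) = Arg \<rho>" using assms by auto
    have "\<rho> = cis (\<eta> * (\<eta> * Arg \<rho>))" unfolding eq by (rule e)
    ultimately show "\<rho> \<in> (\<lambda>t. cis (\<eta> * t)) ` {0<..<pi}" by (rule rev_image_eqI)
  next
    fix \<rho> assume "\<rho> \<in> (\<lambda>t. cis (\<eta> * t)) ` {0<..<pi}"
    then show "\<rho> \<in> half_circle \<eta>" using assms sin_gt_zero by (auto simp: half_circle_def)
  qed
  also have "connected \<dots>"
    by (intro connected_continuous_image continuous_intros) auto
  finally show ?thesis .
qed

text \<open>This makes limits at 1 along the half-circle unique, so the prescribed real limit really
  pins down the branch.\<close>

lemma arc_nontrivial:
  assumes "\<eta> = 1 \<or> \<eta> = - 1"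
  shows "at 1 within half_circle \<eta> \<noteq> bot"
proof -
  have "filterlim (\<lambda>t. cis (\<eta> * t)) (at 1 within half_circle \<eta>) (at_right 0)"
    unfolding filterlim_at
  proof
    have "eventually (\<lambda>t. t \<in> {0<..<pi}) (at_right (0::real))"
      by (rule eventually_at_right_real) simp
    then show "\<forall>\<^sub>F t in at_right 0. cis (\<eta> * t) \<in> half_circle \<eta> \<and> cis (\<eta> * t) \<noteq> 1"
    proof eventually_elim
      case (elim t)
      then have "sin t > 0" using sin_gt_zero by auto
      then have "0 < \<eta> * Im (cis (\<eta> * t))" using assms by auto
      moreover from this have "Im (cis (\<eta> * t)) \<noteq> 0" by auto
      then have "cis (\<eta> * t) \<noteq> 1" by (metis one_complex.sel(2))
      ultimately show ?case by (simp add: half_circle_def)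
    qed
    have "((\<lambda>t. cis (\<eta> * t)) \<longlongrightarrow> cis (\<eta> * 0)) (at_right 0)" by (intro tendsto_intros)
    then show "((\<lambda>t. cis (\<eta> * t)) \<longlongrightarrow> 1) (at_right 0)" by simp
  qed
  then have "eventually (\<lambda>_. False) (at 1 within half_circle \<eta>) \<Longrightarrow> eventually (\<lambda>_. False) (at_right (0::real))"
    unfolding filterlim_iff by blast
  then show ?thesis unfolding eventually_False using trivial_limit_at_right_real[of 0] by blast
qed

context arrangement
begin

abbreviation off :: "nat set \<Rightarrow> nat set" where "off X \<equiv> {1..N} - X"

lemma laplace_cone_at: "X \<in> vertices CARD('k) N \<Longrightarrow> laplace_cone X (off X)"
  using vertexD[of X] by unfold_locales auto

definition cone_fun :: "real \<Rightarrow> nat set \<Rightarrow> (nat \<Rightarrow> real) \<Rightarrow> (nat \<Rightarrow> real) \<Rightarrow> complex \<Rightarrow> complex" where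
  "cone_fun \<eta> X = laplace_cone.Eh X (off X) (slope X) \<eta>"

text \<open>
  Up to a constant depending only on \<open>X\<close>, \<open>red_int \<eta> X Z\<close> is the integral over the cone at \<open>X\<close> of \<open>exp (- \<mu> * f0)\<close> times the product of the powers
  of the forms, divided by \<open>f j\<close> for \<open>j \<in> Z\<close>.  Besides the vertices, sets \<open>Z\<close> with one element fewer
  occur in the contiguity relations.
\<close>

definition edge_exp :: "nat set \<Rightarrow> nat set \<Rightarrow> nat \<Rightarrow> real" where
  "edge_exp X Z i = (if i \<in> X then \<alpha> i + (if i \<in> Z then 0 else 1) else 0)"

text \<open>The asymmetry with \<open>edge_exp\<close> stems from \<open>T\<close>, where a
  coordinate carries the power \<open>\<beta> i - 1\<close> and a factor \<open>1 + s * t\<close>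
  the power \<open>\<gamma> j\<close> itself.\<close>

definition face_exp :: "nat set \<Rightarrow> nat set \<Rightarrow> nat \<Rightarrow> real" where
  "face_exp X Z j = (if j \<in> X then 0 else \<alpha> j - (if j \<in> Z then 1 else 0))"

definition inv_scal :: "nat set \<Rightarrow> nat set \<Rightarrow> real" where
  "inv_scal X Z = 1 / (\<Prod>j\<in>Z. scal X j)"

definition red_int :: "real \<Rightarrow> nat set \<Rightarrow> nat set \<Rightarrow> complex \<Rightarrow> complex" where
  "red_int \<eta> X Z \<mu> = of_real (inv_scal X Z) * exp (- \<mu> * of_real (f0 (pt X))) * cone_fun \<eta> X (edge_exp X Z) (face_exp X Z) \<mu>"

section \<open>The branch over the rotated cones\<close>

definition branch_const :: "nat set \<Rightarrow> real" where
  "branch_const X = (\<Prod>j\<in>{1..N}. \<bar>scal X j\<bar> powr \<alpha> j)"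

lemma branch_const_pos: "X \<in> vertices CARD('k) N \<Longrightarrow> branch_const X > 0"
  unfolding branch_const_def using scal_nz by (intro prod_pos) auto

lemma edge_exp_pos: "X \<in> vertices CARD('k) N \<Longrightarrow> \<forall>i\<in>X. 0 < edge_exp X Z i"
  using \<alpha>_pos vertex_index[of X] by (auto simp: edge_exp_def add_pos_nonneg)

text \<open>Division by \<open>scal X j\<close> makes the forms positive on the domain at
  \<open>X\<close> and keeps them off the closed negative half-line over the rotated cones, so
  principal logarithms give the continuation that is real on the domain.\<close>

definition expl_branch :: "nat set \<Rightarrow> complex^'k \<Rightarrow> complex" where
  "expl_branch X z = of_real (branch_const X) * exp (\<Sum>j\<in>{1..N}. of_real (\<alpha> j) * Ln (cext (f j) z / of_real (scal X j)))"

definition swept_cone :: "real \<Rightarrow> nat set \<Rightarrow> (complex^'k) set" where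
  "swept_cone \<eta> X = (\<Union>\<rho>\<in>half_circle \<eta>. rot_cone f f0 X \<rho>)"

lemma sign_cone_eq_cone_point: "X \<in> vertices CARD('k) N \<Longrightarrow> sign_cone X = cone_point X ` {a. \<forall>j\<in>X. 0 < a j}"
proof (intro set_eqI iffI)
  fix x assume X: "X \<in> vertices CARD('k) N" and x: "x \<in> sign_cone X"
  then show "x \<in> cone_point X ` {a. \<forall>j\<in>X. 0 < a j}"
    using cone_point_coord[OF X, of x] by (intro image_eqI[of _ _ "\<lambda>j. f j x / scal X j"]) (auto simp: sign_cone_def)
qed (use cone_point_in_sign_cone in auto)

lemma swept_cone_eq:
  assumes X: "X \<in> vertices CARD('k) N"
  shows "swept_cone \<eta> X = (\<lambda>(\<rho>, x). rot f X \<rho> x) ` (half_circle \<eta> \<times> sign_cone X)"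
proof -
  have "rot_cone f f0 X \<rho> = rot f X \<rho> ` sign_cone X" for \<rho>
    unfolding sign_cone_eq_cone_point[OF X] rot_cone_def image_image by (auto simp: rot_def cone_point_def)
  then show ?thesis by (auto simp: swept_cone_def)
qed

lemma cext_rot:
  assumes X: "X \<in> vertices CARD('k) N" and j: "j \<in> {1..N}"
  shows "cext (f j) (rot f X \<rho> x) = of_real (f j (pt X)) + \<rho> * of_real (f j x - f j (pt X))"
proof -
  have "l j (x - pt X) = f j x - f j (pt X)" using f_add[OF j, of "pt X" "x - pt X"] by simp
  then show ?thesis unfolding rot_def using cext_line[OF linear_l[OF j], of "pt X" \<rho> "x - pt X"] by simp
qed

definition face_ratio :: "nat set \<Rightarrow> complex \<Rightarrow> (nat \<Rightarrow> real) \<Rightarrow> nat \<Rightarrow> complex" where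
  "face_ratio X \<rho> a j = (if j \<in> X then \<rho> * of_real (a j) else 1 + \<rho> * of_real (\<Sum>i\<in>X. slope X j i * a i))"

lemma cext_face_ratio:
  assumes X: "X \<in> vertices CARD('k) N" and j: "j \<in> {1..N}"
  shows "cext (f j) (rot f X \<rho> (cone_point X a)) = of_real (scal X j) * face_ratio X \<rho> a j"
proof (cases "j \<in> X")
  case True
  then show ?thesis using f_cone_point_in[OF X True, of a] X by (simp add: cext_rot[OF X j] face_ratio_def)
next
  case False
  then have "j \<in> {1..N} - X" using j by blast
  have "scal X j = f j (pt X)" using False by (simp add: scal_def)
  then show ?thesis using False unfolding cext_rot[OF X j] f_cone_point_out[OF X \<open>j \<in> {1..N} - X\<close>]
    by (simp add: face_ratio_def algebra_simps)
qed

lemma face_ratio_nonpos: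
  assumes "\<rho> \<in> half_circle \<eta>" "\<forall>i\<in>X. 0 < a i"
  shows "face_ratio X \<rho> a j \<notin> \<real>\<^sub>\<le>\<^sub>0"
proof (cases "j \<in> X")
  case True
  have "Im \<rho> \<noteq> 0" using assms(1) by (auto simp: half_circle_def)
  moreover have "a j > 0" using assms(2) True by blast
  ultimately show ?thesis using True by (simp add: face_ratio_def complex_nonpos_Reals_iff)
next
  case False
  have "Im \<rho> \<noteq> 0 \<or> \<rho> = 0" using assms(1) by (auto simp: half_circle_def)
  from one_plus_notin_nonpos_Reals[OF this, of "\<Sum>i\<in>X. slope X j i * a i"] show ?thesis using False by (simp add: face_ratio_def)
qed

lemma cext_ratio:
  assumes X: "X \<in> vertices CARD('k) N" and j: "j \<in> {1..N}" and z: "z \<in> swept_cone \<eta> X"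
  shows "cext (f j) z / of_real (scal X j) \<notin> \<real>\<^sub>\<le>\<^sub>0"
proof -
  obtain \<rho> a where za: "\<rho> \<in> half_circle \<eta>" "\<forall>i\<in>X. 0 < a i" "z = rot f X \<rho> (cone_point X a)"
    using z unfolding swept_cone_eq[OF X] sign_cone_eq_cone_point[OF X] by auto
  then show ?thesis using cext_face_ratio[OF X j, of \<rho> a] face_ratio_nonpos[OF za(1,2)] scal_nz[OF X j] by simp
qed

lemma expl_branch_limit:
  assumes X: "X \<in> vertices CARD('k) N" and x: "x \<in> sign_domain X"
  shows "((\<lambda>\<rho>. expl_branch X (rot f X \<rho> x)) \<longlongrightarrow> of_real (\<Prod>j\<in>{1..N}. \<bar>f j x\<bar> powr \<alpha> j)) (at 1 within A)"
proof -
  have pos: "0 < f j x / scal X j" if "j \<in> {1..N}" for j using x that by (auto simp: sign_domain_def)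
  have t: "((\<lambda>\<rho>. Ln (cext (f j) (rot f X \<rho> x) / of_real (scal X j))) \<longlongrightarrow> Ln (of_real (f j x / scal X j))) (at 1 within A)"
    if j: "j \<in> {1..N}" for j
  proof -
    have "((\<lambda>\<rho>. (of_real (f j (pt X)) + \<rho> * of_real (f j x - f j (pt X))) / of_real (scal X j)) \<longlongrightarrow>
        (of_real (f j (pt X)) + 1 * of_real (f j x - f j (pt X))) / complex_of_real (scal X j)) (at 1 within A)"
      using scal_nz[OF X j] by (intro tendsto_intros) auto
    then have "((\<lambda>\<rho>. cext (f j) (rot f X \<rho> x) / of_real (scal X j)) \<longlongrightarrow> of_real (f j x / scal X j)) (at 1 within A)"
      by (simp add: cext_rot[OF X j])
    moreover have "complex_of_real (f j x / scal X j) \<notin> \<real>\<^sub>\<le>\<^sub>0"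
      using pos[OF j] by (simp only: complex_nonpos_Reals_iff Re_complex_of_real) simp
    ultimately show ?thesis by (intro tendsto_Ln)
  qed
  have "((\<lambda>\<rho>. expl_branch X (rot f X \<rho> x)) \<longlongrightarrow>
      of_real (branch_const X) * exp (\<Sum>j\<in>{1..N}. of_real (\<alpha> j) * Ln (of_real (f j x / scal X j)))) (at 1 within A)"
    unfolding expl_branch_def by (intro tendsto_intros t)
  also have "of_real (branch_const X) * exp (\<Sum>j\<in>{1..N}. of_real (\<alpha> j) * Ln (of_real (f j x / scal X j))) =
      complex_of_real (\<Prod>j\<in>{1..N}. \<bar>f j x\<bar> powr \<alpha> j)"
  proof -
    have "exp (\<Sum>j\<in>{1..N}. of_real (\<alpha> j) * Ln (of_real (f j x / scal X j))) =
        (\<Prod>j\<in>{1..N}. exp (complex_of_real (\<alpha> j * ln (f j x / scal X j))))"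
      unfolding exp_sum[OF finite_atLeastAtMost]
    proof (rule prod.cong[OF refl])
      fix j assume "j \<in> {1..N}"
      then show "exp (of_real (\<alpha> j) * Ln (of_real (f j x / scal X j))) = exp (complex_of_real (\<alpha> j * ln (f j x / scal X j)))"
        using Ln_of_real[OF pos] by (simp only: of_real_mult)
    qed
    also have "\<dots> = of_real (\<Prod>j\<in>{1..N}. (f j x / scal X j) powr \<alpha> j)"
    proof -
      have "exp (complex_of_real (\<alpha> j * ln (f j x / scal X j))) = of_real ((f j x / scal X j) powr \<alpha> j)" if "j \<in> {1..N}" for j
        using pos[OF that] unfolding powr_def exp_of_real by auto
      then show ?thesis unfolding of_real_prod by (intro prod.cong refl)
    qed
    finally have "of_real (branch_const X) * exp (\<Sum>j\<in>{1..N}. of_real (\<alpha> j) * Ln (of_real (f j x / scal X j))) =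
       complex_of_real ((\<Prod>j\<in>{1..N}. \<bar>scal X j\<bar> powr \<alpha> j) * (\<Prod>j\<in>{1..N}. (f j x / scal X j) powr \<alpha> j))"
      by (simp only: branch_const_def of_real_mult)
    also have "(\<Prod>j\<in>{1..N}. \<bar>scal X j\<bar> powr \<alpha> j) * (\<Prod>j\<in>{1..N}. (f j x / scal X j) powr \<alpha> j) = (\<Prod>j\<in>{1..N}. \<bar>f j x\<bar> powr \<alpha> j)"
      unfolding prod.distrib[symmetric]
    proof (rule prod.cong[OF refl])
      fix j assume j: "j \<in> {1..N}"
      have "\<bar>scal X j\<bar> * (f j x / scal X j) = \<bar>f j x\<bar>"
        using pos[OF j] scal_nz[OF X j] by (auto simp: abs_if zero_less_divide_iff)
      then show "\<bar>scal X j\<bar> powr \<alpha> j * (f j x / scal X j) powr \<alpha> j = \<bar>f j x\<bar> powr \<alpha> j"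
        using pos[OF j] by (metis abs_ge_zero less_imp_le powr_mult)
    qed
    finally show ?thesis .
  qed
  finally show ?thesis .
qed

lemma continuous_on_log:
  assumes X: "X \<in> vertices CARD('k) N" and j: "j \<in> {1..N}"
  shows "continuous_on (swept_cone \<eta> X) (\<lambda>z. Ln (cext (f j) z / of_real (scal X j)) + Ln (of_real (scal X j)))"
proof -
  have "continuous_on (swept_cone \<eta> X) (\<lambda>z. cext (f j) z / of_real (scal X j))"
    by (rule continuous_on_divide[OF continuous_on_cext[OF linear_l[OF j]] continuous_on_const])
       (use scal_nz[OF X j] in simp)
  then have "continuous_on (swept_cone \<eta> X) (\<lambda>z. Ln (cext (f j) z / of_real (scal X j)))"
    by (rule continuous_on_Ln') (rule cext_ratio[OF X j])
  then show ?thesis by (intro continuous_on_add continuous_on_const)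
qed

lemma exp_log:
  assumes X: "X \<in> vertices CARD('k) N" and j: "j \<in> {1..N}" and z: "z \<in> swept_cone \<eta> X"
  shows "exp (Ln (cext (f j) z / of_real (scal X j)) + Ln (of_real (scal X j))) = cext (f j) z"
proof -
  have "cext (f j) z / of_real (scal X j) \<noteq> 0" using cext_ratio[OF X j z] by (metis nonpos_Reals_zero_I)
  then show ?thesis using scal_nz[OF X j] by (simp add: exp_add)
qed

lemma is_branch_expl_branch:
  assumes X: "X \<in> vertices CARD('k) N"
  shows "is_branch N f \<alpha> f0 (half_circle \<eta>) X (expl_branch X)"
  unfolding is_branch_def swept_cone_def[symmetric] vertex_domain_eq(1)[OF X]
proof (intro conjI ballI)
  let ?M = "\<lambda>j z. Ln (cext (f j) z / of_real (scal X j)) + Ln (of_real (scal X j))"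
  let ?c = "of_real (branch_const X) / exp (\<Sum>j\<in>{1..N}. of_real (\<alpha> j) * Ln (of_real (scal X j)))"
  have "expl_branch X z = ?c * exp (\<Sum>j\<in>{1..N}. of_real (\<alpha> j) * ?M j z)" for z
    by (simp add: expl_branch_def distrib_left sum.distrib exp_add)
  then show "\<exists>M c. (\<forall>j\<in>{1..N}. continuous_on (swept_cone \<eta> X) (M j) \<and> (\<forall>z\<in>swept_cone \<eta> X. exp (M j z) = cext (f j) z)) \<and>
      (\<forall>z\<in>swept_cone \<eta> X. expl_branch X z = c * exp (\<Sum>j\<in>{1..N}. of_real (\<alpha> j) * M j z))"
    using continuous_on_log[OF X] exp_log[OF X] by (intro exI[of _ ?M] exI[of _ ?c]) blast
qed (rule expl_branch_limit[OF X])

lemma connected_swept_cone: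
  assumes X: "X \<in> vertices CARD('k) N" and \<eta>: "\<eta> = 1 \<or> \<eta> = - 1"
  shows "connected (swept_cone \<eta> X)"
proof -
  have "X \<subseteq> {1..N}" using vertexD[OF X] by blast
  moreover have "sign_cone X \<noteq> {}" using cone_point_in_sign_cone[OF X, of "\<lambda>_. 1"] by auto
  ultimately have "sign_cone X \<in> components (- (\<Union>j\<in>X. hyp f j))"
    unfolding sign_cone_def by (intro sign_region_component[OF X]) auto
  then have "connected (sign_cone X)" by (rule in_components_connected)
  then have "connected (half_circle \<eta> \<times> sign_cone X)" using arc_connected[OF \<eta>] by (rule connected_Times[rotated])
  moreover have "continuous_on (half_circle \<eta> \<times> sign_cone X) (\<lambda>(\<rho>, x). rot f X \<rho> x)"
    unfolding rot_def cvec_def vector_scalar_mult_def case_prod_unfold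
    by (intro continuous_intros continuous_on_vec_lambda)
  ultimately show ?thesis unfolding swept_cone_eq[OF X] by (rule connected_continuous_image[rotated])
qed

text \<open>Two continuous logarithms of one function on a connected set differ by a constant, so
  every branch is a constant multiple of the explicit one. The limit at a point of the domain at
  \<open>X\<close> shows that the multiple is 1, and the choice made in \<open>branch\<close> has no
  effect on the swept cone.\<close>

lemma branch_eq:
  assumes X: "X \<in> vertices CARD('k) N" and \<eta>: "\<eta> = 1 \<or> \<eta> = - 1" and z: "z \<in> swept_cone \<eta> X"
  shows "branch N f \<alpha> f0 (half_circle \<eta>) X z = expl_branch X z"
proof -
  define \<Phi> where "\<Phi> = branch N f \<alpha> f0 (half_circle \<eta>) X"
  have "is_branch N f \<alpha> f0 (half_circle \<eta>) X \<Phi>"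
    unfolding \<Phi>_def branch_def using someI[of "is_branch N f \<alpha> f0 (half_circle \<eta>) X", OF is_branch_expl_branch[OF X]] .
  then obtain M c where M: "\<And>j. j \<in> {1..N} \<Longrightarrow> continuous_on (swept_cone \<eta> X) (M j)"
      "\<And>j z. j \<in> {1..N} \<Longrightarrow> z \<in> swept_cone \<eta> X \<Longrightarrow> exp (M j z) = cext (f j) z"
    and \<Phi>: "\<And>z. z \<in> swept_cone \<eta> X \<Longrightarrow> \<Phi> z = c * exp (\<Sum>j\<in>{1..N}. of_real (\<alpha> j) * M j z)"
    and lim: "\<And>x. x \<in> sign_domain X \<Longrightarrow> ((\<lambda>\<rho>. \<Phi> (rot f X \<rho> x)) \<longlongrightarrow> of_real (\<Prod>j\<in>{1..N}. \<bar>f j x\<bar> powr \<alpha> j)) (at 1 within half_circle \<eta>)"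
    unfolding is_branch_def swept_cone_def[symmetric] vertex_domain_eq(1)[OF X] by blast
  define M0 where "M0 j z = Ln (cext (f j) z / of_real (scal X j)) + Ln (of_real (scal X j))" for j z
  have "(\<lambda>z. M j z - M0 j z) constant_on swept_cone \<eta> X" if j: "j \<in> {1..N}" for j
  proof (rule continuous_discrete_range_constant[OF connected_swept_cone[OF X \<eta>]])
    show "continuous_on (swept_cone \<eta> X) (\<lambda>z. M j z - M0 j z)"
      unfolding M0_def by (intro continuous_on_diff M j continuous_on_log[OF X])
    have int: "\<exists>n :: int. M j z - M0 j z = of_int (2 * n) * pi * \<i>" if "z \<in> swept_cone \<eta> X" for z
    proof -
      have "exp (M j z) = exp (M0 j z)" using M(2)[OF j that] exp_log[OF X j that] by (simp add: M0_def)
      then obtain n :: int where "M j z = M0 j z + (of_int (2 * n) * pi) * \<i>" unfolding exp_eq by blast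
      then show ?thesis by (intro exI[of _ n]) simp
    qed
    fix x assume x: "x \<in> swept_cone \<eta> X"
    show "\<exists>e>0. \<forall>y. y \<in> swept_cone \<eta> X \<and> M j y - M0 j y \<noteq> M j x - M0 j x \<longrightarrow> e \<le> cmod (M j y - M0 j y - (M j x - M0 j x))"
    proof (intro exI[of _ 1] conjI allI impI)
      fix y assume y: "y \<in> swept_cone \<eta> X \<and> M j y - M0 j y \<noteq> M j x - M0 j x"
      obtain m n :: int where mn: "M j y - M0 j y = of_int (2 * m) * pi * \<i>" "M j x - M0 j x = of_int (2 * n) * pi * \<i>"
        using int x y by blast
      have "m \<noteq> n" using y mn by auto
      then have "1 \<le> \<bar>real_of_int (m - n)\<bar>" by linarith
      then have "1 \<le> \<bar>real_of_int (m - n)\<bar> * (2 * pi)" using pi_gt3 mult_mono[of 1 "\<bar>real_of_int (m - n)\<bar>" 1 "2 * pi"] by simp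
      moreover have "M j y - M0 j y - (M j x - M0 j x) = of_real (real_of_int (m - n) * (2 * pi)) * \<i>"
        unfolding mn by (simp add: algebra_simps)
      ultimately show "1 \<le> cmod (M j y - M0 j y - (M j x - M0 j x))"
        by (simp only: norm_mult norm_of_real norm_ii abs_mult) simp
    qed simp
  qed
  then have "\<forall>j\<in>{1..N}. \<exists>d. \<forall>z\<in>swept_cone \<eta> X. M j z - M0 j z = d" unfolding constant_on_def by blast
  then obtain d where d: "\<And>j z. j \<in> {1..N} \<Longrightarrow> z \<in> swept_cone \<eta> X \<Longrightarrow> M j z - M0 j z = d j" by metis
  define C where "C = c * exp (\<Sum>j\<in>{1..N}. of_real (\<alpha> j) * (d j + Ln (of_real (scal X j)))) / of_real (branch_const X)"
  have eq: "\<Phi> z = C * expl_branch X z" if z: "z \<in> swept_cone \<eta> X" for z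
  proof -
    have "(\<Sum>j\<in>{1..N}. of_real (\<alpha> j) * M j z) = (\<Sum>j\<in>{1..N}. of_real (\<alpha> j) * (d j + Ln (of_real (scal X j)))
       + of_real (\<alpha> j) * Ln (cext (f j) z / of_real (scal X j)))"
    proof (rule sum.cong[OF refl])
      fix j assume j: "j \<in> {1..N}"
      have "M j z = d j + M0 j z" using d[OF j z] by (simp add: algebra_simps)
      then show "of_real (\<alpha> j) * M j z = of_real (\<alpha> j) * (d j + Ln (of_real (scal X j)))
       + of_real (\<alpha> j) * Ln (cext (f j) z / of_real (scal X j))" by (simp add: M0_def algebra_simps)
    qed
    then show ?thesis
      using \<Phi>[OF z] branch_const_pos[OF X] by (simp add: C_def expl_branch_def sum.distrib exp_add)
  qed
  obtain x where x: "x \<in> sign_domain X" using vertex_domain_eq(2)[OF X] by blast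
  have xc: "x \<in> sign_cone X" using x vertexD[OF X] by (auto simp: sign_domain_def sign_cone_def)
  define L where "L = complex_of_real (\<Prod>j\<in>{1..N}. \<bar>f j x\<bar> powr \<alpha> j)"
  have "L \<noteq> 0" using x unfolding L_def sign_domain_def by auto
  have "((\<lambda>\<rho>. C * expl_branch X (rot f X \<rho> x)) \<longlongrightarrow> C * L) (at 1 within half_circle \<eta>)"
    unfolding L_def by (intro tendsto_intros expl_branch_limit[OF X x])
  moreover have "\<forall>\<^sub>F \<rho> in at 1 within half_circle \<eta>. C * expl_branch X (rot f X \<rho> x) = \<Phi> (rot f X \<rho> x)"
    unfolding eventually_at_filter
  proof (rule always_eventually, intro allI impI)
    fix \<rho> assume "\<rho> \<in> half_circle \<eta>"
    then have "rot f X \<rho> x \<in> swept_cone \<eta> X" using xc unfolding swept_cone_eq[OF X] by auto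
    then show "C * expl_branch X (rot f X \<rho> x) = \<Phi> (rot f X \<rho> x)" using eq by simp
  qed
  ultimately have "((\<lambda>\<rho>. \<Phi> (rot f X \<rho> x)) \<longlongrightarrow> C * L) (at 1 within half_circle \<eta>)"
    by (rule Lim_transform_eventually)
  then have "C * L = L" using lim[OF x] arc_nontrivial[OF \<eta>] tendsto_unique unfolding L_def by blast
  then have "C = 1" using \<open>L \<noteq> 0\<close> by simp
  then show ?thesis using eq[OF z] by (simp add: \<Phi>_def)
qed

text \<open>The orientation enters once through the form and once through the integral. The two
  signs combine with that of the determinant into an absolute value.\<close>

lemma log_form_eq:
  assumes W: "W \<in> vertices CARD('k) N" and ori: "ori = 1 \<or> ori = - 1"
  shows "of_real ori * log_form f ori W z (\<lambda>b. \<rho> *s axis b 1) =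
    \<rho> ^ CARD('k) * of_real (abs_det W) / (\<Prod>j\<in>W. cext (f j) z)"
proof -
  define p where "p = (SOME p :: 'k \<Rightarrow> nat. bij_betw p UNIV W)"
  have "\<exists>p :: 'k \<Rightarrow> nat. bij_betw p UNIV W" using obtain_enum[OF W] by metis
  then have p: "bij_betw p UNIV W" unfolding p_def by (rule someI_ex)
  have pW: "p a \<in> {1..N}" for a using p vertex_index[OF W] by (auto simp: bij_betw_def)
  have "cext (l (p a)) (\<rho> *s axis b 1) = \<rho> * of_real (row_matrix p $ a $ b)" for a b
  proof -
    have ll: "lin_part (l (p a)) = l (p a)" by (simp add: lin_part_def fun_eq_iff)
    have cv: "cvec 0 = (0 :: complex^'k)" "cvec (axis b 1) = (axis b 1 :: complex^'k)"
      by (auto simp: cvec_def vec_eq_iff axis_def)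
    have "l (p a) 0 = 0" by (simp add: lin_part_def)
    then show ?thesis
      using cext_line[of "l (p a)" 0 \<rho> "axis b 1"] linear_l[OF pW[of a]] unfolding ll cv by (simp add: row_matrix_def)
  qed
  then have "det (\<chi> a b. cext (l (p a)) (\<rho> *s axis b 1)) = det (\<chi> a b. \<rho> * (\<chi> a b. complex_of_real (row_matrix p $ a $ b)) $ a $ b)"
    by simp
  also have "\<dots> = \<rho> ^ CARD('k) * of_real (det (row_matrix p))"
    unfolding det_scale det_complex_of_real ..
  finally have d: "det (\<chi> a b. cext (l (p a)) (\<rho> *s axis b 1)) = \<rho> ^ CARD('k) * of_real (det (row_matrix p))" .
  have pr: "(\<Prod>a\<in>UNIV. cext (f (p a)) z) = (\<Prod>j\<in>W. cext (f j) z)"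
    by (rule prod.reindex_bij_betw[OF p])
  have s: "ori * (sgn (ori * det (row_matrix p)) * det (row_matrix p)) = abs_det W"
    unfolding abs_det_eq[OF p] using ori by (auto simp: sgn_if)
  have "of_real ori * log_form f ori W z (\<lambda>b. \<rho> *s axis b 1) =
     \<rho> ^ CARD('k) * of_real (ori * (sgn (ori * det (row_matrix p)) * det (row_matrix p))) / (\<Prod>j\<in>W. cext (f j) z)"
    unfolding log_form_def Let_def p_def[symmetric] d pr row_matrix_def[symmetric] by simp
  then show ?thesis unfolding s .
qed

text \<open>All factors are exponentials of principal logarithms. A coordinate contributes
  \<open>Ln \<rho>\<close> with coefficient \<open>edge_exp X W i - 1\<close>, and the factor
  \<open>\<rho> ^ CARD('k)\<close> from the differential supplies the missing 1 for each coordinate,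
  which gives exactly the prefactor in \<open>Es\<close>.\<close>

lemma density_eq:
  assumes X: "X \<in> vertices CARD('k) N" and W: "W \<in> vertices CARD('k) N"
    and \<eta>: "\<eta> = 1 \<or> \<eta> = - 1" and ori: "ori = 1 \<or> ori = - 1"
    and \<rho>: "\<rho> \<in> half_circle \<eta>" and a: "\<forall>i\<in>X. 0 < a i"
  shows "pullback_density N f \<alpha> f0 ori (half_circle \<eta>) X W \<mu> \<rho> (cone_point X a) =
    of_real (branch_const X * abs_det W * inv_scal X W) * exp (- \<mu> * of_real (f0 (pt X))) *
    (exp (of_real (\<Sum>i\<in>X. edge_exp X W i) * Ln \<rho>) * laplace_cone.T X (off X) (slope X) (edge_exp X W) (face_exp X W) (\<mu> * \<rho>) \<rho> a)"
proof -
  interpret L: laplace_cone X "off X" "slope X" by (rule laplace_cone_at[OF X])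
  define z where "z = rot f X \<rho> (cone_point X a)"
  have zU: "z \<in> swept_cone \<eta> X" unfolding z_def swept_cone_eq[OF X] using \<rho> cone_point_in_sign_cone[OF X a] by auto
  have XN: "X \<subseteq> {1..N}" and WN: "W \<subseteq> {1..N}" and cX: "card X = CARD('k)" and fX: "finite X" and fW: "finite W"
    using vertexD[OF X] vertexD[OF W] by auto
  define q where "q = face_ratio X \<rho> a"
  have qn: "q j \<noteq> 0" for j
    using face_ratio_nonpos[OF \<rho> a, of j] unfolding q_def by (metis nonpos_Reals_zero_I)
  have fq: "cext (f j) z = of_real (scal X j) * q j" if "j \<in> {1..N}" for j
    unfolding z_def q_def by (rule cext_face_ratio[OF X that])
  have \<rho>0: "\<rho> \<noteq> 0" using \<rho> by (auto simp: half_circle_def)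
  have f0z: "cext f0 z = of_real (f0 (pt X)) + \<rho> * of_real (L.csum a)"
  proof -
    have lf: "lin_part f0 = f0" using linear_0[OF lin_f0] by (simp add: lin_part_def fun_eq_iff)
    have "f0 (cone_point X a - pt X) = L.csum a"
      using f0_cone_point[OF X, of a] by (simp add: linear_diff[OF lin_f0] L.csum_def)
    then show ?thesis
      using cext_line[of f0 "pt X" \<rho> "cone_point X a - pt X"] lin_f0 unfolding lf z_def rot_def by simp
  qed
  have \<Phi>: "branch N f \<alpha> f0 (half_circle \<eta>) X z = of_real (branch_const X) * exp (\<Sum>j\<in>{1..N}. of_real (\<alpha> j) * Ln (q j))"
  proof -
    have "cext (f j) z / of_real (scal X j) = q j" if "j \<in> {1..N}" for j
      using fq[OF that] scal_nz[OF X that] by simp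
    then show ?thesis unfolding branch_eq[OF X \<eta> zU] expl_branch_def by (auto intro!: sum.cong)
  qed
  have pr: "(\<Prod>j\<in>W. cext (f j) z) = (\<Prod>j\<in>W. of_real (scal X j)) * exp (\<Sum>j\<in>W. Ln (q j))"
    using WN qn by (simp add: exp_sum[OF fW] prod.distrib[symmetric] fq subset_iff)
  have \<rho>k: "\<rho> ^ CARD('k) = exp (\<Sum>i\<in>X. Ln \<rho>)"
    using \<rho>0 by (simp add: cX exp_of_nat_mult)
  have main: "\<rho> ^ CARD('k) * exp (\<Sum>j\<in>{1..N}. of_real (\<alpha> j) * Ln (q j)) / exp (\<Sum>j\<in>W. Ln (q j)) =
      exp (of_real (\<Sum>i\<in>X. edge_exp X W i) * Ln \<rho>) * of_real (\<Prod>i\<in>X. a i powr (edge_exp X W i - 1)) * L.ph (face_exp X W) \<rho> a"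
  proof -
    have split: "{1..N} = X \<union> off X" "X \<inter> off X = {}" using XN by auto
    have "(\<Sum>j\<in>W. Ln (q j)) = (\<Sum>j\<in>{1..N}. if j \<in> W then Ln (q j) else 0)"
      using WN by (simp add: sum.If_cases Int_absorb1)
    then have "(\<Sum>j\<in>{1..N}. of_real (\<alpha> j) * Ln (q j)) - (\<Sum>j\<in>W. Ln (q j)) =
      (\<Sum>j\<in>{1..N}. of_real (\<alpha> j - (if j \<in> W then 1 else 0)) * Ln (q j))"
      by (simp add: sum_subtractf[symmetric]) (intro sum.cong refl, simp add: algebra_simps)
    also have "\<dots> = (\<Sum>j\<in>X. of_real (\<alpha> j - (if j \<in> W then 1 else 0)) * Ln (q j)) +
       (\<Sum>j\<in>off X. of_real (\<alpha> j - (if j \<in> W then 1 else 0)) * Ln (q j))"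
      by (subst split(1), rule sum.union_disjoint) (use fX split in auto)
    also have "(\<Sum>j\<in>off X. of_real (\<alpha> j - (if j \<in> W then 1 else 0)) * Ln (q j)) =
       (\<Sum>j\<in>off X. of_real (face_exp X W j) * Ln (1 + \<rho> * of_real (L.lform j a)))"
      by (intro sum.cong refl) (auto simp: face_exp_def q_def face_ratio_def L.lform_def)
    also have "(\<Sum>j\<in>X. of_real (\<alpha> j - (if j \<in> W then 1 else 0)) * Ln (q j)) =
       (\<Sum>i\<in>X. of_real (edge_exp X W i) * Ln \<rho> + of_real ((edge_exp X W i - 1) * ln (a i))) - (\<Sum>i\<in>X. Ln \<rho>)"
      unfolding sum_subtractf[symmetric]
    proof (intro sum.cong refl)
      fix i assume i: "i \<in> X"
      \<comment> \<open>The factor \<open>a i\<close> is positive, so the principal logarithm of the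
        product splits without a jump.\<close>
      have m1: "Ln (q i) = of_real (ln (a i)) + Ln \<rho>"
        using i a \<rho>0 Ln_times_of_real[of "a i" \<rho>] by (simp add: q_def face_ratio_def mult.commute Ln_of_real)
      have m2: "\<alpha> i - (if i \<in> W then 1 else 0) = edge_exp X W i - 1" using i by (simp add: edge_exp_def)
      show "of_real (\<alpha> i - (if i \<in> W then 1 else 0)) * Ln (q i) =
         of_real (edge_exp X W i) * Ln \<rho> + of_real ((edge_exp X W i - 1) * ln (a i)) - Ln \<rho>"
        unfolding m1 m2 by (simp add: algebra_simps)
    qed
    finally have fin: "(\<Sum>j\<in>{1..N}. of_real (\<alpha> j) * Ln (q j)) - (\<Sum>j\<in>W. Ln (q j)) =
       (\<Sum>i\<in>X. of_real (edge_exp X W i) * Ln \<rho> + of_real ((edge_exp X W i - 1) * ln (a i))) - (\<Sum>i\<in>X. Ln \<rho>) +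
       (\<Sum>j\<in>off X. of_real (face_exp X W j) * Ln (1 + \<rho> * of_real (L.lform j a)))" .
    have sd: "(\<Sum>i\<in>X. of_real (edge_exp X W i) * Ln \<rho> + of_real ((edge_exp X W i - 1) * ln (a i))) =
       of_real (\<Sum>i\<in>X. edge_exp X W i) * Ln \<rho> + of_real (\<Sum>i\<in>X. (edge_exp X W i - 1) * ln (a i))"
      by (simp only: sum.distrib of_real_sum sum_distrib_right)
    have gen: "A - B = S - P + K \<Longrightarrow> P + A - B = S + K" for A B S P K :: complex
      by (simp add: algebra_simps)
    have "(\<Sum>i\<in>X. Ln \<rho>) + (\<Sum>j\<in>{1..N}. of_real (\<alpha> j) * Ln (q j)) - (\<Sum>j\<in>W. Ln (q j)) =
       of_real (\<Sum>i\<in>X. edge_exp X W i) * Ln \<rho> + of_real (\<Sum>i\<in>X. (edge_exp X W i - 1) * ln (a i)) +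
       (\<Sum>j\<in>off X. of_real (face_exp X W j) * Ln (1 + \<rho> * of_real (L.lform j a)))"
      using gen[OF fin] unfolding sd .
    then have "\<rho> ^ CARD('k) * exp (\<Sum>j\<in>{1..N}. of_real (\<alpha> j) * Ln (q j)) / exp (\<Sum>j\<in>W. Ln (q j)) =
       exp (of_real (\<Sum>i\<in>X. edge_exp X W i) * Ln \<rho>) * exp (of_real (\<Sum>i\<in>X. (edge_exp X W i - 1) * ln (a i))) *
       exp (\<Sum>j\<in>off X. of_real (face_exp X W j) * Ln (1 + \<rho> * of_real (L.lform j a)))"
      unfolding \<rho>k exp_add[symmetric] exp_diff[symmetric] by (rule arg_cong)
    moreover have "exp (complex_of_real (\<Sum>i\<in>X. (edge_exp X W i - 1) * ln (a i))) = of_real (\<Prod>i\<in>X. a i powr (edge_exp X W i - 1))"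
      unfolding exp_of_real exp_sum[OF fX] using a by (auto simp: powr_def intro!: prod.cong)
    ultimately show ?thesis by (simp only: L.ph_def)
  qed
  have "pullback_density N f \<alpha> f0 ori (half_circle \<eta>) X W \<mu> \<rho> (cone_point X a) =
     exp (- \<mu> * cext f0 z) * branch N f \<alpha> f0 (half_circle \<eta>) X z * (of_real ori * log_form f ori W z (\<lambda>b. \<rho> *s axis b 1))"
    unfolding pullback_density_def Let_def z_def by simp
  also have "\<dots> = exp (- \<mu> * cext f0 z) * (of_real (branch_const X) * of_real (abs_det W) * (1 / (\<Prod>j\<in>W. of_real (scal X j)))) *
     (\<rho> ^ CARD('k) * exp (\<Sum>j\<in>{1..N}. of_real (\<alpha> j) * Ln (q j)) / exp (\<Sum>j\<in>W. Ln (q j)))"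
    unfolding log_form_eq[OF W ori] \<Phi> pr by (simp add: field_simps)
  also have "exp (- \<mu> * cext f0 z) = exp (- \<mu> * of_real (f0 (pt X))) * exp (- (\<mu> * \<rho>) * of_real (L.csum a))"
    unfolding f0z exp_add[symmetric] by (simp add: algebra_simps)
  finally show ?thesis
    unfolding main L.T_def inv_scal_def by (simp add: mult_ac)
qed

text \<open>The order of quantifiers matters: \<open>c\<close> depends on \<open>X\<close> only. It
  therefore rescales a whole column, and it is the same for the plus and minus integrals, which are
  later compared through a common diagonal solution. Every admissible direction gives the same
  value, which resolves the definite description in \<open>cone_integral\<close>.\<close>

lemma integral_value:
  assumes X: "X \<in> vertices CARD('k) N"
  obtains c where "c > 0" "\<And>W \<eta> ori \<mu>. W \<in> vertices CARD('k) N \<Longrightarrow> \<eta> = 1 \<or> \<eta> = - 1 \<Longrightarrow> ori = 1 \<or> ori = - 1 \<Longrightarrow>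
    \<mu> \<in> cut_plane \<eta> \<Longrightarrow> cone_integral N f \<alpha> f0 ori (half_circle \<eta>) X \<mu> W = of_real (c * abs_det W) * red_int \<eta> X W \<mu>"
proof -
  interpret L: laplace_cone X "off X" "slope X" by (rule laplace_cone_at[OF X])
  show ?thesis
  proof (rule change_of_variables[OF X])
  fix c :: real
  assume c: "c > 0"
    "\<And>h v (g :: real^'k \<Rightarrow> complex). has_bochner_integral L.PM h v \<Longrightarrow>
      (\<And>x. x \<in> sign_cone X \<Longrightarrow> g x = h (\<lambda>j\<in>X. f j x / scal X j)) \<Longrightarrow>
      has_bochner_integral lborel (\<lambda>x. indicator (sign_cone X) x *\<^sub>R g x) (c *\<^sub>R v)"
  show thesis
  proof (rule that[of "c * branch_const X"])
    show "c * branch_const X > 0" using c(1) branch_const_pos[OF X] by simp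
    fix W and \<eta> ori :: real and \<mu> :: complex
    assume W: "W \<in> vertices CARD('k) N" and \<eta>: "\<eta> = 1 \<or> \<eta> = - 1" and ori: "ori = 1 \<or> ori = - 1" and \<mu>: "\<mu> \<in> cut_plane \<eta>"
    define v where "v = of_real (c * branch_const X * abs_det W) * red_int \<eta> X W \<mu>"
    have key: "has_bochner_integral lborel
        (\<lambda>x. indicator (vertex_cone f f0 X) x *\<^sub>R pullback_density N f \<alpha> f0 ori (half_circle \<eta>) X W \<mu> \<rho> x) v"
      if \<rho>: "\<rho> \<in> half_circle \<eta>" "0 < Re (\<rho> * \<mu>)" for \<rho>
    proof -
      have admissible: "L.admissible \<eta> \<mu> \<rho>" using \<rho> by (simp add: L.admissible_def half_circle_def mult.commute)
      define K0 where "K0 = of_real (branch_const X * abs_det W * inv_scal X W) * exp (- \<mu> * of_real (f0 (pt X)))"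
      have h: "has_bochner_integral L.PM
        (\<lambda>a. K0 * (exp (of_real (\<Sum>i\<in>X. edge_exp X W i) * Ln \<rho>) * L.T (edge_exp X W) (face_exp X W) (\<mu> * \<rho>) \<rho> a))
        (K0 * L.Eh \<eta> (edge_exp X W) (face_exp X W) \<mu>)"
        by (rule has_bochner_integral_mult_right, rule L.Eh_integral[OF admissible edge_exp_pos[OF X]])
      have "has_bochner_integral lborel
        (\<lambda>x. indicator (sign_cone X) x *\<^sub>R pullback_density N f \<alpha> f0 ori (half_circle \<eta>) X W \<mu> \<rho> x)
        (c *\<^sub>R (K0 * L.Eh \<eta> (edge_exp X W) (face_exp X W) \<mu>))"
      proof (rule c(2)[OF h])
        fix x assume x: "x \<in> sign_cone X"
        define a where "a = (\<lambda>j\<in>X. f j x / scal X j)"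
        have "cone_point X a = cone_point X (\<lambda>j. f j x / scal X j)" unfolding cone_point_def a_def by simp
        then have ax: "cone_point X a = x" using cone_point_coord[OF X] by simp
        have ap: "\<forall>i\<in>X. 0 < a i" using x by (simp add: a_def sign_cone_def)
        show "pullback_density N f \<alpha> f0 ori (half_circle \<eta>) X W \<mu> \<rho> x =
           K0 * (exp (of_real (\<Sum>i\<in>X. edge_exp X W i) * Ln \<rho>) *
             L.T (edge_exp X W) (face_exp X W) (\<mu> * \<rho>) \<rho> (\<lambda>j\<in>X. f j x / scal X j))"
          using density_eq[OF X W \<eta> ori \<rho>(1) ap, of \<mu>] unfolding K0_def a_def[symmetric] ax .
      qed
      moreover have "c *\<^sub>R (K0 * L.Eh \<eta> (edge_exp X W) (face_exp X W) \<mu>) = v"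
        by (simp add: v_def K0_def red_int_def cone_fun_def scaleR_conv_of_real)
      ultimately show ?thesis unfolding vertex_cone_eq[OF X] by simp
    qed
    obtain \<rho> where \<rho>: "\<rho> \<in> half_circle \<eta>" "0 < Re (\<mu> * \<rho>)" using cut_plane_arc[OF \<mu>] by metis
    have "cone_integral N f \<alpha> f0 ori (half_circle \<eta>) X \<mu> W = v"
      unfolding cone_integral_def
    proof (rule the_equality)
      fix u assume "\<forall>\<rho>\<in>half_circle \<eta>. 0 < Re (\<rho> * \<mu>) \<longrightarrow> has_bochner_integral lborel
        (\<lambda>x. indicator (vertex_cone f f0 X) x *\<^sub>R pullback_density N f \<alpha> f0 ori (half_circle \<eta>) X W \<mu> \<rho> x) u"
      then show "u = v"
        using key[of \<rho>] \<rho> has_bochner_integral_eq by (metis mult.commute)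
    qed (use key in blast)
    then show "cone_integral N f \<alpha> f0 ori (half_circle \<eta>) X \<mu> W = of_real (c * branch_const X * abs_det W) * red_int \<eta> X W \<mu>"
      by (simp add: v_def)
  qed
  qed
qed

end

section \<open>Contiguity relations\<close>

context arrangement
begin

lemma cut_plane_nz: "\<mu> \<in> cut_plane \<eta> \<Longrightarrow> \<mu> \<noteq> 0"
  by (auto simp: cut_plane_def)

lemma edge_exp_insert: "i \<in> X \<Longrightarrow> i \<notin> Z \<Longrightarrow> incr i (edge_exp X (insert i Z)) = edge_exp X Z"
  "i \<in> X \<Longrightarrow> i \<notin> Z \<Longrightarrow> edge_exp X (insert i Z) i = \<alpha> i"
  "i \<in> X \<Longrightarrow> face_exp X (insert i Z) = face_exp X Z"
  "r \<notin> X \<Longrightarrow> edge_exp X (insert r Z) = edge_exp X Z"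
  "r \<notin> X \<Longrightarrow> r \<notin> Z \<Longrightarrow> decr r (face_exp X Z) = face_exp X (insert r Z)"
  by (auto simp: incr_def decr_def edge_exp_def face_exp_def fun_eq_iff)

lemma inv_scal_insert: "finite U \<Longrightarrow> r \<notin> U \<Longrightarrow> inv_scal X (insert r U) = inv_scal X U / scal X r"
  by (simp add: inv_scal_def)

text \<open>
  Integration by parts along the direction \<open>edge W j\<close>, decomposed into the coordinate directions at \<open>X\<close>.
\<close>

lemma red_int_ibp:
  assumes X: "X \<in> vertices CARD('k) N" and W: "W \<in> vertices CARD('k) N" and j: "j \<in> W" and \<mu>: "\<mu> \<in> cut_plane \<eta>"
  shows "\<mu> * red_int \<eta> X (W - {j}) \<mu> =
    (\<Sum>r\<in>{1..N} - (W - {j}). of_real (\<alpha> r * l r (edge W j)) * red_int \<eta> X (insert r (W - {j})) \<mu>)"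
proof -
  interpret L: laplace_cone X "off X" "slope X" by (rule laplace_cone_at[OF X])
  obtain s where s: "L.admissible \<eta> \<mu> s" using \<mu> by (auto simp: cut_plane_def L.admissible_def)
  define U where "U = W - {j}"
  define e where "e = edge W j"
  have fX: "finite X" "X \<subseteq> {1..N}" and fU: "finite U" using vertexD[OF X] vertexD[OF W] by (auto simp: U_def)
  define EZ where "EZ Z = cone_fun \<eta> X (edge_exp X Z) (face_exp X Z) \<mu>" for Z
  define D where "D r = cone_fun \<eta> X (edge_exp X U) (decr r (face_exp X U)) \<mu>" for r
  \<comment> \<open>For \<open>i \<in> X\<close>, the coordinates of \<open>edge W j\<close> in the
    edge basis at \<open>X\<close>; these sum to 1 because \<open>f0\<close> is 1 on all edge
    vectors. The same formula is reused for indices outside \<open>X\<close>.\<close>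
  define c where "c i = l i e / scal X i" for i
  have leU: "l i e = 0" if "i \<in> U" for i using edge_props(2)[OF W j] that by (auto simp: U_def e_def)
  have c1: "(\<Sum>i\<in>X. c i) = 1"
  proof -
    have "(\<Sum>i\<in>X. c i) = (\<Sum>i\<in>X. l i e / l i (edge X i))" by (intro sum.cong) (auto simp: c_def scal_def)
    also have "\<dots> = f0 e" by (rule f0_expansion[OF X, symmetric])
    finally show ?thesis using edge_props(1)[OF W j] by (simp add: e_def)
  qed
  have ct: "(\<Sum>i\<in>X. c i * slope X r i) = l r e / scal X r" if r: "r \<in> off X" for r
  proof -
    have "(\<Sum>i\<in>X. c i * slope X r i) = (\<Sum>i\<in>X. l i e / l i (edge X i) * l r (edge X i)) / scal X r"
      unfolding sum_divide_distrib using r by (intro sum.cong) (auto simp: c_def scal_def slope_def)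
    also have "(\<Sum>i\<in>X. l i e / l i (edge X i) * l r (edge X i)) = l r e"
      using linear_expansion[OF X linear_l, of r e] r by simp
    finally show ?thesis .
  qed
  have ibp: "of_real (c i) * (\<mu> * EZ U) = of_real (c i * \<alpha> i) * EZ (insert i U)
      + (\<Sum>r\<in>off X. of_real (face_exp X U r) * of_real (c i * slope X r i) * D r)" if i: "i \<in> X - U" for i
  proof -
    have iX: "i \<in> X" "i \<notin> U" using i by auto
    from L.Eh_ibp[OF s edge_exp_pos[OF X] iX(1), of "insert i U" "face_exp X U"]
    have "\<mu> * EZ U = of_real (\<alpha> i) * EZ (insert i U) + (\<Sum>r\<in>off X. of_real (face_exp X U r * slope X r i) * D r)"
      unfolding EZ_def D_def cone_fun_def edge_exp_insert(1)[OF iX] edge_exp_insert(2)[OF iX] edge_exp_insert(3)[OF iX(1)] .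
    then show ?thesis by (simp add: distrib_left sum_distrib_left mult_ac)
  qed
  have "\<mu> * EZ U = of_real (\<Sum>i\<in>X. c i) * (\<mu> * EZ U)" by (simp add: c1)
  also have "\<dots> = (\<Sum>i\<in>X. of_real (c i) * (\<mu> * EZ U))" by (simp only: of_real_sum sum_distrib_right)
  \<comment> \<open>The direction \<open>edge W j\<close> is parallel to the hyperplanes in
    \<open>U\<close>, so those coordinates vanish. For the others, \<open>EZ U\<close> arises from
    \<open>EZ (insert i U)\<close> by raising the exponent of \<open>i\<close>, as integration by
    parts requires.\<close>
  also have "\<dots> = (\<Sum>i\<in>X - U. of_real (c i) * (\<mu> * EZ U))"
    using leU fX by (intro sum.mono_neutral_right) (auto simp: c_def)
  also have "\<dots> = (\<Sum>i\<in>X - U. of_real (c i * \<alpha> i) * EZ (insert i U))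
      + (\<Sum>i\<in>X - U. \<Sum>r\<in>off X. of_real (face_exp X U r) * of_real (c i * slope X r i) * D r)"
    unfolding sum.distrib[symmetric] by (rule sum.cong[OF refl]) (rule ibp)
  \<comment> \<open>The indices added back have \<open>c i = 0\<close>; over all of \<open>X\<close>
    the inner sums are given by \<open>ct\<close>.\<close>
  also have "(\<Sum>i\<in>X - U. \<Sum>r\<in>off X. of_real (face_exp X U r) * of_real (c i * slope X r i) * D r) =
     (\<Sum>i\<in>X. \<Sum>r\<in>off X. of_real (face_exp X U r) * of_real (c i * slope X r i) * D r)"
    using leU fX by (intro sum.mono_neutral_left) (auto simp: c_def)
  also have "\<dots> = (\<Sum>r\<in>off X. of_real (face_exp X U r) * of_real (\<Sum>i\<in>X. c i * slope X r i) * D r)"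
    by (subst sum.swap) (simp add: sum_distrib_left sum_distrib_right)
  also have "\<dots> = (\<Sum>r\<in>off X. of_real (face_exp X U r) * of_real (l r e / scal X r) * D r)"
    using ct by (intro sum.cong refl) simp
  also have "\<dots> = (\<Sum>r\<in>off X - U. of_real (face_exp X U r) * of_real (l r e / scal X r) * D r)"
    using leU by (intro sum.mono_neutral_right) auto
  also have "\<dots> = (\<Sum>r\<in>off X - U. of_real (c r * \<alpha> r) * EZ (insert r U))"
  proof (rule sum.cong[OF refl])
    fix r assume r: "r \<in> off X - U"
    then have "r \<notin> X" "r \<notin> U" by auto
    then show "of_real (face_exp X U r) * of_real (l r e / scal X r) * D r = of_real (c r * \<alpha> r) * EZ (insert r U)"
      unfolding D_def EZ_def edge_exp_insert(4)[OF \<open>r \<notin> X\<close>] edge_exp_insert(5)[OF \<open>r \<notin> X\<close> \<open>r \<notin> U\<close>]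
      by (simp add: c_def face_exp_def)
  qed
  also have "(\<Sum>i\<in>X - U. of_real (c i * \<alpha> i) * EZ (insert i U)) + (\<Sum>r\<in>off X - U. of_real (c r * \<alpha> r) * EZ (insert r U)) =
     (\<Sum>r\<in>{1..N} - U. of_real (c r * \<alpha> r) * EZ (insert r U))"
  proof -
    have "{1..N} - U = (X - U) \<union> (off X - U)" using fX by auto
    then show ?thesis using fX by (subst sum.union_disjoint[symmetric]) auto
  qed
  finally have main: "\<mu> * EZ U = (\<Sum>r\<in>{1..N} - U. of_real (c r * \<alpha> r) * EZ (insert r U))" .
  let ?x = "exp (- \<mu> * of_real (f0 (pt X)))"
  have "\<mu> * red_int \<eta> X U \<mu> = of_real (inv_scal X U) * ?x * (\<mu> * EZ U)" by (simp add: red_int_def EZ_def mult_ac)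
  also have "\<dots> = (\<Sum>r\<in>{1..N} - U. of_real (\<alpha> r * l r e) * red_int \<eta> X (insert r U) \<mu>)"
    unfolding main sum_distrib_left
  proof (rule sum.cong[OF refl])
    fix r assume "r \<in> {1..N} - U"
    then have "r \<notin> U" by blast
    show "of_real (inv_scal X U) * ?x * (of_real (c r * \<alpha> r) * EZ (insert r U)) = of_real (\<alpha> r * l r e) * red_int \<eta> X (insert r U) \<mu>"
      unfolding red_int_def inv_scal_insert[OF fU \<open>r \<notin> U\<close>] EZ_def by (simp add: c_def mult_ac)
  qed
  finally show ?thesis by (simp add: U_def e_def)
qed

text \<open>Differentiation multiplies the integrand by \<open>- f0\<close>, and
  \<open>f0 - f0 (pt W)\<close> is the combination of the \<open>f j\<close>,
  \<open>j \<in> W\<close>, with coefficients \<open>1 / l j (edge W j)\<close>. Each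
  \<open>f j\<close> cancels the denominator with the same index.\<close>

lemma red_int_deriv:
  assumes X: "X \<in> vertices CARD('k) N" and W: "W \<in> vertices CARD('k) N" and \<mu>: "\<mu> \<in> cut_plane \<eta>"
  shows "((\<lambda>\<mu>. red_int \<eta> X W \<mu>) has_field_derivative
     - of_real (f0 (pt W)) * red_int \<eta> X W \<mu> - (\<Sum>j\<in>W. red_int \<eta> X (W - {j}) \<mu> / of_real (l j (edge W j)))) (at \<mu>)"
proof -
  interpret L: laplace_cone X "off X" "slope X" by (rule laplace_cone_at[OF X])
  obtain s where s: "L.admissible \<eta> \<mu> s" using \<mu> by (auto simp: cut_plane_def L.admissible_def)
  have fW: "finite W" "W \<subseteq> {1..N}" using vertexD[OF W] by auto
  define EZ where "EZ Z = cone_fun \<eta> X (edge_exp X Z) (face_exp X Z) \<mu>" for Z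
  define UP where "UP i = cone_fun \<eta> X (incr i (edge_exp X W)) (face_exp X W) \<mu>" for i
  \<comment> \<open>Multiplication by \<open>f j\<close> in the coordinates at \<open>X\<close>: a
    single coordinate if \<open>j \<in> X\<close>, and otherwise an affine form, for which
    \<open>Eh_decr\<close> is used.\<close>
  have step: "of_real (scal X j) * EZ (W - {j}) = of_real (f j (pt X)) * EZ W + (\<Sum>i\<in>X. of_real (l j (edge X i)) * UP i)"
    if j: "j \<in> W" for j
  proof (cases "j \<in> X")
    case True
    have ins: "insert j (W - {j}) = W" using j by auto
    have u: "incr j (edge_exp X W) = edge_exp X (W - {j})" "face_exp X W = face_exp X (W - {j})"
      using edge_exp_insert(1)[OF True, of "W - {j}"] edge_exp_insert(3)[OF True, of "W - {j}"] unfolding ins by auto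
    have "(\<Sum>i\<in>X. of_real (l j (edge X i)) * UP i) = (\<Sum>i\<in>X. if i = j then of_real (l j (edge X j)) * UP j else 0)"
      using edge_props(2)[OF X _ True] by (intro sum.cong) auto
    also have "\<dots> = of_real (scal X j) * EZ (W - {j})"
      using True vertexD[OF X] u by (simp add: UP_def EZ_def scal_def)
    finally show ?thesis using X True by simp
  next
    case False
    then have jJ: "j \<in> off X" using j fW by auto
    have ins: "insert j (W - {j}) = W" using j by auto
    have u: "edge_exp X (W - {j}) = edge_exp X W" "decr j (face_exp X (W - {j})) = face_exp X W"
      using edge_exp_insert(4)[OF False, of "W - {j}"] edge_exp_insert(5)[OF False, of "W - {j}"] unfolding ins by auto
    have "EZ (W - {j}) = EZ W + (\<Sum>i\<in>X. of_real (slope X j i) * UP i)"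
      using L.Eh_decr[OF s edge_exp_pos[OF X] jJ, of "W - {j}" "face_exp X (W - {j})"] unfolding u EZ_def UP_def cone_fun_def .
    moreover have "scal X j = f j (pt X)" "f j (pt X) \<noteq> 0" using False f_pt_nz[OF X jJ] by (auto simp: scal_def)
    ultimately show ?thesis by (simp add: slope_def distrib_left sum_distrib_left)
  qed
  have s1: "(\<Sum>j\<in>W. f j (pt X) / l j (edge W j)) = f0 (pt X) - f0 (pt W)"
  proof -
    have "f j (pt X) = l j (pt X - pt W)" if "j \<in> W" for j
      using f_add[OF vertex_index[OF W that], of "pt W" "pt X - pt W"] W that by simp
    then have "(\<Sum>j\<in>W. f j (pt X) / l j (edge W j)) = f0 (pt X - pt W)"
      unfolding f0_expansion[OF W, of "pt X - pt W"] by (intro sum.cong) auto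
    then show ?thesis by (simp add: linear_diff[OF lin_f0])
  qed
  have s2: "(\<Sum>j\<in>W. l j (edge X i) / l j (edge W j)) = 1" if "i \<in> X" for i
    using f0_expansion[OF W, of "edge X i"] edge_props(1)[OF X that] by simp
  have "(\<Sum>j\<in>W. of_real (scal X j / l j (edge W j)) * EZ (W - {j})) =
     (\<Sum>j\<in>W. of_real (f j (pt X) / l j (edge W j)) * EZ W + (\<Sum>i\<in>X. of_real (l j (edge X i) / l j (edge W j)) * UP i))"
  proof (rule sum.cong[OF refl])
    fix j assume "j \<in> W"
    from step[OF this] have "(of_real (scal X j) * EZ (W - {j})) / of_real (l j (edge W j)) =
       (of_real (f j (pt X)) * EZ W + (\<Sum>i\<in>X. of_real (l j (edge X i)) * UP i)) / of_real (l j (edge W j))" by simp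
    then show "of_real (scal X j / l j (edge W j)) * EZ (W - {j}) =
      of_real (f j (pt X) / l j (edge W j)) * EZ W + (\<Sum>i\<in>X. of_real (l j (edge X i) / l j (edge W j)) * UP i)"
      by (simp add: add_divide_distrib sum_divide_distrib)
  qed
  also have "\<dots> = of_real (\<Sum>j\<in>W. f j (pt X) / l j (edge W j)) * EZ W
     + (\<Sum>i\<in>X. of_real (\<Sum>j\<in>W. l j (edge X i) / l j (edge W j)) * UP i)"
    unfolding sum.distrib of_real_sum sum_distrib_right by (subst sum.swap) simp
  also have "\<dots> = of_real (f0 (pt X) - f0 (pt W)) * EZ W + (\<Sum>i\<in>X. UP i)"
    unfolding s1 using s2 by (intro arg_cong2[of _ _ _ _ "(+)"] sum.cong refl) simp
  finally have main: "(\<Sum>j\<in>W. of_real (scal X j / l j (edge W j)) * EZ (W - {j})) =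
     of_real (f0 (pt X) - f0 (pt W)) * EZ W + (\<Sum>i\<in>X. UP i)" .
  let ?x = "exp (- \<mu> * of_real (f0 (pt X)))"
  have Rj: "red_int \<eta> X (W - {j}) \<mu> = of_real (inv_scal X W * scal X j) * ?x * EZ (W - {j})" if j: "j \<in> W" for j
  proof -
    have "insert j (W - {j}) = W" using j by auto
    then have "inv_scal X W = inv_scal X (W - {j}) / scal X j" using inv_scal_insert[of "W - {j}" j X] fW by simp
    then have "inv_scal X (W - {j}) = inv_scal X W * scal X j" using scal_nz[OF X vertex_index[OF W j]] by simp
    then show ?thesis by (simp add: red_int_def EZ_def)
  qed
  have d1: "((\<lambda>\<mu>. cone_fun \<eta> X (edge_exp X W) (face_exp X W) \<mu>) has_field_derivative - (\<Sum>i\<in>X. UP i)) (at \<mu>)"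
    using L.Eh_deriv[OF s edge_exp_pos[OF X], of W "face_exp X W"] unfolding cone_fun_def UP_def .
  have d2: "((\<lambda>\<mu>. of_real (inv_scal X W) * exp (- \<mu> * of_real (f0 (pt X)))) has_field_derivative
      of_real (inv_scal X W) * (?x * - of_real (f0 (pt X)))) (at \<mu>)"
    by (auto intro!: derivative_eq_intros)
  have "((\<lambda>\<mu>. red_int \<eta> X W \<mu>) has_field_derivative
     of_real (inv_scal X W) * (?x * - of_real (f0 (pt X))) * EZ W + - (\<Sum>i\<in>X. UP i) * (of_real (inv_scal X W) * ?x)) (at \<mu>)"
    unfolding red_int_def EZ_def by (rule DERIV_mult[OF d2 d1])
  also have "of_real (inv_scal X W) * (?x * - of_real (f0 (pt X))) * EZ W + - (\<Sum>i\<in>X. UP i) * (of_real (inv_scal X W) * ?x) =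
     - of_real (f0 (pt W)) * red_int \<eta> X W \<mu> - of_real (inv_scal X W) * ?x * (of_real (f0 (pt X) - f0 (pt W)) * EZ W + (\<Sum>i\<in>X. UP i))"
    by (simp add: red_int_def EZ_def algebra_simps)
  also have "of_real (inv_scal X W) * ?x * (of_real (f0 (pt X) - f0 (pt W)) * EZ W + (\<Sum>i\<in>X. UP i)) =
     (\<Sum>j\<in>W. red_int \<eta> X (W - {j}) \<mu> / of_real (l j (edge W j)))"
    unfolding main[symmetric] sum_distrib_left using Rj by (intro sum.cong refl) simp
  finally show ?thesis .
qed

section \<open>Neighbouring vertices and the differential system\<close>

lemma finite_V: "finite (vertices CARD('k) N)"
  by (rule finite_subset[of _ "Pow {1..N}"]) (auto simp: vertices_def)

lemma neighbour:
  assumes W: "W \<in> vertices CARD('k) N" and j: "j \<in> W" and r: "r \<in> {1..N} - W"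
  shows "insert r (W - {j}) \<in> vertices CARD('k) N" "W \<inter> insert r (W - {j}) = W - {j}"
    "W - insert r (W - {j}) = {j}" "insert r (W - {j}) - W = {r}" "insert r (W - {j}) \<noteq> W"
proof -
  have "card (insert r (W - {j})) = CARD('k)"
    using vertexD[OF W] j r card_Suc_Diff1[of W j] by simp
  then show "insert r (W - {j}) \<in> vertices CARD('k) N"
    using vertexD[OF W] r by (auto simp: vertices_def)
qed (use j r in auto)

lemma matB_neighbour:
  assumes W: "W \<in> vertices CARD('k) N" and j: "j \<in> W" and r: "r \<in> {1..N} - W"
  shows "matB f \<alpha> f0 W (insert r (W - {j})) = of_real (sgn (l j (edge W j) * l r (edge W j)) * \<alpha> r)"
proof -
  have "card (W - {j}) = CARD('k) - 1" using vertexD[OF W] j by simp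
  then show ?thesis
    unfolding matB_def neighbour(2-4)[OF W j r] using neighbour(5)[OF W j r] by (simp add: Let_def)
qed

lemma matB_zero:
  assumes W: "W \<in> vertices CARD('k) N" and Y: "Y \<in> vertices CARD('k) N" "Y \<noteq> W"
    and nn: "\<And>j r. j \<in> W \<Longrightarrow> r \<in> {1..N} - W \<Longrightarrow> Y \<noteq> insert r (W - {j})"
  shows "matB f \<alpha> f0 W Y = 0"
proof (rule ccontr)
  assume "matB f \<alpha> f0 W Y \<noteq> 0"
  then have c: "card (W \<inter> Y) = CARD('k) - 1" using Y(2) by (auto simp: matB_def split: if_splits)
  have k: "CARD('k) \<ge> 1" by (simp add: Suc_leI)
  have "card (W - Y) = 1" "card (Y - W) = 1"
    using c k vertexD[OF W] vertexD[OF Y(1)] card_Diff_subset_Int[of W Y] card_Diff_subset_Int[of Y W] by (simp_all add: Int_commute)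
  then obtain j r where "W - Y = {j}" "Y - W = {r}" by (metis card_1_singletonE)
  then have "j \<in> W" "r \<in> {1..N} - W" "Y = insert r (W - {j})" using vertexD[OF Y(1)] by blast+
  then show False using nn by blast
qed

text \<open>The neighbours of \<open>W\<close> correspond bijectively to the pairs of a removed
  index \<open>j\<close> and an added index \<open>r\<close>; all other entries off the diagonal
  vanish.\<close>

lemma sum_matB:
  assumes W: "W \<in> vertices CARD('k) N"
  shows "(\<Sum>Y\<in>vertices CARD('k) N. matB f \<alpha> f0 W Y * G Y) = of_real (\<Sum>j\<in>W. \<alpha> j) * G W +
    (\<Sum>j\<in>W. \<Sum>r\<in>{1..N} - W. of_real (sgn (l j (edge W j) * l r (edge W j)) * \<alpha> r) * G (insert r (W - {j})))"
proof -
  let ?V = "vertices CARD('k) N"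
  define h where "h p = insert (snd p) (W - {fst p})" for p :: "nat \<times> nat"
  let ?T = "W \<times> ({1..N} - W)"
  have fW: "finite W" using vertexD[OF W] by blast
  have inj: "inj_on h ?T"
  proof (rule inj_onI)
    fix p q assume pq: "p \<in> ?T" "q \<in> ?T" "h p = h q"
    have "{fst p} = W - h p" "{snd p} = h p - W" using pq(1) by (auto simp: h_def)
    moreover have "{fst q} = W - h q" "{snd q} = h q - W" using pq(2) by (auto simp: h_def)
    ultimately show "p = q" using pq(3) by (metis prod.expand the_elem_eq)
  qed
  have hV: "h ` ?T \<subseteq> ?V - {W}" using neighbour(1,5)[OF W] by (auto simp: h_def)
  have "(\<Sum>Y\<in>?V. matB f \<alpha> f0 W Y * G Y) = matB f \<alpha> f0 W W * G W + (\<Sum>Y\<in>?V - {W}. matB f \<alpha> f0 W Y * G Y)"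
    by (rule sum.remove[OF finite_V W])
  also have "(\<Sum>Y\<in>?V - {W}. matB f \<alpha> f0 W Y * G Y) = (\<Sum>Y\<in>h ` ?T. matB f \<alpha> f0 W Y * G Y)"
  proof (rule sum.mono_neutral_right)
    show "\<forall>Y\<in>?V - {W} - h ` ?T. matB f \<alpha> f0 W Y * G Y = 0"
    proof
      fix Y assume Y: "Y \<in> ?V - {W} - h ` ?T"
      have "Y \<noteq> insert r (W - {j})" if "j \<in> W" "r \<in> {1..N} - W" for j r
      proof
        assume "Y = insert r (W - {j})"
        then have "Y = h (j, r)" by (simp add: h_def)
        then show False using Y that by blast
      qed
      then have "matB f \<alpha> f0 W Y = 0" using Y by (intro matB_zero[OF W]) auto
      then show "matB f \<alpha> f0 W Y * G Y = 0" by simp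
    qed
  qed (use finite_V hV in auto)
  also have "\<dots> = (\<Sum>p\<in>?T. matB f \<alpha> f0 W (h p) * G (h p))"
    by (rule sum.reindex_cong[OF inj refl]) simp
  also have "\<dots> = (\<Sum>(j, r)\<in>?T. of_real (sgn (l j (edge W j) * l r (edge W j)) * \<alpha> r) * G (insert r (W - {j})))"
    using matB_neighbour[OF W] by (intro sum.cong refl) (auto simp: h_def)
  also have "\<dots> = (\<Sum>j\<in>W. \<Sum>r\<in>{1..N} - W. of_real (sgn (l j (edge W j) * l r (edge W j)) * \<alpha> r) * G (insert r (W - {j})))"
    by (rule sum.cartesian_product[symmetric])
  finally show ?thesis by (simp add: matB_def)
qed

text \<open>Substituting \<open>red_int_ibp\<close> into \<open>red_int_deriv\<close> produces the
  factor \<open>1 / \<mu>\<close> and the coefficients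
  \<open>\<alpha> r * l r (edge W j) / l j (edge W j)\<close>. The weights \<open>abs_det\<close>
  absorb their absolute ratios by \<open>abs_det_swap\<close>, leaving the signs.\<close>

lemma G_ode:
  assumes X: "X \<in> vertices CARD('k) N" and W: "W \<in> vertices CARD('k) N" and \<mu>: "\<mu> \<in> cut_plane \<eta>"
  shows "((\<lambda>\<mu>. of_real (abs_det W) * red_int \<eta> X W \<mu>) has_field_derivative
    (\<Sum>Y\<in>vertices CARD('k) N. sys_matrix (matA f f0) (matB f \<alpha> f0) \<mu> W Y * (of_real (abs_det Y) * red_int \<eta> X Y \<mu>))) (at \<mu>)"
proof -
  let ?V = "vertices CARD('k) N"
  define G where "G Y = of_real (abs_det Y) * red_int \<eta> X Y \<mu>" for Y
  have \<mu>0: "\<mu> \<noteq> 0" by (rule cut_plane_nz[OF \<mu>])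
  have fW: "finite W" "W \<subseteq> {1..N}" using vertexD[OF W] by auto
  have step: "of_real (abs_det W) * (\<mu> * red_int \<eta> X (W - {j}) \<mu> / of_real (l j (edge W j))) =
    of_real (\<alpha> j) * G W + (\<Sum>r\<in>{1..N} - W. of_real (sgn (l j (edge W j) * l r (edge W j)) * \<alpha> r) * G (insert r (W - {j})))"
    if j: "j \<in> W" for j
  proof -
    define e where "e = edge W j"
    have lj: "l j e \<noteq> 0" using edge_props(3)[OF W j] by (simp add: e_def)
    \<comment> \<open>The index \<open>r = j\<close> puts the removed hyperplane back and yields
      \<open>W\<close> itself, hence the contribution \<open>\<alpha> j\<close> to the
      diagonal.\<close>
    have set: "{1..N} - (W - {j}) = insert j ({1..N} - W)" using j fW by auto
    have ins: "insert j (W - {j}) = W" using j by auto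
    have "\<mu> * red_int \<eta> X (W - {j}) \<mu> = of_real (\<alpha> j * l j e) * red_int \<eta> X W \<mu> +
       (\<Sum>r\<in>{1..N} - W. of_real (\<alpha> r * l r e) * red_int \<eta> X (insert r (W - {j})) \<mu>)"
    proof -
      have "(\<Sum>r\<in>insert j ({1..N} - W). of_real (\<alpha> r * l r e) * red_int \<eta> X (insert r (W - {j})) \<mu>) =
        of_real (\<alpha> j * l j e) * red_int \<eta> X (insert j (W - {j})) \<mu> +
        (\<Sum>r\<in>{1..N} - W. of_real (\<alpha> r * l r e) * red_int \<eta> X (insert r (W - {j})) \<mu>)"
        using j by (intro sum.insert) auto
      then show ?thesis unfolding red_int_ibp[OF X W j \<mu>] set e_def[symmetric] ins .
    qed
    then have "of_real (abs_det W) * (\<mu> * red_int \<eta> X (W - {j}) \<mu> / of_real (l j e)) =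
       of_real (\<alpha> j) * G W + (\<Sum>r\<in>{1..N} - W. of_real (abs_det W / l j e * (\<alpha> r * l r e)) * red_int \<eta> X (insert r (W - {j})) \<mu>)"
      using lj by (simp add: add_divide_distrib distrib_left sum_divide_distrib sum_distrib_left G_def mult_ac)
    also have "(\<Sum>r\<in>{1..N} - W. of_real (abs_det W / l j e * (\<alpha> r * l r e)) * red_int \<eta> X (insert r (W - {j})) \<mu>) =
       (\<Sum>r\<in>{1..N} - W. of_real (sgn (l j e * l r e) * \<alpha> r) * G (insert r (W - {j})))"
    proof (rule sum.cong[OF refl])
      fix r assume r: "r \<in> {1..N} - W"
      have sw: "abs_det (insert r (W - {j})) * \<bar>l j e\<bar> = abs_det W * \<bar>l r e\<bar>"
        unfolding e_def by (rule abs_det_swap[OF W j r])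
      have "sgn (l j e * l r e) * abs_det (insert r (W - {j})) * \<bar>l j e\<bar> = sgn (l j e) * sgn (l r e) * (abs_det W * \<bar>l r e\<bar>)"
        by (simp only: sgn_mult sw[symmetric] mult_ac)
      also have "\<dots> = abs_det W * l r e * sgn (l j e)" using sgn_mult_abs[of "l r e"] by (simp add: mult_ac)
      also have "\<dots> = abs_det W * l r e / l j e * \<bar>l j e\<bar>" using lj by (simp add: sgn_if abs_if)
      finally have eq: "sgn (l j e * l r e) * abs_det (insert r (W - {j})) * \<bar>l j e\<bar> = abs_det W * l r e / l j e * \<bar>l j e\<bar>" .
      have "\<bar>l j e\<bar> \<noteq> 0" using lj by simp
      from iffD1[OF mult_right_cancel[OF this] eq]
      have "sgn (l j e * l r e) * abs_det (insert r (W - {j})) = abs_det W * l r e / l j e" .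
      then have "abs_det W / l j e * (\<alpha> r * l r e) = sgn (l j e * l r e) * \<alpha> r * abs_det (insert r (W - {j}))"
        by (simp add: mult_ac)
      then show "of_real (abs_det W / l j e * (\<alpha> r * l r e)) * red_int \<eta> X (insert r (W - {j})) \<mu> =
        of_real (sgn (l j e * l r e) * \<alpha> r) * G (insert r (W - {j}))"
        by (simp only: G_def of_real_mult mult.assoc)
    qed
    finally show ?thesis by (simp only: e_def)
  qed
  have "of_real (abs_det W) * (\<Sum>j\<in>W. red_int \<eta> X (W - {j}) \<mu> / of_real (l j (edge W j))) =
     (1 / \<mu>) * (\<Sum>j\<in>W. of_real (abs_det W) * (\<mu> * red_int \<eta> X (W - {j}) \<mu> / of_real (l j (edge W j))))"
    using \<mu>0 by (simp add: sum_distrib_left)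
  also have "(\<Sum>j\<in>W. of_real (abs_det W) * (\<mu> * red_int \<eta> X (W - {j}) \<mu> / of_real (l j (edge W j)))) = (\<Sum>Y\<in>?V. matB f \<alpha> f0 W Y * G Y)"
    unfolding sum_matB[OF W] of_real_sum sum_distrib_right sum.distrib[symmetric] by (rule sum.cong[OF refl step])
  finally have S: "of_real (abs_det W) * (\<Sum>j\<in>W. red_int \<eta> X (W - {j}) \<mu> / of_real (l j (edge W j))) = (1 / \<mu>) * (\<Sum>Y\<in>?V. matB f \<alpha> f0 W Y * G Y)" .
  have "((\<lambda>\<mu>. of_real (abs_det W) * red_int \<eta> X W \<mu>) has_field_derivative
     of_real (abs_det W) * (- of_real (f0 (pt W)) * red_int \<eta> X W \<mu> - (\<Sum>j\<in>W. red_int \<eta> X (W - {j}) \<mu> / of_real (l j (edge W j))))) (at \<mu>)"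
    by (rule DERIV_cmult[OF red_int_deriv[OF X W \<mu>]])
  also have "of_real (abs_det W) * (- of_real (f0 (pt W)) * red_int \<eta> X W \<mu> - (\<Sum>j\<in>W. red_int \<eta> X (W - {j}) \<mu> / of_real (l j (edge W j)))) =
     - of_real (f0 (pt W)) * G W - (1 / \<mu>) * (\<Sum>Y\<in>?V. matB f \<alpha> f0 W Y * G Y)"
    unfolding S[symmetric] by (simp add: G_def algebra_simps)
  also have "\<dots> = (\<Sum>Y\<in>?V. sys_matrix (matA f f0) (matB f \<alpha> f0) \<mu> W Y * G Y)"
  proof -
    have "(\<Sum>Y\<in>?V. matA f f0 W Y * G Y) = (\<Sum>Y\<in>?V. if Y = W then of_real (f0 (pt W)) * G W else 0)"
      by (intro sum.cong) (auto simp: matA_def)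
    also have "\<dots> = of_real (f0 (pt W)) * G W" using W finite_V by simp
    finally have "(\<Sum>Y\<in>?V. matA f f0 W Y * G Y) = of_real (f0 (pt W)) * G W" .
    then show ?thesis
      by (simp add: sys_matrix_def algebra_simps sum_negf sum.distrib sum_subtractf sum_divide_distrib)
  qed
  finally show ?thesis by (simp only: G_def)
qed

end

section \<open>Sectorial normalization\<close>

text \<open>
  The columns of the quotient are independent near infinity since the leading term is the identity, and
  hence everywhere by uniqueness of solutions.  The expansion may be differentiated along \<open>Q\<close>, which
  stays away from the boundary of \<open>S\<close>, and uniqueness of expansions turns the differential equation
  into its formal counterpart.
\<close>

lemma sectorial_normalizationI:
  fixes V :: "'v set"
  assumes V: "finite V" and S: "open S" "connected S" "0 \<notin> S" and Q: "Q \<subseteq> S" "\<And>r. \<exists>\<mu>\<in>Q. r \<le> cmod \<mu>"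
      "\<And>\<mu>. \<mu> \<in> Q \<Longrightarrow> ball \<mu> (cmod \<mu>) \<subseteq> S"
    and AD: "\<And>x y. x \<noteq> y \<Longrightarrow> A x y = 0"
    and w: "\<And>y \<mu>. y \<in> V \<Longrightarrow> \<mu> \<in> S \<Longrightarrow> w y \<mu> \<noteq> 0"
      "\<And>y \<mu>. y \<in> V \<Longrightarrow> \<mu> \<in> S \<Longrightarrow> (w y has_field_derivative sys_matrix A B \<mu> y y * w y \<mu>) (at \<mu>)"
    and I: "\<And>y. y \<in> V \<Longrightarrow> solution_on V A B S (I y)"
    and F: "\<And>x y. x \<in> V \<Longrightarrow> y \<in> V \<Longrightarrow> asymp_exp S (\<lambda>\<mu>. I y \<mu> x / w y \<mu>) (F x y)"
      "\<And>x y. x \<in> V \<Longrightarrow> y \<in> V \<Longrightarrow> fps_nth (F x y) 0 = (if x = y then 1 else 0)"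
  shows "sectorial_normalization V A B S (\<lambda>\<mu> x y. I y \<mu> x / w y \<mu>)"
proof -
  define H where "H \<mu> x y = I y \<mu> x / w y \<mu>" for \<mu> x y
  define M where "M = sys_matrix A B"
  define ND where "ND = sys_matrix A (diag_part B)"
  have ND: "ND \<mu> z y = (if z = y then M \<mu> y y else 0)" for \<mu> z y
    using AD by (auto simp: ND_def M_def sys_matrix_def diag_part_def)
  have sumND: "(\<Sum>z\<in>V. H \<mu> x z * ND \<mu> z y) = H \<mu> x y * M \<mu> y y" if "y \<in> V" for \<mu> x y
  proof -
    have "(\<Sum>z\<in>V. H \<mu> x z * ND \<mu> z y) = (\<Sum>z\<in>V. if z = y then H \<mu> x y * M \<mu> y y else 0)"
      by (intro sum.cong) (auto simp: ND)
    then show ?thesis using that V by simp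
  qed
  have dI: "((\<lambda>\<nu>. I y \<nu> x) has_field_derivative (\<Sum>z\<in>V. M \<mu> x z * I y \<mu> z)) (at \<mu>)"
    if "x \<in> V" "y \<in> V" "\<mu> \<in> S" for x y \<mu>
    using I[OF that(2)] that unfolding solution_on_def M_def by blast
  have dH: "((\<lambda>\<nu>. H \<nu> x y) has_field_derivative (\<Sum>z\<in>V. M \<mu> x z * H \<mu> z y) - H \<mu> x y * M \<mu> y y) (at \<mu>)"
    if "x \<in> V" "y \<in> V" "\<mu> \<in> S" for x y \<mu>
  proof -
    have w0: "w y \<mu> \<noteq> 0" using w(1) that by blast
    have "((\<lambda>\<nu>. I y \<nu> x / w y \<nu>) has_field_derivative
      ((\<Sum>z\<in>V. M \<mu> x z * I y \<mu> z) * w y \<mu> - I y \<mu> x * (M \<mu> y y * w y \<mu>)) / (w y \<mu> * w y \<mu>)) (at \<mu>)"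
      using w(2)[OF that(2,3)] unfolding M_def[symmetric] by (intro DERIV_divide dI[OF that] w0)
    also have "((\<Sum>z\<in>V. M \<mu> x z * I y \<mu> z) * w y \<mu> - I y \<mu> x * (M \<mu> y y * w y \<mu>)) / (w y \<mu> * w y \<mu>) =
      (\<Sum>z\<in>V. M \<mu> x z * I y \<mu> z) / w y \<mu> - I y \<mu> x / w y \<mu> * M \<mu> y y"
      using w0 by (simp add: field_simps)
    also have "(\<Sum>z\<in>V. M \<mu> x z * I y \<mu> z) / w y \<mu> = (\<Sum>z\<in>V. M \<mu> x z * H \<mu> z y)"
      by (simp add: sum_divide_distrib H_def)
    finally show ?thesis by (simp only: H_def)
  qed
  have holH: "(\<lambda>\<nu>. H \<nu> x y) holomorphic_on S" if "x \<in> V" "y \<in> V" for x y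
    using dH[OF that] S(1) by (auto simp: holomorphic_on_open)
  have FH: "asymp_exp S (\<lambda>\<mu>. H \<mu> x y) (F x y)" if "x \<in> V" "y \<in> V" for x y
    using F(1)[OF that] by (simp only: H_def)
  have formal: "formal_normalization V A B F"
    unfolding formal_normalization_def
  proof (intro ballI conjI)
    fix x y assume xy: "x \<in> V" "y \<in> V"
    show "fps_nth (F x y) 0 = (if x = y then 1 else 0)" by (rule F(2)[OF xy])
    have a1: "asymp_exp Q (\<lambda>\<mu>. deriv (\<lambda>\<nu>. H \<nu> x y) \<mu>) (- (fps_X\<^sup>2 * fps_deriv (F x y)))"
      by (rule asymp_exp_deriv[OF FH[OF xy] Q(3) holH[OF xy]])
    have entry: "asymp_exp S (\<lambda>\<mu>. sys_matrix A B' \<mu> p q * H \<mu> u v) (fps_sys_matrix A B' p q * F u v)"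
      if "u \<in> V" "v \<in> V" for B' p q u v
    proof -
      have "asymp_exp S (\<lambda>\<mu>. - A p q * H \<mu> u v + - B' p q * (H \<mu> u v / \<mu>))
         (fps_const (- A p q) * F u v + fps_const (- B' p q) * (fps_X * F u v))"
        by (intro asymp_exp_add asymp_exp_cmult asymp_exp_divide FH that)
      moreover have "fps_const (- A p q) * F u v + fps_const (- B' p q) * (fps_X * F u v) = fps_sys_matrix A B' p q * F u v"
        by (simp add: fps_sys_matrix_def algebra_simps fps_const_neg[symmetric] del: fps_const_neg)
      moreover have "(\<lambda>\<mu>. - A p q * H \<mu> u v + - B' p q * (H \<mu> u v / \<mu>)) = (\<lambda>\<mu>. sys_matrix A B' \<mu> p q * H \<mu> u v)"
        by (auto simp: sys_matrix_def algebra_simps)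
      ultimately show ?thesis by simp
    qed
    have e2: "asymp_exp S (\<lambda>\<mu>. H \<mu> x z * sys_matrix A (diag_part B) \<mu> z y) (F x z * fps_sys_matrix A (diag_part B) z y)" if "z \<in> V" for z
      using entry[OF xy(1) that, of "diag_part B" z y] by (simp only: mult.commute)
    have "asymp_exp S (\<lambda>\<mu>. (\<Sum>z\<in>V. M \<mu> x z * H \<mu> z y) - (\<Sum>z\<in>V. H \<mu> x z * ND \<mu> z y))
       ((\<Sum>z\<in>V. fps_sys_matrix A B x z * F z y) - (\<Sum>z\<in>V. F x z * fps_sys_matrix A (diag_part B) z y))"
      unfolding M_def ND_def by (intro asymp_exp_diff asymp_exp_sum V entry e2 xy)
    then have "asymp_exp Q (\<lambda>\<mu>. (\<Sum>z\<in>V. M \<mu> x z * H \<mu> z y) - (\<Sum>z\<in>V. H \<mu> x z * ND \<mu> z y))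
       ((\<Sum>z\<in>V. fps_sys_matrix A B x z * F z y) - (\<Sum>z\<in>V. F x z * fps_sys_matrix A (diag_part B) z y))"
      by (rule asymp_exp_subset[OF _ Q(1)])
    then have a2: "asymp_exp Q (\<lambda>\<mu>. deriv (\<lambda>\<nu>. H \<nu> x y) \<mu>)
       ((\<Sum>z\<in>V. fps_sys_matrix A B x z * F z y) - (\<Sum>z\<in>V. F x z * fps_sys_matrix A (diag_part B) z y))"
      by (rule asymp_exp_cong) (use DERIV_imp_deriv[OF dH[OF xy]] Q(1) sumND[OF xy(2)] in auto)
    show "- (fps_X\<^sup>2 * fps_deriv (F x y)) =
       (\<Sum>z\<in>V. fps_sys_matrix A B x z * F z y) - (\<Sum>z\<in>V. F x z * fps_sys_matrix A (diag_part B) z y)"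
      by (rule asymp_exp_unique[OF a1 a2 Q(2)])
  qed
  have far: "\<exists>\<mu>\<in>Q. \<forall>c. (\<forall>x\<in>V. (\<Sum>y\<in>V. H \<mu> x y * c y) = 0) \<longrightarrow> (\<forall>y\<in>V. c y = 0)"
  proof -
    \<comment> \<open>With entries within \<open>e\<close> of the identity and
      \<open>card V * e < 1\<close>, the kernel is trivial: the largest component of a kernel vector
      would be smaller than itself.\<close>
    define e where "e = 1 / (2 * (real (card V) + 1))"
    have e: "e > 0" by (simp add: e_def)
    have "\<forall>x\<in>V. \<forall>y\<in>V. \<exists>r. \<forall>\<mu>\<in>S. r \<le> cmod \<mu> \<longrightarrow> cmod (H \<mu> x y - fps_nth (F x y) 0) < e"
      using asymp_exp_tendsto[OF FH e] by metis
    then obtain r where r: "\<And>x y \<mu>. x \<in> V \<Longrightarrow> y \<in> V \<Longrightarrow> \<mu> \<in> S \<Longrightarrow> r x y \<le> cmod \<mu> \<Longrightarrow> cmod (H \<mu> x y - fps_nth (F x y) 0) < e"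
      by metis
    define rr where "rr = (\<Sum>x\<in>V. \<Sum>y\<in>V. \<bar>r x y\<bar>)"
    have rle: "r x y \<le> rr" if "x \<in> V" "y \<in> V" for x y
    proof -
      have "r x y \<le> \<bar>r x y\<bar>" by simp
      also have "\<dots> \<le> (\<Sum>y\<in>V. \<bar>r x y\<bar>)" using that V by (intro member_le_sum) auto
      also have "\<dots> \<le> rr" unfolding rr_def using that V by (intro member_le_sum[of x V "\<lambda>x. \<Sum>y\<in>V. \<bar>r x y\<bar>"]) (auto intro!: sum_nonneg)
      finally show ?thesis .
    qed
    obtain \<mu> where \<mu>: "\<mu> \<in> Q" "rr \<le> cmod \<mu>" using Q(2) by blast
    have close: "cmod (H \<mu> x y - (if x = y then 1 else 0)) < e" if "x \<in> V" "y \<in> V" for x y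
    proof -
      have "\<mu> \<in> S" using \<mu> Q(1) by blast
      moreover have "r x y \<le> cmod \<mu>" using rle[OF that] \<mu> by linarith
      ultimately show ?thesis using r[OF that] F(2)[OF that] by simp
    qed
    have "\<forall>y\<in>V. c y = 0" if c: "\<forall>x\<in>V. (\<Sum>y\<in>V. H \<mu> x y * c y) = 0" for c
    proof (rule ccontr)
      assume "\<not> (\<forall>y\<in>V. c y = 0)"
      then have ne: "V \<noteq> {}" by blast
      define m where "m = Max ((\<lambda>y. cmod (c y)) ` V)"
      have mle: "cmod (c y) \<le> m" if "y \<in> V" for y unfolding m_def using V that by (intro Max_ge) auto
      have "m \<in> (\<lambda>y. cmod (c y)) ` V" unfolding m_def using V ne by (intro Max_in) auto
      then obtain x where x: "x \<in> V" "m = cmod (c x)" by blast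
      have mpos: "m > 0"
      proof -
        obtain y where "y \<in> V" "c y \<noteq> 0" using \<open>\<not> (\<forall>y\<in>V. c y = 0)\<close> by blast
        then show ?thesis using mle[of y] by (meson order_less_le_trans zero_less_norm_iff)
      qed
      have "c x = (\<Sum>y\<in>V. (if x = y then 1 else 0) * c y)"
        using V x(1) by (simp add: if_distrib[of "\<lambda>t. t * _"] cong: if_cong)
      also have "\<dots> = (\<Sum>y\<in>V. ((if x = y then 1 else 0) - H \<mu> x y) * c y)"
        using c x(1) by (simp add: left_diff_distrib sum_subtractf)
      finally have "m \<le> (\<Sum>y\<in>V. cmod (((if x = y then 1 else 0) - H \<mu> x y) * c y))"
        using norm_sum[of "\<lambda>y. ((if x = y then 1 else 0) - H \<mu> x y) * c y" V] x(2) by simp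
      also have "\<dots> \<le> (\<Sum>y\<in>V. e * m)"
      proof (rule sum_mono)
        fix y assume y: "y \<in> V"
        have "cmod ((if x = y then 1 else 0) - H \<mu> x y) \<le> e"
          using close[OF x(1) y] by (simp only: norm_minus_commute less_imp_le)
        then show "cmod (((if x = y then 1 else 0) - H \<mu> x y) * c y) \<le> e * m"
          unfolding norm_mult using mle[OF y] e by (intro mult_mono) auto
      qed
      also have "\<dots> = real (card V) * e * m" by simp
      also have "\<dots> < 1 * m"
        using mpos by (intro mult_strict_right_mono) (auto simp: e_def divide_simps)
      finally show False by simp
    qed
    then show ?thesis using \<mu>(1) by blast
  qed
  have inv: "invertible_matrix V (H \<mu>0)" if \<mu>0: "\<mu>0 \<in> S" for \<mu>0
  proof (rule invertible_matrixI[OF V])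
    fix c assume c: "\<forall>x\<in>V. (\<Sum>y\<in>V. H \<mu>0 x y * c y) = 0"
    \<comment> \<open>After division by \<open>w y \<mu>0\<close>, the kernel vector yields a
      combination of the solutions with constant coefficients that vanishes at
      \<open>\<mu>0\<close>. It then vanishes everywhere, in particular at a far point, where the
      kernel is trivial.\<close>
    define d where "d y = c y / w y \<mu>0" for y
    define u where "u \<mu> x = (\<Sum>y\<in>V. I y \<mu> x * d y)" for \<mu> x
    have uH: "u \<mu> x = (\<Sum>y\<in>V. H \<mu> x y * (w y \<mu> * d y))" if "\<mu> \<in> S" for \<mu> x
      unfolding u_def using w(1) that by (intro sum.cong refl) (simp add: H_def)
    have u0: "u \<mu>0 x = 0" if "x \<in> V" for x
    proof -
      have "u \<mu>0 x = (\<Sum>y\<in>V. H \<mu>0 x y * c y)"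
        unfolding uH[OF \<mu>0] using w(1) \<mu>0 by (intro sum.cong refl) (simp add: d_def)
      then show ?thesis using c that by simp
    qed
    have du: "((\<lambda>\<mu>. u \<mu> x) has_field_derivative (\<Sum>z\<in>V. M \<mu> x z * u \<mu> z)) (at \<mu>)" if "\<mu> \<in> S" "x \<in> V" for \<mu> x
    proof -
      have "((\<lambda>\<mu>. \<Sum>y\<in>V. I y \<mu> x * d y) has_field_derivative (\<Sum>y\<in>V. (\<Sum>z\<in>V. M \<mu> x z * I y \<mu> z) * d y)) (at \<mu>)"
        by (intro DERIV_sum DERIV_cmult_right dI that)
      also have "(\<Sum>y\<in>V. (\<Sum>z\<in>V. M \<mu> x z * I y \<mu> z) * d y) = (\<Sum>z\<in>V. M \<mu> x z * u \<mu> z)"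
        unfolding u_def sum_distrib_left sum_distrib_right by (subst sum.swap) (simp add: mult.assoc)
      finally show ?thesis by (simp only: u_def)
    qed
    have holM: "(\<lambda>\<mu>. M \<mu> x z) holomorphic_on S" for x z
      unfolding M_def sys_matrix_def using S(3) by (intro holomorphic_intros) auto
    have u: "u \<mu> x = 0" if "\<mu> \<in> S" "x \<in> V" for \<mu> x
      by (rule linear_ode_zero[OF V S(1,2) \<mu>0 holM du u0 that])
    obtain \<mu>1 where \<mu>1: "\<mu>1 \<in> Q" "\<And>c. (\<forall>x\<in>V. (\<Sum>y\<in>V. H \<mu>1 x y * c y) = 0) \<Longrightarrow> (\<forall>y\<in>V. c y = 0)"
      using far by blast
    have \<mu>1S: "\<mu>1 \<in> S" using \<mu>1(1) Q(1) by blast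
    have "\<forall>x\<in>V. (\<Sum>y\<in>V. H \<mu>1 x y * (w y \<mu>1 * d y)) = 0"
      using u[OF \<mu>1S] unfolding uH[OF \<mu>1S] by blast
    then have "\<forall>y\<in>V. w y \<mu>1 * d y = 0" by (rule \<mu>1(2))
    then show "\<forall>y\<in>V. c y = 0" using w(1) \<mu>1S \<mu>0 by (auto simp: d_def)
  qed
  have "sectorial_normalization V A B S H"
    unfolding sectorial_normalization_def M_def[symmetric] ND_def[symmetric]
  proof (intro conjI ballI)
    show "(\<lambda>\<nu>. H \<nu> x y) holomorphic_on S" if "x \<in> V" "y \<in> V" for x y by (rule holH[OF that])
    show "invertible_matrix V (H \<mu>)" if "\<mu> \<in> S" for \<mu> by (rule inv[OF that])
    show "((\<lambda>\<nu>. H \<nu> x y) has_field_derivative (\<Sum>z\<in>V. M \<mu> x z * H \<mu> z y) - (\<Sum>z\<in>V. H \<mu> x z * ND \<mu> z y)) (at \<mu>)"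
      if "\<mu> \<in> S" "x \<in> V" "y \<in> V" for \<mu> x y
      using dH[OF that(2,3,1)] unfolding sumND[OF that(3)] .
    show "\<exists>F. formal_normalization V A B F \<and> (\<forall>x\<in>V. \<forall>y\<in>V. \<forall>n.
           (\<lambda>\<nu>. H \<nu> x y - (\<Sum>m\<le>n. fps_nth (F x y) m / \<nu> ^ m)) \<in> O[inf at_infinity (principal S)](\<lambda>\<nu>. 1 / \<nu> ^ (n + 1)))"
      using formal asymp_exp_bigo[OF FH] by blast
  qed
  then show ?thesis unfolding H_def .
qed

section \<open>Sectors and strips\<close>

text \<open>
  The branch of the logarithm cut along the ray on which \<open>cut_plane \<eta>\<close> is not defined, and real on the
  positive half-line.
\<close>

definition cut_log :: "real \<Rightarrow> complex \<Rightarrow> complex" where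
  "cut_log \<eta> \<mu> = Ln (of_real \<eta> * \<i> * \<mu>) - of_real \<eta> * \<i> * of_real (pi / 2)"

lemma Ln_polar:
  assumes "0 < r" "- pi < \<theta>" "\<theta> \<le> pi"
  shows "Ln (of_real r * cis \<theta>) = of_real (ln r) + \<i> * of_real \<theta>"
proof -
  have "of_real r * cis \<theta> = exp (of_real (ln r) + \<i> * of_real \<theta>)"
    using assms(1) by (simp add: exp_add exp_of_real cis_conv_exp)
  then show ?thesis using assms by (simp add: Ln_exp)
qed

lemma cut_log_polar:
  assumes \<eta>: "\<eta> = 1 \<or> \<eta> = - 1" and r: "0 < r" and \<theta>: "- pi / 2 < - \<eta> * \<theta>" "- \<eta> * \<theta> < 3 * pi / 2"
  shows "cut_log \<eta> (of_real r * cis \<theta>) = of_real (ln r) + \<i> * of_real \<theta>"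
proof -
  have "of_real \<eta> * \<i> * (of_real r * cis \<theta>) = of_real r * cis (\<theta> + \<eta> * (pi / 2))"
    using \<eta> by (auto simp: cis_mult[symmetric] complex_eq_iff)
  moreover have "- pi < \<theta> + \<eta> * (pi / 2)" "\<theta> + \<eta> * (pi / 2) \<le> pi" using \<eta> \<theta> by auto
  ultimately have "Ln (of_real \<eta> * \<i> * (of_real r * cis \<theta>)) = of_real (ln r) + \<i> * of_real (\<theta> + \<eta> * (pi / 2))"
    using Ln_polar[OF r, of "\<theta> + \<eta> * (pi / 2)"] by (simp only:)
  then show ?thesis unfolding cut_log_def by (simp only:) (simp add: algebra_simps)
qed

lemma exp_cut_log:
  assumes \<eta>: "\<eta> = 1 \<or> \<eta> = - 1" and "\<mu> \<noteq> 0"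
  shows "exp (cut_log \<eta> \<mu>) = \<mu>"
proof -
  have "exp (of_real \<eta> * \<i> * of_real (pi / 2)) = of_real \<eta> * \<i>"
  proof -
    have "exp (of_real \<eta> * \<i> * of_real (pi / 2)) = cis (\<eta> * (pi / 2))" by (simp add: cis_conv_exp mult_ac)
    also have "\<dots> = of_real \<eta> * \<i>" using \<eta> by (auto simp: complex_eq_iff)
    finally show ?thesis .
  qed
  then show ?thesis using assms by (auto simp: cut_log_def exp_diff)
qed

definition sector :: "real \<Rightarrow> real \<Rightarrow> complex set" where
  "sector \<eta> \<epsilon> = {of_real r * cis \<theta> | r \<theta>. 0 < r \<and> \<epsilon> - pi/2 < - \<eta> * \<theta> \<and> - \<eta> * \<theta> < 3*pi/2 - \<epsilon>}"

text \<open>The sheets over the sector. The index \<open>m\<close> counts in the direction of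
  growing \<open>- \<eta> * Im w\<close>, hence in opposite directions for the two signs.\<close>

definition strip :: "real \<Rightarrow> real \<Rightarrow> int \<Rightarrow> complex set" where
  "strip \<eta> \<epsilon> m = {w. \<epsilon> - pi/2 + 2 * pi * of_int m < - \<eta> * Im w \<and> - \<eta> * Im w < 3*pi/2 - \<epsilon> + 2 * pi * of_int m}"

lemma exp_polar: "exp w = of_real (exp (Re w)) * cis (Im w)"
  by (metis exp_eq_polar)

lemma sector_eq: "sector \<eta> \<epsilon> = exp ` strip \<eta> \<epsilon> 0"
proof (intro set_eqI iffI)
  fix \<mu> assume "\<mu> \<in> sector \<eta> \<epsilon>"
  then obtain r \<theta> where rt: "\<mu> = of_real r * cis \<theta>" "0 < r" "\<epsilon> - pi/2 < - \<eta> * \<theta>" "- \<eta> * \<theta> < 3*pi/2 - \<epsilon>"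
    by (auto simp: sector_def)
  then have "\<mu> = exp (Complex (ln r) \<theta>)" by (simp add: exp_polar[of "Complex (ln r) \<theta>"])
  then show "\<mu> \<in> exp ` strip \<eta> \<epsilon> 0" using rt by (intro image_eqI[of _ _ "Complex (ln r) \<theta>"]) (auto simp: strip_def)
next
  fix \<mu> assume "\<mu> \<in> exp ` strip \<eta> \<epsilon> 0"
  then obtain w where "\<mu> = exp w" "w \<in> strip \<eta> \<epsilon> 0" by blast
  then show "\<mu> \<in> sector \<eta> \<epsilon>"
    unfolding sector_def using exp_polar[of w]
    by (intro CollectI exI[of _ "exp (Re w)"] exI[of _ "Im w"]) (auto simp: strip_def)
qed

lemma convex_strip: "convex (strip \<eta> \<epsilon> m)"
proof -
  have "strip \<eta> \<epsilon> m = {w. inner (Complex 0 (- \<eta>)) w > \<epsilon> - pi/2 + 2 * pi * of_int m} \<inter>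
      {w. inner (Complex 0 (- \<eta>)) w < 3*pi/2 - \<epsilon> + 2 * pi * of_int m}"
    by (auto simp: strip_def inner_complex_def)
  then show ?thesis by (simp only: convex_Int convex_halfspace_gt convex_halfspace_lt)
qed

lemma open_strip: "open (strip \<eta> \<epsilon> m)"
  unfolding strip_def by (intro open_Collect_conj open_Collect_less continuous_intros)

lemma sector_props:
  assumes \<eta>: "\<eta> = 1 \<or> \<eta> = - 1" and \<epsilon>: "0 < \<epsilon>"
  shows "open (sector \<eta> \<epsilon>)" "connected (sector \<eta> \<epsilon>)" "0 \<notin> sector \<eta> \<epsilon>"
proof -
  show "connected (sector \<eta> \<epsilon>)"
    unfolding sector_eq by (intro connected_continuous_image convex_connected convex_strip continuous_intros)
  show "0 \<notin> sector \<eta> \<epsilon>" unfolding sector_eq by auto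
  \<comment> \<open>The width \<open>2 * pi - 2 * \<epsilon>\<close> of the strip is below a full
    turn.\<close>
  have "inj_on exp (strip \<eta> \<epsilon> 0)"
  proof (rule inj_onI)
    fix x y :: complex assume xy: "x \<in> strip \<eta> \<epsilon> 0" "y \<in> strip \<eta> \<epsilon> 0" "exp x = exp y"
    show "x = y"
    proof (rule exp_complex_eqI[OF _ xy(3)])
      show "\<bar>Im x - Im y\<bar> < 2 * pi" using xy(1,2) \<eta> \<epsilon> by (auto simp: strip_def)
    qed
  qed
  then show "open (sector \<eta> \<epsilon>)"
    unfolding sector_eq by (intro open_mapping_thm3 open_strip holomorphic_intros)
qed

section \<open>Expansions on subsectors and on the whole sector\<close>

lemma sin_ge:
  assumes "0 \<le> d" "d \<le> pi/2" "d \<le> x" "x \<le> pi - d"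
  shows "sin d \<le> sin x"
proof (cases "x \<le> pi/2")
  case True
  then show ?thesis using assms by (intro sin_monotone_2pi_le) auto
next
  case False
  then have "sin d \<le> sin (pi - x)" using assms by (intro sin_monotone_2pi_le) auto
  then show ?thesis by simp
qed

text \<open>
  On a subsector one may take \<open>s = cis \<omega> / \<mu>\<close> as direction of rotation, with the constant product
  \<open>\<mu> * s = cis \<omega>\<close>.  Two subsectors cover the whole sector, and both contain the middle ray, on which
  the expansions are compared.
\<close>

definition subsector :: "real \<Rightarrow> real \<Rightarrow> real \<Rightarrow> complex set" where
  "subsector \<eta> d \<tau> = {of_real r * cis \<theta> | r \<theta>. 0 < r \<and> d \<le> \<eta> * (\<tau> - \<theta>) \<and> \<eta> * (\<tau> - \<theta>) \<le> pi - d}"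

lemma subsector_cut_plane:
  assumes \<eta>: "\<eta> = 1 \<or> \<eta> = - 1" and \<tau>: "- pi/2 < \<tau>" "\<tau> < pi/2" and d: "0 < d" and \<mu>: "\<mu> \<in> subsector \<eta> d \<tau>"
  shows "\<mu> \<in> cut_plane \<eta>"
proof -
  obtain r \<theta> where rt: "\<mu> = of_real r * cis \<theta>" "0 < r" "d \<le> \<eta> * (\<tau> - \<theta>)" "\<eta> * (\<tau> - \<theta>) \<le> pi - d"
    using \<mu> by (auto simp: subsector_def)
  have "0 < sin (\<eta> * (\<tau> - \<theta>))" using rt d by (intro sin_gt_zero) auto
  also have "sin (\<eta> * (\<tau> - \<theta>)) = \<eta> * Im (cis (\<tau> - \<theta>))"
    using \<eta> sin_minus[of "\<tau> - \<theta>"] by auto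
  finally have "0 < \<eta> * Im (cis (\<tau> - \<theta>))" .
  moreover have "\<mu> * cis (\<tau> - \<theta>) = of_real r * cis \<tau>"
    unfolding rt(1) by (simp add: mult.assoc cis_mult)
  then have "0 < Re (\<mu> * cis (\<tau> - \<theta>))" using rt(2) \<tau> cos_gt_zero_pi[of \<tau>] by simp
  ultimately show ?thesis unfolding cut_plane_def by blast
qed

text \<open>With \<open>s = cis \<omega> / \<mu>\<close> the damping is constant, so an expansion in
  \<open>s\<close> is one in \<open>1 / \<mu>\<close>, and the margin \<open>d\<close> keeps
  \<open>s\<close> at a positive angle from the real axis. The arguments of the two logarithms add
  up to \<open>\<omega>\<close> without a multiple of \<open>2 * pi\<close>, so the powers cancel up
  to the constant \<open>e\<close>. For \<open>\<omega> = 0\<close> the leading coefficient is a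
  real integral.\<close>

lemma (in laplace_cone) Eh_asymp_subsector:
  assumes \<eta>: "\<eta> = 1 \<or> \<eta> = - 1" and \<omega>: "- pi/2 < \<omega>" "\<omega> < pi/2" and d: "0 < d" "d \<le> pi/2"
    and \<beta>: "\<forall>i\<in>X. 0 < \<beta> i"
  obtains F where "asymp_exp (subsector \<eta> d \<omega>) (\<lambda>\<mu>. exp (of_real (\<Sum>i\<in>X. \<beta> i) * cut_log \<eta> \<mu>) * Eh \<eta> \<beta> \<gamma> \<mu>) F"
    "\<omega> = 0 \<Longrightarrow> fps_nth F 0 = of_real (integral\<^sup>L PM (wt 1 \<beta>))"
proof -
  define b where "b = (\<Sum>i\<in>X. \<beta> i)"
  define \<sigma> where "\<sigma> = cis \<omega>"
  define e where "e = exp (of_real b * (\<i> * of_real \<omega>))"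
  have e1: "cmod e = 1" by (simp add: e_def norm_exp_eq_Re)
  have \<sigma>: "0 < Re \<sigma>" "cmod \<sigma> = 1" using cos_gt_zero_pi[of \<omega>] \<omega> by (simp_all add: \<sigma>_def)
  have sd: "0 < sin d" using d pi_gt_zero by (intro sin_gt_zero) linarith+
  define F where "F = Abs_fps (\<lambda>m. e * tcoeff \<beta> \<gamma> \<sigma> m * \<sigma> ^ m)"
  show ?thesis
  proof (rule that[of F])
    show "\<omega> = 0 \<Longrightarrow> fps_nth F 0 = of_real (integral\<^sup>L PM (wt 1 \<beta>))"
      using tcoeff_0[of \<beta> \<gamma>] by (simp add: F_def e_def \<sigma>_def)
    show "asymp_exp (subsector \<eta> d \<omega>) (\<lambda>\<mu>. exp (of_real (\<Sum>i\<in>X. \<beta> i) * cut_log \<eta> \<mu>) * Eh \<eta> \<beta> \<gamma> \<mu>) F"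
    proof (rule asymp_expI)
      fix n
      obtain C where C: "\<And>s. sin d * cmod s \<le> \<bar>Im s\<bar> \<Longrightarrow> cmod s \<le> 1 \<Longrightarrow>
          norm (E \<beta> \<gamma> \<sigma> s - (\<Sum>m\<le>n. tcoeff \<beta> \<gamma> \<sigma> m * s ^ m)) \<le> C * cmod s ^ Suc n"
        using E_expansion[OF \<sigma>(1) \<beta> sd sin_le_one, of 1 \<gamma> n] by auto
      have "cmod (exp (of_real (\<Sum>i\<in>X. \<beta> i) * cut_log \<eta> \<mu>) * Eh \<eta> \<beta> \<gamma> \<mu> - (\<Sum>m\<le>n. fps_nth F m / \<mu> ^ m)) \<le> C / cmod \<mu> ^ (n + 1)"
        if \<mu>: "\<mu> \<in> subsector \<eta> d \<omega>" "1 \<le> cmod \<mu>" for \<mu>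
      proof -
        obtain r \<theta> where rt: "\<mu> = of_real r * cis \<theta>" "0 < r" "d \<le> \<eta> * (\<omega> - \<theta>)" "\<eta> * (\<omega> - \<theta>) \<le> pi - d"
          using \<mu> by (auto simp: subsector_def)
        have \<mu>0: "\<mu> \<noteq> 0" using rt by simp
        have r: "cmod \<mu> = r" using rt by (simp add: norm_mult)
        define s where "s = \<sigma> / \<mu>"
        have s: "s = of_real (1 / r) * cis (\<omega> - \<theta>)"
          using rt(2) by (simp add: s_def \<sigma>_def rt(1) cis_divide[symmetric] field_simps)
        have cs: "cmod s = 1 / cmod \<mu>" by (simp add: s_def norm_divide \<sigma>(2))
        have "sin d \<le> sin (\<eta> * (\<omega> - \<theta>))" using d rt by (intro sin_ge) auto
        moreover have "sin (\<eta> * (\<omega> - \<theta>)) = \<eta> * sin (\<omega> - \<theta>)" using \<eta> sin_minus[of "\<omega> - \<theta>"] by auto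
        ultimately have si: "sin d \<le> \<eta> * sin (\<omega> - \<theta>)" by simp
        have Ims: "\<eta> * Im s = (\<eta> * sin (\<omega> - \<theta>)) / r" by (simp add: s)
        have "sin d / r \<le> \<eta> * Im s" unfolding Ims using si rt(2) by (intro divide_right_mono) auto
        then have s1: "sin d * cmod s \<le> \<eta> * Im s" unfolding cs r by simp
        have "0 < sin d / r" using sd rt(2) by simp
        then have \<eta>Im: "0 < \<eta> * Im s" using \<open>sin d / r \<le> \<eta> * Im s\<close> by linarith
        have "\<eta> * Im s \<le> \<bar>Im s\<bar>" using \<eta> by auto
        then have s2: "sin d * cmod s \<le> \<bar>Im s\<bar>" using s1 by linarith
        have s3: "cmod s \<le> 1" unfolding cs using \<mu>(2) by (simp add: divide_le_eq)
        have \<mu>s: "\<mu> * s = \<sigma>" using \<mu>0 by (simp add: s_def)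
        have admissible: "admissible \<eta> \<mu> s" using \<eta>Im \<sigma>(1) by (simp add: admissible_def \<mu>s)
        have "cut_log \<eta> \<mu> = of_real (ln r) + \<i> * of_real \<theta>"
          unfolding rt(1) using \<eta> \<omega> d rt(3,4) by (intro cut_log_polar \<eta> rt(2)) (auto simp: algebra_simps)
        moreover have "Ln s = of_real (ln (1 / r)) + \<i> * of_real (\<omega> - \<theta>)"
          unfolding s using \<eta> d rt(2-4) by (intro Ln_polar) auto
        moreover have "ln (1 / r) = - ln r" using rt(2) by (simp add: ln_div)
        ultimately have "cut_log \<eta> \<mu> + Ln s = \<i> * of_real \<omega>" by (simp add: algebra_simps)
        then have "exp (of_real b * cut_log \<eta> \<mu>) * exp (of_real b * Ln s) = e"
          unfolding e_def exp_add[symmetric] distrib_left[symmetric] by simp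
        then have ex: "exp (of_real b * cut_log \<eta> \<mu>) * Eh \<eta> \<beta> \<gamma> \<mu> = e * E \<beta> \<gamma> \<sigma> s"
          unfolding Eh_eq[OF admissible \<beta>] Es_def \<mu>s b_def[symmetric] by (metis mult.assoc)
        have "(\<Sum>m\<le>n. fps_nth F m / \<mu> ^ m) = e * (\<Sum>m\<le>n. tcoeff \<beta> \<gamma> \<sigma> m * s ^ m)"
          by (simp add: F_def s_def power_divide sum_distrib_left mult.assoc)
        then have "exp (of_real b * cut_log \<eta> \<mu>) * Eh \<eta> \<beta> \<gamma> \<mu> - (\<Sum>m\<le>n. fps_nth F m / \<mu> ^ m) =
           e * (E \<beta> \<gamma> \<sigma> s - (\<Sum>m\<le>n. tcoeff \<beta> \<gamma> \<sigma> m * s ^ m))"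
          unfolding ex by (simp add: right_diff_distrib)
        then have "cmod (exp (of_real b * cut_log \<eta> \<mu>) * Eh \<eta> \<beta> \<gamma> \<mu> - (\<Sum>m\<le>n. fps_nth F m / \<mu> ^ m)) \<le> C * cmod s ^ Suc n"
          using C[OF s2 s3] by (simp add: norm_mult e1)
        then show ?thesis unfolding cs b_def by (simp add: power_divide)
      qed
      then show "\<exists>C R. \<forall>\<mu>\<in>subsector \<eta> d \<omega>. R \<le> cmod \<mu> \<longrightarrow>
        cmod (exp (of_real (\<Sum>i\<in>X. \<beta> i) * cut_log \<eta> \<mu>) * Eh \<eta> \<beta> \<gamma> \<mu> - (\<Sum>m\<le>n. fps_nth F m / \<mu> ^ m)) \<le> C / cmod \<mu> ^ (n + 1)"
        by blast
    qed
  qed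
qed

text \<open>The bisector of the sector, opposite to the cut. The disc of radius
  \<open>cmod \<mu>\<close> about a point of it lies in a half-plane, and for
  \<open>\<epsilon> < pi/2\<close> this half-plane lies in the sector; hence expansions can be
  differentiated there.\<close>

definition mid_ray :: "real \<Rightarrow> complex set" where
  "mid_ray \<eta> = {of_real r * cis (- \<eta> * (pi / 2)) | r. 0 < r}"

lemma mid_ray_unbounded: "\<exists>\<mu>\<in>mid_ray \<eta>. R \<le> cmod \<mu>"
proof -
  have "of_real (\<bar>R\<bar> + 1) * cis (- \<eta> * (pi / 2)) \<in> mid_ray \<eta>"
    unfolding mid_ray_def by (intro CollectI exI[of _ "\<bar>R\<bar> + 1"]) simp
  moreover have "cmod (of_real (\<bar>R\<bar> + 1) * cis (- \<eta> * (pi / 2))) = \<bar>R\<bar> + 1"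
    by (simp only: norm_mult norm_of_real norm_cis) simp
  ultimately show ?thesis by (metis abs_ge_self add_increasing2 zero_le_one)
qed

lemma mid_ray_subsector:
  assumes \<eta>: "\<eta> = 1 \<or> \<eta> = - 1" and "d \<le> \<eta> * \<tau> + pi/2" "\<eta> * \<tau> + pi / 2 \<le> pi - d"
  shows "mid_ray \<eta> \<subseteq> subsector \<eta> d \<tau>"
proof
  fix \<mu> assume "\<mu> \<in> mid_ray \<eta>"
  then obtain r where r: "\<mu> = of_real r * cis (- \<eta> * (pi / 2))" "0 < r" by (auto simp: mid_ray_def)
  have "\<eta> * (\<tau> - - \<eta> * (pi / 2)) = \<eta> * \<tau> + pi/2" using \<eta> by auto
  then have "d \<le> \<eta> * (\<tau> - - \<eta> * (pi / 2)) \<and> \<eta> * (\<tau> - - \<eta> * (pi / 2)) \<le> pi - d" using assms by presburger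
  then show "\<mu> \<in> subsector \<eta> d \<tau>" unfolding subsector_def using r by blast
qed

lemma mid_ray_ball:
  assumes \<eta>: "\<eta> = 1 \<or> \<eta> = - 1" and \<epsilon>: "\<epsilon> < pi / 2" and \<mu>: "\<mu> \<in> mid_ray \<eta>"
  shows "ball \<mu> (cmod \<mu>) \<subseteq> sector \<eta> \<epsilon>"
proof
  fix z assume z: "z \<in> ball \<mu> (cmod \<mu>)"
  obtain r where r: "\<mu> = of_real r * cis (- \<eta> * (pi / 2))" "0 < r" using \<mu> by (auto simp: mid_ray_def)
  have cis: "cis (- \<eta> * (pi / 2)) = - of_real \<eta> * \<i>" using \<eta> by (auto simp: complex_eq_iff)
  have "cmod (\<mu> - z) < r" using z r by (simp add: dist_norm norm_mult)
  then have "\<bar>Im (\<mu> - z)\<bar> < r" using abs_Im_le_cmod[of "\<mu> - z"] by linarith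
  then have "0 < - \<eta> * Im z" using \<eta> r(2) unfolding r(1) cis by auto
  then have z0: "z \<noteq> 0" by auto
  have zp: "z = of_real (cmod z) * cis (Arg z)" using z0 by (metis rcis_cmod_Arg rcis_def)
  have "0 < - \<eta> * Arg z \<and> - \<eta> * Arg z < pi"
  proof (cases "\<eta> = 1")
    case True
    then have "Im z < 0" using \<open>0 < - \<eta> * Im z\<close> by simp
    then show ?thesis using True Arg_neg_iff[of z] Arg_bounded[of z] by auto
  next
    case False
    then have "\<eta> = - 1" using \<eta> by simp
    then have "0 < Im z" using \<open>0 < - \<eta> * Im z\<close> by simp
    then show ?thesis using \<open>\<eta> = - 1\<close> Arg_lt_pi[of z] by auto
  qed
  then have "\<epsilon> - pi/2 < - \<eta> * Arg z" "- \<eta> * Arg z < 3*pi/2 - \<epsilon>" using \<epsilon> by linarith+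
  then show "z \<in> sector \<eta> \<epsilon>" unfolding sector_def using zp z0
    by (intro CollectI exI[of _ "cmod z"] exI[of _ "Arg z"]) auto
qed

text \<open>The two directions lie \<open>\<epsilon>/2\<close> inside the limits
  \<open>- pi/2\<close> and \<open>pi/2\<close>, which leaves room for the margin
  \<open>\<epsilon>/4\<close>. The half of the sector up to the middle ray falls into the first
  subsector, the rest into the second.\<close>

lemma sector_cover:
  assumes \<eta>: "\<eta> = 1 \<or> \<eta> = - 1" and \<epsilon>: "0 < \<epsilon>"
  shows "sector \<eta> \<epsilon> \<subseteq> subsector \<eta> (\<epsilon>/4) (\<eta> * (pi/2 - \<epsilon>/2)) \<union> subsector \<eta> (\<epsilon>/4) (- \<eta> * (pi/2 - \<epsilon>/2))"
proof
  fix \<mu> assume "\<mu> \<in> sector \<eta> \<epsilon>"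
  then obtain r \<theta> where rt: "\<mu> = of_real r * cis \<theta>" "0 < r" "\<epsilon> - pi/2 < - \<eta> * \<theta>" "- \<eta> * \<theta> < 3*pi/2 - \<epsilon>"
    by (auto simp: sector_def)
  define t where "t = - \<eta> * \<theta>"
  have 1: "\<eta> * (\<eta> * (pi/2 - \<epsilon>/2) - \<theta>) = pi/2 - \<epsilon>/2 + t"
    "\<eta> * (- \<eta> * (pi/2 - \<epsilon>/2) - \<theta>) = - (pi/2) + \<epsilon>/2 + t"
    using \<eta> by (auto simp: t_def)
  have t: "\<epsilon> - pi/2 < t" "t < 3*pi/2 - \<epsilon>" using rt by (simp_all add: t_def)
  show "\<mu> \<in> subsector \<eta> (\<epsilon>/4) (\<eta> * (pi/2 - \<epsilon>/2)) \<union> subsector \<eta> (\<epsilon>/4) (- \<eta> * (pi/2 - \<epsilon>/2))"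
  proof (cases "t \<le> pi/2")
    case True
    have "\<epsilon>/4 \<le> \<eta> * (\<eta> * (pi/2 - \<epsilon>/2) - \<theta>) \<and> \<eta> * (\<eta> * (pi/2 - \<epsilon>/2) - \<theta>) \<le> pi - \<epsilon>/4"
      unfolding 1 using t True \<epsilon> by linarith
    then show ?thesis unfolding subsector_def using rt(1,2) by blast
  next
    case False
    have "\<epsilon>/4 \<le> \<eta> * (- \<eta> * (pi/2 - \<epsilon>/2) - \<theta>) \<and> \<eta> * (- \<eta> * (pi/2 - \<epsilon>/2) - \<theta>) \<le> pi - \<epsilon>/4"
      unfolding 1 using t False \<epsilon> by linarith
    then show ?thesis unfolding subsector_def using rt(1,2) by blast
  qed
qed

lemma sector_cut_plane:
  assumes \<eta>: "\<eta> = 1 \<or> \<eta> = - 1" and \<epsilon>: "0 < \<epsilon>" "\<epsilon> < pi/2"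
  shows "sector \<eta> \<epsilon> \<subseteq> cut_plane \<eta>"
proof
  fix \<mu> assume "\<mu> \<in> sector \<eta> \<epsilon>"
  then consider "\<mu> \<in> subsector \<eta> (\<epsilon>/4) (\<eta> * (pi/2 - \<epsilon>/2))" | "\<mu> \<in> subsector \<eta> (\<epsilon>/4) (- \<eta> * (pi/2 - \<epsilon>/2))"
    using sector_cover[OF \<eta> \<epsilon>(1)] by blast
  then show "\<mu> \<in> cut_plane \<eta>"
    by cases (rule subsector_cut_plane[OF \<eta>]; use \<eta> \<epsilon> in auto)+
qed

text \<open>The two extreme directions supply the expansion on the whole sector, the direction 0 the
  value of its leading coefficient. All three series agree, as the middle ray is common to the three
  subsectors.\<close>

lemma (in laplace_cone) Eh_asymp_sector:
  assumes \<eta>: "\<eta> = 1 \<or> \<eta> = - 1" and \<epsilon>: "0 < \<epsilon>" "\<epsilon> < pi/2" and \<beta>: "\<forall>i\<in>X. 0 < \<beta> i"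
  obtains F where "asymp_exp (sector \<eta> \<epsilon>) (\<lambda>\<mu>. exp (of_real (\<Sum>i\<in>X. \<beta> i) * cut_log \<eta> \<mu>) * Eh \<eta> \<beta> \<gamma> \<mu>) F"
    "fps_nth F 0 = of_real (integral\<^sup>L PM (wt 1 \<beta>))"
proof -
  let ?g = "\<lambda>\<mu>. exp (of_real (\<Sum>i\<in>X. \<beta> i) * cut_log \<eta> \<mu>) * Eh \<eta> \<beta> \<gamma> \<mu>"
  let ?t = "pi/2 - \<epsilon>/2"
  have d: "0 < \<epsilon>/4" "\<epsilon>/4 \<le> pi/2" using \<epsilon> by auto
  have t1: "- pi/2 < \<eta> * ?t" "\<eta> * ?t < pi/2" and t2: "- pi/2 < - \<eta> * ?t" "- \<eta> * ?t < pi/2"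
    using \<eta> \<epsilon> by auto
  have t0: "- pi/2 < (0::real)" "(0::real) < pi/2" using pi_gt_zero by linarith+
  obtain F1 where F1: "asymp_exp (subsector \<eta> (\<epsilon>/4) (\<eta> * ?t)) ?g F1"
    by (rule Eh_asymp_subsector[OF \<eta> t1 d \<beta>, of \<gamma>]) blast
  obtain F2 where F2: "asymp_exp (subsector \<eta> (\<epsilon>/4) (- \<eta> * ?t)) ?g F2"
    by (rule Eh_asymp_subsector[OF \<eta> t2 d \<beta>, of \<gamma>]) blast
  obtain F0 where F0: "asymp_exp (subsector \<eta> (\<epsilon>/4) 0) ?g F0" "fps_nth F0 0 = of_real (integral\<^sup>L PM (wt 1 \<beta>))"
    by (rule Eh_asymp_subsector[OF \<eta> t0 d \<beta>, of \<gamma>]) blast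
  have \<eta>\<eta>: "\<eta> * (\<eta> * ?t) = ?t" "\<eta> * (- \<eta> * ?t) = - ?t" using \<eta> by auto
  have R1: "mid_ray \<eta> \<subseteq> subsector \<eta> (\<epsilon>/4) (\<eta> * ?t)" by (rule mid_ray_subsector[OF \<eta>]) (unfold \<eta>\<eta>, (use \<epsilon> in linarith)+)
  have R2: "mid_ray \<eta> \<subseteq> subsector \<eta> (\<epsilon>/4) (- \<eta> * ?t)" by (rule mid_ray_subsector[OF \<eta>]) (unfold \<eta>\<eta>, (use \<epsilon> in linarith)+)
  have R0: "mid_ray \<eta> \<subseteq> subsector \<eta> (\<epsilon>/4) 0" by (rule mid_ray_subsector[OF \<eta>]) (use \<epsilon> in auto)
  have "F1 = F0" "F2 = F0"
    using asymp_exp_unique[OF asymp_exp_subset[OF F1 R1] asymp_exp_subset[OF F0(1) R0] mid_ray_unbounded]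
      asymp_exp_unique[OF asymp_exp_subset[OF F2 R2] asymp_exp_subset[OF F0(1) R0] mid_ray_unbounded] by auto
  then have "asymp_exp (sector \<eta> \<epsilon>) ?g F0"
    using asymp_exp_subset[OF asymp_exp_Un sector_cover[OF \<eta> \<epsilon>(1)]] F1 F2 by blast
  then show ?thesis using F0(2) by (rule that)
qed

section \<open>Sheets over the sectors\<close>

lemma sector_vimage:
  assumes \<eta>: "\<eta> = 1 \<or> \<eta> = - 1"
  shows "exp -` sector \<eta> \<epsilon> = (\<Union>m. strip \<eta> \<epsilon> m)"
proof (intro set_eqI iffI)
  fix w assume "w \<in> exp -` sector \<eta> \<epsilon>"
  then obtain v where v: "v \<in> strip \<eta> \<epsilon> 0" "exp w = exp v" unfolding sector_eq by auto
  then obtain n :: int where n: "w = v + (of_int (2 * n) * pi) * \<i>" unfolding exp_eq by blast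
  show "w \<in> (\<Union>m. strip \<eta> \<epsilon> m)"
  proof (cases "\<eta> = 1")
    case True
    then have "w \<in> strip \<eta> \<epsilon> (- n)" using v(1) n by (auto simp: strip_def algebra_simps)
    then show ?thesis by blast
  next
    case False
    then have "w \<in> strip \<eta> \<epsilon> n" using v(1) n \<eta> by (auto simp: strip_def algebra_simps)
    then show ?thesis by blast
  qed
next
  fix w assume "w \<in> (\<Union>m. strip \<eta> \<epsilon> m)"
  then obtain m where m: "w \<in> strip \<eta> \<epsilon> m" by blast
  define v where "v = w + (of_int (2 * (if \<eta> = 1 then m else - m)) * pi) * \<i>"
  have "exp w = exp v" unfolding exp_eq v_def by (intro exI[of _ "- (if \<eta> = 1 then m else - m)"]) (simp add: algebra_simps)
  moreover have "v \<in> strip \<eta> \<epsilon> 0" using m \<eta> by (auto simp: v_def strip_def algebra_simps)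
  ultimately show "w \<in> exp -` sector \<eta> \<epsilon>" unfolding sector_eq by auto
qed

text \<open>Consecutive strips are separated by gaps of width \<open>2 * \<epsilon>\<close>, so the
  image of a component under \<open>- \<eta> * Im\<close> is connected and misses the ends of all
  strips.\<close>

lemma component_strip:
  assumes \<eta>: "\<eta> = 1 \<or> \<eta> = - 1" and \<epsilon>: "0 < \<epsilon>" and S: "S \<in> components (exp -` sector \<eta> \<epsilon>)"
  obtains m where "S = strip \<eta> \<epsilon> m"
proof -
  have Ssub: "S \<subseteq> exp -` sector \<eta> \<epsilon>" and Scon: "connected S" and Sne: "S \<noteq> {}"
    using S in_components_subset in_components_connected in_components_nonempty by blast+
  obtain w0 m where w0: "w0 \<in> S" "w0 \<in> strip \<eta> \<epsilon> m" using Ssub Sne unfolding sector_vimage[OF \<eta>] by blast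
  define a where "a = \<epsilon> - pi/2 + 2 * pi * of_int m"
  define b where "b = 3*pi/2 - \<epsilon> + 2 * pi * of_int m"
  define t where "t w = - \<eta> * Im w" for w
  have tS: "connected (t ` S)" unfolding t_def by (intro connected_continuous_image continuous_intros Scon)
  have noend: "x \<noteq> a" "x \<noteq> b" if x: "x \<in> t ` S" for x
  proof -
    obtain k :: int where k: "\<epsilon> - pi/2 + 2 * pi * of_int k < x" "x < 3*pi/2 - \<epsilon> + 2 * pi * of_int k"
    proof -
      obtain w where w: "w \<in> S" "x = t w" using x by blast
      then obtain k where "w \<in> strip \<eta> \<epsilon> k" using Ssub unfolding sector_vimage[OF \<eta>] by blast
      then show ?thesis using that[of k] w(2) unfolding strip_def t_def by blast
    qed
    have *: False if "0 < 2 * pi * real_of_int i" "2 * pi * real_of_int i < 2 * pi" for i :: int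
    proof -
      have "0 < real_of_int i" using that(1) pi_gt_zero by (simp add: zero_less_mult_iff)
      moreover have "real_of_int i < 1" using that(2) pi_gt_zero by simp
      ultimately show False by simp
    qed
    show "x \<noteq> a"
    proof
      assume "x = a"
      then have "0 < 2 * pi * real_of_int (m - k)" "2 * pi * real_of_int (m - k) < 2 * pi"
        using k \<epsilon> unfolding a_def by (simp_all add: algebra_simps)
      then show False by (rule *)
    qed
    show "x \<noteq> b"
    proof
      assume "x = b"
      then have "0 < 2 * pi * real_of_int (k - m)" "2 * pi * real_of_int (k - m) < 2 * pi"
        using k \<epsilon> unfolding b_def by (simp_all add: algebra_simps)
      then show False by (rule *)
    qed
  qed
  have t0: "a < t w0" "t w0 < b" "t w0 \<in> t ` S" using w0 by (auto simp: strip_def a_def b_def t_def)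
  have "S \<subseteq> strip \<eta> \<epsilon> m"
  proof
    fix w assume w: "w \<in> S"
    have "a < t w"
    proof (rule ccontr)
      assume "\<not> a < t w"
      then have "a \<in> t ` S" using connectedD_interval[OF tS _ t0(3), of "t w" a] w t0(1) by auto
      then show False using noend(1) by blast
    qed
    moreover have "t w < b"
    proof (rule ccontr)
      assume "\<not> t w < b"
      then have "b \<in> t ` S" using connectedD_interval[OF tS t0(3), of "t w" b] w t0(2) by auto
      then show False using noend(2) by blast
    qed
    ultimately show "w \<in> strip \<eta> \<epsilon> m" by (simp add: strip_def a_def b_def t_def)
  qed
  moreover have "strip \<eta> \<epsilon> m \<subseteq> S"
    using w0 by (intro components_maximal[OF S convex_connected[OF convex_strip]]) (auto simp: sector_vimage[OF \<eta>])
  ultimately show ?thesis using that by blast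
qed

lemma Sup_Im_interval: "a < b \<Longrightarrow> Sup (Im ` {w. a < Im w \<and> Im w < b}) = b"
proof -
  assume ab: "a < b"
  have "Im ` {w. a < Im w \<and> Im w < b} = {a<..<b}"
  proof (intro set_eqI iffI)
    fix x assume "x \<in> {a<..<b}"
    then show "x \<in> Im ` {w. a < Im w \<and> Im w < b}" by (intro image_eqI[of _ _ "Complex 0 x"]) auto
  qed auto
  then show ?thesis using ab by simp
qed

lemma sector_plus_eq: "sector_plus \<epsilon> = sector (- 1) \<epsilon>" and sector_minus_eq: "sector_minus \<epsilon> = sector 1 \<epsilon>"
  by (simp_all add: sector_plus_def sector_minus_def sector_def)

text \<open>Overlaps and the order of the suprema give strict inequalities between integers that
  leave a single solution up to a common shift \<open>m\<close>. The sign of the index of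
  \<open>S1\<close> reflects the opposite numbering of the sheets over the minus sector.\<close>

lemma clockwise_strips:
  assumes \<epsilon>: "0 < \<epsilon>" "\<epsilon> < pi/2" and S: "clockwise_sectors \<epsilon> S0 S1 S2"
  obtains m where "S0 = strip (- 1) \<epsilon> m" "S1 = strip 1 \<epsilon> (- m)" "S2 = strip (- 1) \<epsilon> (m - 1)"
proof -
  obtain m0 where m0: "S0 = strip (- 1) \<epsilon> m0"
    using component_strip[OF _ \<epsilon>(1), of "-1" S0] S unfolding clockwise_sectors_def sector_plus_eq by blast
  obtain m1 where m1: "S1 = strip 1 \<epsilon> m1"
    using component_strip[OF _ \<epsilon>(1), of 1 S1] S unfolding clockwise_sectors_def sector_minus_eq by blast
  obtain m2 where m2: "S2 = strip (- 1) \<epsilon> m2"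
    using component_strip[OF _ \<epsilon>(1), of "-1" S2] S unfolding clockwise_sectors_def sector_plus_eq by blast
  have St: "strip (- 1) \<epsilon> m = {w. \<epsilon> - pi/2 + 2 * pi * of_int m < Im w \<and> Im w < 3*pi/2 - \<epsilon> + 2 * pi * of_int m}" for m
    by (simp add: strip_def)
  have St': "strip 1 \<epsilon> m = {w. - (3*pi/2 - \<epsilon> + 2 * pi * of_int m) < Im w \<and> Im w < - (\<epsilon> - pi/2 + 2 * pi * of_int m)}" for m
    by (auto simp: strip_def)
  have S0: "Sup (Im ` S0) = 3*pi/2 - \<epsilon> + 2 * pi * of_int m0"
    unfolding m0 St by (rule Sup_Im_interval) (use \<epsilon> in linarith)
  have S1: "Sup (Im ` S1) = - (\<epsilon> - pi/2 + 2 * pi * of_int m1)"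
    unfolding m1 St' by (rule Sup_Im_interval) (use \<epsilon> in linarith)
  have S2: "Sup (Im ` S2) = 3*pi/2 - \<epsilon> + 2 * pi * of_int m2"
    unfolding m2 St by (rule Sup_Im_interval) (use \<epsilon> in linarith)
  obtain w where w: "w \<in> S0" "w \<in> S1" using S unfolding clockwise_sectors_def by blast
  obtain v where v: "v \<in> S1" "v \<in> S2" using S unfolding clockwise_sectors_def by blast
  have lt: "real_of_int i < c" if "2 * pi * real_of_int i < 2 * pi * c" for i :: int and c :: real
    using that pi_gt_zero by simp
  have Sup: "Sup (Im ` S1) < Sup (Im ` S0)" "Sup (Im ` S2) < Sup (Im ` S1)"
    using S unfolding clockwise_sectors_def by blast+
  have "2 * pi * real_of_int (- m1 - m0) < 2 * pi * 1"
    using Sup(1) unfolding S0 S1 of_int_diff of_int_minus right_diff_distrib using pi_gt_zero by linarith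
  from lt[OF this] have a: "- m1 - m0 < 1" by linarith
  have "2 * pi * real_of_int (m0 + m1) < 2 * pi * 1"
    using w \<epsilon> unfolding m0 m1 St St' by (simp add: algebra_simps)
  from lt[OF this] have b: "m0 + m1 < 1" by linarith
  have "2 * pi * real_of_int (m2 + m1) < 2 * pi * 0"
    using Sup(2) unfolding S1 S2 of_int_add distrib_left using pi_gt_zero by linarith
  from lt[OF this] have c: "m2 + m1 < 0" by linarith
  have "2 * pi * real_of_int (- m1 - m2) < 2 * pi * 2"
    using v \<epsilon> unfolding m2 m1 St St' by (simp add: algebra_simps)
  from lt[OF this] have d: "- m1 - m2 < 2" by linarith
  have "m1 = - m0" "m2 = m0 - 1" using a b c d by linarith+
  then show ?thesis using that m0 m1 m2 by blast
qed

text \<open>The source of the monodromy: on the sheet \<open>m\<close> the cut logarithm differs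
  from the coordinate of the cover by \<open>m\<close> full turns.\<close>

lemma cut_log_strip:
  assumes \<eta>: "\<eta> = 1 \<or> \<eta> = - 1" and \<epsilon>: "0 < \<epsilon>" and w: "w \<in> strip \<eta> \<epsilon> m"
  shows "cut_log \<eta> (exp w) = w + of_real (2 * pi * \<eta> * of_int m) * \<i>" "exp w \<in> sector \<eta> \<epsilon>"
proof -
  show "exp w \<in> sector \<eta> \<epsilon>" using w sector_vimage[OF \<eta>, of \<epsilon>] by blast
  define \<theta> where "\<theta> = Im w + 2 * pi * \<eta> * of_int m"
  have "cis (Im w) = cis \<theta>"
  proof -
    have "cis (2 * pi * \<eta> * of_int m) = 1"
      using \<eta> cis_multiple_2pi[of "of_int m"] cis_multiple_2pi[of "- of_int m"] by (auto simp: Ints_minus)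
    then show ?thesis by (simp add: \<theta>_def cis_mult[symmetric])
  qed
  then have e: "exp w = of_real (exp (Re w)) * cis \<theta>" using exp_polar[of w] by simp
  have "cut_log \<eta> (exp w) = of_real (ln (exp (Re w))) + \<i> * of_real \<theta>"
    unfolding e using w \<eta> \<epsilon> by (intro cut_log_polar \<eta>) (auto simp: \<theta>_def strip_def algebra_simps)
  also have "\<dots> = w + of_real (2 * pi * \<eta> * of_int m) * \<i>"
    by (simp add: \<theta>_def complex_eq_iff)
  finally show "cut_log \<eta> (exp w) = w + of_real (2 * pi * \<eta> * of_int m) * \<i>" .
qed

section \<open>Canonical bases\<close>

lemma cut_plane_eq:
  assumes \<eta>: "\<eta> = 1 \<or> \<eta> = - 1"
  shows "cut_plane \<eta> = - {\<mu>. Re \<mu> = 0 \<and> 0 \<le> \<eta> * Im \<mu>}"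
proof (intro set_eqI iffI)
  fix \<mu> assume "\<mu> \<in> cut_plane \<eta>"
  then obtain s where s: "0 < \<eta> * Im s" "0 < Re (\<mu> * s)" by (auto simp: cut_plane_def)
  have False if "Re \<mu> = 0" "0 \<le> \<eta> * Im \<mu>"
  proof -
    have "0 \<le> (\<eta> * Im \<mu>) * (\<eta> * Im s)" by (rule mult_nonneg_nonneg[OF that(2) less_imp_le[OF s(1)]])
    also have "\<dots> = Im \<mu> * Im s" using \<eta> by auto
    finally show False using s(2) that by simp
  qed
  then show "\<mu> \<in> - {\<mu>. Re \<mu> = 0 \<and> 0 \<le> \<eta> * Im \<mu>}" by blast
next
  fix \<mu> assume \<mu>: "\<mu> \<in> - {\<mu>. Re \<mu> = 0 \<and> 0 \<le> \<eta> * Im \<mu>}"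
  have \<eta>\<eta>: "0 < \<eta> * \<eta>" using \<eta> by auto
  show "\<mu> \<in> cut_plane \<eta>"
  proof (cases "Re \<mu> = 0")
    case True
    then have "\<eta> * Im \<mu> < 0" using \<mu> by auto
    then have "0 < Re (\<mu> * Complex 0 \<eta>)" by (simp add: mult.commute)
    then show ?thesis unfolding cut_plane_def using \<eta>\<eta> by (intro CollectI exI[of _ "Complex 0 \<eta>"]) simp
  next
    case False
    \<comment> \<open>The imaginary part of the witness is \<open>\<eta>\<close>; its real part is
      chosen so that the real part of the product is 1.\<close>
    then have "0 < Re (\<mu> * Complex ((Im \<mu> * \<eta> + 1) / Re \<mu>) \<eta>)" by simp
    then show ?thesis unfolding cut_plane_def using \<eta>\<eta>
      by (intro CollectI exI[of _ "Complex ((Im \<mu> * \<eta> + 1) / Re \<mu>) \<eta>"]) simp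
  qed
qed

lemma open_cut_plane: "open (cut_plane \<eta>)"
proof -
  have "cut_plane \<eta> = (\<Union>s\<in>{s. 0 < \<eta> * Im s}. {\<mu>. 0 < Re (\<mu> * s)})" by (auto simp: cut_plane_def)
  then show ?thesis by (auto intro!: open_Collect_less continuous_intros)
qed

lemma half_circle_eq: "half_circle (- 1) = lower_arc" "half_circle 1 = upper_arc"
  by (auto simp: half_circle_def lower_arc_def upper_arc_def)

lemma cut_log_deriv:
  assumes \<eta>: "\<eta> = 1 \<or> \<eta> = - 1" and \<mu>: "\<mu> \<in> cut_plane \<eta>"
  shows "(cut_log \<eta> has_field_derivative 1 / \<mu>) (at \<mu>)"
proof -
  have nz: "\<mu> \<noteq> 0" using \<mu> by (auto simp: cut_plane_def)
  have "of_real \<eta> * \<i> * \<mu> \<notin> \<real>\<^sub>\<le>\<^sub>0"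
  proof
    assume "of_real \<eta> * \<i> * \<mu> \<in> \<real>\<^sub>\<le>\<^sub>0"
    then have "Im (of_real \<eta> * \<i> * \<mu>) = 0" "Re (of_real \<eta> * \<i> * \<mu>) \<le> 0"
      by (auto simp: complex_nonpos_Reals_iff)
    then show False using \<mu> \<eta> unfolding cut_plane_eq[OF \<eta>] by auto
  qed
  then have "((\<lambda>\<mu>. Ln (of_real \<eta> * \<i> * \<mu>)) has_field_derivative 1 / \<mu>) (at \<mu>)"
    using nz \<eta> by (auto intro!: derivative_eq_intros simp: field_simps)
  then have "((\<lambda>\<mu>. Ln (of_real \<eta> * \<i> * \<mu>) - of_real \<eta> * \<i> * of_real (pi / 2)) has_field_derivative 1 / \<mu> - 0) (at \<mu>)"
    by (intro DERIV_diff DERIV_const)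
  then show ?thesis unfolding cut_log_def[abs_def] by simp
qed

lemma invertible_diagonal:
  assumes "finite V" "\<And>x. x \<in> V \<Longrightarrow> d x \<noteq> 0"
  shows "invertible_matrix V (\<lambda>x y. if x = y then d x else 0)"
proof (rule invertible_matrixI[OF assms(1)])
  fix c assume c: "\<forall>x\<in>V. (\<Sum>y\<in>V. (if x = y then d x else 0) * c y) = 0"
  have "(\<Sum>y\<in>V. (if x = y then d x else 0) * c y) = d x * c x" if "x \<in> V" for x
  proof -
    have "(\<Sum>y\<in>V. (if x = y then d x else 0) * c y) = (\<Sum>y\<in>V. if x = y then d x * c x else 0)"
      by (intro sum.cong) auto
    then show ?thesis using that assms(1) by simp
  qed
  then show "\<forall>y\<in>V. c y = 0" using c assms(2) by auto
qed

lemma sum_diag_part: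
  fixes w :: "'v \<Rightarrow> complex"
  assumes "finite V" "y \<in> V" "\<And>x y. x \<noteq> y \<Longrightarrow> A x y = 0"
  shows "(\<Sum>z\<in>V. sys_matrix A (diag_part B) \<mu> x z * (if z = y then w z else 0)) =
    (if x = y then sys_matrix A B \<mu> x x * w x else 0)"
proof -
  have "(\<Sum>z\<in>V. sys_matrix A (diag_part B) \<mu> x z * (if z = y then w z else 0)) =
      (\<Sum>z\<in>V. if z = y then sys_matrix A (diag_part B) \<mu> x y * w y else 0)"
    by (intro sum.cong) auto
  also have "\<dots> = sys_matrix A (diag_part B) \<mu> x y * w y" using assms by simp
  finally show ?thesis using assms(3) by (auto simp: sys_matrix_def diag_part_def)
qed

context arrangement
begin

section \<open>The integrals as columns of normalized bases\<close>

definition weight :: "nat set \<Rightarrow> real" where "weight X = (\<Sum>j\<in>X. \<alpha> j)"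

definition jacobian :: "nat set \<Rightarrow> real" where
  "jacobian X = (SOME c. 0 < c \<and> (\<forall>W\<in>vertices CARD('k) N. \<forall>\<eta> ori \<mu>. \<eta> = 1 \<or> \<eta> = - 1 \<longrightarrow> ori = 1 \<or> ori = - 1 \<longrightarrow>
    \<mu> \<in> cut_plane \<eta> \<longrightarrow> cone_integral N f \<alpha> f0 ori (half_circle \<eta>) X \<mu> W = of_real (c * abs_det W) * red_int \<eta> X W \<mu>))"

lemma jacobian:
  assumes X: "X \<in> vertices CARD('k) N"
  shows "0 < jacobian X" "W \<in> vertices CARD('k) N \<Longrightarrow> \<eta> = 1 \<or> \<eta> = - 1 \<Longrightarrow> ori = 1 \<or> ori = - 1 \<Longrightarrow> \<mu> \<in> cut_plane \<eta> \<Longrightarrow>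
    cone_integral N f \<alpha> f0 ori (half_circle \<eta>) X \<mu> W = of_real (jacobian X * abs_det W) * red_int \<eta> X W \<mu>"
proof -
  let ?P = "\<lambda>c. 0 < c \<and> (\<forall>W\<in>vertices CARD('k) N. \<forall>\<eta> ori \<mu>. \<eta> = 1 \<or> \<eta> = - 1 \<longrightarrow> ori = 1 \<or> ori = - 1 \<longrightarrow>
    \<mu> \<in> cut_plane \<eta> \<longrightarrow> cone_integral N f \<alpha> f0 ori (half_circle \<eta>) X \<mu> W = of_real (c * abs_det W) * red_int \<eta> X W \<mu>)"
  have "\<exists>c. ?P c" by (rule integral_value[OF X]) blast
  then have "?P (jacobian X)" unfolding jacobian_def by (rule someI_ex)
  then show "0 < jacobian X" "W \<in> vertices CARD('k) N \<Longrightarrow> \<eta> = 1 \<or> \<eta> = - 1 \<Longrightarrow> ori = 1 \<or> ori = - 1 \<Longrightarrow> \<mu> \<in> cut_plane \<eta> \<Longrightarrow>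
    cone_integral N f \<alpha> f0 ori (half_circle \<eta>) X \<mu> W = of_real (jacobian X * abs_det W) * red_int \<eta> X W \<mu>" by blast+
qed

text \<open>The constant for which the diagonal quotient of the integral by
  \<open>normal_sol\<close> tends to 1. It does not involve \<open>\<eta>\<close>, so the plus and
  minus bases are normalized alike.\<close>

definition lead_const :: "nat set \<Rightarrow> real" where
  "lead_const X = jacobian X * abs_det X * inv_scal X X * integral\<^sup>L (Pi\<^sub>M X (\<lambda>_. pos_measure)) (laplace_cone.wt X 1 (edge_exp X X))"

definition normal_sol :: "real \<Rightarrow> nat set \<Rightarrow> complex \<Rightarrow> complex" where
  "normal_sol \<eta> X \<mu> = of_real (lead_const X) * exp (- \<mu> * of_real (f0 (pt X))) * exp (- of_real (weight X) * cut_log \<eta> \<mu>)"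

lemma lead_const_nz:
  assumes X: "X \<in> vertices CARD('k) N"
  shows "lead_const X \<noteq> 0"
proof -
  interpret L: laplace_cone X "off X" "slope X" by (rule laplace_cone_at[OF X])
  show ?thesis
    using jacobian(1)[OF X] abs_det_pos[OF X] L.integral_wt_pos[OF edge_exp_pos[OF X, of X]] scal_nz[OF X] vertex_index[OF X] vertexD[OF X]
    unfolding lead_const_def inv_scal_def by auto
qed

lemma normal_sol_nz: "X \<in> vertices CARD('k) N \<Longrightarrow> normal_sol \<eta> X \<mu> \<noteq> 0"
  using lead_const_nz[of X] by (simp add: normal_sol_def)

lemma normal_sol_deriv:
  assumes \<eta>: "\<eta> = 1 \<or> \<eta> = - 1" and \<mu>: "\<mu> \<in> cut_plane \<eta>"
  shows "(normal_sol \<eta> X has_field_derivative sys_matrix (matA f f0) (matB f \<alpha> f0) \<mu> X X * normal_sol \<eta> X \<mu>) (at \<mu>)"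
proof -
  define p where "p = complex_of_real (f0 (pt X))"
  define a where "a = complex_of_real (weight X)"
  define C where "C = complex_of_real (lead_const X)"
  have "((\<lambda>\<mu>. C * exp (- \<mu> * p) * exp (- a * cut_log \<eta> \<mu>)) has_field_derivative
    - (p + a / \<mu>) * (C * exp (- \<mu> * p) * exp (- a * cut_log \<eta> \<mu>))) (at \<mu>)"
    by (rule derivative_eq_intros cut_log_deriv[OF \<eta> \<mu>] refl)+ (simp add: algebra_simps)
  then show ?thesis
    unfolding normal_sol_def[abs_def] p_def[symmetric] a_def[symmetric] C_def[symmetric]
    by (simp add: sys_matrix_def matA_def matB_def p_def a_def weight_def)
qed

definition arc_int :: "real \<Rightarrow> real \<Rightarrow> nat set \<Rightarrow> complex \<Rightarrow> nat set \<Rightarrow> complex" where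
  "arc_int \<eta> ori = cone_integral N f \<alpha> f0 ori (half_circle \<eta>)"

lemma arc_int_solution:
  assumes X: "X \<in> vertices CARD('k) N" and \<eta>: "\<eta> = 1 \<or> \<eta> = - 1" and ori: "ori = 1 \<or> ori = - 1"
  shows "solution_on (vertices CARD('k) N) (matA f f0) (matB f \<alpha> f0) (cut_plane \<eta>) (arc_int \<eta> ori X)"
  unfolding solution_on_def
proof (intro ballI)
  fix \<mu> W assume \<mu>: "\<mu> \<in> cut_plane \<eta>" and W: "W \<in> vertices CARD('k) N"
  have val: "arc_int \<eta> ori X \<nu> Y = of_real (jacobian X) * (of_real (abs_det Y) * red_int \<eta> X Y \<nu>)"
    if "\<nu> \<in> cut_plane \<eta>" "Y \<in> vertices CARD('k) N" for \<nu> Y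
    unfolding arc_int_def jacobian(2)[OF X that(2) \<eta> ori that(1)] by simp
  have "((\<lambda>\<mu>. of_real (jacobian X) * (of_real (abs_det W) * red_int \<eta> X W \<mu>)) has_field_derivative
    of_real (jacobian X) * (\<Sum>Y\<in>vertices CARD('k) N. sys_matrix (matA f f0) (matB f \<alpha> f0) \<mu> W Y * (of_real (abs_det Y) * red_int \<eta> X Y \<mu>))) (at \<mu>)"
    by (rule DERIV_cmult[OF G_ode[OF X W \<mu>]])
  then have "((\<lambda>\<nu>. arc_int \<eta> ori X \<nu> W) has_field_derivative
    of_real (jacobian X) * (\<Sum>Y\<in>vertices CARD('k) N. sys_matrix (matA f f0) (matB f \<alpha> f0) \<mu> W Y * (of_real (abs_det Y) * red_int \<eta> X Y \<mu>))) (at \<mu>)"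
    by (rule has_field_derivative_transform_within_open[OF _ open_cut_plane \<mu>]) (simp only: val W)
  also have "of_real (jacobian X) * (\<Sum>Y\<in>vertices CARD('k) N. sys_matrix (matA f f0) (matB f \<alpha> f0) \<mu> W Y * (of_real (abs_det Y) * red_int \<eta> X Y \<mu>))
    = (\<Sum>Y\<in>vertices CARD('k) N. sys_matrix (matA f f0) (matB f \<alpha> f0) \<mu> W Y * arc_int \<eta> ori X \<mu> Y)"
    unfolding sum_distrib_left by (intro sum.cong refl) (simp add: val \<mu>)
  finally show "((\<lambda>\<nu>. arc_int \<eta> ori X \<nu> W) has_field_derivative
    (\<Sum>Y\<in>vertices CARD('k) N. sys_matrix (matA f f0) (matB f \<alpha> f0) \<mu> W Y * arc_int \<eta> ori X \<mu> Y)) (at \<mu>)" .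
qed

lemma sum_edge_exp:
  assumes "finite X"
  shows "(\<Sum>i\<in>X. edge_exp X W i) = weight X + real (card (X - W))"
proof -
  have "(\<Sum>i\<in>X. edge_exp X W i) = (\<Sum>i\<in>X. \<alpha> i + (if i \<in> X - W then 1 else 0))"
    by (intro sum.cong) (auto simp: edge_exp_def)
  also have "\<dots> = weight X + (\<Sum>i\<in>X. if i \<in> X - W then 1 else 0)"
    by (simp add: sum.distrib weight_def)
  also have "(\<Sum>i\<in>X. if i \<in> X - W then 1 else 0) = (\<Sum>i\<in>X \<inter> (X - W). (1::real))"
    by (rule sum.inter_restrict[OF assms, symmetric])
  also have "\<dots> = real (card (X - W))" by (simp add: Int_absorb1)
  finally show ?thesis .
qed

text \<open>Each index of \<open>X\<close> missing from \<open>W\<close> raises one exponent by 1,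
  and the power normalizing the Laplace integral then exceeds that of \<open>normal_sol\<close> by
  \<open>d = card (X - W)\<close>. The quotient thus carries a factor \<open>1 / \<mu> ^ d\<close>,
  which removes the leading term off the diagonal.\<close>

lemma arc_int_asymp:
  assumes X: "X \<in> vertices CARD('k) N" and W: "W \<in> vertices CARD('k) N"
    and \<eta>: "\<eta> = 1 \<or> \<eta> = - 1" and ori: "ori = 1 \<or> ori = - 1" and \<epsilon>: "0 < \<epsilon>" "\<epsilon> < pi/2"
  shows "\<exists>F. asymp_exp (sector \<eta> \<epsilon>) (\<lambda>\<mu>. arc_int \<eta> ori X \<mu> W / normal_sol \<eta> X \<mu>) F \<and> fps_nth F 0 = (if W = X then 1 else 0)"
proof -
  interpret L: laplace_cone X "off X" "slope X" by (rule laplace_cone_at[OF X])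
  define d where "d = card (X - W)"
  define c where "c = complex_of_real (jacobian X * abs_det W * inv_scal X W / lead_const X)"
  obtain F where F: "asymp_exp (sector \<eta> \<epsilon>) (\<lambda>\<mu>. exp (of_real (\<Sum>i\<in>X. edge_exp X W i) * cut_log \<eta> \<mu>) * L.Eh \<eta> (edge_exp X W) (face_exp X W) \<mu>) F"
    "fps_nth F 0 = of_real (integral\<^sup>L L.PM (L.wt 1 (edge_exp X W)))"
    by (rule L.Eh_asymp_sector[OF \<eta> \<epsilon> edge_exp_pos[OF X]]) blast
  from asymp_exp_cmult[OF asymp_exp_divide_power[OF F(1), of d], of c]
  have "asymp_exp (sector \<eta> \<epsilon>) (\<lambda>\<mu>. arc_int \<eta> ori X \<mu> W / normal_sol \<eta> X \<mu>) (fps_const c * (fps_X ^ d * F))"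
  proof (rule asymp_exp_cong)
    fix \<mu> assume \<mu>: "\<mu> \<in> sector \<eta> \<epsilon>" "\<mu> \<noteq> 0"
    then have D: "\<mu> \<in> cut_plane \<eta>" using sector_cut_plane[OF \<eta> \<epsilon>] by blast
    define a where "a = complex_of_real (weight X)"
    have "exp (of_real (\<Sum>i\<in>X. edge_exp X W i) * cut_log \<eta> \<mu>) = exp (a * cut_log \<eta> \<mu> + of_nat d * cut_log \<eta> \<mu>)"
      using sum_edge_exp[of X W] vertexD[OF X] by (simp add: a_def d_def distrib_right)
    also have "\<dots> = exp (a * cut_log \<eta> \<mu>) * \<mu> ^ d"
      by (simp add: exp_add exp_of_nat_mult exp_cut_log[OF \<eta> \<mu>(2)])
    finally have 1: "exp (of_real (\<Sum>i\<in>X. edge_exp X W i) * cut_log \<eta> \<mu>) = exp (a * cut_log \<eta> \<mu>) * \<mu> ^ d" .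
    have 2: "exp (- a * cut_log \<eta> \<mu>) = 1 / exp (a * cut_log \<eta> \<mu>)" by (simp add: exp_minus field_simps)
    have 3: "arc_int \<eta> ori X \<mu> W = of_real (jacobian X * abs_det W) * (of_real (inv_scal X W) * exp (- \<mu> * of_real (f0 (pt X))) * L.Eh \<eta> (edge_exp X W) (face_exp X W) \<mu>)"
      unfolding arc_int_def jacobian(2)[OF X W \<eta> ori D] red_int_def cone_fun_def ..
    show "c * (exp (of_real (\<Sum>i\<in>X. edge_exp X W i) * cut_log \<eta> \<mu>) * L.Eh \<eta> (edge_exp X W) (face_exp X W) \<mu> / \<mu> ^ d) = arc_int \<eta> ori X \<mu> W / normal_sol \<eta> X \<mu>"
      unfolding 1 3 normal_sol_def a_def[symmetric] 2 c_def using \<mu>(2) lead_const_nz[OF X] by (simp add: field_simps)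
  qed
  moreover have "fps_nth (fps_const c * (fps_X ^ d * F)) 0 = (if W = X then 1 else 0)"
  proof (cases "W = X")
    case True
    then show ?thesis using lead_const_nz[OF X] F(2) by (simp add: d_def c_def lead_const_def)
  next
    case False
    then have "\<not> X \<subseteq> W" using vertexD[OF X] vertexD[OF W] by (metis card_subset_eq)
    then have "d \<noteq> 0" using vertexD[OF X] by (simp add: d_def)
    then show ?thesis using False by (simp add: fps_X_power_nth)
  qed
  ultimately show ?thesis by blast
qed

lemma matA_off: "x \<noteq> y \<Longrightarrow> matA f f0 x y = 0"
  by (simp add: matA_def)

lemma arc_int_normalization:
  assumes \<eta>: "\<eta> = 1 \<or> \<eta> = - 1" and ori: "ori = 1 \<or> ori = - 1" and \<epsilon>: "0 < \<epsilon>" "\<epsilon> < pi/2"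
  shows "sectorial_normalization (vertices CARD('k) N) (matA f f0) (matB f \<alpha> f0) (sector \<eta> \<epsilon>)
    (\<lambda>\<mu> x y. arc_int \<eta> ori y \<mu> x / normal_sol \<eta> y \<mu>)"
proof -
  define F where "F x y = (SOME F. asymp_exp (sector \<eta> \<epsilon>) (\<lambda>\<mu>. arc_int \<eta> ori y \<mu> x / normal_sol \<eta> y \<mu>) F \<and>
      fps_nth F 0 = (if x = y then 1 else 0))" for x y
  have F: "asymp_exp (sector \<eta> \<epsilon>) (\<lambda>\<mu>. arc_int \<eta> ori y \<mu> x / normal_sol \<eta> y \<mu>) (F x y) \<and> fps_nth (F x y) 0 = (if x = y then 1 else 0)"
    if "x \<in> vertices CARD('k) N" "y \<in> vertices CARD('k) N" for x y
    unfolding F_def by (rule someI_ex[OF arc_int_asymp[OF that(2,1) \<eta> ori \<epsilon>]])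
  show ?thesis
  proof (rule sectorial_normalizationI[where Q = "mid_ray \<eta>" and F = F])
    show "mid_ray \<eta> \<subseteq> sector \<eta> \<epsilon>"
    proof
      fix \<mu> assume \<mu>: "\<mu> \<in> mid_ray \<eta>"
      have "\<mu> \<noteq> 0" using \<mu> by (auto simp: mid_ray_def)
      then show "\<mu> \<in> sector \<eta> \<epsilon>" using mid_ray_ball[OF \<eta> \<epsilon>(2) \<mu>] by auto
    qed
    show "solution_on (vertices CARD('k) N) (matA f f0) (matB f \<alpha> f0) (sector \<eta> \<epsilon>) (arc_int \<eta> ori y)"
      if "y \<in> vertices CARD('k) N" for y
      using arc_int_solution[OF that \<eta> ori] sector_cut_plane[OF \<eta> \<epsilon>] unfolding solution_on_def by blast
    show "(normal_sol \<eta> y has_field_derivative sys_matrix (matA f f0) (matB f \<alpha> f0) \<mu> y y * normal_sol \<eta> y \<mu>) (at \<mu>)"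
      if "\<mu> \<in> sector \<eta> \<epsilon>" for y \<mu>
      using sector_cut_plane[OF \<eta> \<epsilon>] that by (intro normal_sol_deriv[OF \<eta>]) blast
  qed (use sector_props[OF \<eta> \<epsilon>(1)] F in \<open>auto simp: finite_V normal_sol_nz matA_off mid_ray_unbounded mid_ray_ball[OF \<eta> \<epsilon>(2)]\<close>)
qed

lemma diagonal_sum:
  fixes H v :: "nat set \<Rightarrow> complex"
  assumes "x \<in> vertices CARD('k) N"
  shows "(\<Sum>z\<in>vertices CARD('k) N. H z / v z * (if z = x then v z else 0)) = (if v x = 0 then 0 else H x)"
proof -
  have "(\<Sum>z\<in>vertices CARD('k) N. H z / v z * (if z = x then v z else 0)) =
      (\<Sum>z\<in>vertices CARD('k) N. if z = x then H x / v x * v x else 0)"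
    by (intro sum.cong) auto
  then show ?thesis using assms finite_V by simp
qed

lemma arc_int_canonical:
  assumes \<eta>: "\<eta> = 1 \<or> \<eta> = - 1" and ori: "ori = 1 \<or> ori = - 1" and \<epsilon>: "0 < \<epsilon>" "\<epsilon> < pi/2"
  shows "canonical_sectorial_basis (vertices CARD('k) N) (matA f f0) (matB f \<alpha> f0) (sector \<eta> \<epsilon>) (arc_int \<eta> ori)"
proof -
  let ?V = "vertices CARD('k) N"
  define H where "H = (\<lambda>\<mu> x y. arc_int \<eta> ori y \<mu> x / normal_sol \<eta> y \<mu>)"
  define W where "W = (\<lambda>\<mu> x y. if x = y then normal_sol \<eta> x \<mu> else 0)"
  have "sectorial_normalization ?V (matA f f0) (matB f \<alpha> f0) (sector \<eta> \<epsilon>) H"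
    unfolding H_def by (rule arc_int_normalization[OF assms])
  moreover have "diagonal_fundamental ?V (matA f f0) (matB f \<alpha> f0) (sector \<eta> \<epsilon>) W"
    unfolding diagonal_fundamental_def
  proof (intro conjI ballI impI)
    show "invertible_matrix ?V (W \<mu>)" for \<mu>
      unfolding W_def by (intro invertible_diagonal finite_V normal_sol_nz)
    show "W \<mu> x y = 0" if "x \<noteq> y" for \<mu> x y using that by (simp add: W_def)
    show "solution_on ?V (matA f f0) (diag_part (matB f \<alpha> f0)) (sector \<eta> \<epsilon>) (\<lambda>\<mu> x. W \<mu> x y)" if y: "y \<in> ?V" for y
      unfolding solution_on_def
    proof (intro ballI)
      fix \<mu> x assume \<mu>: "\<mu> \<in> sector \<eta> \<epsilon>"
      have "((\<lambda>\<nu>. W \<nu> x y) has_field_derivative (if x = y then sys_matrix (matA f f0) (matB f \<alpha> f0) \<mu> x x * normal_sol \<eta> x \<mu> else 0)) (at \<mu>)"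
        using sector_cut_plane[OF \<eta> \<epsilon>] \<mu> normal_sol_deriv[OF \<eta>, of \<mu> x] by (auto simp: W_def)
      moreover have e: "(\<Sum>z\<in>?V. sys_matrix (matA f f0) (diag_part (matB f \<alpha> f0)) \<mu> x z * W \<mu> z y) =
        (if x = y then sys_matrix (matA f f0) (matB f \<alpha> f0) \<mu> x x * normal_sol \<eta> x \<mu> else 0)"
        unfolding W_def by (rule sum_diag_part[OF finite_V y]) (rule matA_off)
      ultimately show "((\<lambda>\<nu>. W \<nu> x y) has_field_derivative
         (\<Sum>z\<in>?V. sys_matrix (matA f f0) (diag_part (matB f \<alpha> f0)) \<mu> x z * W \<mu> z y)) (at \<mu>)"
        by (simp only: e)
    qed
  qed
  moreover have "\<forall>\<mu>\<in>sector \<eta> \<epsilon>. \<forall>x\<in>?V. \<forall>x'\<in>?V. arc_int \<eta> ori x \<mu> x' = (\<Sum>z\<in>?V. H \<mu> x' z * W \<mu> z x)"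
    unfolding H_def W_def using diagonal_sum normal_sol_nz by simp
  ultimately show ?thesis unfolding canonical_sectorial_basis_def by blast
qed

lemma arc_int_tuple:
  assumes ori: "ori = 1 \<or> ori = - 1" and \<epsilon>: "0 < \<epsilon>" "\<epsilon> < pi/2" and S: "clockwise_sectors \<epsilon> S0 S1 S2"
  shows "normalized_tuple (vertices CARD('k) N) (matA f f0) (matB f \<alpha> f0) \<epsilon> S0 S1 S2
    (\<lambda>X w. arc_int (- 1) ori X (exp w)) (\<lambda>X w. arc_int 1 ori X (exp w))
    (\<lambda>X w X'. exp (2 * complex_of_real pi * \<i> * of_real (\<Sum>j\<in>X. \<alpha> j)) * arc_int (- 1) ori X (exp w) X')"
proof -
  let ?V = "vertices CARD('k) N"
  let ?A = "matA f f0" and ?B = "matB f \<alpha> f0"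
  have \<eta>: "- 1 = 1 \<or> - 1 = (- 1 :: real)" "1 = 1 \<or> 1 = (- 1 :: real)" by auto
  obtain m where m: "S0 = strip (- 1) \<epsilon> m" "S1 = strip 1 \<epsilon> (- m)" "S2 = strip (- 1) \<epsilon> (m - 1)"
    by (rule clockwise_strips[OF \<epsilon> S])
  define H where "H = (\<lambda>\<eta> \<mu> x y. arc_int \<eta> ori y \<mu> x / normal_sol \<eta> y \<mu>)"
  \<comment> \<open>One branch of the diagonal solution on the whole cover. The factor with
    \<open>m\<close> makes it agree with \<open>normal_sol (- 1)\<close> on the sheet
    \<open>S0\<close>, whichever sheet that is.\<close>
  define v where "v u x = of_real (lead_const x) * exp (2 * of_real pi * \<i> * of_int m * of_real (weight x)) *
      exp (- exp u * of_real (f0 (pt x))) * exp (- of_real (weight x) * u)" for u x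
  define W where "W = (\<lambda>u x y. if x = y then v u x else 0)"
  have Hn: "sectorial_normalization ?V ?A ?B (sector_plus \<epsilon>) (H (- 1))"
    "sectorial_normalization ?V ?A ?B (sector_minus \<epsilon>) (H 1)"
    unfolding H_def sector_plus_eq sector_minus_eq by (intro arc_int_normalization[OF _ ori \<epsilon>] \<eta>)+
  have vnz: "v u x \<noteq> 0" if "x \<in> ?V" for u x using lead_const_nz[OF that] by (simp add: v_def)
  have W: "diagonal_fundamental_cover ?V ?A ?B W"
    unfolding diagonal_fundamental_cover_def
  proof (intro conjI ballI impI allI)
    show "invertible_matrix ?V (W u)" for u unfolding W_def by (intro invertible_diagonal finite_V vnz)
    show "W u x y = 0" if "x \<noteq> y" for u x y using that by (simp add: W_def)
    fix u x y assume y: "y \<in> ?V"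
    define p where "p = complex_of_real (f0 (pt x))"
    define a where "a = complex_of_real (weight x)"
    define C where "C = of_real (lead_const x) * exp (2 * of_real pi * \<i> * of_int m * of_real (weight x))"
    have "((\<lambda>u. C * exp (- exp u * p) * exp (- a * u)) has_field_derivative
      exp u * (- (p + a / exp u) * (C * exp (- exp u * p) * exp (- a * u)))) (at u)"
      by (rule derivative_eq_intros refl)+ (simp add: algebra_simps)
    moreover have "v u x = C * exp (- exp u * p) * exp (- a * u)" for u by (simp only: v_def C_def p_def a_def)
    moreover have "sys_matrix ?A ?B (exp u) x x = - (p + a / exp u)"
      by (simp add: sys_matrix_def matA_def matB_def p_def a_def weight_def)
    ultimately have "((\<lambda>u. v u x) has_field_derivative exp u * (sys_matrix ?A ?B (exp u) x x * v u x)) (at u)"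
      by (simp only:)
    then have "((\<lambda>u. W u x y) has_field_derivative exp u * (if x = y then sys_matrix ?A ?B (exp u) x x * v u x else 0)) (at u)"
      by (auto simp: W_def)
    moreover have e: "(\<Sum>z\<in>?V. sys_matrix ?A (diag_part ?B) (exp u) x z * W u z y) =
      (if x = y then sys_matrix ?A ?B (exp u) x x * v u x else 0)"
      unfolding W_def by (rule sum_diag_part[OF finite_V y]) (rule matA_off)
    ultimately show "((\<lambda>u. W u x y) has_field_derivative exp u * (\<Sum>z\<in>?V. sys_matrix ?A (diag_part ?B) (exp u) x z * W u z y)) (at u)"
      by (simp only: e)
  qed
  have sum: "(\<Sum>z\<in>?V. H \<eta> (exp u) x' z * W u z x) = arc_int \<eta> ori x (exp u) x' * (v u x / normal_sol \<eta> x (exp u))"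
    if "x \<in> ?V" for \<eta> u x x'
  proof -
    have "(\<Sum>z\<in>?V. H \<eta> (exp u) x' z * W u z x) = (\<Sum>z\<in>?V. if z = x then H \<eta> (exp u) x' x * v u x else 0)"
      by (intro sum.cong) (auto simp: W_def)
    then show ?thesis using that finite_V by (simp add: H_def)
  qed
  \<comment> \<open>The difference between the entire function \<open>v\<close> and the cut solution
    is concentrated in \<open>cut_log \<eta> (exp u) - u\<close>, which is constant on each
    sheet.\<close>
  have quot: "v u x = exp (of_real (weight x) * (cut_log \<eta> (exp u) - u + 2 * of_real pi * \<i> * of_int m)) * normal_sol \<eta> x (exp u)" for \<eta> u x
  proof -
    have "exp (of_real (weight x) * (cut_log \<eta> (exp u) - u + 2 * of_real pi * \<i> * of_int m)) * exp (- of_real (weight x) * cut_log \<eta> (exp u)) =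
      exp (2 * of_real pi * \<i> * of_int m * of_real (weight x)) * exp (- of_real (weight x) * u)"
      unfolding exp_add[symmetric] by (simp add: algebra_simps)
    then show ?thesis unfolding v_def normal_sol_def by (simp only: mult_ac)
  qed
  have eq: "(\<Sum>z\<in>?V. H \<eta> (exp u) x' z * W u z x) =
      exp (of_real (weight x) * (cut_log \<eta> (exp u) - u + 2 * of_real pi * \<i> * of_int m)) * arc_int \<eta> ori x (exp u) x'"
    if "x \<in> ?V" for \<eta> u x x'
    unfolding sum[OF that] quot[of u x \<eta>] using normal_sol_nz[OF that] by simp
  have "arc_int (- 1) ori x (exp u) x' = (\<Sum>z\<in>?V. H (- 1) (exp u) x' z * W u z x)" if "x \<in> ?V" "u \<in> S0" for x x' u
    unfolding eq[OF that(1)] using cut_log_strip(1)[OF \<eta>(1) \<epsilon>(1) that(2)[unfolded m]] by (simp add: algebra_simps)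
  moreover have "arc_int 1 ori x (exp u) x' = (\<Sum>z\<in>?V. H 1 (exp u) x' z * W u z x)" if "x \<in> ?V" "u \<in> S1" for x x' u
    unfolding eq[OF that(1)] using cut_log_strip(1)[OF \<eta>(2) \<epsilon>(1) that(2)[unfolded m]] by (simp add: algebra_simps)
  moreover have "exp (2 * complex_of_real pi * \<i> * of_real (\<Sum>j\<in>x. \<alpha> j)) * arc_int (- 1) ori x (exp u) x' =
      (\<Sum>z\<in>?V. H (- 1) (exp u) x' z * W u z x)" if "x \<in> ?V" "u \<in> S2" for x x' u
  proof -
    \<comment> \<open>The sheet \<open>S2\<close> has index \<open>m - 1\<close>, so one full turn
      remains uncompensated; on \<open>S0\<close> and \<open>S1\<close> the bracket
      vanishes.\<close>
    have "of_real (weight x) * (cut_log (- 1) (exp u) - u + 2 * of_real pi * \<i> * of_int m) = 2 * complex_of_real pi * \<i> * of_real (\<Sum>j\<in>x. \<alpha> j)"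
      unfolding cut_log_strip(1)[OF \<eta>(1) \<epsilon>(1) that(2)[unfolded m]] weight_def[symmetric] by (simp add: algebra_simps)
    then show ?thesis unfolding eq[OF that(1)] by (simp only:)
  qed
  ultimately show ?thesis
    unfolding normalized_tuple_def using Hn W by blast
qed

end

theorem proposition2p4:
  fixes N :: nat
    and f :: "nat \<Rightarrow> real^'k \<Rightarrow> real"
    and \<alpha> :: "nat \<Rightarrow> real"
    and f0 :: "real^'k \<Rightarrow> real"
    and ori \<epsilon> :: real
    and S0 S1 S2 :: "complex set"
  assumes "generic_arrangement N f"
    and "\<forall>j\<in>{1..N}. 0 < \<alpha> j"
    and "generic_linear_form N f f0"
    and "ori = 1 \<or> ori = - 1"
    and "0 < \<epsilon>" and "\<epsilon> < pi / 2"
    and "clockwise_sectors \<epsilon> S0 S1 S2"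
  shows
    "let V = vertices CARD('k) N;
         A = matA f f0;
         B = matB f \<alpha> f0;
         I_plus = Iplus N f \<alpha> f0 ori;
         I_minus = Iminus N f \<alpha> f0 ori
     in (\<forall>X\<in>V. solution_on V A B (- {\<mu>. Re \<mu> = 0 \<and> Im \<mu> \<le> 0}) (I_plus X)) \<and>
        (\<forall>X\<in>V. solution_on V A B (- {\<mu>. Re \<mu> = 0 \<and> Im \<mu> \<ge> 0}) (I_minus X)) \<and>
        canonical_sectorial_basis V A B (sector_plus \<epsilon>) I_plus \<and>
        canonical_sectorial_basis V A B (sector_minus \<epsilon>) I_minus \<and>
        normalized_tuple V A B \<epsilon> S0 S1 S2
          (\<lambda>X w. I_plus X (exp w))
          (\<lambda>X w. I_minus X (exp w))
          (\<lambda>X w X'. exp (2 * complex_of_real pi * \<i> * of_real (\<Sum>j\<in>X. \<alpha> j)) * I_plus X (exp w) X')"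
proof -
  interpret arrangement N f \<alpha> f0 using assms(1-3) by unfold_locales
  have I: "Iplus N f \<alpha> f0 ori = arc_int (- 1) ori" "Iminus N f \<alpha> f0 ori = arc_int 1 ori"
    by (simp_all only: Iplus_def Iminus_def arc_int_def half_circle_eq)
  have D: "- {\<mu>. Re \<mu> = 0 \<and> Im \<mu> \<le> 0} = cut_plane (- 1)" "- {\<mu>. Re \<mu> = 0 \<and> Im \<mu> \<ge> 0} = cut_plane 1"
    by (simp_all add: cut_plane_eq)
  show ?thesis
    unfolding Let_def I D sector_plus_eq sector_minus_eq
    using arc_int_solution[OF _ _ assms(4)] arc_int_canonical[OF _ assms(4-6)] arc_int_tuple[OF assms(4-7)] by auto
qed

end
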